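(* Let $(M,\omega)$ be a closed connected $2n$-dimensional symplectic manifold. The symplectic leaves of $P^\infty(M)$, with the Poisson structure $P$ induced from the Poisson structure of $(M,\omega)$, are the orbits of the action of $\mathrm{Ham}(M)$ on $P^\infty(M)$. Given $\mu\in P^\infty(M)$ and $\phi_1,\phi_2\in C^\infty(M)$, let $\widehat{H}_{\phi_1},\widehat{H}_{\phi_2}\in T_\mu P^\infty(M)$ be the infinitesimal motions of $\mu$ under the flows generated by the Hamiltonian vector fields $H_{\phi_1},H_{\phi_2}$ on $M$. Then the symplectic form $\Omega$ on the leaf through $\mu$ satisfies $$\Omega(\widehat{H}_{\phi_1},\widehat{H}_{\phi_2})=\int_M\{\phi_1,\phi_2\}\,d\mu.$$
   Context: $P^\infty(M)$ is the space of probability measures on $M$ with smooth, everywhere positive density, with the smooth topology. It is an infinite-dimensional smooth manifold (in the sense of Kriegl–Michor), being an open subset of an affine space modelled on the space of smooth densities with total integral zero. $\{\cdot,\cdot\}$ is the Poisson bracket on $C^\infty(M)$ determined by $\omega$, and the Hamiltonian vector field $H_\phi$ of $\phi\in C^\infty(M)$ is given by $H_\phi f=\{\phi,f\}$ (with the sign convention $\omega(H_f,H_g)=\{f,g\}$). $\mathrm{Ham}(M)$ is the group of Hamiltonian symplectomorphisms of $M$ (time-one maps of flows of time-dependent Hamiltonian vector fields), acting on $P^\infty(M)$ by pushforward of measures. The infinitesimal motion $\widehat{H}_\phi\in T_\mu P^\infty(M)$ is the derivative at $t=0$ of the pushforward of $\mu$ by the time-$t$ flow of $H_\phi$. For $\phi\in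 C^\infty(M)$, $F_\phi\in C^\infty(P^\infty(M))$ is $F_\phi(\mu)=\int_M\phi\,d\mu$. The map $\phi\mapsto dF_\phi|_\mu$ identifies $C^\infty(M)/\mathbb{R}$ with $T^*_\mu P^\infty(M)$. The Poisson structure $P$ on $P^\infty(M)$ is the skew bivector field with Poisson bracket determined by $\{F_{\phi_1},F_{\phi_2}\}=F_{\{\phi_1,\phi_2\}}$. For a function $F$ on $P^\infty(M)$ let $W_F$ be the vector field with $W_F\widehat{F}=\{F,\widehat{F}\}$. As for finite-dimensional Poisson manifolds, the symplectic leaves are the leaves of the (possibly singular) foliation whose leafwise tangent vector fields are spanned by the vector fields $W_F$; since differentials at a point are of the form $dF_\phi|_\mu$, the leafwise tangent space at $\mu$ is $\{W_{F_\phi}|_\mu:\phi\in C^\infty(M)\}$, and the leaf through $\mu$ consists of the measures $c(1)$ for smooth curves $c:[0,1]\to P^\infty(M)$ with $c(0)=\mu$ and $c'(t)=W_{F_{\phi(t)}}|_{c(t)}$ for some smooth family $\phi(t)\in C^\infty(M)$. The symplectic form $\Omega$ on a leaf is given by $\Omega(W_{F_{\phi_1}},W_{F_{\phi_2}})=\{F_{\phi_1},F_{\phi_2}\}$. *)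

theory Defs
  imports "HOL-Probability.Probability"
begin

section \<open>Smooth maps between normed spaces\<close>

text \<open>Both notions are meant for open \<open>S\<close> only: the derivatives are taken in the full space.\<close>

primrec Ck_on :: "nat \<Rightarrow> 'v::real_normed_vector set \<Rightarrow> ('v \<Rightarrow> 'w::real_normed_vector) \<Rightarrow> bool" where
  "Ck_on 0 S f \<longleftrightarrow> continuous_on S f"
| "Ck_on (Suc k) S f \<longleftrightarrow>
     (\<forall>x\<in>S. f differentiable (at x)) \<and> (\<forall>v. Ck_on k S (\<lambda>x. frechet_derivative f (at x) v))"

definition smooth_on :: "'v::real_normed_vector set \<Rightarrow> ('v \<Rightarrow> 'w::real_normed_vector) \<Rightarrow> bool" where
  "smooth_on S f \<longleftrightarrow> (\<forall>k. Ck_on k S f)"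


section \<open>Smooth manifolds\<close>

text \<open>A chart is a pair of its domain and its coordinate map; the values of the coordinate map
  outside the domain are irrelevant. Manifolds are given by a smooth atlas, not necessarily
  a maximal one.\<close>

type_synonym ('a, 'e) chart = "'a set \<times> ('a \<Rightarrow> 'e)"

locale smooth_manifold =
  fixes M :: "'a topology" and \<A> :: "('a, 'e::euclidean_space) chart set"
  assumes Hausdorff: "Hausdorff_space M"
    and second_countable: "second_countable M"
    and chart_domain: "\<And>U x. (U, x) \<in> \<A> \<Longrightarrow> openin M U"
    and chart_codomain: "\<And>U x. (U, x) \<in> \<A> \<Longrightarrow> open (x ` U)"
    and chart_homeomorphic:
      "\<And>U x. (U, x) \<in> \<A> \<Longrightarrow> homeomorphic_map (subtopology M U) (top_of_set (x ` U)) x"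
    and charts_cover: "\<Union>(fst ` \<A>) = topspace M"
    and charts_compatible:
      "\<And>U x V y. \<lbrakk>(U, x) \<in> \<A>; (V, y) \<in> \<A>\<rbrakk> \<Longrightarrow> smooth_on (x ` (U \<inter> V)) (y \<circ> inv_into U x)"
begin

definition smooth_functions :: "('a \<Rightarrow> real) set" where
  "smooth_functions = {f. \<forall>(U, x)\<in>\<A>. smooth_on (x ` U) (f \<circ> inv_into U x)}"

text \<open>Smooth families of smooth functions, parametrised by an open set \<open>J\<close> of times.\<close>

definition smooth_family :: "real set \<Rightarrow> (real \<Rightarrow> 'a \<Rightarrow> real) \<Rightarrow> bool" where
  "smooth_family J \<phi> \<longleftrightarrow>
     (\<forall>(U, x)\<in>\<A>. smooth_on (J \<times> x ` U) (\<lambda>(t, q). \<phi> t (inv_into U x q)))"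

text \<open>A tangent vector is identified with its action on smooth functions.
  \<open>coord_vector (U, x) p v\<close> is the sum of the \<open>v\<^sub>i \<partial>/\<partial>x\<^sub>i\<close> at \<open>p\<close>.
  It is made zero on all other functions, so that vectors coming from different charts can be equal.\<close>

definition coord_vector :: "('a, 'e) chart \<Rightarrow> 'a \<Rightarrow> 'e \<Rightarrow> ('a \<Rightarrow> real) \<Rightarrow> real" where
  "coord_vector = (\<lambda>(U, x) p v f.
     if f \<in> smooth_functions then frechet_derivative (f \<circ> inv_into U x) (at (x p)) v else 0)"

definition tangent_space :: "'a \<Rightarrow> (('a \<Rightarrow> real) \<Rightarrow> real) set" where
  "tangent_space p = {coord_vector (U, x) p v | U x v. (U, x) \<in> \<A> \<and> p \<in> U}"


subsection \<open>The space of smooth positive probability measures\<close>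

definition borelM :: "'a measure" where
  "borelM = sigma (topspace M) {U. openin M U}"

definition has_chart_density :: "('a set \<Rightarrow> real) \<Rightarrow> ('a, 'e) chart \<Rightarrow> ('e \<Rightarrow> real) \<Rightarrow> bool" where
  "has_chart_density \<nu> = (\<lambda>(U, x) \<rho>. \<forall>A\<in>sets borelM. A \<subseteq> U \<longrightarrow>
     set_integrable lborel (x ` A) \<rho> \<and> \<nu> A = (LINT q:x ` A|lborel. \<rho> q))"

definition Pinf :: "'a measure set" where
  "Pinf = {\<mu>. prob_space \<mu> \<and> sets \<mu> = sets borelM \<and>
     (\<forall>(U, x)\<in>\<A>. \<exists>\<rho>. smooth_on (x ` U) \<rho> \<and> (\<forall>q\<in>x ` U. \<rho> q > 0) \<and>
        has_chart_density (measure \<mu>) (U, x) \<rho>)}"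

text \<open>Smooth densities of arbitrary sign are represented by the signed measures they define, that
  is, by countably additive set functions (made zero off the Borel sets). Those with total
  integral zero form the model space of the manifold \<open>Pinf\<close>, hence its tangent space at every point.\<close>

definition smooth_densities :: "('a set \<Rightarrow> real) set" where
  "smooth_densities = {\<nu>. (\<forall>A. A \<notin> sets borelM \<longrightarrow> \<nu> A = 0) \<and>
     (\<forall>A :: nat \<Rightarrow> 'a set. range A \<subseteq> sets borelM \<and> disjoint_family A \<longrightarrow>
        (\<lambda>i. \<nu> (A i)) sums \<nu> (\<Union>i. A i)) \<and>
     (\<forall>(U, x)\<in>\<A>. \<exists>\<rho>. smooth_on (x ` U) \<rho> \<and> has_chart_density \<nu> (U, x) \<rho>)}"

definition tangent_Pinf :: "'a measure \<Rightarrow> ('a set \<Rightarrow> real) set" where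
  "tangent_Pinf \<mu> = {\<nu> \<in> smooth_densities. \<nu> (topspace M) = 0}"

text \<open>A curve in \<open>Pinf\<close> is smooth on the open set \<open>J\<close> of times if its density depends smoothly on time
  and position together. (By the exponential law this is smoothness in the sense of convenient calculus.)\<close>

definition smooth_curve :: "real set \<Rightarrow> (real \<Rightarrow> 'a measure) \<Rightarrow> bool" where
  "smooth_curve J c \<longleftrightarrow> (\<forall>t\<in>J. c t \<in> Pinf) \<and>
     (\<forall>(U, x)\<in>\<A>. \<exists>\<rho>. smooth_on (J \<times> x ` U) (\<lambda>(t, q). \<rho> t q) \<and>
        (\<forall>t\<in>J. has_chart_density (measure (c t)) (U, x) (\<rho> t)))"

definition has_velocity :: "(real \<Rightarrow> 'a measure) \<Rightarrow> ('a set \<Rightarrow> real) \<Rightarrow> real \<Rightarrow> bool" where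
  "has_velocity c v t \<longleftrightarrow> v \<in> tangent_Pinf (c t) \<and>
     (\<forall>A\<in>sets borelM. ((\<lambda>s. measure (c s) A) has_real_derivative v A) (at t))"

definition smooth_on_Pinf :: "('a measure \<Rightarrow> real) \<Rightarrow> bool" where
  "smooth_on_Pinf F \<longleftrightarrow> (\<forall>c. smooth_curve UNIV c \<longrightarrow> smooth_on UNIV (F \<circ> c))"

definition differential :: "('a measure \<Rightarrow> real) \<Rightarrow> 'a measure \<Rightarrow> ('a set \<Rightarrow> real) \<Rightarrow> real" where
  "differential F \<mu> v = (if v \<in> tangent_Pinf \<mu> then
     (THE d. \<forall>J c. open J \<and> 0 \<in> J \<and> smooth_curve J c \<and> c 0 = \<mu> \<and> has_velocity c v 0 \<longrightarrow>
        ((F \<circ> c) has_real_derivative d) (at 0)) else 0)"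

definition lin_fun :: "('a \<Rightarrow> real) \<Rightarrow> 'a measure \<Rightarrow> real" where
  "lin_fun \<phi> \<mu> = (\<integral>p. \<phi> p \<partial>\<mu>)"

text \<open>This is the smooth cotangent space, isomorphic to the smooth functions on \<open>M\<close> modulo constants.
  There are functions that are smooth along all smooth curves but have more singular
  differentials (such as the density at a given point); brackets are taken only of functions in
  \<open>Pinf_functions\<close>, whose differentials are all smooth covectors.\<close>

definition cotangent_Pinf :: "'a measure \<Rightarrow> (('a set \<Rightarrow> real) \<Rightarrow> real) set" where
  "cotangent_Pinf \<mu> = {differential (lin_fun \<phi>) \<mu> | \<phi>. \<phi> \<in> smooth_functions}"

definition Pinf_functions :: "('a measure \<Rightarrow> real) set" where
  "Pinf_functions = {F. smooth_on_Pinf F \<and> (\<forall>\<mu>\<in>Pinf. differential F \<mu> \<in> cotangent_Pinf \<mu>)}"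

end


section \<open>Closed symplectic manifolds\<close>

locale closed_symplectic_manifold = smooth_manifold M \<A>
  for M :: "'a topology" and \<A> :: "('a, 'e::euclidean_space) chart set" +
  fixes \<omega> :: "'a \<Rightarrow> (('a \<Rightarrow> real) \<Rightarrow> real) \<Rightarrow> (('a \<Rightarrow> real) \<Rightarrow> real) \<Rightarrow> real" and n :: nat
  assumes compact: "compact_space M"
    and connected: "connected_space M"
    and dimension: "DIM('e) = 2 * n"
    and form_linear: "\<And>p X Y Z a b. \<lbrakk>p \<in> topspace M; X \<in> tangent_space p; Y \<in> tangent_space p;
        Z \<in> tangent_space p\<rbrakk> \<Longrightarrow> \<omega> p (\<lambda>f. a * X f + b * Y f) Z = a * \<omega> p X Z + b * \<omega> p Y Z"
    and form_skew: "\<And>p X Y. \<lbrakk>p \<in> topspace M; X \<in> tangent_space p; Y \<in> tangent_space p\<rbrakk> \<Longrightarrow>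
        \<omega> p X Y = - \<omega> p Y X"
    and form_nondegenerate: "\<And>p X. \<lbrakk>p \<in> topspace M; X \<in> tangent_space p;
        \<forall>Y\<in>tangent_space p. \<omega> p X Y = 0\<rbrakk> \<Longrightarrow> X = (\<lambda>f. 0)"
    and form_smooth: "\<And>U x v w. (U, x) \<in> \<A> \<Longrightarrow> smooth_on (x ` U)
        (\<lambda>q. let p = inv_into U x q in \<omega> p (coord_vector (U, x) p v) (coord_vector (U, x) p w))"
    and form_closed: "\<And>U x q u v w. \<lbrakk>(U, x) \<in> \<A>; q \<in> x ` U\<rbrakk> \<Longrightarrow>
        (let \<omega>x = (\<lambda>v w q. let p = inv_into U x q
                             in \<omega> p (coord_vector (U, x) p v) (coord_vector (U, x) p w))
         in frechet_derivative (\<omega>x v w) (at q) u + frechet_derivative (\<omega>x w u) (at q) v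
              + frechet_derivative (\<omega>x u v) (at q) w = 0)"
begin

text \<open>The sign in \<open>\<omega>(Y, H\<^sub>\<phi>) = d\<phi>(Y)\<close> is the one for which
  \<open>\<omega>(H\<^sub>\<phi>, H\<^sub>f) = H\<^sub>\<phi> f = {\<phi>, f}\<close>.\<close>

definition ham_vector :: "('a \<Rightarrow> real) \<Rightarrow> 'a \<Rightarrow> ('a \<Rightarrow> real) \<Rightarrow> real" where
  "ham_vector \<phi> p = (THE X. X \<in> tangent_space p \<and> (\<forall>Y\<in>tangent_space p. \<omega> p Y X = Y \<phi>))"

definition poisson :: "('a \<Rightarrow> real) \<Rightarrow> ('a \<Rightarrow> real) \<Rightarrow> 'a \<Rightarrow> real" where
  "poisson \<phi> f p = \<omega> p (ham_vector \<phi> p) (ham_vector f p)"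

definition ham_integral_curve :: "real set \<Rightarrow> (real \<Rightarrow> 'a \<Rightarrow> real) \<Rightarrow> (real \<Rightarrow> 'a) \<Rightarrow> bool" where
  "ham_integral_curve T \<phi> \<gamma> \<longleftrightarrow> (\<forall>t\<in>T. \<gamma> t \<in> topspace M \<and>
     (\<forall>f\<in>smooth_functions.
        ((\<lambda>s. f (\<gamma> s)) has_real_derivative ham_vector (\<phi> t) (\<gamma> t) f) (at t within T)))"

definition ham_flow :: "real set \<Rightarrow> (real \<Rightarrow> 'a \<Rightarrow> real) \<Rightarrow> real \<Rightarrow> 'a \<Rightarrow> 'a" where
  "ham_flow T \<phi> t p = (THE q. \<exists>\<gamma>. ham_integral_curve T \<phi> \<gamma> \<and> \<gamma> 0 = p \<and> \<gamma> t = q)"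

text \<open>Here and below, smoothness of a family on the closed interval \<open>[0,1]\<close> means that it is
  the restriction of a smooth family on an open neighbourhood of the interval.\<close>

definition Ham :: "('a \<Rightarrow> 'a) set" where
  "Ham = {ham_flow {0..1} \<phi> 1 | \<phi>. \<exists>J. open J \<and> {0..1} \<subseteq> J \<and> smooth_family J \<phi>}"

definition Ham_orbit :: "'a measure \<Rightarrow> 'a measure set" where
  "Ham_orbit \<mu> = {distr \<mu> borelM g | g. g \<in> Ham}"

definition inf_motion :: "('a \<Rightarrow> real) \<Rightarrow> 'a measure \<Rightarrow> 'a set \<Rightarrow> real" where
  "inf_motion \<phi> \<mu> = (THE v. has_velocity (\<lambda>t. distr \<mu> borelM (ham_flow UNIV (\<lambda>_. \<phi>) t)) v 0)"


subsection \<open>The Poisson structure on the space of measures\<close>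

definition bivector ::
  "'a measure \<Rightarrow> (('a set \<Rightarrow> real) \<Rightarrow> real) \<Rightarrow> (('a set \<Rightarrow> real) \<Rightarrow> real) \<Rightarrow> real" where
  "bivector \<mu> \<alpha> \<beta> = (THE r. \<exists>\<phi>1\<in>smooth_functions. \<exists>\<phi>2\<in>smooth_functions.
     \<alpha> = differential (lin_fun \<phi>1) \<mu> \<and> \<beta> = differential (lin_fun \<phi>2) \<mu> \<and>
     r = lin_fun (poisson \<phi>1 \<phi>2) \<mu>)"

definition bracket :: "('a measure \<Rightarrow> real) \<Rightarrow> ('a measure \<Rightarrow> real) \<Rightarrow> 'a measure \<Rightarrow> real" where
  "bracket F G \<mu> = bivector \<mu> (differential F \<mu>) (differential G \<mu>)"

definition W :: "('a measure \<Rightarrow> real) \<Rightarrow> 'a measure \<Rightarrow> 'a set \<Rightarrow> real" where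
  "W F \<mu> = (THE v. v \<in> tangent_Pinf \<mu> \<and> (\<forall>G\<in>Pinf_functions. differential G \<mu> v = bracket F G \<mu>))"

definition leaf_tangent :: "'a measure \<Rightarrow> ('a set \<Rightarrow> real) set" where
  "leaf_tangent \<mu> = {W (lin_fun \<phi>) \<mu> | \<phi>. \<phi> \<in> smooth_functions}"

definition symplectic_leaf :: "'a measure \<Rightarrow> 'a measure set" where
  "symplectic_leaf \<mu> = {c 1 | c. \<exists>J \<phi>. open J \<and> {0..1} \<subseteq> J \<and> smooth_curve J c \<and> smooth_family J \<phi> \<and>
     c 0 = \<mu> \<and> (\<forall>t\<in>{0..1}. has_velocity c (W (lin_fun (\<phi> t)) (c t)) t)}"

definition leaf_form :: "'a measure \<Rightarrow> ('a set \<Rightarrow> real) \<Rightarrow> ('a set \<Rightarrow> real) \<Rightarrow> real" where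
  "leaf_form \<mu> v w = (THE r. \<exists>\<phi>1\<in>smooth_functions. \<exists>\<phi>2\<in>smooth_functions.
     v = W (lin_fun \<phi>1) \<mu> \<and> w = W (lin_fun \<phi>2) \<mu> \<and> r = bracket (lin_fun \<phi>1) (lin_fun \<phi>2) \<mu>)"

end

end

theory Submission
  imports Defs
begin

text \<open>
  Integrating by parts in charts, with a partition of unity, gives every vector field \<open>X\<close> a smooth
  divergence with respect to \<open>\<mu>\<close>. Applied to \<open>H\<^sub>\<phi>\<close> this shows that \<open>\<integral>{\<phi>, \<psi>} d\<mu>\<close>, as a function of \<open>\<psi>\<close>,
  is the differential of \<open>F\<^sub>\<psi>\<close> at a smooth density, so that the bracket is well defined on covectors and
  \<open>W\<close> of \<open>F\<^sub>\<phi>\<close> is minus the Lie derivative of \<open>\<mu>\<close> along \<open>H\<^sub>\<phi>\<close>. A curve of measures tangent to these fields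
  is therefore a solution of the continuity equation of a time-dependent Hamiltonian field. By the method
  of characteristics the solutions of that equation are exactly the pushforwards under the flow: a test function
  \<open>\<psi>\<close>, transported backwards along the flow, has constant integral, which gives uniqueness; and the
  exponential of minus the integral of the divergence along flow lines is the density of the pushforward, which is
  therefore a smooth curve. The flow depends smoothly on initial values
  because the difference quotients of solutions satisfy linear Volterra equations.
\<close>

section \<open>Calculus of smooth maps\<close>

text \<open>Most objects of the statement (\<open>differential\<close>, \<open>ham_vector\<close>,
  \<open>ham_flow\<close>, \<open>bivector\<close>, \<open>W\<close>, \<open>leaf_form\<close>,
  \<open>inf_motion\<close>) are definite descriptions, so nothing can be said about them before
  existence and uniqueness of their values are known. The common device is a reference measure
  \<mu>: its chart densities are positive, so every smooth density is \<mu> times one global smooth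
  function, every smooth curve of measures is \<mu> times one smooth family, and charts disappear
  from the later arguments. Uniqueness then mostly comes from testing: two smooth densities with the
  same integrals against smooth functions agree almost everywhere, since their difference is itself
  a test function, and finite Borel measures with the same integrals are equal. The density of a
  pushforward is not computed from the flow map. It is constructed as a solution of the continuity
  equation and afterwards recognised by testing. Compactness makes the flow of a time-dependent
  field exist for all starting points over a whole closed interval of times; nondegeneracy of
  \<omega> yields the coefficients of a Hamiltonian field from a linear system.\<close>

lemma Ck_on_subset: "Ck_on k S f \<Longrightarrow> T \<subseteq> S \<Longrightarrow> Ck_on k T f"
proof (induction k arbitrary: f)
  case 0
  then show ?case by (auto intro: continuous_on_subset)
next
  case (Suc k)
  then show ?case by (simp add: subset_iff)
qed

lemma Ck_on_SucD:
  assumes "Ck_on (Suc k) S f"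
  shows "x \<in> S \<Longrightarrow> (f has_derivative frechet_derivative f (at x)) (at x)"
    and "Ck_on k S (\<lambda>x. frechet_derivative f (at x) v)"
  using assms by (auto simp: frechet_derivative_works)

text \<open>The values on an open set determine the derivative in the full space, so the replacement
  passes through every order of the recursion.\<close>

lemma Ck_on_cong:
  assumes "open S" "\<And>x. x \<in> S \<Longrightarrow> f x = g x" "Ck_on k S f"
  shows "Ck_on k S g"
  using assms(2,3)
proof (induction k arbitrary: f g)
  case 0
  then show ?case using continuous_on_eq by (metis Ck_on.simps(1))
next
  case (Suc k)
  have d: "(g has_derivative frechet_derivative f (at x)) (at x)" if "x \<in> S" for x
    by (rule has_derivative_transform_within_open[OF Ck_on_SucD(1)[OF Suc.prems(2) that] assms(1) that])
      (simp add: Suc.prems)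
  have "Ck_on k S (\<lambda>x. frechet_derivative g (at x) v)" for v
    using frechet_derivative_at[OF d]
    by (intro Suc.IH[OF _ Ck_on_SucD(2)[OF Suc.prems(2), of v]]) metis
  then show ?case using d by (auto simp: differentiable_def)
qed

text \<open>Lets an explicit formula stand in for \<open>frechet_derivative\<close>, which is
  defined by choice; by uniqueness of derivatives the two coincide on \<open>S\<close>.\<close>

lemma Ck_on_SucI:
  assumes "open S" "\<And>x. x \<in> S \<Longrightarrow> (f has_derivative f' x) (at x)"
    and "\<And>v. Ck_on k S (\<lambda>x. f' x v)"
  shows "Ck_on (Suc k) S f"
proof -
  have "Ck_on k S (\<lambda>x. frechet_derivative f (at x) v)" for v
    using frechet_derivative_at[OF assms(2)]
    by (intro Ck_on_cong[OF assms(1) _ assms(3)[of v]]) metis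
  then show ?thesis
    using assms(2) by (auto simp: differentiable_def)
qed

lemma Ck_on_Suc_imp: "Ck_on (Suc k) S f \<Longrightarrow> Ck_on k S f"
proof (induction k arbitrary: f)
  case 0
  then show ?case
    by (auto intro!: continuous_at_imp_continuous_on differentiable_imp_continuous_within)
next
  case (Suc k)
  then show ?case
    by (subst Ck_on.simps(2)) (auto intro!: Suc.IH simp del: Ck_on.simps dest: Ck_on_SucD simp: differentiable_def)
qed

lemma Ck_on_imp_continuous_on: "Ck_on k S f \<Longrightarrow> continuous_on S f"
  by (induction k) (auto simp del: Ck_on.simps(2) intro: Ck_on_Suc_imp)

lemma Ck_on_local:
  assumes "\<And>x. x \<in> S \<Longrightarrow> \<exists>T. open T \<and> x \<in> T \<and> Ck_on k T f"
  shows "Ck_on k S f"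
  using assms
proof (induction k arbitrary: f)
  case 0
  have "isCont f x" if "x \<in> S" for x
    using 0[OF that] continuous_on_eq_continuous_at by (metis Ck_on.simps(1))
  then show ?case by (simp add: continuous_at_imp_continuous_on)
next
  case (Suc k)
  have "f differentiable (at x)" if "x \<in> S" for x
    using Suc.prems[OF that] by auto
  moreover have "Ck_on k S (\<lambda>x. frechet_derivative f (at x) v)" for v
    by (rule Suc.IH) (use Suc.prems Ck_on_SucD(2) in metis)
  ultimately show ?case by simp
qed

lemma Ck_on_const: "open S \<Longrightarrow> Ck_on k S (\<lambda>x. c)"
proof (induction k arbitrary: c)
  case (Suc k)
  then show ?case by (intro Ck_on_SucI[where f' = "\<lambda>x v. 0"]) auto
qed auto

lemma Ck_on_compose_linear:
  assumes "bounded_linear L" "open S" "Ck_on k S f"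
  shows "Ck_on k S (\<lambda>x. L (f x))"
  using assms(3)
proof (induction k arbitrary: f)
  case 0
  then show ?case by (simp add: bounded_linear.continuous_on[OF assms(1)])
next
  case (Suc k)
  show ?case
    by (rule Ck_on_SucI[where f' = "\<lambda>x v. L (frechet_derivative f (at x) v)"])
      (use Ck_on_SucD[OF Suc.prems] in \<open>auto intro: assms(2) Suc.IH bounded_linear.has_derivative[OF assms(1)]\<close>)
qed

lemma Ck_on_id: "open S \<Longrightarrow> Ck_on k S (\<lambda>x. x)"
proof (cases k)
  case (Suc j)
  assume "open S"
  then show ?thesis unfolding Suc
    by (intro Ck_on_SucI[where f' = "\<lambda>x v. v"] Ck_on_const) auto
qed auto

lemma Ck_on_add:
  assumes "open S" "Ck_on k S f" "Ck_on k S g"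
  shows "Ck_on k S (\<lambda>x. f x + g x)"
  using assms(2,3)
proof (induction k arbitrary: f g)
  case 0
  then show ?case by (auto intro: continuous_intros)
next
  case (Suc k)
  show ?case
    by (rule Ck_on_SucI[where f' = "\<lambda>x v. frechet_derivative f (at x) v + frechet_derivative g (at x) v"])
      (use assms(1) Ck_on_SucD[OF Suc.prems(1)] Ck_on_SucD[OF Suc.prems(2)] in
        \<open>auto intro!: Suc.IH has_derivative_add\<close>)
qed

lemma Ck_on_bilinear:
  assumes "bounded_bilinear pr" "open S" "Ck_on k S f" "Ck_on k S g"
  shows "Ck_on k S (\<lambda>x. pr (f x) (g x))"
  using assms(3,4)
proof (induction k arbitrary: f g)
  case 0
  then show ?case by (simp add: bounded_bilinear.continuous_on[OF assms(1)])
next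
  case (Suc k)
  show ?case
    by (rule Ck_on_SucI[where f' = "\<lambda>x v. pr (f x) (frechet_derivative g (at x) v)
        + pr (frechet_derivative f (at x) v) (g x)"])
      (use assms Ck_on_SucD[OF Suc.prems(1)] Ck_on_SucD[OF Suc.prems(2)]
          Ck_on_Suc_imp[OF Suc.prems(1)] Ck_on_Suc_imp[OF Suc.prems(2)] in
        \<open>auto intro!: Suc.IH Ck_on_add bounded_bilinear.FDERIV\<close>)
qed

lemma Ck_on_sum:
  assumes "open S" "\<And>i. i \<in> I \<Longrightarrow> Ck_on k S (f i)"
  shows "Ck_on k S (\<lambda>x. \<Sum>i\<in>I. f i x)"
  using assms(2) by (induction I rule: infinite_finite_induct) (auto intro: Ck_on_const Ck_on_add assms(1))

lemma Ck_on_componentwise: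
  fixes f :: "'v::real_normed_vector \<Rightarrow> 'w::euclidean_space"
  assumes "open S" "\<And>b. b \<in> Basis \<Longrightarrow> Ck_on k S (\<lambda>x. f x \<bullet> b)"
  shows "Ck_on k S f"
proof -
  have "Ck_on k S (\<lambda>x. \<Sum>b\<in>Basis. (f x \<bullet> b) *\<^sub>R b)"
    by (intro Ck_on_sum Ck_on_compose_linear[OF bounded_linear_scaleR_left] assms)
  then show ?thesis by (simp add: euclidean_representation)
qed

lemma linear_expand_Basis:
  fixes A :: "'w::euclidean_space \<Rightarrow> 'u::real_vector"
  assumes "linear A"
  shows "A w = (\<Sum>b\<in>Basis. (w \<bullet> b) *\<^sub>R A b)"
proof -
  have "A w = A (\<Sum>b\<in>Basis. (w \<bullet> b) *\<^sub>R b)" by (simp add: euclidean_representation)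
  then show ?thesis by (simp add: linear_sum[OF assms] linear_scale[OF assms])
qed

text \<open>A family of linear maps is handled through its values on basis vectors, so smoothness
  never refers to a space of operators: expansion in the basis turns application into a finite sum
  of products.\<close>

lemma Ck_on_apply_linear:
  fixes g :: "'v::real_normed_vector \<Rightarrow> 'w::euclidean_space"
  assumes "open S" "\<And>x. x \<in> S \<Longrightarrow> linear (A x)"
    and "\<And>w. w \<in> Basis \<Longrightarrow> Ck_on k S (\<lambda>x. A x w)" "Ck_on k S g"
  shows "Ck_on k S (\<lambda>x. A x (g x))"
proof -
  have "Ck_on k S (\<lambda>x. \<Sum>b\<in>Basis. (g x \<bullet> b) *\<^sub>R A x b)"
    by (intro Ck_on_sum Ck_on_bilinear[OF bounded_bilinear_scaleR] assms
        Ck_on_compose_linear[OF bounded_linear_inner_left])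
  then show ?thesis
  proof (rule Ck_on_cong[OF assms(1), rotated])
    fix x assume "x \<in> S"
    then show "(\<Sum>b\<in>Basis. (g x \<bullet> b) *\<^sub>R A x b) = A x (g x)"
      using linear_expand_Basis[OF assms(2)] by simp
  qed
qed

lemma continuous_on_apply_linear:
  fixes g :: "'v::topological_space \<Rightarrow> 'w::euclidean_space" and A :: "'v \<Rightarrow> 'w \<Rightarrow> 'u::real_normed_vector"
  assumes "\<And>x. x \<in> S \<Longrightarrow> linear (A x)"
    and "\<And>w. w \<in> Basis \<Longrightarrow> continuous_on S (\<lambda>x. A x w)" "continuous_on S g"
  shows "continuous_on S (\<lambda>x. A x (g x))"
proof -
  have "continuous_on S (\<lambda>x. \<Sum>b\<in>Basis. (g x \<bullet> b) *\<^sub>R A x b)"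
    by (intro continuous_intros assms)
  then show ?thesis
  proof (rule continuous_on_eq)
    fix x assume "x \<in> S"
    then show "(\<Sum>b\<in>Basis. (g x \<bullet> b) *\<^sub>R A x b) = A x (g x)"
      using linear_expand_Basis[OF assms(1)] by simp
  qed
qed

text \<open>By the chain rule the derivative is a family of linear maps, one order less smooth,
  applied to a derivative of \<open>f\<close>. This is the case of
  \<open>Ck_on_apply_linear\<close>, and the reason why the middle space is Euclidean.\<close>

lemma Ck_on_compose:
  fixes f :: "'u::real_normed_vector \<Rightarrow> 'v::euclidean_space" and g :: "'v \<Rightarrow> 'w::real_normed_vector"
  assumes "open S" "open T" "f ` S \<subseteq> T" "Ck_on k S f" "Ck_on k T g"
  shows "Ck_on k S (\<lambda>x. g (f x))"
  using assms(3-)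
proof (induction k arbitrary: f g)
  case 0
  then show ?case by (auto intro: continuous_on_compose2)
next
  case (Suc k)
  note f = Ck_on_SucD[OF Suc.prems(2)] and g = Ck_on_SucD[OF Suc.prems(3)]
  show ?case
  proof (rule Ck_on_SucI[where f' = "\<lambda>x v. frechet_derivative g (at (f x)) (frechet_derivative f (at x) v)"])
    show "((\<lambda>x. g (f x)) has_derivative (\<lambda>v. frechet_derivative g (at (f x)) (frechet_derivative f (at x) v))) (at x)"
      if "x \<in> S" for x
      using that Suc.prems(1) by (intro has_derivative_compose[OF f(1) g(1)]) auto
    show "Ck_on k S (\<lambda>x. frechet_derivative g (at (f x)) (frechet_derivative f (at x) v))" for v
    proof (rule Ck_on_apply_linear[OF assms(1)])
      show "linear (frechet_derivative g (at (f x)))" if "x \<in> S" for x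
        using g(1)[of "f x"] that Suc.prems(1) has_derivative_linear by blast
      show "Ck_on k S (\<lambda>x. frechet_derivative g (at (f x)) w)" for w
        by (rule Suc.IH[OF Suc.prems(1) Ck_on_Suc_imp[OF Suc.prems(2)] g(2)])
      show "Ck_on k S (\<lambda>x. frechet_derivative f (at x) v)" by (rule f(2))
    qed
  qed (rule assms(1))
qed

lemma Ck_on_Pair:
  assumes "open S" "Ck_on k S f" "Ck_on k S g"
  shows "Ck_on k S (\<lambda>x. (f x, g x))"
proof -
  have "Ck_on k S (\<lambda>x. (f x, 0) + (0, g x))"
    by (intro Ck_on_add assms Ck_on_compose_linear[where L = "\<lambda>y. (y, 0)"]
        Ck_on_compose_linear[where L = "\<lambda>y. (0, y)"] bounded_linear_intros)
  then show ?thesis by simp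
qed

section \<open>Derivatives from difference quotients and from partial derivatives\<close>

lemma has_vector_derivative_along_line:
  assumes "(f has_derivative f') (at x)"
  shows "((\<lambda>s. f (x + s *\<^sub>R v)) has_vector_derivative f' v) (at 0)"
proof -
  have "((\<lambda>s. x + s *\<^sub>R v) has_derivative (\<lambda>s. s *\<^sub>R v)) (at 0)"
    by (auto intro!: derivative_eq_intros)
  then have "((\<lambda>s. f (x + s *\<^sub>R v)) has_derivative (\<lambda>s. f' (s *\<^sub>R v))) (at 0)"
    using has_derivative_compose[of "\<lambda>s. x + s *\<^sub>R v" _ 0 UNIV f f'] assms by simp
  then show ?thesis
    using linear_scale[OF has_derivative_linear[OF assms]] by (simp add: has_vector_derivative_def)
qed

lemma has_vector_derivative_line_shift:
  fixes y :: "'v::real_vector"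
  assumes "((\<lambda>s. f ((y + t *\<^sub>R b) + s *\<^sub>R b)) has_vector_derivative D) (at (0::real))"
  shows "((\<lambda>s. f (y + s *\<^sub>R b)) has_vector_derivative D) (at t)"
proof -
  have "((\<lambda>s. s - t) has_vector_derivative 1) (at t)"
    by (auto intro!: derivative_eq_intros)
  then have "((\<lambda>s. f (y + t *\<^sub>R b + (s - t) *\<^sub>R b)) has_vector_derivative D) (at t)"
    using vector_diff_chain_at[of "\<lambda>s. s - t" 1 t "\<lambda>s. f ((y + t *\<^sub>R b) + s *\<^sub>R b)" D] assms
    by (simp add: o_def)
  moreover have "y + t *\<^sub>R b + (s - t) *\<^sub>R b = y + s *\<^sub>R b" for s
    by (simp add: add.assoc flip: scaleR_add_left)
  ultimately show ?thesis by simp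
qed

lemma has_vector_derivative_0_iff:
  fixes f :: "real \<Rightarrow> 'b::real_normed_vector"
  shows "(f has_vector_derivative D) (at 0) \<longleftrightarrow> ((\<lambda>s. inverse s *\<^sub>R (f s - f 0)) \<longlongrightarrow> D) (at 0)"
proof -
  have eq: "norm (f s - f 0 - s *\<^sub>R D) / norm s = norm (inverse s *\<^sub>R (f s - f 0) - D)" if "s \<noteq> 0" for s
  proof -
    have "inverse s *\<^sub>R (f s - f 0) - D = inverse s *\<^sub>R (f s - f 0 - s *\<^sub>R D)"
      using that by (simp add: algebra_simps)
    then show ?thesis using that by (simp add: divide_inverse)
  qed
  have "(f has_vector_derivative D) (at 0) \<longleftrightarrow> ((\<lambda>s. norm (f s - f 0 - s *\<^sub>R D) / norm s) \<longlongrightarrow> 0) (at 0)"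
    by (simp add: has_vector_derivative_def has_derivative_iff_norm bounded_linear_scaleR_left)
  also have "\<dots> \<longleftrightarrow> ((\<lambda>s. norm (inverse s *\<^sub>R (f s - f 0) - D)) \<longlongrightarrow> 0) (at 0)"
    by (rule Lim_cong_within) (use eq in auto)
  finally show ?thesis by (simp add: tendsto_norm_zero_iff LIM_zero_iff)
qed

lemma vector_derivative_bound:
  fixes f :: "real \<Rightarrow> 'b::real_normed_vector"
  assumes "convex S" "\<And>x. x \<in> S \<Longrightarrow> (f has_vector_derivative f' x) (at x within S)"
    and "\<And>x. x \<in> S \<Longrightarrow> norm (f' x) \<le> B" "x \<in> S" "y \<in> S"
  shows "norm (f x - f y) \<le> B * \<bar>x - y\<bar>"
proof -
  have "onorm (\<lambda>h. h *\<^sub>R f' x) \<le> B" if "x \<in> S" for x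
    by (rule onorm_le) (use assms(3)[OF that] in \<open>simp add: mult.commute[of B] mult_left_mono\<close>)
  then show ?thesis
    using differentiable_bound[OF assms(1), of f "\<lambda>x h. h *\<^sub>R f' x" B x y] assms
    by (auto simp: has_vector_derivative_def)
qed

text \<open>The point \<open>y\<close> is reached from \<open>x\<close> along a path parallel to the
  axes. On each edge the error against the linear approximation has derivative \<open>g c\<close>
  minus its value at \<open>x\<close>, which continuity makes small; the edges are added by
  induction on a set of basis vectors.\<close>

lemma has_derivative_partials:
  fixes f :: "'v::euclidean_space \<Rightarrow> 'w::real_normed_vector"
  assumes "open S" "x \<in> S"
    and partial: "\<And>y b. y \<in> S \<Longrightarrow> b \<in> Basis \<Longrightarrow> ((\<lambda>s. f (y + s *\<^sub>R b)) has_vector_derivative g b y) (at 0)"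
    and cont: "\<And>b. b \<in> Basis \<Longrightarrow> continuous_on S (g b)"
  shows "(f has_derivative (\<lambda>h. \<Sum>b\<in>Basis. (h \<bullet> b) *\<^sub>R g b x)) (at x)"
  unfolding has_derivative_within_alt
proof (intro conjI allI impI)
  show "bounded_linear (\<lambda>h. \<Sum>b\<in>Basis. (h \<bullet> b) *\<^sub>R g b x)"
    by (intro bounded_linear_intros)
  fix e :: real assume "e > 0"
  \<comment> \<open>There is one error term for each coordinate, and each coordinate of
    \<open>h\<close> is at most \<open>norm h\<close>; hence the division by the dimension.\<close>
  define e' where "e' = e / DIM('v)"
  have e': "e' > 0" using \<open>e > 0\<close> by (simp add: e'_def)
  have "\<exists>d>0. ball x d \<subseteq> S \<and> (\<forall>y\<in>ball x d. norm (g b y - g b x) \<le> e')" if "b \<in> Basis" for b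
  proof -
    have "isCont (g b) x" using cont[OF that] assms(1,2) continuous_on_eq_continuous_at by blast
    then obtain d where "d > 0" "\<forall>y. dist y x < d \<longrightarrow> dist (g b y) (g b x) < e'"
      unfolding continuous_at_eps_delta using e' by blast
    moreover obtain d' where "d' > 0" "ball x d' \<subseteq> S"
      using assms(1,2) open_contains_ball by blast
    ultimately show ?thesis
      by (intro exI[of _ "min d d'"]) (auto simp: dist_norm norm_minus_commute less_imp_le subset_iff)
  qed
  then obtain d where d: "\<And>b. b \<in> Basis \<Longrightarrow> d b > 0 \<and> ball x (d b) \<subseteq> S
      \<and> (\<forall>y\<in>ball x (d b). norm (g b y - g b x) \<le> e')" by metis
  define D where "D = Min (d ` Basis)"
  have D: "D > 0" "\<And>b. b \<in> Basis \<Longrightarrow> D \<le> d b"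
    using d by (auto simp: D_def)
  show "\<exists>d>0. \<forall>y\<in>UNIV. norm (y - x) < d \<longrightarrow>
      norm (f y - f x - (\<Sum>b\<in>Basis. ((y - x) \<bullet> b) *\<^sub>R g b x)) \<le> e * norm (y - x)"
  proof (intro exI conjI ballI impI)
    fix y assume "norm (y - x) < D"
    define h where "h = y - x"
    have h: "norm h < D" using \<open>norm (y - x) < D\<close> by (simp add: h_def)
    \<comment> \<open>Every coordinate of the offset from \<open>x\<close> is bounded by that of
      \<open>h\<close>, so the whole path stays in the ball where the partial derivatives are
      controlled.\<close>
    have near: "x + (\<Sum>b\<in>B. (h \<bullet> b) *\<^sub>R b) + s *\<^sub>R c \<in> ball x D"
      if "c \<in> Basis" "B \<subseteq> Basis" "c \<notin> B" "\<bar>s\<bar> \<le> \<bar>h \<bullet> c\<bar>" for B c s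
    proof -
      have "norm ((\<Sum>b\<in>B. (h \<bullet> b) *\<^sub>R b) + s *\<^sub>R c) \<le> norm h"
      proof (rule norm_le_componentwise)
        fix i :: 'v assume i: "i \<in> Basis"
        have "finite B" using that(2) finite_Basis finite_subset by blast
        have "(\<Sum>b\<in>B. (h \<bullet> b) *\<^sub>R b) \<bullet> i = (\<Sum>b\<in>B. if b = i then h \<bullet> b else 0)"
          unfolding inner_sum_left by (intro sum.cong refl) (use that(2) i in \<open>auto simp: inner_Basis\<close>)
        also have "\<dots> = (if i \<in> B then h \<bullet> i else 0)" using \<open>finite B\<close> by simp
        finally show "\<bar>((\<Sum>b\<in>B. (h \<bullet> b) *\<^sub>R b) + s *\<^sub>R c) \<bullet> i\<bar> \<le> \<bar>h \<bullet> i\<bar>"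
          using that i by (auto simp: inner_add_left inner_Basis)
      qed
      moreover have "dist x (x + w) = norm w" for w by (simp add: dist_norm)
      ultimately show ?thesis using h by (simp add: add.assoc)
    qed
    have "norm (f (x + (\<Sum>b\<in>B. (h \<bullet> b) *\<^sub>R b)) - f x - (\<Sum>b\<in>B. (h \<bullet> b) *\<^sub>R g b x)) \<le> (\<Sum>b\<in>B. e' * \<bar>h \<bullet> b\<bar>)"
      if "finite B" "B \<subseteq> Basis" for B
      using that
    proof (induction B rule: finite_induct)
      case (insert c B)
      define p where "p = x + (\<Sum>b\<in>B. (h \<bullet> b) *\<^sub>R b)"
      let ?I = "{-\<bar>h \<bullet> c\<bar>..\<bar>h \<bullet> c\<bar>}"
      have pS: "p + s *\<^sub>R c \<in> ball x D" if "s \<in> ?I" for s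
        using near[of c B s] that insert by (auto simp: p_def)
      have "norm ((f (p + (h \<bullet> c) *\<^sub>R c) - (h \<bullet> c) *\<^sub>R g c x) - (f (p + 0 *\<^sub>R c) - 0 *\<^sub>R g c x)) \<le> e' * \<bar>h \<bullet> c - 0\<bar>"
      proof (rule vector_derivative_bound[of ?I _ "\<lambda>s. g c (p + s *\<^sub>R c) - g c x"])
        fix s assume s: "s \<in> ?I"
        have b: "p + s *\<^sub>R c \<in> ball x (d c)" using pS[OF s] D(2)[of c] insert.prems by auto
        have "((\<lambda>s. f (p + s *\<^sub>R c)) has_vector_derivative g c (p + s *\<^sub>R c)) (at s)"
          by (rule has_vector_derivative_line_shift, rule partial) (use b d insert.prems in blast)+
        then have "((\<lambda>s. f (p + s *\<^sub>R c) - s *\<^sub>R g c x) has_vector_derivative g c (p + s *\<^sub>R c) - g c x) (at s)"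
          by (auto intro!: derivative_eq_intros)
        then show "((\<lambda>s. f (p + s *\<^sub>R c) - s *\<^sub>R g c x) has_vector_derivative g c (p + s *\<^sub>R c) - g c x) (at s within ?I)"
          by (rule has_vector_derivative_at_within)
        show "norm (g c (p + s *\<^sub>R c) - g c x) \<le> e'" using b d insert.prems by auto
      qed auto
      moreover have "x + (\<Sum>b\<in>insert c B. (h \<bullet> b) *\<^sub>R b) = p + (h \<bullet> c) *\<^sub>R c"
        using insert by (simp add: p_def algebra_simps)
      moreover have "norm (f p - f x - (\<Sum>b\<in>B. (h \<bullet> b) *\<^sub>R g b x)) \<le> (\<Sum>b\<in>B. e' * \<bar>h \<bullet> b\<bar>)"
        using insert by (simp add: p_def)
      moreover have "(\<Sum>b\<in>insert c B. (h \<bullet> b) *\<^sub>R g b x) = (h \<bullet> c) *\<^sub>R g c x + (\<Sum>b\<in>B. (h \<bullet> b) *\<^sub>R g b x)"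
        "(\<Sum>b\<in>insert c B. e' * \<bar>h \<bullet> b\<bar>) = e' * \<bar>h \<bullet> c\<bar> + (\<Sum>b\<in>B. e' * \<bar>h \<bullet> b\<bar>)"
        using insert by auto
      ultimately show ?case
        using norm_triangle_ineq[of "f (p + (h \<bullet> c) *\<^sub>R c) - (h \<bullet> c) *\<^sub>R g c x - f p"
            "f p - f x - (\<Sum>b\<in>B. (h \<bullet> b) *\<^sub>R g b x)"]
        by (simp add: algebra_simps)
    qed simp
    from this[of Basis] have "norm (f y - f x - (\<Sum>b\<in>Basis. (h \<bullet> b) *\<^sub>R g b x)) \<le> (\<Sum>b\<in>Basis. e' * \<bar>h \<bullet> b\<bar>)"
      by (simp add: euclidean_representation h_def)
    also have "\<dots> \<le> (\<Sum>b\<in>(Basis::'v set). e' * norm h)"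
      using e' by (intro sum_mono mult_left_mono Basis_le_norm) auto
    also have "\<dots> = e * norm h" by (simp add: e'_def)
    finally show "norm (f y - f x - (\<Sum>b\<in>Basis. ((y - x) \<bullet> b) *\<^sub>R g b x)) \<le> e * norm (y - x)"
      by (simp add: h_def)
  qed (rule D(1))
qed

text \<open>The way to differentiate functions given only by integrals or equations: it suffices to
  find limits of difference quotients along the axes and to know that these limits have order
  \<open>k\<close>.\<close>

lemma Ck_on_Suc_partials:
  fixes f :: "'v::euclidean_space \<Rightarrow> 'w::real_normed_vector"
  assumes "open S"
    and partial: "\<And>y b. y \<in> S \<Longrightarrow> b \<in> Basis \<Longrightarrow> ((\<lambda>s. f (y + s *\<^sub>R b)) has_vector_derivative g b y) (at 0)"
    and Ck: "\<And>b. b \<in> Basis \<Longrightarrow> Ck_on k S (g b)"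
  shows "Ck_on (Suc k) S f"
proof (rule Ck_on_SucI[OF assms(1) has_derivative_partials[OF assms(1) _ partial]])
  show "continuous_on S (g b)" if "b \<in> Basis" for b
    using Ck[OF that] by (rule Ck_on_imp_continuous_on)
  show "Ck_on k S (\<lambda>x. \<Sum>b\<in>Basis. (v \<bullet> b) *\<^sub>R g b x)" for v
    by (intro Ck_on_sum Ck_on_compose_linear[OF bounded_linear_scaleR_right] Ck assms(1))
qed auto


subsection \<open>Smooth maps\<close>

lemma smooth_onI: "(\<And>k. Ck_on k S f) \<Longrightarrow> smooth_on S f"
  and smooth_onD: "smooth_on S f \<Longrightarrow> Ck_on k S f"
  by (auto simp: smooth_on_def)

lemma smooth_on_subset: "smooth_on S f \<Longrightarrow> T \<subseteq> S \<Longrightarrow> smooth_on T f"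
  unfolding smooth_on_def by (blast intro: Ck_on_subset)

lemma smooth_on_cong:
  assumes "open S" "\<And>x. x \<in> S \<Longrightarrow> f x = g x"
  shows "smooth_on S f \<longleftrightarrow> smooth_on S g"
  using Ck_on_cong[OF assms(1), of f g] Ck_on_cong[OF assms(1), of g f] assms(2)
  by (auto simp: smooth_on_def)

lemma smooth_on_local:
  "(\<And>x. x \<in> S \<Longrightarrow> \<exists>T. open T \<and> x \<in> T \<and> smooth_on T f) \<Longrightarrow> smooth_on S f"
  unfolding smooth_on_def by (intro allI Ck_on_local) blast

lemma smooth_on_imp_continuous_on: "smooth_on S f \<Longrightarrow> continuous_on S f"
  using Ck_on_imp_continuous_on smooth_onD by blast

lemma smooth_on_const: "open S \<Longrightarrow> smooth_on S (\<lambda>x. c)"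
  by (simp add: smooth_on_def Ck_on_const)

lemma smooth_on_id: "open S \<Longrightarrow> smooth_on S (\<lambda>x. x)"
  by (simp add: smooth_on_def Ck_on_id)

lemma smooth_on_linear: "bounded_linear L \<Longrightarrow> open S \<Longrightarrow> smooth_on S f \<Longrightarrow> smooth_on S (\<lambda>x. L (f x))"
  by (simp add: smooth_on_def Ck_on_compose_linear)

lemma smooth_on_add: "open S \<Longrightarrow> smooth_on S f \<Longrightarrow> smooth_on S g \<Longrightarrow> smooth_on S (\<lambda>x. f x + g x)"
  by (simp add: smooth_on_def Ck_on_add)

lemma smooth_on_sum:
  "open S \<Longrightarrow> (\<And>i. i \<in> I \<Longrightarrow> smooth_on S (f i)) \<Longrightarrow> smooth_on S (\<lambda>x. \<Sum>i\<in>I. f i x)"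
  by (simp add: smooth_on_def Ck_on_sum)

lemma smooth_on_bilinear:
  "bounded_bilinear pr \<Longrightarrow> open S \<Longrightarrow> smooth_on S f \<Longrightarrow> smooth_on S g \<Longrightarrow> smooth_on S (\<lambda>x. pr (f x) (g x))"
  by (simp add: smooth_on_def Ck_on_bilinear)

lemmas smooth_on_mult = smooth_on_bilinear[OF bounded_bilinear_mult]
  and smooth_on_scaleR = smooth_on_bilinear[OF bounded_bilinear_scaleR]
  and smooth_on_inner = smooth_on_bilinear[OF bounded_bilinear_inner]

lemma smooth_on_uminus: "open S \<Longrightarrow> smooth_on S f \<Longrightarrow> smooth_on S (\<lambda>x. - f x)"
  by (rule smooth_on_linear[OF bounded_linear_minus[OF bounded_linear_ident]])

lemma smooth_on_diff: "open S \<Longrightarrow> smooth_on S f \<Longrightarrow> smooth_on S g \<Longrightarrow> smooth_on S (\<lambda>x. f x - g x)"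
  using smooth_on_add[of S f "\<lambda>x. - g x"] smooth_on_uminus[of S g] by simp

lemma smooth_on_fst: "open S \<Longrightarrow> smooth_on S f \<Longrightarrow> smooth_on S (\<lambda>x. fst (f x))"
  by (rule smooth_on_linear[OF bounded_linear_fst])

lemma smooth_on_snd: "open S \<Longrightarrow> smooth_on S f \<Longrightarrow> smooth_on S (\<lambda>x. snd (f x))"
  by (rule smooth_on_linear[OF bounded_linear_snd])

lemma smooth_on_Pair: "open S \<Longrightarrow> smooth_on S f \<Longrightarrow> smooth_on S g \<Longrightarrow> smooth_on S (\<lambda>x. (f x, g x))"
  by (simp add: smooth_on_def Ck_on_Pair)

lemma smooth_on_componentwise:
  fixes f :: "'v::real_normed_vector \<Rightarrow> 'w::euclidean_space"
  shows "open S \<Longrightarrow> (\<And>b. b \<in> Basis \<Longrightarrow> smooth_on S (\<lambda>x. f x \<bullet> b)) \<Longrightarrow> smooth_on S f"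
  by (simp add: smooth_on_def Ck_on_componentwise)

lemma smooth_on_compose:
  fixes f :: "'u::real_normed_vector \<Rightarrow> 'v::euclidean_space" and g :: "'v \<Rightarrow> 'w::real_normed_vector"
  shows "smooth_on T g \<Longrightarrow> smooth_on S f \<Longrightarrow> open S \<Longrightarrow> open T \<Longrightarrow> f ` S \<subseteq> T \<Longrightarrow> smooth_on S (\<lambda>x. g (f x))"
  using Ck_on_compose by (metis smooth_on_def)

lemma smooth_on_has_derivative:
  "smooth_on S f \<Longrightarrow> x \<in> S \<Longrightarrow> (f has_derivative frechet_derivative f (at x)) (at x)"
  using Ck_on_SucD(1) smooth_onD by blast

lemma smooth_on_frechet_derivative:
  "smooth_on S f \<Longrightarrow> smooth_on S (\<lambda>x. frechet_derivative f (at x) v)"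
  using Ck_on_SucD(2) by (metis smooth_on_def)

lemma smooth_on_apply_linear:
  fixes g :: "'v::real_normed_vector \<Rightarrow> 'w::euclidean_space"
  shows "open S \<Longrightarrow> (\<And>x. x \<in> S \<Longrightarrow> linear (A x)) \<Longrightarrow> (\<And>w. w \<in> Basis \<Longrightarrow> smooth_on S (\<lambda>x. A x w)) \<Longrightarrow>
    smooth_on S g \<Longrightarrow> smooth_on S (\<lambda>x. A x (g x))"
  by (simp add: smooth_on_def Ck_on_apply_linear)

lemma Ck_on_real_Suc:
  fixes g :: "real \<Rightarrow> real"
  assumes "open S" "\<And>x. x \<in> S \<Longrightarrow> (g has_real_derivative g' x) (at x)" "Ck_on k S g'"
  shows "Ck_on (Suc k) S g"
  by (rule Ck_on_SucI[OF assms(1), of _ "\<lambda>x v. g' x * v"])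
    (use assms in \<open>auto simp: has_field_derivative_def intro: Ck_on_bilinear[OF bounded_bilinear_mult] Ck_on_const\<close>)

lemma smooth_on_exp:
  fixes f :: "'u::real_normed_vector \<Rightarrow> real"
  assumes "open S" "smooth_on S f"
  shows "smooth_on S (\<lambda>x. exp (f x))"
proof (rule smooth_on_compose[of UNIV exp, OF _ assms(2,1)])
  have "Ck_on k UNIV (exp :: real \<Rightarrow> real)" for k
    by (induction k) (auto intro!: continuous_intros Ck_on_real_Suc derivative_eq_intros simp del: Ck_on.simps(2))
  then show "smooth_on UNIV (exp :: real \<Rightarrow> real)" by (rule smooth_onI)
qed auto

lemma smooth_on_inverse:
  fixes f :: "'u::real_normed_vector \<Rightarrow> real"
  assumes "open S" "smooth_on S f" "\<And>x. x \<in> S \<Longrightarrow> f x \<noteq> 0"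
  shows "smooth_on S (\<lambda>x. inverse (f x))"
proof (rule smooth_on_compose[of "- {0}" inverse, OF _ assms(2,1)])
  have "Ck_on k (- {0}) (inverse :: real \<Rightarrow> real)" for k
  proof (induction k)
    case (Suc k)
    show ?case
      by (rule Ck_on_real_Suc[of _ _ "\<lambda>x. - (inverse x * inverse x)"])
        (use Suc in \<open>auto intro!: derivative_eq_intros Ck_on_bilinear[OF bounded_bilinear_mult]
            Ck_on_compose_linear[OF bounded_linear_minus[OF bounded_linear_ident]]\<close>)
  qed (auto intro!: continuous_intros)
  then show "smooth_on (- {0}) (inverse :: real \<Rightarrow> real)" by (rule smooth_onI)
qed (use assms(3) in auto)

lemma smooth_on_divide:
  fixes f :: "'u::real_normed_vector \<Rightarrow> real"
  shows "open S \<Longrightarrow> smooth_on S f \<Longrightarrow> smooth_on S g \<Longrightarrow> (\<And>x. x \<in> S \<Longrightarrow> g x \<noteq> 0) \<Longrightarrow> smooth_on S (\<lambda>x. f x / g x)"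
  unfolding divide_inverse by (intro smooth_on_mult smooth_on_inverse)

lemmas smooth_on_intros = smooth_on_const smooth_on_id smooth_on_add smooth_on_diff smooth_on_uminus
  smooth_on_mult smooth_on_scaleR smooth_on_inner smooth_on_fst smooth_on_snd smooth_on_Pair smooth_on_exp


subsection \<open>Bump functions\<close>

text \<open>The classical flat function is the case \<open>m = 0\<close>. Powers of
  \<open>inverse t\<close> are included because they make the family stable under differentiation,
  so that smoothness is an induction on the order.\<close>

definition flat :: "nat \<Rightarrow> real \<Rightarrow> real" where
  "flat m t = (if t > 0 then exp (- inverse t) * inverse t ^ m else 0)"

lemma flat_tendsto_0: "(flat m \<longlongrightarrow> 0) (at 0)"
proof (rule filterlim_split_at_real)
  show "(flat m \<longlongrightarrow> 0) (at_left 0)"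
    by (rule tendsto_eventually) (auto simp: eventually_at_filter flat_def)
  have "((\<lambda>t::real. inverse t ^ m / exp (inverse t)) \<longlongrightarrow> 0) (at_right 0)"
    by (rule filterlim_compose[OF tendsto_power_div_exp_0 filterlim_inverse_at_top_right])
  then show "(flat m \<longlongrightarrow> 0) (at_right 0)"
    by (rule Lim_transform_eventually) (auto simp: eventually_at_filter flat_def exp_minus field_simps)
qed

lemma flat_has_derivative:
  "(flat m has_real_derivative flat (m + 2) t - m * flat (m + 1) t) (at t)"
proof (cases "t = 0")
  case True
  \<comment> \<open>At 0 the difference quotient of \<open>flat m\<close> is
    \<open>flat (m + 1)\<close>, whose limit is known.\<close>
  have "((\<lambda>s. (flat m s - flat m 0) / (s - 0)) \<longlongrightarrow> 0) (at 0)"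
    by (rule Lim_transform_eventually[OF flat_tendsto_0[of "m + 1"]])
      (auto simp: eventually_at_filter flat_def divide_inverse)
  then show ?thesis using True by (simp add: has_field_derivative_iff flat_def)
next
  case False
  show ?thesis
  proof (cases "t > 0")
    case True
    have "((\<lambda>t. exp (- inverse t) * inverse t ^ m) has_real_derivative flat (m + 2) t - m * flat (m + 1) t) (at t)"
    proof -
      \<comment> \<open>Truncated subtraction turns \<open>m - Suc 0\<close> into 0 at
        \<open>m = 0\<close>; the factor \<open>real m\<close> absorbs that case.\<close>
      have "real m * inverse t ^ (m - Suc 0) * (inverse t * inverse t) = real m * inverse t ^ (m + 1)"
        by (cases m) auto
      moreover have "((\<lambda>t. exp (- inverse t) * inverse t ^ m) has_real_derivative
          exp (- inverse t) * (inverse t * inverse t) * inverse t ^ m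
          - exp (- inverse t) * (real m * inverse t ^ (m - Suc 0) * (inverse t * inverse t))) (at t)"
        using True by (auto intro!: derivative_eq_intros)
      moreover have "flat (m + 2) t - m * flat (m + 1) t = exp (- inverse t) * (inverse t * inverse t) * inverse t ^ m
          - exp (- inverse t) * (real m * inverse t ^ (m + 1))"
        using True by (simp add: flat_def)
      ultimately show ?thesis by (simp only:)
    qed
    then show ?thesis
      by (rule has_field_derivative_transform_within_open[of _ _ _ "{0<..}"]) (use True in \<open>auto simp: flat_def\<close>)
  next
    case False
    then have "t < 0" using \<open>t \<noteq> 0\<close> by simp
    have "((\<lambda>t. 0) has_real_derivative flat (m + 2) t - m * flat (m + 1) t) (at t)"
      using \<open>t < 0\<close> by (auto simp: flat_def)
    then show ?thesis
      by (rule has_field_derivative_transform_within_open[of _ _ _ "{..<0}"]) (use \<open>t < 0\<close> in \<open>auto simp: flat_def\<close>)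
  qed
qed

lemma smooth_on_flat: "smooth_on UNIV (flat m)"
proof (rule smooth_onI)
  fix k show "Ck_on k UNIV (flat m)"
  proof (induction k arbitrary: m)
    case 0
    then show ?case
      using DERIV_isCont[OF flat_has_derivative] by (auto intro!: continuous_at_imp_continuous_on)
  next
    case (Suc k)
    show ?case
      using Ck_on_add[of UNIV k "flat (m + 2)" "\<lambda>t. - (m * flat (m + 1) t)"] Suc
      by (intro Ck_on_real_Suc[OF _ flat_has_derivative])
        (auto intro!: Ck_on_compose_linear[of "\<lambda>y. - (real m * y)"] bounded_linear_minus bounded_linear_mult_right simp del: add_Suc_right)
  qed
qed

text \<open>The function is \<open>u / (u + v)\<close>, where \<open>u\<close> is positive exactly
  inside the ball of radius \<open>r\<close> and \<open>v\<close> exactly outside the closed ball of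
  radius \<open>r / 2\<close>. These regions cover the space, so the denominator never
  vanishes.\<close>

lemma bump_function_exists:
  fixes a :: "'e::euclidean_space"
  assumes "r > 0"
  obtains \<beta> :: "'e \<Rightarrow> real" where "smooth_on UNIV \<beta>" "\<And>q. 0 \<le> \<beta> q" "\<And>q. \<beta> q \<le> 1"
    "\<And>q. q \<in> ball a (r / 2) \<Longrightarrow> \<beta> q = 1" "\<And>q. q \<notin> cball a r \<Longrightarrow> \<beta> q = 0"
proof
  define u where "u q = flat 0 (r\<^sup>2 - (q - a) \<bullet> (q - a))" for q
  define v where "v q = flat 0 ((q - a) \<bullet> (q - a) - (r / 2)\<^sup>2)" for q
  define \<beta> where "\<beta> q = u q / (u q + v q)" for q
  have nn: "(q - a) \<bullet> (q - a) = (dist a q)\<^sup>2" for q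
    by (metis dist_commute dist_norm power2_norm_eq_inner)
  have nonneg: "u q \<ge> 0" "v q \<ge> 0" for q by (auto simp: u_def v_def flat_def)
  have "u q > 0 \<or> v q > 0" for q
  proof (cases "dist a q < r")
    case True
    then show ?thesis by (simp add: u_def flat_def nn power_strict_mono)
  next
    case False
    then have "(r/2)\<^sup>2 < (dist a q)\<^sup>2" using assms by (intro power_strict_mono) auto
    then show ?thesis by (simp add: v_def flat_def nn)
  qed
  then have pos: "u q + v q > 0" for q using nonneg[of q] by (metis add_pos_nonneg add_nonneg_pos)
  have "smooth_on UNIV u" "smooth_on UNIV v" unfolding u_def v_def
    by (intro smooth_on_compose[OF smooth_on_flat] smooth_on_intros open_UNIV subset_UNIV)+
  then show "smooth_on UNIV \<beta>" unfolding \<beta>_def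
    by (intro smooth_on_divide smooth_on_add) (use pos less_imp_neq in \<open>fastforce+\<close>)
  show "0 \<le> \<beta> q" for q using nonneg[of q] by (simp add: \<beta>_def)
  show "\<beta> q \<le> 1" for q using nonneg[of q] pos[of q] by (simp add: \<beta>_def)
  show "\<beta> q = 1" if "q \<in> ball a (r / 2)" for q
  proof -
    have "(dist a q)\<^sup>2 < (r/2)\<^sup>2" using that by (intro power_strict_mono) auto
    then have "v q = 0" by (simp add: v_def flat_def nn)
    then show ?thesis using pos[of q] by (simp add: \<beta>_def)
  qed
  show "\<beta> q = 0" if "q \<notin> cball a r" for q
  proof -
    have "r\<^sup>2 < (dist a q)\<^sup>2" using that assms by (intro power_strict_mono) auto
    then show ?thesis by (simp add: \<beta>_def u_def flat_def nn)
  qed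
qed


subsection \<open>Solutions of linear equations with smooth coefficients\<close>

text \<open>An injective linear map of a finite-dimensional space has a positive lower bound
  \<open>B\<close>. Near \<open>z0\<close> the values on the basis change so little that the map
  changes by at most \<open>B/2\<close> times the norm, and half of the bound survives.\<close>

lemma linear_family_bounded_below:
  fixes A :: "'v::metric_space \<Rightarrow> 'w::euclidean_space \<Rightarrow> 'w"
  assumes "open S" "z0 \<in> S" "\<And>z. z \<in> S \<Longrightarrow> linear (A z)" "\<And>w. A z0 w = 0 \<Longrightarrow> w = 0"
    and "\<And>w. continuous_on S (\<lambda>z. A z w)"
  obtains c where "c > 0" "eventually (\<lambda>z. z \<in> S \<and> (\<forall>w. c * norm w \<le> norm (A z w))) (nhds z0)"
proof -
  have lin0: "linear (A z0)" using assms by blast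
  then have "inj (A z0)" using assms(4) linear_injective_0 by blast
  then obtain B where B: "B > 0" "\<And>w. B * norm w \<le> norm (A z0 w)"
    using linear_inj_bounded_below_pos[OF lin0] by blast
  define f where "f z = (\<Sum>b\<in>Basis. norm (A z b - A z0 b))" for z
  have "isCont f z0" unfolding f_def
    by (intro continuous_intros) (use assms continuous_on_eq_continuous_at in blast)
  then have "(f \<longlongrightarrow> f z0) (nhds z0)"
    by (simp add: isCont_def tendsto_at_iff_tendsto_nhds)
  then have "eventually (\<lambda>z. f z < B / 2) (nhds z0)"
    by (rule order_tendstoD) (use B in \<open>simp add: f_def\<close>)
  moreover have "eventually (\<lambda>z. z \<in> S) (nhds z0)"
    using assms by (simp add: eventually_nhds_in_open)
  ultimately have "eventually (\<lambda>z. z \<in> S \<and> (\<forall>w. B/2 * norm w \<le> norm (A z w))) (nhds z0)"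
  proof eventually_elim
    case (elim z)
    have "B/2 * norm w \<le> norm (A z w)" for w
    proof -
      have lin: "linear (\<lambda>w. A z w - A z0 w)"
        using assms(3) elim lin0 linear_compose_sub by blast
      have "norm (A z w - A z0 w) = norm (\<Sum>b\<in>Basis. (w \<bullet> b) *\<^sub>R (A z b - A z0 b))"
        using linear_expand_Basis[OF lin, of w] by simp
      also have "\<dots> \<le> (\<Sum>b\<in>Basis. norm w * norm (A z b - A z0 b))"
        by (rule order_trans[OF norm_sum]) (auto intro!: sum_mono mult_right_mono Basis_le_norm)
      also have "\<dots> = norm w * f z" by (simp add: f_def sum_distrib_left)
      also have "\<dots> \<le> norm w * (B/2)" using elim by (intro mult_left_mono) auto
      finally show ?thesis
        using B(2)[of w] norm_triangle_ineq2[of "A z0 w" "A z w"] by (simp add: norm_minus_commute mult.commute)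
    qed
    then show ?case using elim by blast
  qed
  then show ?thesis using that B by (metis half_gt_zero)
qed

text \<open>Differentiating \<open>A z (X z) = b z\<close> gives a linear equation for the
  derivative of \<open>X\<close> with the same family \<open>A\<close> and a right-hand side of one
  order less, so the induction on \<open>k\<close> applies to the derivative. It will show that
  Hamiltonian fields are smooth.\<close>

lemma Ck_on_linear_solve:
  fixes A :: "'v::euclidean_space \<Rightarrow> 'w::euclidean_space \<Rightarrow> 'w"
  assumes "open S" and lin: "\<And>z. z \<in> S \<Longrightarrow> linear (A z)"
    and inj: "\<And>z w. z \<in> S \<Longrightarrow> A z w = 0 \<Longrightarrow> w = 0"
    and "\<And>w. Ck_on k S (\<lambda>z. A z w)" "Ck_on k S b" "\<And>z. z \<in> S \<Longrightarrow> A z (X z) = b z"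
  shows "Ck_on k S X"
  using assms(4-)
proof (induction k arbitrary: b X)
  case 0
  have "isCont X z0" if z0: "z0 \<in> S" for z0
  proof -
    have cA: "continuous_on S (\<lambda>z. A z w)" for w using 0 by simp
    obtain c where c: "c > 0" "eventually (\<lambda>z. z \<in> S \<and> (\<forall>w. c * norm w \<le> norm (A z w))) (nhds z0)"
      using linear_family_bounded_below[OF assms(1) z0 lin inj[OF z0] cA] by blast
    have "isCont (\<lambda>z. norm (b z - A z (X z0)) / c) z0"
      using 0 cA assms(1) z0 c(1) by (intro continuous_intros) (auto simp: continuous_on_eq_continuous_at)
    then have lim: "((\<lambda>z. norm (b z - A z (X z0)) / c) \<longlongrightarrow> 0) (at z0)"
      using 0(3)[OF z0] by (simp add: isCont_def)
    have "eventually (\<lambda>z. norm (X z - X z0) \<le> norm (b z - A z (X z0)) / c) (nhds z0)"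
      using c(2)
    proof eventually_elim
      case (elim z)
      then have "A z (X z - X z0) = b z - A z (X z0)"
        using linear_diff[OF lin] 0(3) by metis
      then have "c * norm (X z - X z0) \<le> norm (b z - A z (X z0))" using elim by metis
      then show ?case using c(1) by (simp add: field_simps)
    qed
    then have "((\<lambda>z. X z - X z0) \<longlongrightarrow> 0) (at z0)"
      by (intro Lim_null_comparison[OF _ lim]) (simp add: eventually_at_filter eventually_mono)
    then show ?thesis unfolding isCont_def using LIM_zero_cancel by blast
  qed
  then show ?case by (simp add: continuous_at_imp_continuous_on)
next
  case (Suc k)
  note A = Ck_on_SucD[OF Suc.prems(1)] and b = Ck_on_SucD[OF Suc.prems(2)]
  have XCk: "Ck_on k S X"
    using Suc.IH[of b X] Suc.prems Ck_on_Suc_imp by metis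
  have surj: "\<exists>w. A z w = r" if "z \<in> S" for z r
    using linear_injective_imp_surjective[OF lin[OF that]] linear_injective_0[OF lin[OF that]] inj[OF that]
    by (metis surjD)
  define r where "r v z = frechet_derivative b (at z) v
      - (\<Sum>c\<in>Basis. (X z \<bullet> c) *\<^sub>R frechet_derivative (\<lambda>z. A z c) (at z) v)" for v z
  define Y where "Y v z = (SOME w. A z w = r v z)" for v z
  have Y: "A z (Y v z) = r v z" if "z \<in> S" for v z
    unfolding Y_def by (rule someI_ex[OF surj[OF that]])
  have rCk: "Ck_on k S (r v)" for v
  proof -
    have "Ck_on k S (\<lambda>z. frechet_derivative b (at z) v
        + - (\<Sum>c\<in>Basis. (X z \<bullet> c) *\<^sub>R frechet_derivative (\<lambda>z. A z c) (at z) v))"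
      by (intro Ck_on_add b(2) Ck_on_compose_linear[OF bounded_linear_minus[OF bounded_linear_ident]] Ck_on_sum
          Ck_on_bilinear[OF bounded_bilinear_scaleR] A(2) assms(1)
          Ck_on_compose_linear[OF bounded_linear_inner_left] XCk)
    then show ?thesis unfolding r_def by simp
  qed
  show ?case
  proof (rule Ck_on_Suc_partials[OF assms(1)])
    show "Ck_on k S (Y v)" for v
      by (rule Suc.IH[OF _ rCk Y]) (use Suc.prems Ck_on_Suc_imp in blast)+
    fix z v :: 'v assume z: "z \<in> S"
    have cA: "continuous_on S (\<lambda>z. A z w)" for w using Suc.prems(1) Ck_on_imp_continuous_on by blast
    obtain c where c: "c > 0" "eventually (\<lambda>y. y \<in> S \<and> (\<forall>w. c * norm w \<le> norm (A y w))) (nhds z)"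
      using linear_family_bounded_below[OF assms(1) z lin inj[OF z] cA] by blast
    let ?l = "\<lambda>s. z + s *\<^sub>R v"
    have l: "filterlim ?l (nhds z) (at 0)"
    proof -
      have "(?l \<longlongrightarrow> z + 0 *\<^sub>R v) (at 0)" by (intro tendsto_intros)
      then show ?thesis by simp
    qed
    \<comment> \<open>With \<open>X z\<close> frozen, the residual vanishes at \<open>z\<close> and
      has derivative \<open>r v z\<close>. Its difference quotient is \<open>A (?l s)\<close>
      applied to the difference quotient of \<open>X\<close>, and the lower bound \<open>c\<close>
      carries the limit back to \<open>X\<close>.\<close>
    have "((\<lambda>s. b (?l s) - A (?l s) (X z)) has_vector_derivative r v z) (at 0)"
    proof -
      have AX: "A y (X z) = (\<Sum>c\<in>Basis. (X z \<bullet> c) *\<^sub>R A y c)" if "y \<in> S" for y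
        by (rule linear_expand_Basis[OF lin[OF that]])
      have 1: "((\<lambda>s. b (?l s) - (\<Sum>c\<in>Basis. (X z \<bullet> c) *\<^sub>R A (?l s) c)) has_vector_derivative r v z) (at 0)"
        unfolding r_def
        by (intro has_vector_derivative_diff has_vector_derivative_sum has_vector_derivative_along_line b(1) z
            bounded_linear.has_vector_derivative[OF bounded_linear_scaleR_right]
            has_vector_derivative_along_line[of "\<lambda>z. A z _"] A(1))
      have "open (?l -` S)" by (intro open_vimage assms(1) continuous_intros)
      then show ?thesis
        by (rule has_vector_derivative_transform_within_open[OF 1]) (use z in \<open>auto simp: AX\<close>)
    qed
    moreover have "b z - A z (X z) = 0" using Suc.prems(3)[OF z] by simp
    ultimately have "((\<lambda>s. inverse s *\<^sub>R (b (?l s) - A (?l s) (X z))) \<longlongrightarrow> r v z) (at 0)"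
      by (simp add: has_vector_derivative_0_iff)
    moreover have "((\<lambda>s. A (?l s) (Y v z)) \<longlongrightarrow> r v z) (at 0)"
    proof -
      have "isCont (\<lambda>y. A y (Y v z)) z"
        using cA assms(1) z continuous_on_eq_continuous_at by blast
      from isCont_tendsto_compose[OF this l] show ?thesis using Y[OF z] by simp
    qed
    ultimately have "((\<lambda>s. norm (inverse s *\<^sub>R (b (?l s) - A (?l s) (X z)) - A (?l s) (Y v z)) / c) \<longlongrightarrow> 0) (at 0)"
      using tendsto_divide[OF tendsto_norm[OF tendsto_diff] tendsto_const[of c]] c(1) by fastforce
    moreover have "eventually (\<lambda>s. norm (inverse s *\<^sub>R (X (?l s) - X z) - Y v z)
        \<le> norm (inverse s *\<^sub>R (b (?l s) - A (?l s) (X z)) - A (?l s) (Y v z)) / c) (at 0)"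
      using filterlim_iff[THEN iffD1, OF l, rule_format, OF c(2)]
    proof eventually_elim
      case (elim s)
      then have S: "?l s \<in> S" by blast
      have "A (?l s) (inverse s *\<^sub>R (X (?l s) - X z) - Y v z)
          = inverse s *\<^sub>R (b (?l s) - A (?l s) (X z)) - A (?l s) (Y v z)"
        using linear_diff[OF lin[OF S]] linear_scale[OF lin[OF S]] Suc.prems(3)[OF S] by simp
      then have "c * norm (inverse s *\<^sub>R (X (?l s) - X z) - Y v z)
          \<le> norm (inverse s *\<^sub>R (b (?l s) - A (?l s) (X z)) - A (?l s) (Y v z))"
        using elim by metis
      then show ?case using c(1) by (simp add: field_simps)
    qed
    ultimately have "((\<lambda>s. inverse s *\<^sub>R (X (?l s) - X z) - Y v z) \<longlongrightarrow> 0) (at 0)"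
      by (rule Lim_null_comparison[rotated])
    then show "((\<lambda>s. X (?l s)) has_vector_derivative Y v z) (at 0)"
      by (simp add: has_vector_derivative_0_iff LIM_zero_iff)
  qed
qed

lemma Ck_on_mono: "j \<le> k \<Longrightarrow> Ck_on k S f \<Longrightarrow> Ck_on j S f"
  by (induction k rule: dec_induct) (auto simp del: Ck_on.simps(2) dest: Ck_on_Suc_imp)

section \<open>Ordinary differential equations\<close>

subsection \<open>Primitives\<close>

text \<open>Rescaling the integral from \<open>0\<close> to \<open>t\<close> to the fixed interval \<open>[0,1]\<close> makes it meaningful
  for \<open>t\<close> of either sign.\<close>

definition prim :: "(real \<Rightarrow> 'w::banach) \<Rightarrow> real \<Rightarrow> 'w" where
  "prim f t = t *\<^sub>R integral {0..1} (\<lambda>u. f (u * t))"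

lemma prim_zero [simp]: "prim f 0 = 0"
  by (simp add: prim_def)

lemma scale_in_interval:
  fixes t :: real
  assumes "is_interval I" "0 \<in> I" "t \<in> I" "u \<in> {0..1}"
  shows "u * t \<in> I"
proof -
  have "convex I" using assms(1) by (simp add: is_interval_convex_1)
  then have "(1 - u) *\<^sub>R 0 + u *\<^sub>R t \<in> I" using assms by (intro convexD) auto
  then show ?thesis by simp
qed

lemma prim_continuous_integrand:
  fixes t :: real
  assumes "is_interval I" "0 \<in> I" "continuous_on I f" "t \<in> I"
  shows "continuous_on {0..1} (\<lambda>u. f (u * t))"
  by (rule continuous_on_compose2[OF assms(3)])
    (use scale_in_interval[OF assms(1,2,4)] in \<open>auto intro!: continuous_intros\<close>)

lemma prim_cong:
  assumes "is_interval I" "0 \<in> I" "t \<in> I" "\<And>s. s \<in> I \<Longrightarrow> f s = g s"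
  shows "prim f t = prim g t"
  unfolding prim_def using scale_in_interval[OF assms(1-3)] assms(4) by (metis (mono_tags, lifting) integral_cong)

lemma prim_add:
  assumes "is_interval I" "0 \<in> I" "continuous_on I f" "continuous_on I g" "t \<in> I"
  shows "prim (\<lambda>s. f s + g s) t = prim f t + prim g t"
  unfolding prim_def
  using integrable_continuous_real[OF prim_continuous_integrand[OF assms(1,2,3,5)]]
    integrable_continuous_real[OF prim_continuous_integrand[OF assms(1,2,4,5)]]
  by (simp add: integral_add scaleR_add_right)

lemma prim_diff:
  assumes "is_interval I" "0 \<in> I" "continuous_on I f" "continuous_on I g" "t \<in> I"
  shows "prim (\<lambda>s. f s - g s) t = prim f t - prim g t"
  unfolding prim_def
  using integrable_continuous_real[OF prim_continuous_integrand[OF assms(1,2,3,5)]]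
    integrable_continuous_real[OF prim_continuous_integrand[OF assms(1,2,4,5)]]
  by (simp add: integral_diff scaleR_diff_right)

lemma prim_scaleR: "prim (\<lambda>s. c *\<^sub>R f s) t = c *\<^sub>R prim f t"
  unfolding prim_def by simp

lemma norm_prim_le:
  assumes "is_interval I" "0 \<in> I" "continuous_on I f" "t \<in> I" "\<And>s. s \<in> I \<Longrightarrow> norm (f s) \<le> B"
  shows "norm (prim f t) \<le> \<bar>t\<bar> * B"
proof -
  have "norm (integral {0..1} (\<lambda>u. f (u * t))) \<le> B * (1 - 0)"
    using scale_in_interval[OF assms(1,2,4)] assms(5)
    by (intro integral_bound prim_continuous_integrand[OF assms(1-4)]) auto
  then show ?thesis by (simp add: prim_def mult_left_mono)
qed

lemma prim_eq_diff:
  assumes "is_interval I" "0 \<in> I" "t \<in> I"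
    and "\<And>s. s \<in> I \<Longrightarrow> (y has_vector_derivative f s) (at s within I)"
  shows "prim f t = y t - y 0"
proof -
  have "((\<lambda>u. t *\<^sub>R f (u * t)) has_integral (y (1 * t) - y (0 * t))) {0..1}"
  proof (rule fundamental_theorem_of_calculus)
    fix u :: real assume u: "u \<in> {0..1}"
    have "((\<lambda>u. u * t) has_vector_derivative t) (at u within {0..1})"
      by (auto intro!: derivative_eq_intros)
    moreover have "(y has_vector_derivative f (u * t)) (at (u * t) within (\<lambda>u. u * t) ` {0..1})"
      by (rule has_vector_derivative_within_subset[OF assms(4)])
        (use scale_in_interval[OF assms(1-3)] u in auto)
    ultimately show "((\<lambda>u. y (u * t)) has_vector_derivative t *\<^sub>R f (u * t)) (at u within {0..1})"
      using vector_diff_chain_within[of "\<lambda>u. u * t" t u "{0..1}" y] by (simp add: o_def)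
  qed simp
  then show ?thesis unfolding prim_def
    by (metis integral_cmul integral_unique mult_1 mult_zero_left)
qed

lemma open_interval_covers:
  fixes t :: real
  assumes "open I" "is_interval I" "s \<in> I" "t \<in> I"
  obtains a b where "{a..b} \<subseteq> I" "a < s" "s < b" "a < t" "t < b"
proof -
  obtain e where e: "e > 0" "cball s e \<subseteq> I" using assms open_contains_cball by blast
  obtain d where d: "d > 0" "cball t d \<subseteq> I" using assms open_contains_cball by blast
  define m where "m = min d e"
  have m: "m > 0" "m \<le> d" "m \<le> e" using d e by (auto simp: m_def)
  have "min s t - m \<in> I" "max s t + m \<in> I"
    using d e m by (auto simp: min_def max_def dist_real_def subset_iff)
  then have "{min s t - m..max s t + m} \<subseteq> I"
    using mem_is_interval_1_I[OF assms(2)] by (meson atLeastAtMost_iff subsetI)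
  then show ?thesis using m by (intro that[of "min s t - m" "max s t + m"]) auto
qed

lemma prim_has_derivative:
  fixes f :: "real \<Rightarrow> 'w::banach"
  assumes "open I" "is_interval I" "0 \<in> I" "continuous_on I f" "t \<in> I"
  shows "(prim f has_vector_derivative f t) (at t)"
proof -
  obtain a b where ab: "{a..b} \<subseteq> I" "a < 0" "0 < b" "a < t" "t < b"
    using open_interval_covers[OF assms(1,2,3,5)] by metis
  define G where "G t = integral {a..t} f" for t
  have G: "(G has_vector_derivative f s) (at s within {a..b})" if "s \<in> {a..b}" for s
    unfolding G_def using integral_has_vector_derivative[OF continuous_on_subset[OF assms(4) ab(1)] that] .
  have eq: "prim f s = G s - G 0" if "s \<in> {a..b}" for s
    by (rule prim_eq_diff[of "{a..b}"]) (use ab that G in \<open>auto simp: is_interval_cc\<close>)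
  have "(G has_vector_derivative f t) (at t)"
    using has_vector_derivative_within_subset[OF G[of t], of "{a<..<b}"] ab at_within_open[of t "{a<..<b}"]
    by (auto simp: greaterThanLessThan_subseteq_atLeastAtMost_iff)
  then have "((\<lambda>s. G s - G 0) has_vector_derivative f t) (at t)"
    by (auto intro!: derivative_eq_intros)
  then show ?thesis
    by (rule has_vector_derivative_transform_within_open[of _ _ _ "{a<..<b}"]) (use ab eq in auto)
qed

lemma prim_continuous_param:
  fixes f :: "real \<times> 'p::topological_space \<Rightarrow> 'w::banach"
  assumes "is_interval I" "0 \<in> I" "continuous_on (I \<times> K) f"
  shows "continuous_on (I \<times> K) (\<lambda>(t, p). prim (\<lambda>s. f (s, p)) t)"
proof -
  have "continuous_on ((I \<times> K) \<times> cbox 0 1) (\<lambda>(z, u). f (u * fst z, snd z))"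
    unfolding case_prod_unfold
    by (rule continuous_on_compose2[OF assms(3)])
      (use scale_in_interval[OF assms(1,2)] in \<open>auto intro!: continuous_intros\<close>)
  from integral_continuous_on_param[OF this] show ?thesis
    unfolding prim_def case_prod_unfold
    by (intro continuous_intros) (simp add: box_real)
qed

lemma has_vector_derivative_within_UNIV_ball:
  assumes "(f has_vector_derivative D) (at 0 within {-d..d})" "0 < (d::real)"
  shows "(f has_vector_derivative D) (at 0)"
  using has_vector_derivative_within_subset[OF assms(1), of "{-d<..<d}"] assms(2)
    at_within_open[of 0 "{-d<..<d}"] by (auto simp: greaterThanLessThan_subseteq_atLeastAtMost_iff)

lemma open_line_segment_nbhd:
  fixes q v :: "'p::real_normed_vector"
  assumes "open Q" "q \<in> Q"
  obtains d where "d > 0" "\<And>s. \<bar>s\<bar> \<le> d \<Longrightarrow> q + s *\<^sub>R v \<in> Q"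
proof -
  have "open ((\<lambda>s. q + s *\<^sub>R v) -` Q)" by (intro open_vimage assms(1) continuous_intros)
  moreover have "0 \<in> (\<lambda>s. q + s *\<^sub>R v) -` Q" using assms(2) by simp
  ultimately obtain d where "d > 0" "cball 0 d \<subseteq> (\<lambda>s. q + s *\<^sub>R v) -` Q"
    using open_contains_cball by metis
  then show ?thesis using that by (auto simp: subset_iff)
qed

lemma partial_snd:
  assumes "(f has_derivative f') (at (t, q))"
  shows "((\<lambda>s. f (t, q + s *\<^sub>R v)) has_vector_derivative f' (0, v)) (at 0)"
  using has_vector_derivative_along_line[OF assms, of "(0, v)"] by simp

lemma partial_fst:
  fixes t :: real
  assumes "(f has_derivative f') (at (t, q))"
  shows "((\<lambda>s. f (s, q)) has_vector_derivative f' (1, 0)) (at t)"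
proof -
  have "((\<lambda>s. f ((0, q) + t *\<^sub>R (1, 0) + s *\<^sub>R (1, 0))) has_vector_derivative f' (1, 0)) (at 0)"
    using has_vector_derivative_along_line[OF assms, of "(1, 0)"] by simp
  from has_vector_derivative_line_shift[OF this] show ?thesis by simp
qed

text \<open>In the time direction the derivative is the integrand itself; in a parameter direction
  it is again a primitive, now of a derivative of \<open>f\<close>. Both have order \<open>k\<close>
  when \<open>f\<close> has order \<open>Suc k\<close>.\<close>

lemma Ck_on_prim:
  fixes f :: "real \<times> 'p::euclidean_space \<Rightarrow> 'w::banach"
  assumes "open I" "is_interval I" "0 \<in> I" "open Q" "Ck_on k (I \<times> Q) f"
  shows "Ck_on k (I \<times> Q) (\<lambda>(t, q). prim (\<lambda>s. f (s, q)) t)"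
  using assms(5)
proof (induction k arbitrary: f)
  case 0
  then show ?case using prim_continuous_param[OF assms(2,3)] by simp
next
  case (Suc k)
  note f = Ck_on_SucD[OF Suc.prems]
  have oZ: "open (I \<times> Q)" by (intro open_Times assms)
  have cont: "continuous_on (I \<times> Q) f" using Suc.prems by (rule Ck_on_imp_continuous_on)
  have sec: "continuous_on I (\<lambda>s. f (s, q))" if "q \<in> Q" for q
    by (rule continuous_on_compose2[OF cont]) (use that in \<open>auto intro!: continuous_intros\<close>)
  define g where "g b = (if fst b = 0
    then (\<lambda>(t, q). prim (\<lambda>s. frechet_derivative f (at (s, q)) b) t) else f)" for b :: "real \<times> 'p"
  show ?case
  proof (rule Ck_on_Suc_partials[OF oZ])
    fix b :: "real \<times> 'p" assume b: "b \<in> Basis"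
    show "Ck_on k (I \<times> Q) (g b)"
      using Suc.IH[OF f(2)[of b]] Ck_on_Suc_imp[OF Suc.prems] by (simp add: g_def)
    fix y assume y: "y \<in> I \<times> Q"
    obtain t q where tq: "y = (t, q)" "t \<in> I" "q \<in> Q" using y by auto
    show "((\<lambda>s. case y + s *\<^sub>R b of (t, q) \<Rightarrow> prim (\<lambda>s. f (s, q)) t) has_vector_derivative g b y) (at 0)"
    proof (cases "fst b = 0")
      case False
      then have "b = (1, 0)" using b by (auto simp: Basis_prod_def)
      moreover have "(prim (\<lambda>s. f (s, q)) has_vector_derivative f (t, q)) (at t)"
        by (rule prim_has_derivative[OF assms(1-3) sec tq(2)]) (rule tq)
      then have "((\<lambda>s. prim (\<lambda>s. f (s, q)) (t + s)) has_vector_derivative f (t, q)) (at 0)"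
        using vector_diff_chain_at[of "\<lambda>s. t + s" 1 0 "prim (\<lambda>s. f (s, q))" "f (t, q)"]
        using has_vector_derivative_add_const[of "\<lambda>s. s" t 1 "at 0"] has_vector_derivative_id[of "at 0"]
        by (simp add: o_def add.commute)
      ultimately show ?thesis by (simp add: g_def tq)
    next
      case True
      then obtain v where v: "b = (0, v)" by (cases b) auto
      obtain d where d: "d > 0" "\<And>s. \<bar>s\<bar> \<le> d \<Longrightarrow> q + s *\<^sub>R v \<in> Q"
        using open_line_segment_nbhd[OF assms(4) tq(3)] by metis
      have inZ: "(u * t, q + s *\<^sub>R v) \<in> I \<times> Q" if "s \<in> {-d..d}" "u \<in> {0..1}" for s u
        using that d scale_in_interval[OF assms(2,3) tq(2)] by auto
      have "((\<lambda>s. integral (cbox 0 1) (\<lambda>u. f (u * t, q + s *\<^sub>R v))) has_vector_derivative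
          integral (cbox 0 1) (\<lambda>u. frechet_derivative f (at (u * t, q + 0 *\<^sub>R v)) b)) (at 0 within {-d..d})"
      proof (rule leibniz_rule_vector_derivative[of _ _ _ _ "\<lambda>s u. frechet_derivative f (at (u * t, q + s *\<^sub>R v)) b"])
        fix s u assume su: "s \<in> {-d..d}" "u \<in> cbox 0 (1::real)"
        have "((\<lambda>s'. f (u * t, (q + s *\<^sub>R v) + s' *\<^sub>R v)) has_vector_derivative
            frechet_derivative f (at (u * t, q + s *\<^sub>R v)) (0, v)) (at 0)"
          by (rule partial_snd[OF f(1)[OF inZ]]) (use su in auto)
        then have "((\<lambda>s'. f (u * t, q + s' *\<^sub>R v)) has_vector_derivative
            frechet_derivative f (at (u * t, q + s *\<^sub>R v)) b) (at s)"
          unfolding v by (rule has_vector_derivative_line_shift[of "\<lambda>q. f (u * t, q)"])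
        then show "((\<lambda>s'. f (u * t, q + s' *\<^sub>R v)) has_vector_derivative
            frechet_derivative f (at (u * t, q + s *\<^sub>R v)) b) (at s within {-d..d})"
          by (rule has_vector_derivative_at_within)
      next
        fix s assume "s \<in> {-d..d}"
        then show "(\<lambda>u. f (u * t, q + s *\<^sub>R v)) integrable_on cbox 0 1"
          by (intro integrable_continuous continuous_on_compose2[OF cont])
            (use inZ in \<open>auto intro!: continuous_intros\<close>)
      next
        show "continuous_on ({- d..d} \<times> cbox 0 1) (\<lambda>(s, u). frechet_derivative f (at (u * t, q + s *\<^sub>R v)) b)"
          unfolding case_prod_unfold
          by (rule continuous_on_compose2[OF Ck_on_imp_continuous_on[OF f(2)]])
            (use inZ in \<open>auto intro!: continuous_intros\<close>)
      qed (use d in auto)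
      then have "((\<lambda>s. integral {0..1} (\<lambda>u. f (u * t, q + s *\<^sub>R v))) has_vector_derivative
          integral {0..1} (\<lambda>u. frechet_derivative f (at (u * t, q)) b)) (at 0)"
        using has_vector_derivative_within_UNIV_ball[OF _ d(1)] by (simp add: box_real)
      then have "((\<lambda>s. t *\<^sub>R integral {0..1} (\<lambda>u. f (u * t, q + s *\<^sub>R v))) has_vector_derivative
          t *\<^sub>R integral {0..1} (\<lambda>u. frechet_derivative f (at (u * t, q)) b)) (at 0)"
        by (intro bounded_linear.has_vector_derivative[OF bounded_linear_scaleR_right])
      then show ?thesis by (simp add: g_def tq v prim_def)
    qed
  qed
qed

lemma smooth_on_prim:
  fixes f :: "real \<times> 'p::euclidean_space \<Rightarrow> 'w::banach"
  shows "open I \<Longrightarrow> is_interval I \<Longrightarrow> 0 \<in> I \<Longrightarrow> open Q \<Longrightarrow> smooth_on (I \<times> Q) f \<Longrightarrow>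
    smooth_on (I \<times> Q) (\<lambda>(t, q). prim (\<lambda>s. f (s, q)) t)"
  by (simp add: smooth_on_def Ck_on_prim)


subsection \<open>Volterra equations depending on parameters\<close>

text \<open>The contraction principle for continuous maps from \<open>S\<close> to \<open>C\<close>,
  with uniform bounds \<open>d\<close> in place of a metric: the steps between successive iterates
  are dominated by a geometric series.\<close>

lemma contraction_fixpoint:
  fixes T :: "('p::topological_space \<Rightarrow> 'w::banach) \<Rightarrow> 'p \<Rightarrow> 'w"
  assumes "closed C" "compact S"
    and T: "\<And>f. continuous_on S f \<Longrightarrow> f ` S \<subseteq> C \<Longrightarrow> continuous_on S (T f) \<and> T f ` S \<subseteq> C"
    and contr: "\<And>f g d. \<lbrakk>continuous_on S f; f ` S \<subseteq> C; continuous_on S g; g ` S \<subseteq> C;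
        \<forall>x\<in>S. norm (f x - g x) \<le> d\<rbrakk> \<Longrightarrow> \<forall>x\<in>S. norm (T f x - T g x) \<le> d / 2"
    and f0: "continuous_on S f0" "f0 ` S \<subseteq> C"
  obtains f where "continuous_on S f" "f ` S \<subseteq> C" "\<And>x. x \<in> S \<Longrightarrow> T f x = f x"
proof -
  define F where "F n = (T ^^ n) f0" for n
  have F: "continuous_on S (F n) \<and> F n ` S \<subseteq> C" for n
    by (induction n) (use f0 T in \<open>auto simp: F_def\<close>)
  have "compact ((\<lambda>x. F 1 x - F 0 x) ` S)"
    using F by (intro compact_continuous_image assms(2) continuous_intros) auto
  then obtain D where D: "\<And>x. x \<in> S \<Longrightarrow> norm (F 1 x - F 0 x) \<le> D"
    using compact_imp_bounded[of "(\<lambda>x. F 1 x - F 0 x) ` S"] by (auto simp: bounded_iff)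
  have step: "\<forall>x\<in>S. norm (F (Suc n) x - F n x) \<le> D * (1/2) ^ n" for n
  proof (induction n)
    case (Suc n)
    have "\<forall>x\<in>S. norm (T (F (Suc n)) x - T (F n) x) \<le> D * (1/2) ^ n / 2"
      by (rule contr) (use F Suc in auto)
    then show ?case by (simp add: F_def)
  qed (use D in simp)
  have "summable (\<lambda>n. D * (1/2) ^ n)" by (intro summable_mult summable_geometric) simp
  then have U: "uniform_limit S (\<lambda>n x. \<Sum>i<n. F (Suc i) x - F i x) (\<lambda>x. \<Sum>i. F (Suc i) x - F i x) sequentially"
    by (intro Weierstrass_m_test) (use step in auto)
  define f where "f x = F 0 x + (\<Sum>i. F (Suc i) x - F i x)" for x
  have "uniform_limit S (\<lambda>n x. F 0 x + (\<Sum>i<n. F (Suc i) x - F i x)) f sequentially"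
    unfolding f_def by (intro uniform_limit_add U uniform_limit_const)
  moreover have "F 0 x + (\<Sum>i<n. F (Suc i) x - F i x) = F n x" for n x
    using sum_lessThan_telescope[of "\<lambda>i. F i x" n] by simp
  ultimately have UF: "uniform_limit S F f sequentially" by simp
  have cf: "continuous_on S f"
    by (rule uniform_limit_theorem[OF _ UF]) (use F in auto)
  have lim: "(\<lambda>n. F n x) \<longlonglongrightarrow> f x" if "x \<in> S" for x
    using tendsto_uniform_limitI[OF UF that] .
  have fC: "f ` S \<subseteq> C"
    using F by (auto intro!: closed_sequentially[OF assms(1) _ lim])
  have "T f x = f x" if x: "x \<in> S" for x
  proof -
    have "(\<lambda>n. T (F n) x) \<longlonglongrightarrow> T f x"
    proof (rule tendstoI)
      fix e :: real assume "e > 0"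
      then have "\<forall>\<^sub>F n in sequentially. \<forall>x\<in>S. dist (F n x) (f x) < e" using UF by (simp add: uniform_limit_iff)
      then show "\<forall>\<^sub>F n in sequentially. dist (T (F n) x) (T f x) < e"
      proof eventually_elim
        case (elim n)
        then have "norm (T (F n) x - T f x) \<le> e / 2"
          using contr[of "F n" f e] F[of n] cf fC x by (auto simp: dist_norm less_imp_le)
        then show ?case using \<open>e > 0\<close> by (simp add: dist_norm)
      qed
    qed
    moreover have "(\<lambda>n. T (F n) x) \<longlonglongrightarrow> f x"
      using LIMSEQ_Suc[OF lim[OF x]] by (simp add: F_def)
    ultimately show ?thesis by (rule LIMSEQ_unique)
  qed
  with cf fC show ?thesis by (rule that)
qed

text \<open>Compactness supplies a first bound for the difference; halving it again and again leaves
  only 0.\<close>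

lemma contraction_unique:
  fixes f g :: "'p::topological_space \<Rightarrow> 'w::real_normed_vector"
  assumes "compact S" "continuous_on S f" "continuous_on S g"
    and "\<And>d. \<forall>x\<in>S. norm (f x - g x) \<le> d \<Longrightarrow> \<forall>x\<in>S. norm (f x - g x) \<le> d / 2"
    and "x \<in> S"
  shows "f x = g x"
proof -
  have "compact ((\<lambda>x. f x - g x) ` S)"
    by (intro compact_continuous_image assms continuous_intros)
  then obtain D where D: "\<forall>x\<in>S. norm (f x - g x) \<le> D"
    using compact_imp_bounded[of "(\<lambda>x. f x - g x) ` S"] by (auto simp: bounded_iff)
  have "\<forall>x\<in>S. norm (f x - g x) \<le> D * (1/2) ^ n" for n
    by (induction n) (use D assms(4) in force)+
  moreover have "(\<lambda>n. D * (1/2) ^ n) \<longlonglongrightarrow> D * 0"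
    by (intro tendsto_mult tendsto_const LIMSEQ_power_zero) simp
  ultimately have "norm (f x - g x) \<le> 0"
    using assms(5) by (intro LIMSEQ_le_const) auto
  then show ?thesis by simp
qed

text \<open>In this section \<open>\<epsilon> * L \<le> 1/2\<close> makes the integral operator a contraction by \<open>1/2\<close>.\<close>

lemma volterra_contraction:
  fixes A :: "real \<Rightarrow> 'w::euclidean_space \<Rightarrow> 'w"
  assumes "0 \<le> L" "\<epsilon> * L \<le> 1/2" "\<And>s. s \<in> {-\<epsilon>..\<epsilon>} \<Longrightarrow> linear (A s)"
    and "\<And>s w. s \<in> {-\<epsilon>..\<epsilon>} \<Longrightarrow> norm (A s w) \<le> L * norm w" "\<And>w. continuous_on {-\<epsilon>..\<epsilon>} (\<lambda>s. A s w)"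
    and "continuous_on {-\<epsilon>..\<epsilon>} f" "continuous_on {-\<epsilon>..\<epsilon>} g" "\<And>s. s \<in> {-\<epsilon>..\<epsilon>} \<Longrightarrow> norm (f s - g s) \<le> d"
    and t: "t \<in> {-\<epsilon>..\<epsilon>}"
  shows "norm (prim (\<lambda>s. A s (f s)) t - prim (\<lambda>s. A s (g s)) t) \<le> d / 2"
proof -
  let ?J = "{-\<epsilon>..\<epsilon>}"
  have J: "is_interval ?J" "0 \<in> ?J" using t by (auto simp: is_interval_cc)
  have c: "continuous_on ?J (\<lambda>s. A s (f s))" "continuous_on ?J (\<lambda>s. A s (g s))"
    by (rule continuous_on_apply_linear[OF assms(3,5,6)] continuous_on_apply_linear[OF assms(3,5,7)]; assumption)+
  have "d \<ge> 0" using assms(8)[OF J(2)] norm_ge_zero order_trans by blast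
  have "norm (prim (\<lambda>s. A s (f s) - A s (g s)) t) \<le> \<bar>t\<bar> * (L * d)"
  proof (rule norm_prim_le[OF J continuous_on_diff[OF c] t])
    fix s assume s: "s \<in> ?J"
    have "norm (A s (f s) - A s (g s)) = norm (A s (f s - g s))"
      using linear_diff[OF assms(3)[OF s]] by simp
    also have "\<dots> \<le> L * d"
      using assms(4)[OF s] assms(8)[OF s] assms(1) by (meson mult_left_mono order_trans)
    finally show "norm (A s (f s) - A s (g s)) \<le> L * d" .
  qed
  also have "\<dots> \<le> \<epsilon> * (L * d)"
    using t assms(1) \<open>d \<ge> 0\<close> by (intro mult_right_mono) auto
  also have "\<dots> \<le> (1/2) * d"
    using mult_right_mono[OF assms(2) \<open>d \<ge> 0\<close>] by (simp add: mult.assoc)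
  finally show ?thesis using prim_diff[OF J c t] by simp
qed

text \<open>The fixed point is sought among functions of time and parameter together, so joint
  continuity in both comes with existence.\<close>

lemma volterra_exists:
  fixes A :: "real \<times> 'p::metric_space \<Rightarrow> 'w::euclidean_space \<Rightarrow> 'w"
  assumes "0 \<le> \<epsilon>" "0 \<le> L" "\<epsilon> * L \<le> 1/2" "compact K" "\<And>z. z \<in> {-\<epsilon>..\<epsilon>} \<times> K \<Longrightarrow> linear (A z)"
    and "\<And>z w. z \<in> {-\<epsilon>..\<epsilon>} \<times> K \<Longrightarrow> norm (A z w) \<le> L * norm w"
    and "\<And>w. continuous_on ({-\<epsilon>..\<epsilon>} \<times> K) (\<lambda>z. A z w)" "continuous_on ({-\<epsilon>..\<epsilon>} \<times> K) b"
  obtains w where "continuous_on ({-\<epsilon>..\<epsilon>} \<times> K) w"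
    "\<And>t p. t \<in> {-\<epsilon>..\<epsilon>} \<Longrightarrow> p \<in> K \<Longrightarrow> w (t, p) = b (t, p) + prim (\<lambda>s. A (s, p) (w (s, p))) t"
proof -
  let ?J = "{-\<epsilon>..\<epsilon>}"
  have J: "is_interval ?J" "0 \<in> ?J" using assms(1) by (auto simp: is_interval_cc)
  have sec: "continuous_on ?J (\<lambda>s. h (s, p))" if "continuous_on (?J \<times> K) h" "p \<in> K" for h :: "real \<times> 'p \<Rightarrow> 'w" and p
    by (rule continuous_on_compose2[OF that(1)]) (use that in \<open>auto intro!: continuous_intros\<close>)
  define T where "T w = (\<lambda>(t, p). b (t, p) + prim (\<lambda>s. A (s, p) (w (s, p))) t)" for w
  obtain w where w: "continuous_on (?J \<times> K) w" "\<And>z. z \<in> ?J \<times> K \<Longrightarrow> T w z = w z"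
  proof (rule contraction_fixpoint[of UNIV "?J \<times> K" T "\<lambda>_. 0"])
    show "compact (?J \<times> K)" by (intro compact_Times assms compact_Icc)
    fix f :: "real \<times> 'p \<Rightarrow> 'w" assume f: "continuous_on (?J \<times> K) f"
    have "continuous_on (?J \<times> K) (\<lambda>z. A z (f z))"
      by (rule continuous_on_apply_linear[OF assms(5,7) f])
    from prim_continuous_param[OF J this]
    show "continuous_on (?J \<times> K) (T f) \<and> T f ` (?J \<times> K) \<subseteq> UNIV"
      using assms(8) unfolding T_def case_prod_unfold by (auto intro!: continuous_intros)
    fix g :: "real \<times> 'p \<Rightarrow> 'w" and d assume g: "continuous_on (?J \<times> K) g" and d: "\<forall>x\<in>?J \<times> K. norm (f x - g x) \<le> d"
    show "\<forall>x\<in>?J \<times> K. norm (T f x - T g x) \<le> d / 2"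
    proof safe
      fix t p assume t: "t \<in> ?J" and p: "p \<in> K"
      have "norm (prim (\<lambda>s. A (s, p) (f (s, p))) t - prim (\<lambda>s. A (s, p) (g (s, p))) t) \<le> d / 2"
        by (rule volterra_contraction[of L \<epsilon> "\<lambda>s. A (s, p)"]) (use assms p t f g d sec sec[OF assms(7) p] in auto)
      then show "norm (T f (t, p) - T g (t, p)) \<le> d / 2" by (simp add: T_def)
    qed
  qed auto
  show ?thesis
    by (rule that[OF w(1)]) (use w(2) in \<open>force simp: T_def\<close>)
qed

lemma volterra_unique:
  fixes A :: "real \<Rightarrow> 'w::euclidean_space \<Rightarrow> 'w"
  assumes "0 \<le> L" "\<epsilon> * L \<le> 1/2" "\<And>s. s \<in> {-\<epsilon>..\<epsilon>} \<Longrightarrow> linear (A s)"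
    and "\<And>s w. s \<in> {-\<epsilon>..\<epsilon>} \<Longrightarrow> norm (A s w) \<le> L * norm w" "\<And>w. continuous_on {-\<epsilon>..\<epsilon>} (\<lambda>s. A s w)"
    and "continuous_on {-\<epsilon>..\<epsilon>} f" "continuous_on {-\<epsilon>..\<epsilon>} g"
    and "\<And>t. t \<in> {-\<epsilon>..\<epsilon>} \<Longrightarrow> f t = b t + prim (\<lambda>s. A s (f s)) t"
    and "\<And>t. t \<in> {-\<epsilon>..\<epsilon>} \<Longrightarrow> g t = b t + prim (\<lambda>s. A s (g s)) t"
    and t: "t \<in> {-\<epsilon>..\<epsilon>}"
  shows "f t = g t"
proof (rule contraction_unique[OF compact_Icc assms(6,7) _ t])
  fix d assume "\<forall>x\<in>{-\<epsilon>..\<epsilon>}. norm (f x - g x) \<le> d"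
  then have "norm (prim (\<lambda>s. A s (f s)) t - prim (\<lambda>s. A s (g s)) t) \<le> d / 2" if "t \<in> {-\<epsilon>..\<epsilon>}" for t
    by (intro volterra_contraction[OF assms(1-7)] that) auto
  then show "\<forall>x\<in>{-\<epsilon>..\<epsilon>}. norm (f x - g x) \<le> d / 2"
    using assms(8,9) by (metis add_diff_cancel_left)
qed


text \<open>For \<open>s\<close> different from 0 the difference quotient solves a linear Volterra
  equation whose data \<open>A\<close>, \<open>b\<close> are continuous up to \<open>s = 0\<close>.
  The equation has a solution \<open>W\<close> that is continuous also at \<open>s = 0\<close>, and
  uniqueness equates it with the quotient elsewhere; hence the quotient converges to
  \<open>W\<close> at \<open>s = 0\<close>. The set \<open>R\<close> consists of the parameters for
  which the segment to the shifted point stays in \<open>Q\<close>.\<close>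

lemma volterra_difference_quotient:
  fixes y :: "real \<times> 'p::euclidean_space \<Rightarrow> 'w::euclidean_space" and v :: 'p
    and A :: "real \<times> 'p \<times> real \<Rightarrow> 'w \<Rightarrow> 'w" and Q :: "'p set" and \<epsilon> :: real
  defines "R \<equiv> {-\<epsilon><..<\<epsilon>} \<times> {(q, s). closed_segment q (q + s *\<^sub>R v) \<subseteq> Q}"
    and "g \<equiv> \<lambda>z. vector_derivative (\<lambda>s. y (z + s *\<^sub>R (0, v))) (at 0)"
  assumes "0 \<le> L" "\<epsilon> * L \<le> 1/2" "open Q" and y: "continuous_on ({-\<epsilon><..<\<epsilon>} \<times> Q) y"
    and A: "\<And>z. z \<in> R \<Longrightarrow> linear (A z)" "\<And>z w. z \<in> R \<Longrightarrow> norm (A z w) \<le> L * norm w"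
      "\<And>w. continuous_on R (\<lambda>z. A z w)" and b: "continuous_on R b"
    and eq: "\<And>t q s. \<lbrakk>(t, q, s) \<in> R; s \<noteq> 0\<rbrakk> \<Longrightarrow> inverse s *\<^sub>R (y (t, q + s *\<^sub>R v) - y (t, q))
      = b (t, q, s) + prim (\<lambda>r. A (r, q, s) (inverse s *\<^sub>R (y (r, q + s *\<^sub>R v) - y (r, q)))) t"
  shows "z \<in> {-\<epsilon><..<\<epsilon>} \<times> Q \<Longrightarrow> ((\<lambda>s. y (z + s *\<^sub>R (0, v))) has_vector_derivative g z) (at 0)"
    and "continuous_on ({-\<epsilon><..<\<epsilon>} \<times> Q) g"
    and "t \<in> {-\<epsilon><..<\<epsilon>} \<Longrightarrow> q \<in> Q \<Longrightarrow> g (t, q) = b (t, q, 0) + prim (\<lambda>s. A (s, q, 0) (g (s, q))) t"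
proof -
  have local: "\<exists>\<epsilon>' d w. \<bar>t\<bar> < \<epsilon>' \<and> \<epsilon>' < \<epsilon> \<and> 0 < d \<and> continuous_on ({-\<epsilon>'..\<epsilon>'} \<times> cball q d) w \<and>
      (\<forall>t\<in>{-\<epsilon>'..\<epsilon>'}. \<forall>q\<in>cball q d.
        ((\<lambda>s. y ((t, q) + s *\<^sub>R (0, v))) has_vector_derivative w (t, q)) (at 0) \<and>
        w (t, q) = b (t, q, 0) + prim (\<lambda>s. A (s, q, 0) (w (s, q))) t)"
    if tq: "t \<in> {-\<epsilon><..<\<epsilon>}" "q \<in> Q" for t q
  proof -
    define \<epsilon>' where "\<epsilon>' = (\<bar>t\<bar> + \<epsilon>) / 2"
    have \<epsilon>': "\<bar>t\<bar> < \<epsilon>'" "\<epsilon>' < \<epsilon>" "0 \<le> \<epsilon>'" using tq by (auto simp: \<epsilon>'_def)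
    have \<epsilon>L: "\<epsilon>' * L \<le> 1/2"
      using mult_right_mono[of \<epsilon>' \<epsilon> L] assms(3,4) \<epsilon>' by linarith
    obtain r where r: "r > 0" "cball q r \<subseteq> Q" using assms(5) tq open_contains_cball by blast
    \<comment> \<open>Chosen so that \<open>d + d * norm v = r\<close>: a shift by at most
      \<open>d\<close> times \<open>v\<close> of a point at distance at most \<open>d\<close> from
      \<open>q\<close> stays within distance \<open>r\<close>.\<close>
    define d where "d = r / (1 + norm v)"
    have nv: "1 + norm v > 0" using norm_ge_zero[of v] by linarith
    have "d * (1 + norm v) = r" using nv by (simp add: d_def)
    then have d: "d > 0" "d + d * norm v = r" using r nv by (auto simp: d_def distrib_left)
    let ?J = "{-\<epsilon>'..\<epsilon>'}" and ?K = "cball q d \<times> {-d..d}"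
    have seg: "closed_segment p (p + s *\<^sub>R v) \<subseteq> Q" if "p \<in> cball q d" "s \<in> {-d..d}" for p s
    proof -
      have "norm (s *\<^sub>R v) \<le> d * norm v" using that d by (auto intro!: mult_right_mono)
      then have "dist q (p + s *\<^sub>R v) \<le> r"
        using that d norm_triangle_ineq4[of "q - p" "s *\<^sub>R v"] by (simp add: dist_norm algebra_simps)
      moreover have "dist q p \<le> r" using that d by (auto intro: order_trans)
      ultimately have "closed_segment p (p + s *\<^sub>R v) \<subseteq> cball q r"
        by (intro closed_segment_subset) auto
      then show ?thesis using r by blast
    qed
    have JK: "?J \<times> ?K \<subseteq> R" using seg \<epsilon>' by (auto simp: R_def intro: subsetD[OF seg])
    obtain W where W: "continuous_on (?J \<times> ?K) W"
      "\<And>t p. t \<in> ?J \<Longrightarrow> p \<in> ?K \<Longrightarrow> W (t, p) = b (t, p) + prim (\<lambda>s. A (s, p) (W (s, p))) t"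
    proof (rule volterra_exists[OF \<epsilon>'(3) assms(3) \<epsilon>L, of ?K A b])
      show "compact ?K" by (intro compact_Times compact_cball compact_Icc)
      show "continuous_on (?J \<times> ?K) (\<lambda>z. A z w)" for w by (rule continuous_on_subset[OF A(3) JK])
      show "continuous_on (?J \<times> ?K) b" by (rule continuous_on_subset[OF b JK])
    qed (blast intro: A(1,2) subsetD[OF JK])+
    \<comment> \<open>Away from \<open>s = 0\<close> the quotient and \<open>W\<close> solve the
      same equation, so they coincide; only there is the quotient meaningful.\<close>
    have D: "inverse s *\<^sub>R (y (t, p + s *\<^sub>R v) - y (t, p)) = W (t, p, s)"
      if D0: "t \<in> ?J" "p \<in> cball q d" "s \<in> {-d..d}" "s \<noteq> 0" for t p s
    proof (rule volterra_unique[OF assms(3) \<epsilon>L, of "\<lambda>r. A (r, p, s)"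
          "\<lambda>t. inverse s *\<^sub>R (y (t, p + s *\<^sub>R v) - y (t, p))" "\<lambda>t. W (t, p, s)" "\<lambda>r. b (r, p, s)"])
      have R: "(r, p, s) \<in> R" if "r \<in> ?J" for r using JK D0(2,3) that by blast
      show "linear (A (r, p, s))" "norm (A (r, p, s) w) \<le> L * norm w" if "r \<in> ?J" for r w
        using A R that by auto
      show "continuous_on ?J (\<lambda>r. A (r, p, s) w)" for w
        by (rule continuous_on_compose2[OF A(3)]) (use R in \<open>auto intro!: continuous_intros\<close>)
      have sub: "p \<in> Q" "p + s *\<^sub>R v \<in> Q" using seg[OF D0(2,3)] by auto
      have "continuous_on ?J (\<lambda>r. y (r, p'))" if "p' \<in> Q" for p'
        by (rule continuous_on_compose2[OF y]) (use that \<epsilon>' in \<open>auto intro!: continuous_intros\<close>)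
      with sub show "continuous_on ?J (\<lambda>t. inverse s *\<^sub>R (y (t, p + s *\<^sub>R v) - y (t, p)))"
        by (intro continuous_intros)
      show "continuous_on ?J (\<lambda>r. W (r, p, s))"
        by (rule continuous_on_compose2[OF W(1)]) (use D0 in \<open>auto intro!: continuous_intros\<close>)
      show "inverse s *\<^sub>R (y (t, p + s *\<^sub>R v) - y (t, p)) = b (t, p, s)
          + prim (\<lambda>r. A (r, p, s) (inverse s *\<^sub>R (y (r, p + s *\<^sub>R v) - y (r, p)))) t" if "t \<in> ?J" for t
        by (rule eq[OF R[OF that] D0(4)])
      show "W (t, p, s) = b (t, p, s) + prim (\<lambda>r. A (r, p, s) (W (r, p, s))) t" if "t \<in> ?J" for t
        by (rule W(2)) (use that D0(2,3) in auto)
    qed (rule D0(1))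
    define w where "w = (\<lambda>(t, p). W (t, p, 0))"
    have "continuous_on (?J \<times> cball q d) w"
      unfolding w_def case_prod_unfold
      by (rule continuous_on_compose2[OF W(1)]) (use d in \<open>auto intro!: continuous_intros\<close>)
    moreover have "((\<lambda>s. y ((t, p) + s *\<^sub>R (0, v))) has_vector_derivative w (t, p)) (at 0)"
      if "t \<in> ?J" "p \<in> cball q d" for t p
    proof -
      have "continuous_on {-d..d} (\<lambda>s. W (t, p, s))"
        by (rule continuous_on_compose2[OF W(1)]) (use that in \<open>auto intro!: continuous_intros\<close>)
      then have "continuous_on {-d<..<d} (\<lambda>s. W (t, p, s))"
        by (rule continuous_on_subset) auto
      then have "isCont (\<lambda>s. W (t, p, s)) 0"
        using d(1) by (simp add: continuous_on_eq_continuous_at)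
      then have "((\<lambda>s. W (t, p, s)) \<longlongrightarrow> w (t, p)) (at 0)"
        by (simp add: isCont_def w_def)
      moreover have "\<forall>\<^sub>F s in at 0. W (t, p, s) = inverse s *\<^sub>R (y (t, p + s *\<^sub>R v) - y (t, p))"
        unfolding eventually_at using d(1)
        by (intro exI[of _ d]) (auto simp: dist_real_def intro!: D[OF that, symmetric])
      ultimately have "((\<lambda>s. inverse s *\<^sub>R (y (t, p + s *\<^sub>R v) - y (t, p))) \<longlongrightarrow> w (t, p)) (at 0)"
        by (rule Lim_transform_eventually)
      then show ?thesis by (simp add: has_vector_derivative_0_iff)
    qed
    moreover have "w (t, p) = b (t, p, 0) + prim (\<lambda>s. A (s, p, 0) (w (s, p))) t"
      if "t \<in> ?J" "p \<in> cball q d" for t p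
      using W(2)[of t "(p, 0)"] that d by (simp add: w_def)
    ultimately show ?thesis using \<epsilon>' d by blast
  qed
  have gw: "g z = D" if "((\<lambda>s. y (z + s *\<^sub>R (0, v))) has_vector_derivative D) (at 0)" for z D
    using vector_derivative_at[OF that] by (simp add: g_def)
  show der: "((\<lambda>s. y (z + s *\<^sub>R (0, v))) has_vector_derivative g z) (at 0)" if z: "z \<in> {-\<epsilon><..<\<epsilon>} \<times> Q" for z
  proof -
    obtain t q where tq: "z = (t, q)" "t \<in> {-\<epsilon><..<\<epsilon>}" "q \<in> Q" using z by auto
    from local[OF tq(2,3)] obtain \<epsilon>' d w where *: "\<bar>t\<bar> < \<epsilon>'" "0 < d"
      "\<forall>t\<in>{-\<epsilon>'..\<epsilon>'}. \<forall>q\<in>cball q d. ((\<lambda>s. y ((t, q) + s *\<^sub>R (0, v))) has_vector_derivative w (t, q)) (at 0)"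
      by blast
    have "((\<lambda>s. y ((t, q) + s *\<^sub>R (0, v))) has_vector_derivative w (t, q)) (at 0)"
    proof -
      have "t \<in> {-\<epsilon>'..\<epsilon>'}" "q \<in> cball q d" using *(1,2) by auto
      then show ?thesis using *(3) by blast
    qed
    with gw[OF this] show ?thesis by (simp add: tq)
  qed
  have "isCont g (t, q)" if tq: "t \<in> {-\<epsilon><..<\<epsilon>}" "q \<in> Q" for t q
  proof -
    from local[OF tq] obtain \<epsilon>' d w where *: "\<bar>t\<bar> < \<epsilon>'" "0 < d" "continuous_on ({-\<epsilon>'..\<epsilon>'} \<times> cball q d) w"
      "\<forall>t\<in>{-\<epsilon>'..\<epsilon>'}. \<forall>q\<in>cball q d. ((\<lambda>s. y ((t, q) + s *\<^sub>R (0, v))) has_vector_derivative w (t, q)) (at 0)"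
      by blast
    have "continuous_on ({-\<epsilon>'..\<epsilon>'} \<times> cball q d) g"
      by (rule continuous_on_eq[OF *(3)]) (use *(4) gw in force)
    then have "continuous_on ({-\<epsilon>'<..<\<epsilon>'} \<times> ball q d) g"
      by (rule continuous_on_subset) auto
    moreover have "(t, q) \<in> {-\<epsilon>'<..<\<epsilon>'} \<times> ball q d" using * by auto
    moreover have "open ({-\<epsilon>'<..<\<epsilon>'} \<times> ball q d)" by (intro open_Times) auto
    ultimately show ?thesis using continuous_on_eq_continuous_at by blast
  qed
  then show "continuous_on ({-\<epsilon><..<\<epsilon>} \<times> Q) g"
    by (auto intro!: continuous_at_imp_continuous_on)
  show "g (t, q) = b (t, q, 0) + prim (\<lambda>s. A (s, q, 0) (g (s, q))) t" if tq: "t \<in> {-\<epsilon><..<\<epsilon>}" "q \<in> Q" for t q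
  proof -
    from local[OF tq] obtain \<epsilon>' d w where *: "\<bar>t\<bar> < \<epsilon>'" "0 < d"
      "\<forall>t\<in>{-\<epsilon>'..\<epsilon>'}. \<forall>q\<in>cball q d. ((\<lambda>s. y ((t, q) + s *\<^sub>R (0, v))) has_vector_derivative w (t, q)) (at 0)
        \<and> w (t, q) = b (t, q, 0) + prim (\<lambda>s. A (s, q, 0) (w (s, q))) t"
      by blast
    have q: "q \<in> cball q d" and t: "t \<in> {-\<epsilon>'..\<epsilon>'}" using * by auto
    have gq: "g (s, q) = w (s, q)" if "s \<in> {-\<epsilon>'..\<epsilon>'}" for s using *(3) q that gw by blast
    then have "prim (\<lambda>s. A (s, q, 0) (g (s, q))) t = prim (\<lambda>s. A (s, q, 0) (w (s, q))) t"
      by (intro prim_cong[of "{-\<epsilon>'..\<epsilon>'}"]) (use *(1) in \<open>auto simp: is_interval_cc\<close>)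
    then show ?thesis using bspec[OF bspec[OF *(3) t] q] gq[OF t] by simp
  qed
qed

section \<open>Difference quotients as averaged derivatives\<close>

definition diff_quotient ::
    "(real \<times> 'p::real_normed_vector \<Rightarrow> 'w::real_normed_vector) \<Rightarrow> 'p \<Rightarrow> real \<times> 'p \<times> real \<Rightarrow> 'w" where
  "diff_quotient f v = (\<lambda>(t, q, s). if s = 0 then frechet_derivative f (at (t, q)) (0, v)
    else inverse s *\<^sub>R (f (t, q + s *\<^sub>R v) - f (t, q)))"

lemma in_segment_line:
  assumes "closed_segment q (q + s *\<^sub>R v) \<subseteq> Q" "u \<in> {0..1::real}"
  shows "q + (u * s) *\<^sub>R v \<in> Q"
proof -
  have "q + (u * s) *\<^sub>R v = (1 - u) *\<^sub>R q + u *\<^sub>R (q + s *\<^sub>R v)"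
    by (simp add: algebra_simps)
  then have "q + (u * s) *\<^sub>R v \<in> closed_segment q (q + s *\<^sub>R v)"
    using assms(2) by (auto simp: closed_segment_def)
  then show ?thesis using assms(1) by blast
qed

text \<open>Hadamard's formula: the quotient is the average of the directional derivative over the
  segment. The right-hand side makes sense at \<open>s = 0\<close> too, so joint continuity there is
  continuity of a parameter integral.\<close>

lemma diff_quotient_eq_integral:
  fixes f :: "real \<times> 'p::euclidean_space \<Rightarrow> 'w::banach"
  assumes f: "\<And>z. z \<in> I \<times> Q \<Longrightarrow> (f has_derivative frechet_derivative f (at z)) (at z)"
    and z: "t \<in> I" "closed_segment q (q + s *\<^sub>R v) \<subseteq> Q"
  shows "diff_quotient f v (t, q, s) = integral {0..1} (\<lambda>u. frechet_derivative f (at (t, q + (u * s) *\<^sub>R v)) (0, v))"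
proof (cases "s = 0")
  case False
  have "((\<lambda>u. s *\<^sub>R frechet_derivative f (at (t, q + (u * s) *\<^sub>R v)) (0, v)) has_integral
      f (t, q + (1 * s) *\<^sub>R v) - f (t, q + (0 * s) *\<^sub>R v)) {0..1}"
  proof (rule fundamental_theorem_of_calculus)
    fix u :: real assume u: "u \<in> {0..1}"
    have "((\<lambda>s'. f (t, (q + (u * s) *\<^sub>R v) + s' *\<^sub>R v)) has_vector_derivative
        frechet_derivative f (at (t, q + (u * s) *\<^sub>R v)) (0, v)) (at 0)"
      by (rule partial_snd[OF f]) (use in_segment_line[OF z(2) u] z in auto)
    from has_vector_derivative_line_shift[of "\<lambda>q. f (t, q)", OF this]
    have "((\<lambda>s'. f (t, q + s' *\<^sub>R v)) has_vector_derivative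
        frechet_derivative f (at (t, q + (u * s) *\<^sub>R v)) (0, v)) (at (u * s))" .
    moreover have "((\<lambda>u. u * s) has_vector_derivative s) (at u)"
      by (auto intro!: derivative_eq_intros)
    ultimately have "((\<lambda>u. f (t, q + (u * s) *\<^sub>R v)) has_vector_derivative
        s *\<^sub>R frechet_derivative f (at (t, q + (u * s) *\<^sub>R v)) (0, v)) (at u)"
      using vector_diff_chain_at[of "\<lambda>u. u * s" s u "\<lambda>s'. f (t, q + s' *\<^sub>R v)"] by (simp add: o_def)
    then show "((\<lambda>u. f (t, q + (u * s) *\<^sub>R v)) has_vector_derivative
        s *\<^sub>R frechet_derivative f (at (t, q + (u * s) *\<^sub>R v)) (0, v)) (at u within {0..1})"
      by (rule has_vector_derivative_at_within)
  qed simp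
  then have e: "s *\<^sub>R integral {0..1} (\<lambda>u. frechet_derivative f (at (t, q + (u * s) *\<^sub>R v)) (0, v))
      = f (t, q + s *\<^sub>R v) - f (t, q)"
    by (auto dest: integral_unique)
  have "inverse s *\<^sub>R (f (t, q + s *\<^sub>R v) - f (t, q))
      = integral {0..1} (\<lambda>u. frechet_derivative f (at (t, q + (u * s) *\<^sub>R v)) (0, v))"
    unfolding e[symmetric] using False by simp
  then show ?thesis using False by (simp add: diff_quotient_def)
qed (simp add: diff_quotient_def)

lemma continuous_on_diff_quotient:
  fixes f :: "real \<times> 'p::euclidean_space \<Rightarrow> 'w::banach"
  assumes "Ck_on (Suc 0) (I \<times> Q) f"
  shows "continuous_on (I \<times> {(q, s). closed_segment q (q + s *\<^sub>R v) \<subseteq> Q}) (diff_quotient f v)"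
proof -
  let ?R = "I \<times> {(q, s). closed_segment q (q + s *\<^sub>R v) \<subseteq> Q}"
  have "continuous_on (?R \<times> cbox 0 1)
      (\<lambda>(z, u). frechet_derivative f (at (fst z, fst (snd z) + (u * snd (snd z)) *\<^sub>R v)) (0, v))"
    unfolding case_prod_unfold
    by (rule continuous_on_compose2[OF Ck_on_imp_continuous_on[OF Ck_on_SucD(2)[OF assms]]])
      (auto intro!: continuous_intros in_segment_line)
  from integral_continuous_on_param[OF this] show ?thesis
    by (rule continuous_on_eq)
      (use diff_quotient_eq_integral[OF Ck_on_SucD(1)[OF assms]] in \<open>force simp: box_real\<close>)
qed

text \<open>Differentiating the equation in a direction \<open>v\<close> gives an equation with the
  same \<open>A\<close> whose inhomogeneity \<open>b'\<close> involves only first derivatives of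
  \<open>A\<close> and \<open>b\<close> and the function \<open>y\<close> itself. By induction
  \<open>y\<close> has order \<open>k\<close>, therefore so has \<open>b'\<close>, and a second use
  of the induction hypothesis gives order \<open>k\<close> to the derivative
  \<open>g v\<close>.\<close>

lemma volterra_linear_Ck:
  fixes y :: "real \<times> 'p::euclidean_space \<Rightarrow> 'w::euclidean_space" and \<epsilon> :: real
  defines "I \<equiv> {-\<epsilon><..<\<epsilon>}"
  assumes "0 < \<epsilon>" "0 \<le> L" "\<epsilon> * L \<le> 1/2" "open Q"
    and lin: "\<And>z. z \<in> I \<times> Q \<Longrightarrow> linear (A z)"
    and bound: "\<And>z w. z \<in> I \<times> Q \<Longrightarrow> norm (A z w) \<le> L * norm w"
    and A: "\<And>w. Ck_on k (I \<times> Q) (\<lambda>z. A z w)" and b: "Ck_on k (I \<times> Q) b"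
    and y: "continuous_on (I \<times> Q) y"
    and eq: "\<And>t q. t \<in> I \<Longrightarrow> q \<in> Q \<Longrightarrow> y (t, q) = b (t, q) + prim (\<lambda>s. A (s, q) (y (s, q))) t"
  shows "Ck_on k (I \<times> Q) y"
  using A b y eq
proof (induction k arbitrary: b y)
  case 0
  then show ?case by simp
next
  case (Suc k)
  have I: "open I" "is_interval I" "0 \<in> I" using assms(2) by (auto simp: I_def is_interval_oo)
  have oZ: "open (I \<times> Q)" by (intro open_Times I assms)
  have A1: "Ck_on k (I \<times> Q) (\<lambda>z. A z w)" "Ck_on (Suc 0) (I \<times> Q) (\<lambda>z. A z w)" for w
    using Suc.prems(1)[of w] Ck_on_mono[of _ "Suc k"] by (blast intro: le_SucI Suc_leI zero_less_Suc)+
  have b1: "Ck_on k (I \<times> Q) b" "Ck_on (Suc 0) (I \<times> Q) b"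
    using Suc.prems(2) Ck_on_mono[of _ "Suc k"] by (blast intro: le_SucI Suc_leI zero_less_Suc)+
  have yk: "Ck_on k (I \<times> Q) y" by (rule Suc.IH[OF A1(1) b1(1) Suc.prems(3,4)])
  have yc: "continuous_on (I \<times> Q) y" by (rule Suc.prems(3))
  define A' where "A' v z w = (\<Sum>c\<in>Basis. (w \<bullet> c) *\<^sub>R frechet_derivative (\<lambda>z. A z c) (at z) (0, v))" for v z w
  define g where "g v z = vector_derivative (\<lambda>s. y (z + s *\<^sub>R (0, v))) (at 0)" for v z
  define b' where "b' v = (\<lambda>(t, q). frechet_derivative b (at (t, q)) (0, v) + prim (\<lambda>s. A' v (s, q) (y (s, q))) t)" for v
  have gprops: "(\<forall>z\<in>I \<times> Q. ((\<lambda>s. y (z + s *\<^sub>R (0, v))) has_vector_derivative g v z) (at 0)) \<and>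
      continuous_on (I \<times> Q) (g v) \<and>
      (\<forall>t\<in>I. \<forall>q\<in>Q. g v (t, q) = b' v (t, q) + prim (\<lambda>s. A (s, q) (g v (s, q))) t)" for v
  proof -
    let ?R = "I \<times> {(q, s). closed_segment q (q + s *\<^sub>R v) \<subseteq> Q}"
    \<comment> \<open>A discrete product rule: the quotient of \<open>A y\<close> is the quotient
      \<open>Qd\<close> of \<open>A\<close> applied to the unshifted \<open>y\<close>, plus
      \<open>A\<close> at the shifted point applied to the quotient of \<open>y\<close>. The first
      part joins the inhomogeneity \<open>bd\<close>, the second is the new linear term
      \<open>Ad\<close>.\<close>
    define Ad where "Ad = (\<lambda>(t, q, s). A (t, q + s *\<^sub>R v))"
    define Qd where "Qd z w = (\<Sum>c\<in>Basis. (w \<bullet> c) *\<^sub>R diff_quotient (\<lambda>z. A z c) v z)" for z w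
    define bd where "bd = (\<lambda>z. diff_quotient b v z + prim (\<lambda>r. Qd (r, snd z) (y (r, fst (snd z)))) (fst z))"
    have R: "q \<in> Q" "q + s *\<^sub>R v \<in> Q" "t \<in> I" if "(t, q, s) \<in> ?R" for t q s
      using that by auto
    have contQ: "continuous_on ?R (\<lambda>z. Qd z (y (fst z, fst (snd z))))"
      unfolding Qd_def
      by (intro continuous_on_sum continuous_on_scaleR continuous_on_inner continuous_on_const
          continuous_on_diff_quotient[OF A1(2)] continuous_on_compose2[OF yc])
        (use R in \<open>auto intro!: continuous_intros\<close>)
    have contV: "continuous_on ?R (\<lambda>z. prim (\<lambda>r. Qd (r, snd z) (y (r, fst (snd z)))) (fst z))"
      using prim_continuous_param[OF I(2,3) contQ] by (simp add: case_prod_unfold)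
    have bdc: "continuous_on ?R bd"
      unfolding bd_def by (intro continuous_on_add continuous_on_diff_quotient[OF b1(2)] contV)
    have Adc: "continuous_on ?R (\<lambda>z. Ad z w)" for w
      unfolding Ad_def case_prod_unfold
      by (rule continuous_on_compose2[OF Ck_on_imp_continuous_on[OF A1(1)]])
        (use R in \<open>auto intro!: continuous_intros\<close>)
    have deq: "inverse s *\<^sub>R (y (t, q + s *\<^sub>R v) - y (t, q))
      = bd (t, q, s) + prim (\<lambda>r. Ad (r, q, s) (inverse s *\<^sub>R (y (r, q + s *\<^sub>R v) - y (r, q)))) t"
      if z: "(t, q, s) \<in> ?R" "s \<noteq> 0" for t q s
    proof -
      note q = R[OF z(1)]
      define D where "D r = inverse s *\<^sub>R (y (r, q + s *\<^sub>R v) - y (r, q))" for r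
      have cy: "continuous_on I (\<lambda>r. y (r, p))" if "p \<in> Q" for p
        by (rule continuous_on_compose2[OF yc]) (use that in \<open>auto intro!: continuous_intros\<close>)
      have cA: "continuous_on I (\<lambda>r. A (r, p) w)" if "p \<in> Q" for p w
        by (rule continuous_on_compose2[OF Ck_on_imp_continuous_on[OF A1(1)]])
          (use that in \<open>auto intro!: continuous_intros\<close>)
      have cAy: "continuous_on I (\<lambda>r. A (r, p) (y (r, p')))" if "p \<in> Q" "p' \<in> Q" for p p'
        by (rule continuous_on_apply_linear[OF _ cA cy]) (use lin that in auto)
      have cD: "continuous_on I D" unfolding D_def by (intro continuous_intros cy q)
      have cAD: "continuous_on I (\<lambda>r. A (r, q + s *\<^sub>R v) (D r))"
        by (rule continuous_on_apply_linear[OF _ cA cD]) (use lin q in auto)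
      have cQ: "continuous_on I (\<lambda>r. Qd (r, q, s) (y (r, q)))"
        by (rule continuous_on_compose2[OF contQ, of I "\<lambda>r. (r, q, s)", simplified])
          (use z in \<open>auto intro!: continuous_intros\<close>)
      have Qd: "Qd (r, q, s) w = inverse s *\<^sub>R (A (r, q + s *\<^sub>R v) w - A (r, q) w)" if "r \<in> I" for r w
        using linear_expand_Basis[OF lin, of "(r, q + s *\<^sub>R v)" w] linear_expand_Basis[OF lin, of "(r, q)" w] that q z(2)
        by (simp add: Qd_def diff_quotient_def scaleR_sum_right sum_subtractf[symmetric] algebra_simps)
      have "D t = inverse s *\<^sub>R (b (t, q + s *\<^sub>R v) - b (t, q)) + inverse s *\<^sub>R
          (prim (\<lambda>r. A (r, q + s *\<^sub>R v) (y (r, q + s *\<^sub>R v))) t - prim (\<lambda>r. A (r, q) (y (r, q))) t)"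
        unfolding D_def using Suc.prems(4) q by (simp add: algebra_simps)
      also have "inverse s *\<^sub>R (b (t, q + s *\<^sub>R v) - b (t, q)) = diff_quotient b v (t, q, s)"
        using z(2) by (simp add: diff_quotient_def)
      also have "inverse s *\<^sub>R
          (prim (\<lambda>r. A (r, q + s *\<^sub>R v) (y (r, q + s *\<^sub>R v))) t - prim (\<lambda>r. A (r, q) (y (r, q))) t)
          = prim (\<lambda>r. inverse s *\<^sub>R (A (r, q + s *\<^sub>R v) (y (r, q + s *\<^sub>R v)) - A (r, q) (y (r, q)))) t"
        by (simp add: prim_scaleR prim_diff[OF I(2,3) cAy cAy] q)
      also have "\<dots> = prim (\<lambda>r. Qd (r, q, s) (y (r, q)) + A (r, q + s *\<^sub>R v) (D r)) t"
      proof (rule prim_cong[OF I(2,3) q(3)])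
        fix r assume r: "r \<in> I"
        have "A (r, q + s *\<^sub>R v) (D r) = inverse s *\<^sub>R (A (r, q + s *\<^sub>R v) (y (r, q + s *\<^sub>R v)) - A (r, q + s *\<^sub>R v) (y (r, q)))"
          using lin[of "(r, q + s *\<^sub>R v)"] r q by (simp add: D_def linear_scale linear_diff)
        then show "inverse s *\<^sub>R (A (r, q + s *\<^sub>R v) (y (r, q + s *\<^sub>R v)) - A (r, q) (y (r, q)))
            = Qd (r, q, s) (y (r, q)) + A (r, q + s *\<^sub>R v) (D r)"
          by (simp add: Qd[OF r] algebra_simps)
      qed
      also have "\<dots> = prim (\<lambda>r. Qd (r, q, s) (y (r, q))) t + prim (\<lambda>r. A (r, q + s *\<^sub>R v) (D r)) t"
        by (rule prim_add[OF I(2,3) cQ cAD q(3)])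
      finally show ?thesis by (simp add: D_def bd_def Ad_def add.assoc)
    qed
    note vd = volterra_difference_quotient[of L \<epsilon> Q y v Ad bd, folded I_def, OF assms(3-5) yc _ _ Adc bdc deq, folded g_def]
    have "b' v (t, q) = bd (t, q, 0)" for t q
      by (simp add: b'_def bd_def A'_def Qd_def diff_quotient_def)
    moreover have "Ad (t, q, 0) = A (t, q)" for t q by (simp add: Ad_def)
    moreover have "linear (Ad z)" "norm (Ad z w) \<le> L * norm w" if "z \<in> ?R" for z w
      using that R lin bound by (auto simp: Ad_def)
    ultimately show ?thesis using vd by simp
  qed
  have b'k: "Ck_on k (I \<times> Q) (b' v)" for v
  proof -
    have "Ck_on k (I \<times> Q) (\<lambda>z. A' v z (y z))"
      unfolding A'_def
      by (intro Ck_on_sum oZ Ck_on_bilinear[OF bounded_bilinear_scaleR]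
          Ck_on_compose_linear[OF bounded_linear_inner_left] yk Ck_on_SucD(2)[OF Suc.prems(1)])
    from Ck_on_prim[OF I assms(5) this] show ?thesis
      unfolding b'_def case_prod_unfold prod.collapse
      by (intro Ck_on_add oZ Ck_on_SucD(2)[OF Suc.prems(2)])
  qed
  have gk: "Ck_on k (I \<times> Q) (g v)" for v
    by (rule Suc.IH[OF A1(1) b'k]) (use gprops in auto)
  define h where "h c = (if fst c = 0 then g (snd c) else (\<lambda>z. frechet_derivative b (at z) (1, 0) + A z (y z)))"
    for c :: "real \<times> 'p"
  show ?case
  proof (rule Ck_on_Suc_partials[OF oZ])
    fix c :: "real \<times> 'p" assume c: "c \<in> Basis"
    show "Ck_on k (I \<times> Q) (h c)"
    proof (cases "fst c = 0")
      case False
      have "Ck_on k (I \<times> Q) (\<lambda>z. A z (y z))"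
        by (rule Ck_on_apply_linear[OF oZ lin A1(1) yk])
      then show ?thesis
        using False Ck_on_add[OF oZ Ck_on_SucD(2)[OF Suc.prems(2)]] by (simp add: h_def)
    qed (simp add: h_def gk)
    fix z assume z: "z \<in> I \<times> Q"
    obtain t q where tq: "z = (t, q)" "t \<in> I" "q \<in> Q" using z by auto
    show "((\<lambda>s. y (z + s *\<^sub>R c)) has_vector_derivative h c z) (at 0)"
    proof (cases "fst c = 0")
      case True
      have "((\<lambda>s. y (z + s *\<^sub>R (0, snd c))) has_vector_derivative g (snd c) z) (at 0)"
        using gprops z by blast
      then show ?thesis using True by (cases c) (simp add: h_def)
    next
      case False
      then have c10: "c = (1, 0)" using c by (auto simp: Basis_prod_def)
      have "continuous_on (I \<times> Q) (\<lambda>z. A z (y z))"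
        by (rule continuous_on_apply_linear[OF lin Ck_on_imp_continuous_on[OF A1(1)] yc])
      then have "continuous_on I (\<lambda>s. A (s, q) (y (s, q)))"
        by (rule continuous_on_compose2) (use tq in \<open>auto intro!: continuous_intros\<close>)
      from prim_has_derivative[OF I this tq(2)]
      have d: "((\<lambda>s. b (s, q) + prim (\<lambda>s. A (s, q) (y (s, q))) s) has_vector_derivative
          frechet_derivative b (at (t, q)) (1, 0) + A (t, q) (y (t, q))) (at t)"
        by (intro has_vector_derivative_add partial_fst Ck_on_SucD(1)[OF Suc.prems(2)]) (use tq in auto)
      have "((\<lambda>s. y (s, q)) has_vector_derivative h c z) (at t)"
        using has_vector_derivative_transform_within_open[OF d I(1) tq(2), of "\<lambda>s. y (s, q)"] Suc.prems(4) tq False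
        by (simp add: h_def)
      then have "((\<lambda>s. y (t + s, q)) has_vector_derivative h c z) (at 0)"
        using vector_diff_chain_at[of "\<lambda>s. t + s" 1 0 "\<lambda>s. y (s, q)" "h c z"]
          has_vector_derivative_add_const[of "\<lambda>s. s" t 1 "at 0"] has_vector_derivative_id[of "at 0"]
        by (simp add: o_def add.commute)
      then show ?thesis by (simp add: c10 tq)
    qed
  qed
qed



subsection \<open>Local flows\<close>

lemma smooth_on_compact_derivative_bound:
  fixes f :: "'v::euclidean_space \<Rightarrow> 'w::real_normed_vector"
  assumes "smooth_on S f" "compact C" "C \<subseteq> S"
  obtains L where "L \<ge> 0" "\<And>z w. z \<in> C \<Longrightarrow> norm (frechet_derivative f (at z) w) \<le> L * norm w"
proof -
  define h where "h z = (\<Sum>b\<in>Basis. norm (frechet_derivative f (at z) b))" for z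
  have "continuous_on C h" unfolding h_def
    by (intro continuous_intros continuous_on_subset[OF _ assms(3)]
        smooth_on_imp_continuous_on smooth_on_frechet_derivative assms(1))
  then have "bounded (h ` C)" using assms(2) compact_continuous_image compact_imp_bounded by blast
  then obtain L where L: "\<And>z. z \<in> C \<Longrightarrow> \<bar>h z\<bar> \<le> L" by (auto simp: bounded_iff)
  show ?thesis
  proof (rule that[of "max L 0"])
    fix z w assume z: "z \<in> C"
    have lin: "linear (frechet_derivative f (at z))"
      using smooth_on_has_derivative[OF assms(1)] assms(3) z has_derivative_linear by blast
    have "norm (frechet_derivative f (at z) w) \<le> (\<Sum>b\<in>Basis. norm w * norm (frechet_derivative f (at z) b))"
      unfolding linear_expand_Basis[OF lin, of w]
      by (rule order_trans[OF norm_sum]) (auto intro!: sum_mono mult_right_mono Basis_le_norm)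
    also have "\<dots> = norm w * h z" by (simp add: h_def sum_distrib_left)
    also have "\<dots> \<le> norm w * max L 0" using L[OF z] by (intro mult_left_mono) auto
    finally show "norm (frechet_derivative f (at z) w) \<le> max L 0 * norm w" by (simp add: mult.commute)
  qed simp
qed

lemma smooth_on_lipschitz_cball:
  fixes f :: "'v::euclidean_space \<Rightarrow> 'w::real_normed_vector"
  assumes "smooth_on S f" "cball z0 r \<subseteq> S"
    and "\<And>z w. z \<in> cball z0 r \<Longrightarrow> norm (frechet_derivative f (at z) w) \<le> L * norm w"
    and "x \<in> cball z0 r" "y \<in> cball z0 r"
  shows "norm (f x - f y) \<le> L * norm (x - y)"
proof (rule differentiable_bound[OF convex_cball _ _ assms(4,5)])
  fix z assume z: "z \<in> cball z0 r"
  show "(f has_derivative frechet_derivative f (at z)) (at z within cball z0 r)"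
    using smooth_on_has_derivative[OF assms(1)] assms(2) z has_derivative_at_withinI by blast
  show "onorm (frechet_derivative f (at z)) \<le> L" by (rule onorm_le) (rule assms(3)[OF z])
qed

text \<open>Existence is Picard iteration on a small ball. Smoothness in the starting point comes
  from the difference quotients of solutions, which satisfy linear Volterra equations once a
  difference of values of \<open>X\<close> is written as an averaged derivative times a difference
  of solutions.\<close>

lemma local_flow_exists:
  fixes X :: "'v::euclidean_space \<Rightarrow> 'v"
  assumes "open S" "smooth_on S X" "z0 \<in> S"
  obtains \<epsilon> \<delta> \<Phi> where "\<epsilon> > (0::real)" "\<delta> > 0" "\<And>z. z \<in> ball z0 \<delta> \<Longrightarrow> \<Phi> (0, z) = z"
    "\<And>t z. t \<in> {-\<epsilon><..<\<epsilon>} \<Longrightarrow> z \<in> ball z0 \<delta> \<Longrightarrow> \<Phi> (t, z) \<in> S"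
    "\<And>t z. t \<in> {-\<epsilon><..<\<epsilon>} \<Longrightarrow> z \<in> ball z0 \<delta> \<Longrightarrow>
      ((\<lambda>t. \<Phi> (t, z)) has_vector_derivative X (\<Phi> (t, z))) (at t)"
    "smooth_on ({-\<epsilon><..<\<epsilon>} \<times> ball z0 \<delta>) \<Phi>"
proof -
  obtain r where r: "r > 0" "cball z0 r \<subseteq> S" using assms open_contains_cball by blast
  let ?C = "cball z0 r"
  obtain L where L: "L \<ge> 0" "\<And>z w. z \<in> ?C \<Longrightarrow> norm (frechet_derivative X (at z) w) \<le> L * norm w"
    using smooth_on_compact_derivative_bound[OF assms(2) compact_cball r(2)] by blast
  have Xc: "continuous_on ?C X"
    using smooth_on_imp_continuous_on[OF assms(2)] r(2) continuous_on_subset by blast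
  then have "bounded (X ` ?C)" by (intro compact_imp_bounded compact_continuous_image compact_cball)
  then obtain B where B: "\<And>z. z \<in> ?C \<Longrightarrow> norm (X z) \<le> B" unfolding bounded_iff by blast
  have B0: "B \<ge> 0" using B[of z0] r norm_ge_zero order_trans by (metis centre_in_cball less_imp_le)
  \<comment> \<open>The first bound makes the Picard operator a contraction by 1/2; the second lets
    solutions starting within \<open>r/2\<close> travel at most another \<open>r/2\<close>. Adding 1
    keeps the denominators positive when \<open>L\<close> or \<open>B\<close> is 0.\<close>
  define \<epsilon> where "\<epsilon> = min (1 / (2 * (L + 1))) (r / (2 * (B + 1)))"
  have \<epsilon>: "\<epsilon> > 0" using L B0 r by (simp add: \<epsilon>_def)
  have \<epsilon>L: "\<epsilon> * L \<le> 1/2"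
  proof -
    have "\<epsilon> * L \<le> (1 / (2 * (L + 1))) * L" using L by (intro mult_right_mono) (auto simp: \<epsilon>_def)
    also have "\<dots> \<le> 1/2" using L by (simp add: field_simps)
    finally show ?thesis .
  qed
  have \<epsilon>B: "\<epsilon> * B \<le> r/2"
  proof -
    have "\<epsilon> * B \<le> (r / (2 * (B + 1))) * B" using B0 by (intro mult_right_mono) (auto simp: \<epsilon>_def)
    also have "\<dots> \<le> r/2" using B0 r by (simp add: field_simps)
    finally show ?thesis .
  qed
  let ?J = "{-\<epsilon>..\<epsilon>}" and ?K = "cball z0 (r/2)"
  have J: "is_interval ?J" "0 \<in> ?J" using \<epsilon> by (auto simp: is_interval_cc)
  define T where "T f = (\<lambda>(t, q). q + prim (\<lambda>s. X (f (s, q))) t)" for f :: "real \<times> 'v \<Rightarrow> 'v"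
  have Xf: "continuous_on (?J \<times> ?K) (\<lambda>z. X (f z))" if "continuous_on (?J \<times> ?K) f" "f ` (?J \<times> ?K) \<subseteq> ?C" for f
    by (rule continuous_on_compose2[OF Xc that])
  have sec: "continuous_on ?J (\<lambda>s. X (f (s, q)))"
    if "continuous_on (?J \<times> ?K) f" "f ` (?J \<times> ?K) \<subseteq> ?C" "q \<in> ?K" for f :: "real \<times> 'v \<Rightarrow> 'v" and q
    by (rule continuous_on_compose2[OF Xf[OF that(1,2)]]) (use that in \<open>auto intro!: continuous_intros\<close>)
  have in_C: "q + prim f t \<in> ?C" if "q \<in> ?K" "t \<in> ?J" "continuous_on ?J f" "\<And>s. s \<in> ?J \<Longrightarrow> norm (f s) \<le> B" for q t f
  proof -
    have "norm (prim f t) \<le> \<bar>t\<bar> * B" by (rule norm_prim_le[OF J that(3,2,4)])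
    also have "\<dots> \<le> \<epsilon> * B" using that(2) B0 by (intro mult_right_mono) auto
    finally have "norm (prim f t) \<le> r/2" using \<epsilon>B by simp
    then have "dist z0 (q + prim f t) \<le> r"
      using that(1) norm_triangle_ineq4[of "z0 - q" "prim f t"] by (simp add: dist_norm algebra_simps)
    then show ?thesis by simp
  qed
  obtain \<Phi> where \<Phi>: "continuous_on (?J \<times> ?K) \<Phi>" "\<Phi> ` (?J \<times> ?K) \<subseteq> ?C" "\<And>z. z \<in> ?J \<times> ?K \<Longrightarrow> T \<Phi> z = \<Phi> z"
  proof (rule contraction_fixpoint[of ?C "?J \<times> ?K" T "\<lambda>_. z0"])
    show "compact (?J \<times> ?K)" by (intro compact_Times compact_cball compact_Icc)
    fix f :: "real \<times> 'v \<Rightarrow> 'v" assume f: "continuous_on (?J \<times> ?K) f" "f ` (?J \<times> ?K) \<subseteq> ?C"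
    have "T f (t, q) \<in> ?C" if "t \<in> ?J" "q \<in> ?K" for t q
      unfolding T_def case_prod_conv
      by (rule in_C[OF that(2,1) sec[OF f that(2)]]) (use f(2) that in \<open>auto intro!: B\<close>)
    moreover have "continuous_on (?J \<times> ?K) (T f)"
      using prim_continuous_param[OF J Xf[OF f]] unfolding T_def case_prod_unfold
      by (auto intro!: continuous_intros)
    ultimately show "continuous_on (?J \<times> ?K) (T f) \<and> T f ` (?J \<times> ?K) \<subseteq> ?C" by auto
    fix g :: "real \<times> 'v \<Rightarrow> 'v" and d
    assume g: "continuous_on (?J \<times> ?K) g" "g ` (?J \<times> ?K) \<subseteq> ?C" and d: "\<forall>x\<in>?J \<times> ?K. norm (f x - g x) \<le> d"
    show "\<forall>x\<in>?J \<times> ?K. norm (T f x - T g x) \<le> d / 2"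
    proof safe
      fix t q assume tq: "t \<in> ?J" "q \<in> ?K"
      have "d \<ge> 0" using d tq norm_ge_zero order_trans by blast
      have "norm (prim (\<lambda>s. X (f (s, q)) - X (g (s, q))) t) \<le> \<bar>t\<bar> * (L * d)"
      proof (rule norm_prim_le[OF J continuous_on_diff[OF sec[OF f tq(2)] sec[OF g tq(2)]] tq(1)])
        fix s assume s: "s \<in> ?J"
        have fg: "f (s, q) \<in> ?C" "g (s, q) \<in> ?C" using f(2) g(2) s tq by blast+
        have "norm (X (f (s, q)) - X (g (s, q))) \<le> L * norm (f (s, q) - g (s, q))"
          by (rule smooth_on_lipschitz_cball[OF assms(2) r(2) L(2) fg])
        also have "\<dots> \<le> L * d" using d s tq L(1) by (intro mult_left_mono) auto
        finally show "norm (X (f (s, q)) - X (g (s, q))) \<le> L * d" .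
      qed
      also have "\<dots> \<le> \<epsilon> * (L * d)" using tq L(1) \<open>d \<ge> 0\<close> by (intro mult_right_mono) auto
      also have "\<dots> \<le> (1/2) * d" using mult_right_mono[OF \<epsilon>L \<open>d \<ge> 0\<close>] by (simp add: mult.assoc)
      finally show "norm (T f (t, q) - T g (t, q)) \<le> d / 2"
        using prim_diff[OF J sec[OF f tq(2)] sec[OF g tq(2)] tq(1)] by (simp add: T_def)
    qed
  qed (use r in auto)
  define I where "I = {-\<epsilon><..<\<epsilon>}"
  define Q where "Q = ball z0 (r/2)"
  have I: "open I" "is_interval I" "0 \<in> I" and Q: "open Q" using \<epsilon> by (auto simp: I_def Q_def is_interval_oo)
  have oZ: "open (I \<times> Q)" by (intro open_Times I Q)
  have sub: "I \<times> Q \<subseteq> ?J \<times> ?K" by (auto simp: I_def Q_def)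
  have \<Phi>C: "\<Phi> z \<in> ?C" if "z \<in> I \<times> Q" for z using that sub \<Phi>(2) by blast
  have \<Phi>S: "\<Phi> z \<in> S" if "z \<in> I \<times> Q" for z using \<Phi>C[OF that] r by blast
  have \<Phi>c: "continuous_on (I \<times> Q) \<Phi>" using \<Phi>(1) sub continuous_on_subset by blast
  have \<Phi>eq: "\<Phi> (t, q) = q + prim (\<lambda>s. X (\<Phi> (s, q))) t" if "t \<in> I" "q \<in> Q" for t q
    using \<Phi>(3)[of "(t, q)"] sub that by (auto simp: T_def)
  have X\<Phi>: "continuous_on I (\<lambda>s. X (\<Phi> (s, q)))" if "q \<in> Q" for q
    by (rule continuous_on_subset[OF sec[OF \<Phi>(1,2)]]) (use that in \<open>auto simp: I_def Q_def\<close>)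
  have der: "((\<lambda>t. \<Phi> (t, q)) has_vector_derivative X (\<Phi> (t, q))) (at t)" if "t \<in> I" "q \<in> Q" for t q
  proof -
    have d: "((\<lambda>t. q + prim (\<lambda>s. X (\<Phi> (s, q))) t) has_vector_derivative 0 + X (\<Phi> (t, q))) (at t)"
      by (intro has_vector_derivative_add has_vector_derivative_const prim_has_derivative[OF I X\<Phi>] that)
    show ?thesis
      using has_vector_derivative_transform_within_open[OF d I(1) that(1), of "\<lambda>t. \<Phi> (t, q)"] \<Phi>eq that(2) by simp
  qed
  define D where "D v z = vector_derivative (\<lambda>s. \<Phi> (z + s *\<^sub>R (0, v))) (at 0)" for v z
  have gprops: "(\<forall>z\<in>I \<times> Q. ((\<lambda>s. \<Phi> (z + s *\<^sub>R (0, v))) has_vector_derivative D v z) (at 0)) \<and>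
      continuous_on (I \<times> Q) (D v) \<and>
      (\<forall>t\<in>I. \<forall>q\<in>Q. D v (t, q) = v + prim (\<lambda>s. frechet_derivative X (at (\<Phi> (s, q))) (D v (s, q))) t)" for v
  proof -
    let ?R = "I \<times> {(q, s). closed_segment q (q + s *\<^sub>R v) \<subseteq> Q}"
    have R: "q \<in> Q" "q + s *\<^sub>R v \<in> Q" "t \<in> I" if "(t, q, s) \<in> ?R" for t q s
      using that by auto
    \<comment> \<open>The segment between two neighbouring solutions, which stays in the ball by
      convexity. Averaging the derivative of \<open>X\<close> along it yields the family
      \<open>A\<close> below, for which the difference of \<open>X\<close> is exactly
      \<open>A\<close> times the difference of the solutions.\<close>
    define p where "p z u = \<Phi> (fst z, fst (snd z))
      + u *\<^sub>R (\<Phi> (fst z, fst (snd z) + snd (snd z) *\<^sub>R v) - \<Phi> (fst z, fst (snd z)))" for z u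
    have p: "p z u \<in> ?C" if "z \<in> ?R" "u \<in> {0..1}" for z u
    proof -
      obtain t q s where z: "z = (t, q, s)" by (cases z) auto
      have "p z u = (1 - u) *\<^sub>R \<Phi> (t, q) + u *\<^sub>R \<Phi> (t, q + s *\<^sub>R v)"
        by (simp add: p_def z algebra_simps)
      also have "\<dots> \<in> ?C"
        using R[of t q s] that z by (intro convexD[OF convex_cball] \<Phi>C) auto
      finally show ?thesis .
    qed
    have pc: "continuous_on (?R \<times> {0..1}) (\<lambda>(z, u). p z u)"
      unfolding p_def case_prod_unfold
      by (intro continuous_intros continuous_on_compose2[OF \<Phi>c]) (use R in auto)
    have dXc: "continuous_on (?R \<times> {0..1}) (\<lambda>(z, u). frechet_derivative X (at (p z u)) w)" for w
      unfolding case_prod_unfold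
      by (rule continuous_on_compose2[OF smooth_on_imp_continuous_on[OF smooth_on_frechet_derivative[OF assms(2)]]
            pc[unfolded case_prod_unfold]]) (use p r in force)
    have sc: "continuous_on {0..1} (\<lambda>u. frechet_derivative X (at (p z u)) w)" if "z \<in> ?R" for z w
      by (rule continuous_on_compose2[OF dXc, of "{0..1}" "\<lambda>u. (z, u)", simplified])
        (use that in \<open>auto intro!: continuous_intros\<close>)
    define A where "A z w = integral {0..1} (\<lambda>u. frechet_derivative X (at (p z u)) w)" for z w
    have linX: "linear (frechet_derivative X (at z))" if "z \<in> ?C" for z
      using smooth_on_has_derivative[OF assms(2)] r(2) that has_derivative_linear by blast
    have Alin: "linear (A z)" if z: "z \<in> ?R" for z
    proof (rule linearI)
      fix x y c
      have "A z (x + y) = integral {0..1} (\<lambda>u. frechet_derivative X (at (p z u)) x + frechet_derivative X (at (p z u)) y)"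
        unfolding A_def by (rule integral_cong) (use linX[OF p[OF z]] linear_add in blast)
      then show "A z (x + y) = A z x + A z y"
        by (simp add: A_def integral_add integrable_continuous_real[OF sc[OF z]])
      have "A z (c *\<^sub>R x) = integral {0..1} (\<lambda>u. c *\<^sub>R frechet_derivative X (at (p z u)) x)"
        unfolding A_def by (rule integral_cong) (use linX[OF p[OF z]] linear_scale in blast)
      then show "A z (c *\<^sub>R x) = c *\<^sub>R A z x" by (simp add: A_def)
    qed
    have Abound: "norm (A z w) \<le> L * norm w" if z: "z \<in> ?R" for z w
    proof -
      have "norm (A z w) \<le> (L * norm w) * (1 - 0)"
        unfolding A_def by (rule integral_bound[OF _ sc[OF z]]) (use L(2)[OF p[OF z]] in auto)
      then show ?thesis by simp
    qed
    have Acont: "continuous_on ?R (\<lambda>z. A z w)" for w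
      using integral_continuous_on_param[of ?R 0 1 "\<lambda>z u. frechet_derivative X (at (p z u)) w"] dXc
      by (simp add: A_def box_real)
    have Xdiff: "X (\<Phi> (t, q + s *\<^sub>R v)) - X (\<Phi> (t, q)) = A (t, q, s) (\<Phi> (t, q + s *\<^sub>R v) - \<Phi> (t, q))"
      if z: "(t, q, s) \<in> ?R" for t q s
    proof -
      let ?h = "\<Phi> (t, q + s *\<^sub>R v) - \<Phi> (t, q)"
      have "((\<lambda>u. frechet_derivative X (at (p (t, q, s) u)) ?h) has_integral
          X (p (t, q, s) 1) - X (p (t, q, s) 0)) {0..1}"
      proof (rule fundamental_theorem_of_calculus)
        fix u :: real assume u: "u \<in> {0..1}"
        have "((\<lambda>u'. X (p (t, q, s) u + u' *\<^sub>R ?h)) has_vector_derivative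
            frechet_derivative X (at (p (t, q, s) u)) ?h) (at 0)"
          using p[OF z u] r by (intro has_vector_derivative_along_line smooth_on_has_derivative[OF assms(2)]) auto
        then have "((\<lambda>u. X (\<Phi> (t, q) + u *\<^sub>R ?h)) has_vector_derivative
            frechet_derivative X (at (p (t, q, s) u)) ?h) (at u)"
          using has_vector_derivative_line_shift[of X "\<Phi> (t, q)" u ?h] by (simp add: p_def)
        then show "((\<lambda>u. X (p (t, q, s) u)) has_vector_derivative
            frechet_derivative X (at (p (t, q, s) u)) ?h) (at u within {0..1})"
          unfolding p_def fst_conv snd_conv by (rule has_vector_derivative_at_within)
      qed simp
      then show ?thesis by (auto simp: A_def p_def dest: integral_unique)
    qed
    have deq: "inverse s *\<^sub>R (\<Phi> (t, q + s *\<^sub>R v) - \<Phi> (t, q))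
      = v + prim (\<lambda>r. A (r, q, s) (inverse s *\<^sub>R (\<Phi> (r, q + s *\<^sub>R v) - \<Phi> (r, q)))) t"
      if z: "(t, q, s) \<in> ?R" "s \<noteq> 0" for t q s
    proof -
      note q = R[OF z(1)]
      have "prim (\<lambda>r. A (r, q, s) (inverse s *\<^sub>R (\<Phi> (r, q + s *\<^sub>R v) - \<Phi> (r, q)))) t
        = prim (\<lambda>r. inverse s *\<^sub>R (X (\<Phi> (r, q + s *\<^sub>R v)) - X (\<Phi> (r, q)))) t"
      proof (rule prim_cong[OF I(2,3) q(3)])
        fix r assume "r \<in> I"
        then have "(r, q, s) \<in> ?R" using z by auto
        then show "A (r, q, s) (inverse s *\<^sub>R (\<Phi> (r, q + s *\<^sub>R v) - \<Phi> (r, q)))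
            = inverse s *\<^sub>R (X (\<Phi> (r, q + s *\<^sub>R v)) - X (\<Phi> (r, q)))"
          by (simp only: Xdiff[OF \<open>(r, q, s) \<in> ?R\<close>] linear_scale[OF Alin[OF \<open>(r, q, s) \<in> ?R\<close>]])
      qed
      also have "\<dots> = inverse s *\<^sub>R (prim (\<lambda>r. X (\<Phi> (r, q + s *\<^sub>R v))) t - prim (\<lambda>r. X (\<Phi> (r, q))) t)"
        by (simp add: prim_scaleR prim_diff[OF I(2,3) X\<Phi> X\<Phi>] q)
      finally show ?thesis using \<Phi>eq q z(2) by (simp add: algebra_simps)
    qed
    note vd = volterra_difference_quotient[of L \<epsilon> Q \<Phi> v A "\<lambda>_. v", folded I_def, OF L(1) \<epsilon>L Q \<Phi>c Alin Abound Acont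
        continuous_on_const deq, folded D_def]
    have A0: "A (t, q, 0) w = frechet_derivative X (at (\<Phi> (t, q))) w" for t q w
      by (simp add: A_def p_def)
    show ?thesis using vd unfolding A0 by blast
  qed
  \<comment> \<open>Bootstrap: if the flow has order \<open>k\<close>, so has the derivative of
    \<open>X\<close> along it; \<open>volterra_linear_Ck\<close> then gives order \<open>k\<close>
    to the derivatives in the starting point, and the time derivative is \<open>X\<close> along the
    flow. So all first derivatives have order \<open>k\<close>.\<close>
  have "Ck_on k (I \<times> Q) \<Phi>" for k
  proof (induction k)
    case 0
    then show ?case using \<Phi>c by simp
  next
    case (Suc k)
    have comp: "Ck_on k (I \<times> Q) (\<lambda>z. f (\<Phi> z))" if "smooth_on S f" for f :: "'v \<Rightarrow> 'v"
      by (rule Ck_on_compose[OF oZ assms(1) _ Suc smooth_onD[OF that]]) (use \<Phi>S in auto)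
    have Dk: "Ck_on k (I \<times> Q) (D v)" for v
    proof (rule volterra_linear_Ck[OF \<epsilon> L(1) \<epsilon>L Q, where b = "\<lambda>_. v" and A = "\<lambda>z. frechet_derivative X (at (\<Phi> z))",
            folded I_def])
      show "linear (frechet_derivative X (at (\<Phi> z)))" if "z \<in> I \<times> Q" for z
        by (rule has_derivative_linear[OF smooth_on_has_derivative[OF assms(2) \<Phi>S[OF that]]])
      show "norm (frechet_derivative X (at (\<Phi> z)) w) \<le> L * norm w" if "z \<in> I \<times> Q" for z w
        by (rule L(2)[OF \<Phi>C[OF that]])
      show "Ck_on k (I \<times> Q) (\<lambda>z. frechet_derivative X (at (\<Phi> z)) w)" for w
        by (rule comp[OF smooth_on_frechet_derivative[OF assms(2)]])
      show "Ck_on k (I \<times> Q) (\<lambda>_. v)" by (rule Ck_on_const[OF oZ])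
      show "continuous_on (I \<times> Q) (D v)" using gprops by blast
      show "D v (t, q) = v + prim (\<lambda>s. frechet_derivative X (at (\<Phi> (s, q))) (D v (s, q))) t"
        if "t \<in> I" "q \<in> Q" for t q using gprops that by blast
    qed
    define h where "h c = (if fst c = 0 then D (snd c) else (\<lambda>z. X (\<Phi> z)))" for c :: "real \<times> 'v"
    show ?case
    proof (rule Ck_on_Suc_partials[OF oZ])
      fix c :: "real \<times> 'v" assume c: "c \<in> Basis"
      show "Ck_on k (I \<times> Q) (h c)" using Dk comp[OF assms(2)] by (simp add: h_def)
      fix z assume z: "z \<in> I \<times> Q"
      obtain t q where tq: "z = (t, q)" "t \<in> I" "q \<in> Q" using z by auto
      show "((\<lambda>s. \<Phi> (z + s *\<^sub>R c)) has_vector_derivative h c z) (at 0)"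
      proof (cases "fst c = 0")
        case True
        have "((\<lambda>s. \<Phi> (z + s *\<^sub>R (0, snd c))) has_vector_derivative D (snd c) z) (at 0)"
          using gprops z by blast
        then show ?thesis using True by (cases c) (simp add: h_def)
      next
        case False
        then have c10: "c = (1, 0)" using c by (auto simp: Basis_prod_def)
        have "((\<lambda>s. \<Phi> (t + s, q)) has_vector_derivative X (\<Phi> (t, q))) (at 0)"
          using vector_diff_chain_at[of "\<lambda>s. t + s" 1 0 "\<lambda>s. \<Phi> (s, q)" "X (\<Phi> (t, q))"] der[OF tq(2,3)]
            has_vector_derivative_add_const[of "\<lambda>s. s" t 1 "at 0"] has_vector_derivative_id[of "at 0"]
          by (simp add: o_def add.commute)
        then show ?thesis by (simp add: c10 tq h_def)
      qed
    qed
  qed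
  then have smooth: "smooth_on (I \<times> Q) \<Phi>" by (rule smooth_onI)
  show ?thesis
  proof (rule that[OF \<epsilon>, of "r/2" \<Phi>, folded I_def Q_def, OF _ _ _ _ smooth])
    show "\<Phi> (0, z) = z" if "z \<in> Q" for z using \<Phi>eq[OF I(3) that] by simp
  qed (use r \<Phi>S der in auto)
qed

section \<open>Smooth functions on manifolds\<close>

context smooth_manifold
begin

lemma chart_subset: "(U, x) \<in> \<A> \<Longrightarrow> U \<subseteq> topspace M"
  using chart_domain openin_subset by blast

lemma chart_topspace: "(U, x) \<in> \<A> \<Longrightarrow> topspace (subtopology M U) = U"
  using chart_subset by (auto simp: topspace_subtopology)

lemma chart_inj: "(U, x) \<in> \<A> \<Longrightarrow> inj_on x U"
  using homeomorphic_imp_injective_map[OF chart_homeomorphic] chart_topspace by metis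

lemma chart_inv [simp]: "(U, x) \<in> \<A> \<Longrightarrow> p \<in> U \<Longrightarrow> inv_into U x (x p) = p"
  using chart_inj inv_into_f_f by metis

lemma chart_inv_into: "(U, x) \<in> \<A> \<Longrightarrow> q \<in> x ` U \<Longrightarrow> inv_into U x q \<in> U"
  and chart_right_inv [simp]: "(U, x) \<in> \<A> \<Longrightarrow> q \<in> x ` U \<Longrightarrow> x (inv_into U x q) = q"
  by (auto simp: inv_into_into f_inv_into_f)

lemma chart_at:
  assumes "p \<in> topspace M"
  obtains U x where "(U, x) \<in> \<A>" "p \<in> U"
proof -
  have "p \<in> \<Union>(fst ` \<A>)" using assms charts_cover by simp
  then obtain c where "c \<in> \<A>" "p \<in> fst c" by blast
  then show ?thesis using that[of "fst c" "snd c"] by simp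
qed

lemma chart_open_image:
  assumes "(U, x) \<in> \<A>" "openin M W"
  shows "open (x ` (U \<inter> W))"
proof -
  have "open_map (subtopology M U) (top_of_set (x ` U)) x"
    using chart_homeomorphic[OF assms(1)] by (rule homeomorphic_imp_open_map)
  then have "openin (top_of_set (x ` U)) (x ` (U \<inter> W))"
    using openin_subtopology_Int2[OF assms(2), of U] unfolding open_map_def by blast
  then show ?thesis using chart_codomain[OF assms(1)] by (simp add: openin_open_eq)
qed

lemma chart_open_vimage:
  assumes "(U, x) \<in> \<A>" "open W"
  shows "openin M {p \<in> U. x p \<in> W}"
proof -
  have "continuous_map (subtopology M U) (top_of_set (x ` U)) x"
    using chart_homeomorphic[OF assms(1)] by (rule homeomorphic_imp_continuous_map)
  then have "openin (subtopology M U) {p \<in> topspace (subtopology M U). x p \<in> x ` U \<inter> W}"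
    by (rule openin_continuous_map_preimage) (use assms chart_codomain in \<open>simp add: openin_open_eq open_Int\<close>)
  moreover have "{p \<in> topspace (subtopology M U). x p \<in> x ` U \<inter> W} = {p \<in> U. x p \<in> W}"
    using chart_topspace[OF assms(1)] by auto
  ultimately show ?thesis using openin_trans_full chart_domain[OF assms(1)] by metis
qed

lemma chart_compact_vimage:
  assumes "(U, x) \<in> \<A>" "compact C" "C \<subseteq> x ` U"
  shows "compactin M {p \<in> U. x p \<in> C}"
proof -
  have "x ` {p \<in> U. x p \<in> C} = C" using assms(3) by auto
  moreover have "compactin (top_of_set (x ` U)) C" using assms by (simp add: compactin_subtopology)
  ultimately have "compactin (subtopology M U) {p \<in> U. x p \<in> C}"
    using homeomorphic_map_compactness[OF chart_homeomorphic[OF assms(1)], of "{p \<in> U. x p \<in> C}"]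
      chart_topspace[OF assms(1)] by auto
  then show ?thesis by (simp add: compactin_subtopology)
qed

lemma smooth_familyD:
  "smooth_family J \<phi> \<Longrightarrow> (U, x) \<in> \<A> \<Longrightarrow> smooth_on (J \<times> x ` U) (\<lambda>(t, q). \<phi> t (inv_into U x q))"
  by (auto simp: smooth_family_def)

lemma smooth_familyI:
  "(\<And>U x. (U, x) \<in> \<A> \<Longrightarrow> smooth_on (J \<times> x ` U) (\<lambda>(t, q). \<phi> t (inv_into U x q))) \<Longrightarrow> smooth_family J \<phi>"
  by (auto simp: smooth_family_def)

lemma smooth_functionsD:
  "f \<in> smooth_functions \<Longrightarrow> (U, x) \<in> \<A> \<Longrightarrow> smooth_on (x ` U) (\<lambda>q. f (inv_into U x q))"
  by (auto simp: smooth_functions_def o_def)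

lemma smooth_functionsI:
  "(\<And>U x. (U, x) \<in> \<A> \<Longrightarrow> smooth_on (x ` U) (\<lambda>q. f (inv_into U x q))) \<Longrightarrow> f \<in> smooth_functions"
  by (auto simp: smooth_functions_def o_def)

lemma smooth_family_subset: "smooth_family J \<phi> \<Longrightarrow> I \<subseteq> J \<Longrightarrow> smooth_family I \<phi>"
  by (intro smooth_familyI) (rule smooth_on_subset[OF smooth_familyD], auto)

lemma smooth_family_at:
  assumes "open J" "smooth_family J \<phi>" "t \<in> J"
  shows "\<phi> t \<in> smooth_functions"
proof (rule smooth_functionsI)
  fix U x assume c: "(U, x) \<in> \<A>"
  have "smooth_on (x ` U) (\<lambda>q. (case (t, q) of (t, q) \<Rightarrow> \<phi> t (inv_into U x q)))"
    by (rule smooth_on_compose[OF smooth_familyD[OF assms(2) c]])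
      (use assms chart_codomain[OF c] in \<open>auto intro!: smooth_on_intros open_Times\<close>)
  then show "smooth_on (x ` U) (\<lambda>q. \<phi> t (inv_into U x q))" by simp
qed

lemma smooth_family_const:
  assumes "open J" "f \<in> smooth_functions"
  shows "smooth_family J (\<lambda>t. f)"
proof (rule smooth_familyI)
  fix U x assume c: "(U, x) \<in> \<A>"
  have "smooth_on (J \<times> x ` U) (\<lambda>z. f (inv_into U x (snd z)))"
    by (rule smooth_on_compose[OF smooth_functionsD[OF assms(2) c]])
      (use assms chart_codomain[OF c] in \<open>auto intro!: smooth_on_intros open_Times\<close>)
  then show "smooth_on (J \<times> x ` U) (\<lambda>(t, q). f (inv_into U x q))" by (simp add: case_prod_unfold)
qed

lemma smooth_functions_iff: "f \<in> smooth_functions \<longleftrightarrow> smooth_family UNIV (\<lambda>t. f)"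
  using smooth_family_const[of UNIV f] smooth_family_at[of UNIV "\<lambda>t. f" 0] by auto

lemma open_chart_Times: "open J \<Longrightarrow> (U, x) \<in> \<A> \<Longrightarrow> open (J \<times> x ` U)"
  by (simp add: open_Times chart_codomain)

lemma smooth_family_add:
  assumes "open J" "smooth_family J \<phi>" "smooth_family J \<psi>"
  shows "smooth_family J (\<lambda>t p. \<phi> t p + \<psi> t p)"
  by (rule smooth_familyI)
    (use smooth_on_add[OF open_chart_Times smooth_familyD[OF assms(2)] smooth_familyD[OF assms(3)]] assms(1) in
      \<open>simp add: case_prod_unfold\<close>)

lemma smooth_family_mult:
  assumes "open J" "smooth_family J \<phi>" "smooth_family J \<psi>"
  shows "smooth_family J (\<lambda>t p. \<phi> t p * \<psi> t p)"
  by (rule smooth_familyI)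
    (use smooth_on_mult[OF open_chart_Times smooth_familyD[OF assms(2)] smooth_familyD[OF assms(3)]] assms(1) in
      \<open>simp add: case_prod_unfold\<close>)

lemma smooth_family_time:
  assumes "open J" "smooth_on J a"
  shows "smooth_family J (\<lambda>t p. a t)"
proof (rule smooth_familyI)
  fix U x assume c: "(U, x) \<in> \<A>"
  have "smooth_on (J \<times> x ` U) (\<lambda>z. a (fst z))"
    by (rule smooth_on_compose[OF assms(2)])
      (use assms(1) open_chart_Times[OF _ c] in \<open>auto intro!: smooth_on_intros\<close>)
  then show "smooth_on (J \<times> x ` U) (\<lambda>(t, q). a t)" by (simp add: case_prod_unfold)
qed

lemma smooth_family_uminus: "open J \<Longrightarrow> smooth_family J \<phi> \<Longrightarrow> smooth_family J (\<lambda>t p. - \<phi> t p)"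
  using smooth_family_mult[of J "\<lambda>t p. - 1" \<phi>] smooth_family_time[of J "\<lambda>t. - 1"] smooth_on_const by fastforce

lemma smooth_family_diff:
  "open J \<Longrightarrow> smooth_family J \<phi> \<Longrightarrow> smooth_family J \<psi> \<Longrightarrow> smooth_family J (\<lambda>t p. \<phi> t p - \<psi> t p)"
  using smooth_family_add[of J \<phi> "\<lambda>t p. - \<psi> t p"] smooth_family_uminus[of J \<psi>] by simp

lemma smooth_family_sum:
  assumes "open J" "\<And>i. i \<in> F \<Longrightarrow> smooth_family J (\<phi> i)"
  shows "smooth_family J (\<lambda>t p. \<Sum>i\<in>F. \<phi> i t p)"
  using assms(2)
  by (induction F rule: infinite_finite_induct)
    (auto intro: smooth_family_add assms(1) smooth_family_time[OF _ smooth_on_const])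

lemma smooth_family_exp:
  assumes "open J" "smooth_family J \<phi>"
  shows "smooth_family J (\<lambda>t p. exp (\<phi> t p))"
  by (rule smooth_familyI)
    (use smooth_on_exp[OF open_chart_Times smooth_familyD[OF assms(2)]] assms(1) in \<open>simp add: case_prod_unfold\<close>)

lemma smooth_family_inverse:
  assumes "open J" "smooth_family J \<phi>" "\<And>t p. t \<in> J \<Longrightarrow> p \<in> topspace M \<Longrightarrow> \<phi> t p \<noteq> 0"
  shows "smooth_family J (\<lambda>t p. inverse (\<phi> t p))"
proof (rule smooth_familyI)
  fix U x assume c: "(U, x) \<in> \<A>"
  have "smooth_on (J \<times> x ` U) (\<lambda>z. inverse (case z of (t, q) \<Rightarrow> \<phi> t (inv_into U x q)))"
    by (rule smooth_on_inverse[OF open_chart_Times[OF assms(1) c] smooth_familyD[OF assms(2) c]])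
      (use assms(3) chart_inv_into[OF c] chart_subset[OF c] in force)
  then show "smooth_on (J \<times> x ` U) (\<lambda>(t, q). inverse (\<phi> t (inv_into U x q)))" by (simp add: case_prod_unfold)
qed

lemma smooth_functions_add: "f \<in> smooth_functions \<Longrightarrow> g \<in> smooth_functions \<Longrightarrow> (\<lambda>p. f p + g p) \<in> smooth_functions"
  and smooth_functions_diff: "f \<in> smooth_functions \<Longrightarrow> g \<in> smooth_functions \<Longrightarrow> (\<lambda>p. f p - g p) \<in> smooth_functions"
  and smooth_functions_mult: "f \<in> smooth_functions \<Longrightarrow> g \<in> smooth_functions \<Longrightarrow> (\<lambda>p. f p * g p) \<in> smooth_functions"
  and smooth_functions_const: "(\<lambda>p. c) \<in> smooth_functions"
  and smooth_functions_sum: "(\<And>i. i \<in> F \<Longrightarrow> h i \<in> smooth_functions) \<Longrightarrow> (\<lambda>p. \<Sum>i\<in>F. h i p) \<in> smooth_functions"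
  unfolding smooth_functions_iff
  by (intro smooth_family_add smooth_family_diff smooth_family_mult smooth_family_time smooth_family_sum
      smooth_on_const open_UNIV; assumption)+

definition time_deriv :: "(real \<Rightarrow> 'a \<Rightarrow> real) \<Rightarrow> real \<Rightarrow> 'a \<Rightarrow> real" where
  "time_deriv \<phi> t p = deriv (\<lambda>s. \<phi> s p) t"

lemma time_deriv_chart:
  assumes "smooth_family J \<phi>" "(U, x) \<in> \<A>" "t \<in> J" "q \<in> x ` U"
  shows "((\<lambda>s. \<phi> s (inv_into U x q)) has_real_derivative
    frechet_derivative (\<lambda>(t, q). \<phi> t (inv_into U x q)) (at (t, q)) (1, 0)) (at t)"
  using partial_fst[OF smooth_on_has_derivative[OF smooth_familyD[OF assms(1,2)], of "(t, q)"]] assms(3,4)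
  by (simp add: has_real_derivative_iff_has_vector_derivative)

lemma has_time_deriv:
  assumes "smooth_family J \<phi>" "t \<in> J" "p \<in> topspace M"
  shows "((\<lambda>s. \<phi> s p) has_real_derivative time_deriv \<phi> t p) (at t)"
proof -
  obtain U x where c: "(U, x) \<in> \<A>" "p \<in> U" using chart_at[OF assms(3)] .
  have d: "((\<lambda>s. \<phi> s p) has_real_derivative
      frechet_derivative (\<lambda>(t, q). \<phi> t (inv_into U x q)) (at (t, x p)) (1, 0)) (at t)"
    using time_deriv_chart[OF assms(1) c(1) assms(2), of "x p"] c by simp
  then show ?thesis using DERIV_imp_deriv[OF d] by (simp add: time_deriv_def)
qed

lemma smooth_family_time_deriv:
  assumes "open J" "smooth_family J \<phi>"
  shows "smooth_family J (time_deriv \<phi>)"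
proof (rule smooth_familyI)
  fix U x assume c: "(U, x) \<in> \<A>"
  have "smooth_on (J \<times> x ` U) (\<lambda>(t, q). time_deriv \<phi> t (inv_into U x q)) \<longleftrightarrow>
    smooth_on (J \<times> x ` U) (\<lambda>z. frechet_derivative (\<lambda>(t, q). \<phi> t (inv_into U x q)) (at z) (1, 0))"
    by (rule smooth_on_cong[OF open_chart_Times[OF assms(1) c]])
      (use time_deriv_chart[OF assms(2) c] in \<open>auto simp: time_deriv_def dest!: DERIV_imp_deriv\<close>)
  then show "smooth_on (J \<times> x ` U) (\<lambda>(t, q). time_deriv \<phi> t (inv_into U x q))"
    using smooth_on_frechet_derivative[OF smooth_familyD[OF assms(2) c]] by blast
qed

lemma smooth_functions_continuous:
  assumes "f \<in> smooth_functions"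
  shows "continuous_map M euclidean f"
proof (subst continuous_map, intro conjI allI impI)
  fix W :: "real set" assume "openin euclidean W"
  then have W: "open W" by simp
  show "openin M {p \<in> topspace M. f p \<in> W}"
  proof (subst openin_subopen, safe)
    fix p assume p: "p \<in> topspace M" "f p \<in> W"
    obtain U x where c: "(U, x) \<in> \<A>" "p \<in> U" using chart_at[OF p(1)] .
    have "open ((\<lambda>q. f (inv_into U x q)) -` W \<inter> x ` U)"
      using smooth_on_imp_continuous_on[OF smooth_functionsD[OF assms c(1)]] chart_codomain[OF c(1)] W
      by (auto simp: continuous_on_open_vimage)
    from chart_open_vimage[OF c(1) this]
    show "\<exists>T. openin M T \<and> p \<in> T \<and> T \<subseteq> {p \<in> topspace M. f p \<in> W}"
      by (intro exI[of _ "{p \<in> U. x p \<in> (\<lambda>q. f (inv_into U x q)) -` W \<inter> x ` U}"])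
        (use c p chart_subset[OF c(1)] in \<open>auto dest: inj_onD[OF chart_inj[OF c(1)]]\<close>)
  qed
qed auto

text \<open>The preimage of \<open>C\<close> is compact, hence closed in the Hausdorff space
  \<open>M\<close>. Its complement is therefore an open set on which the extension is 0, and
  together with \<open>U\<close> it covers \<open>M\<close>.\<close>

lemma smooth_family_extend:
  assumes "open J" "(U, x) \<in> \<A>" "compact C" "C \<subseteq> x ` U" "smooth_on (J \<times> x ` U) G"
    and G0: "\<And>t q. t \<in> J \<Longrightarrow> q \<in> x ` U \<Longrightarrow> q \<notin> C \<Longrightarrow> G (t, q) = 0"
  shows "smooth_family J (\<lambda>t p. if p \<in> U then G (t, x p) else 0)"
proof (rule smooth_familyI)
  fix V y assume c: "(V, y) \<in> \<A>"
  let ?f = "\<lambda>(t, q). if inv_into V y q \<in> U then G (t, x (inv_into V y q)) else 0"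
  let ?K = "{p \<in> U. x p \<in> C}"
  show "smooth_on (J \<times> y ` V) ?f"
  proof (rule smooth_on_local)
    fix z assume "z \<in> J \<times> y ` V"
    then obtain t p where z: "z = (t, y p)" "t \<in> J" "p \<in> V" by auto
    show "\<exists>T. open T \<and> z \<in> T \<and> smooth_on T ?f"
    proof (cases "p \<in> U")
      case True
      let ?T = "J \<times> y ` (V \<inter> U)"
      have o: "open ?T"
        by (intro open_Times assms(1) chart_open_image c chart_domain[OF assms(2)])
      have "smooth_on ?T (\<lambda>z. G (fst z, (x \<circ> inv_into V y) (snd z)))"
        by (rule smooth_on_compose[OF assms(5)], intro smooth_on_Pair smooth_on_fst smooth_on_id o
            smooth_on_compose[OF charts_compatible[OF c assms(2)]] smooth_on_snd)
          (use o c open_chart_Times[OF assms(1,2)] chart_open_image[OF c chart_domain[OF assms(2)]] in auto)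
      moreover have "smooth_on ?T (\<lambda>z. G (fst z, (x \<circ> inv_into V y) (snd z))) \<longleftrightarrow> smooth_on ?T ?f"
        by (rule smooth_on_cong[OF o]) (use c in auto)
      ultimately show ?thesis using o z True by (intro exI[of _ ?T]) auto
    next
      case False
      have "closedin M ?K"
        using chart_compact_vimage[OF assms(2-4)] Hausdorff compactin_imp_closedin by blast
      then have W: "openin M (topspace M - ?K)" by blast
      let ?T = "J \<times> y ` (V \<inter> (topspace M - ?K))"
      have o: "open ?T" by (intro open_Times assms(1) chart_open_image c W)
      have "smooth_on ?T (\<lambda>z. 0 :: real) \<longleftrightarrow> smooth_on ?T ?f"
      proof (rule smooth_on_cong[OF o])
        fix z assume "z \<in> ?T"
        then obtain t p where "z = (t, y p)" "t \<in> J" "p \<in> V" "p \<in> U \<Longrightarrow> x p \<notin> C" by auto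
        then show "0 = ?f z" using c G0[of t "x p"] by auto
      qed
      then have "smooth_on ?T ?f" using smooth_on_const[OF o] by blast
      then show ?thesis using o z False chart_subset[OF c] by (intro exI[of _ ?T]) auto
    qed
  qed
qed

lemma smooth_functions_extend:
  assumes "(U, x) \<in> \<A>" "compact C" "C \<subseteq> x ` U" "smooth_on (x ` U) g" "\<And>q. q \<in> x ` U \<Longrightarrow> q \<notin> C \<Longrightarrow> g q = 0"
  shows "(\<lambda>p. if p \<in> U then g (x p) else 0) \<in> smooth_functions"
proof -
  have sm: "smooth_on (UNIV \<times> x ` U) (\<lambda>z. g (snd z))"
    by (rule smooth_on_compose[OF assms(4)])
      (use open_chart_Times[OF open_UNIV assms(1)] chart_codomain[OF assms(1)] in \<open>auto intro!: smooth_on_intros\<close>)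
  show ?thesis
    unfolding smooth_functions_iff
    by (rule smooth_family_extend[OF open_UNIV assms(1-3) sm, unfolded snd_conv]) (rule assms(5))
qed

lemma bump_on_manifold:
  assumes "(U, x) \<in> \<A>" "p \<in> U" "openin M W" "p \<in> W"
  obtains \<beta> C N where "smooth_on UNIV \<beta>" "compact C" "C \<subseteq> x ` (U \<inter> W)" "\<And>q. 0 \<le> \<beta> q" "\<And>q. \<beta> q \<le> (1::real)"
    "\<And>q. q \<notin> C \<Longrightarrow> \<beta> q = 0" "openin M N" "p \<in> N" "N \<subseteq> U \<inter> W" "\<And>q. q \<in> N \<Longrightarrow> \<beta> (x q) = 1"
    "(\<lambda>q. if q \<in> U then \<beta> (x q) else 0) \<in> smooth_functions"
proof -
  have "open (x ` (U \<inter> W))" by (rule chart_open_image[OF assms(1,3)])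
  then obtain r where r: "r > 0" "cball (x p) r \<subseteq> x ` (U \<inter> W)"
    using assms open_contains_cball by (metis IntI imageI)
  obtain \<beta> where \<beta>: "smooth_on UNIV \<beta>" "\<And>q. 0 \<le> \<beta> q" "\<And>q. \<beta> q \<le> (1::real)"
    "\<And>q. q \<in> ball (x p) (r / 2) \<Longrightarrow> \<beta> q = 1" "\<And>q. q \<notin> cball (x p) r \<Longrightarrow> \<beta> q = 0"
    using bump_function_exists[OF r(1), of "x p"] by blast
  let ?N = "{q \<in> U. x q \<in> ball (x p) (r/2)}"
  show ?thesis
  proof (rule that[OF \<beta>(1) compact_cball r(2) \<beta>(2,3,5) chart_open_vimage[OF assms(1) open_ball]])
    show "?N \<subseteq> U \<inter> W"
    proof
      fix q assume q: "q \<in> ?N"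
      then have "x q \<in> cball (x p) r" using r by auto
      then obtain q' where q': "q' \<in> U" "q' \<in> W" "x q' = x q" using r by fastforce
      then have "q' = q" using chart_inj[OF assms(1)] q by (auto dest: inj_onD)
      then show "q \<in> U \<inter> W" using q' by blast
    qed
    show "(\<lambda>q. if q \<in> U then \<beta> (x q) else 0) \<in> smooth_functions"
      by (rule smooth_functions_extend[OF assms(1) compact_cball[of "x p" r]])
        (use r \<beta> smooth_on_subset[OF \<beta>(1)] in auto)
  qed (use assms r \<beta>(4) in auto)
qed

lemma bump_at:
  assumes "openin M W" "p \<in> W"
  obtains \<eta> N where "\<eta> \<in> smooth_functions" "\<And>q. 0 \<le> \<eta> q" "\<And>q. \<eta> q \<le> 1" "\<And>q. \<eta> q \<noteq> 0 \<Longrightarrow> q \<in> W"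
    "openin M N" "p \<in> N" "N \<subseteq> W" "\<And>q. q \<in> N \<Longrightarrow> \<eta> q = 1"
proof -
  have "p \<in> topspace M" using assms openin_subset by blast
  then obtain U x where c: "(U, x) \<in> \<A>" "p \<in> U" using chart_at by metis
  obtain \<beta> C N where b: "smooth_on UNIV \<beta>" "compact C" "C \<subseteq> x ` (U \<inter> W)" "\<And>q. 0 \<le> \<beta> q" "\<And>q. \<beta> q \<le> (1::real)"
    "\<And>q. q \<notin> C \<Longrightarrow> \<beta> q = 0" "openin M N" "p \<in> N" "N \<subseteq> U \<inter> W" "\<And>q. q \<in> N \<Longrightarrow> \<beta> (x q) = 1"
    "(\<lambda>q. if q \<in> U then \<beta> (x q) else 0) \<in> smooth_functions"
    using bump_on_manifold[OF c assms] by blast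
  have W: "q \<in> W" if "q \<in> U" "\<beta> (x q) \<noteq> 0" for q
  proof -
    have "x q \<in> x ` (U \<inter> W)" using b that by blast
    then obtain q' where "q' \<in> U" "q' \<in> W" "x q' = x q" by auto
    then show ?thesis using chart_inj[OF c(1)] that by (metis inj_onD)
  qed
  show ?thesis
    by (rule that[OF b(11) _ _ _ b(7,8)]) (use b W in \<open>auto split: if_splits\<close>)
qed

definition smooth_vector_functions :: "('a \<Rightarrow> 'e) set" where
  "smooth_vector_functions = {\<xi>. \<forall>c. (\<lambda>q. \<xi> q \<bullet> c) \<in> smooth_functions}"

lemma smooth_vector_functionsD: "\<xi> \<in> smooth_vector_functions \<Longrightarrow> (\<lambda>q. \<xi> q \<bullet> c) \<in> smooth_functions"
  by (simp add: smooth_vector_functions_def)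

text \<open>Tangent vectors act on global smooth functions only, while coordinates live on a chart
  domain. Multiplying them by a bump function gives global functions that agree with the coordinates
  near \<open>p\<close>.\<close>

lemma local_coordinates:
  assumes "(U, x) \<in> \<A>" "p \<in> U"
  obtains N \<xi> where "openin M N" "p \<in> N" "N \<subseteq> U" "\<xi> \<in> smooth_vector_functions" "\<And>q. q \<in> N \<Longrightarrow> \<xi> q = x q"
proof -
  obtain \<beta> C N where b: "smooth_on UNIV \<beta>" "compact C" "C \<subseteq> x ` (U \<inter> topspace M)" "\<And>q. 0 \<le> \<beta> q" "\<And>q. \<beta> q \<le> (1::real)"
    "\<And>q. q \<notin> C \<Longrightarrow> \<beta> q = 0" "openin M N" "p \<in> N" "N \<subseteq> U \<inter> topspace M" "\<And>q. q \<in> N \<Longrightarrow> \<beta> (x q) = 1"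
    "(\<lambda>q. if q \<in> U then \<beta> (x q) else 0) \<in> smooth_functions"
    using bump_on_manifold[OF assms openin_topspace subsetD[OF chart_subset[OF assms(1)] assms(2)]] by blast
  define \<xi> where "\<xi> q = (if q \<in> U then \<beta> (x q) *\<^sub>R x q else 0)" for q
  have "(\<lambda>q. if q \<in> U then \<beta> (x q) * (x q \<bullet> c) else 0) \<in> smooth_functions" for c
    by (rule smooth_functions_extend[OF assms(1) b(2)])
      (use b chart_codomain[OF assms(1)] in \<open>auto intro!: smooth_on_intros intro: smooth_on_subset\<close>)
  moreover have "(\<lambda>q. if q \<in> U then \<beta> (x q) * (x q \<bullet> c) else 0) = (\<lambda>q. \<xi> q \<bullet> c)" for c
    by (auto simp: \<xi>_def)
  ultimately have "\<xi> \<in> smooth_vector_functions" by (simp add: smooth_vector_functions_def)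
  then show ?thesis
    using that[of N \<xi>] b by (auto simp: \<xi>_def subset_iff)
qed


subsection \<open>Tangent vectors\<close>

lemma coord_vector_apply:
  "f \<in> smooth_functions \<Longrightarrow>
    coord_vector (U, x) p v f = frechet_derivative (\<lambda>q. f (inv_into U x q)) (at (x p)) v"
  by (simp add: coord_vector_def o_def)

lemma coord_vector_has_derivative:
  assumes "(U, x) \<in> \<A>" "p \<in> U" "f \<in> smooth_functions"
  shows "((\<lambda>q. f (inv_into U x q)) has_derivative (\<lambda>v. coord_vector (U, x) p v f)) (at (x p))"
  using smooth_on_has_derivative[OF smooth_functionsD[OF assms(3,1)], of "x p"] assms
  by (simp add: coord_vector_apply)

lemma coord_vector_eqI:
  assumes "(U, x) \<in> \<A>" "p \<in> U" "f \<in> smooth_functions"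
    and "((\<lambda>q. f (inv_into U x q)) has_derivative D) (at (x p))"
  shows "coord_vector (U, x) p v f = D v"
  using has_derivative_unique[OF coord_vector_has_derivative[OF assms(1-3)] assms(4)] by metis

lemma coord_vector_linear:
  assumes "(U, x) \<in> \<A>" "p \<in> U"
  shows "coord_vector (U, x) p (a *\<^sub>R v + b *\<^sub>R w)
    = (\<lambda>f. a * coord_vector (U, x) p v f + b * coord_vector (U, x) p w f)"
proof
  fix f
  show "coord_vector (U, x) p (a *\<^sub>R v + b *\<^sub>R w) f
    = a * coord_vector (U, x) p v f + b * coord_vector (U, x) p w f"
  proof (cases "f \<in> smooth_functions")
    case True
    then have "linear (\<lambda>v. coord_vector (U, x) p v f)"
      using coord_vector_has_derivative[OF assms] has_derivative_linear by blast
    from linear_add[OF this] linear_scale[OF this] show ?thesis by simp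
  qed (simp add: coord_vector_def)
qed

lemma coord_vector_local:
  assumes "(U, x) \<in> \<A>" "p \<in> U" "f \<in> smooth_functions" "g \<in> smooth_functions"
    and "openin M N" "p \<in> N" "\<And>q. q \<in> N \<Longrightarrow> f q = g q"
  shows "coord_vector (U, x) p v f = coord_vector (U, x) p v g"
proof (rule coord_vector_eqI[OF assms(1-3)])
  show "((\<lambda>q. f (inv_into U x q)) has_derivative (\<lambda>v. coord_vector (U, x) p v g)) (at (x p))"
    by (rule has_derivative_transform_within_open[OF coord_vector_has_derivative[OF assms(1,2,4)]
          chart_open_image[OF assms(1,5)]])
      (use assms in auto)
qed

lemma coord_vector_coordinate:
  assumes "(U, x) \<in> \<A>" "p \<in> U" "openin M N" "p \<in> N" "N \<subseteq> U" "(\<lambda>q. \<xi> q \<bullet> c) \<in> smooth_functions"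
    and "\<And>q. q \<in> N \<Longrightarrow> \<xi> q = x q"
  shows "coord_vector (U, x) p v (\<lambda>q. \<xi> q \<bullet> c) = v \<bullet> c"
proof (rule coord_vector_eqI[OF assms(1,2,6)])
  have d: "((\<lambda>q. q \<bullet> c) has_derivative (\<lambda>v. v \<bullet> c)) (at (x p))"
    by (intro bounded_linear_imp_has_derivative bounded_linear_inner_left)
  show "((\<lambda>q. \<xi> (inv_into U x q) \<bullet> c) has_derivative (\<lambda>v. v \<bullet> c)) (at (x p))"
    by (rule has_derivative_transform_within_open[OF d chart_open_image[OF assms(1,3)]])
      (use assms in auto)
qed

text \<open>The cut-off coordinate functions read off the components of the vector.\<close>

lemma coord_vector_inj:
  assumes "(U, x) \<in> \<A>" "p \<in> U" "coord_vector (U, x) p v = coord_vector (U, x) p w"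
  shows "v = w"
proof -
  obtain N \<xi> where N: "openin M N" "p \<in> N" "N \<subseteq> U" "\<xi> \<in> smooth_vector_functions"
    "\<And>q. q \<in> N \<Longrightarrow> \<xi> q = x q"
    using local_coordinates[OF assms(1,2)] by blast
  have "v \<bullet> c = w \<bullet> c" for c
    using coord_vector_coordinate[OF assms(1,2) N(1-3) smooth_vector_functionsD[OF N(4)] N(5), where c = c and v = v]
      coord_vector_coordinate[OF assms(1,2) N(1-3) smooth_vector_functionsD[OF N(4)] N(5), where c = c and v = w]
      assms(3) by simp
  then show ?thesis by (metis euclidean_eqI)
qed

text \<open>The chain rule for the transition map. It makes the tangent space computable in any
  single chart around the point.\<close>

lemma coord_vector_change:
  assumes "(U, x) \<in> \<A>" "p \<in> U" "(V, y) \<in> \<A>" "p \<in> V"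
  shows "coord_vector (U, x) p v
    = coord_vector (V, y) p (frechet_derivative (y \<circ> inv_into U x) (at (x p)) v)"
proof
  fix f
  show "coord_vector (U, x) p v f
    = coord_vector (V, y) p (frechet_derivative (y \<circ> inv_into U x) (at (x p)) v) f"
  proof (cases "f \<in> smooth_functions")
    case True
    show ?thesis
    proof (rule coord_vector_eqI[OF assms(1,2) True])
      have xp: "x p \<in> x ` (U \<inter> V)" using assms by blast
      have "((y \<circ> inv_into U x) has_derivative frechet_derivative (y \<circ> inv_into U x) (at (x p))) (at (x p))"
        by (rule smooth_on_has_derivative[OF charts_compatible[OF assms(1,3)] xp])
      moreover have "((\<lambda>q. f (inv_into V y q)) has_derivative (\<lambda>w. coord_vector (V, y) p w f))
          (at ((y \<circ> inv_into U x) (x p)))"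
        using coord_vector_has_derivative[OF assms(3,4) True] assms by simp
      ultimately have "((\<lambda>q. f (inv_into V y ((y \<circ> inv_into U x) q))) has_derivative
          (\<lambda>v. coord_vector (V, y) p (frechet_derivative (y \<circ> inv_into U x) (at (x p)) v) f)) (at (x p))"
        by (rule has_derivative_compose)
      then show "((\<lambda>q. f (inv_into U x q)) has_derivative
          (\<lambda>v. coord_vector (V, y) p (frechet_derivative (y \<circ> inv_into U x) (at (x p)) v) f)) (at (x p))"
        by (rule has_derivative_transform_within_open[OF _ chart_open_image[OF assms(1) chart_domain[OF assms(3)]] xp])
          (use assms in auto)
    qed
  qed (simp add: coord_vector_def)
qed

lemma tangent_space_chart:
  assumes "(U, x) \<in> \<A>" "p \<in> U"
  shows "tangent_space p = range (coord_vector (U, x) p)"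
proof
  show "tangent_space p \<subseteq> range (coord_vector (U, x) p)"
    unfolding tangent_space_def using coord_vector_change[OF _ _ assms] by blast
  show "range (coord_vector (U, x) p) \<subseteq> tangent_space p"
    unfolding tangent_space_def using assms by blast
qed

lemma coord_vector_const:
  assumes "(U, x) \<in> \<A>" "p \<in> U"
  shows "coord_vector (U, x) p v (\<lambda>q. c) = 0"
  using coord_vector_eqI[OF assms smooth_functions_const, of c "\<lambda>v. 0"] by simp

lemma coord_vector_mult:
  assumes "(U, x) \<in> \<A>" "p \<in> U" "f \<in> smooth_functions" "g \<in> smooth_functions"
  shows "coord_vector (U, x) p v (\<lambda>q. f q * g q) = f p * coord_vector (U, x) p v g + coord_vector (U, x) p v f * g p"
proof -
  have "((\<lambda>q. f (inv_into U x q) * g (inv_into U x q)) has_derivative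
      (\<lambda>v. f (inv_into U x (x p)) * coord_vector (U, x) p v g + coord_vector (U, x) p v f * g (inv_into U x (x p)))) (at (x p))"
    by (intro has_derivative_mult coord_vector_has_derivative assms)
  from coord_vector_eqI[OF assms(1,2) smooth_functions_mult[OF assms(3,4)] this] show ?thesis
    using assms by simp
qed

lemma coord_vector_add:
  assumes "(U, x) \<in> \<A>" "p \<in> U" "f \<in> smooth_functions" "g \<in> smooth_functions"
  shows "coord_vector (U, x) p v (\<lambda>q. f q + g q) = coord_vector (U, x) p v f + coord_vector (U, x) p v g"
  using coord_vector_eqI[OF assms(1,2) smooth_functions_add[OF assms(3,4)]]
    has_derivative_add[OF coord_vector_has_derivative[OF assms(1-3)] coord_vector_has_derivative[OF assms(1,2,4)]]
  by blast


subsection \<open>Smooth maps into the manifold\<close>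

text \<open>Testing with global smooth functions spares any choice of target charts containing the
  image. Continuity is implied, because bump functions are among the tests.\<close>

definition smooth_into :: "'z::euclidean_space set \<Rightarrow> ('z \<Rightarrow> 'a) \<Rightarrow> bool" where
  "smooth_into Z g \<longleftrightarrow> g ` Z \<subseteq> topspace M \<and> (\<forall>f\<in>smooth_functions. smooth_on Z (\<lambda>z. f (g z)))"

lemma smooth_into_open_vimage:
  assumes "open Z" "smooth_into Z g" "openin M W"
  shows "open {z \<in> Z. g z \<in> W}"
proof (subst open_subopen, safe)
  fix z assume z: "z \<in> Z" "g z \<in> W"
  obtain \<eta> N where b: "\<eta> \<in> smooth_functions" "\<And>q. 0 \<le> \<eta> q" "\<And>q. \<eta> q \<le> (1::real)" "\<And>q. \<eta> q \<noteq> 0 \<Longrightarrow> q \<in> W"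
    "openin M N" "g z \<in> N" "N \<subseteq> W" "\<And>q. q \<in> N \<Longrightarrow> \<eta> q = 1"
    using bump_at[OF assms(3) z(2)] by blast
  have "continuous_on Z (\<lambda>z. \<eta> (g z))"
    using smooth_on_imp_continuous_on[OF bspec[OF conjunct2[OF assms(2)[unfolded smooth_into_def]] b(1)]] .
  then have "open ((\<lambda>z. \<eta> (g z)) -` (- {0}) \<inter> Z)"
    using continuous_on_open_vimage[OF assms(1), of "\<lambda>z. \<eta> (g z)"] open_Compl[OF closed_singleton[of "0::real"]] by blast
  then show "\<exists>T. open T \<and> z \<in> T \<and> T \<subseteq> {z \<in> Z. g z \<in> W}"
    by (intro exI[of _ "(\<lambda>z. \<eta> (g z)) -` (- {0}) \<inter> Z"]) (use b z in auto)
qed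

text \<open>Near each parameter the values of \<open>g\<close> lie in a region where cut-off
  coordinates are the true ones. These coordinates are smooth along \<open>g\<close> by testing, and
  composing them with the chart expression of \<open>\<phi>\<close> gives the claim.\<close>

lemma smooth_family_along:
  assumes "open Z" "smooth_into Z g" "smooth_on Z \<tau>" "\<tau> ` Z \<subseteq> J" "open J" "smooth_family J \<phi>"
  shows "smooth_on Z (\<lambda>z. \<phi> (\<tau> z) (g z))"
proof (rule smooth_on_local)
  fix z assume z: "z \<in> Z"
  then have "g z \<in> topspace M" using assms(2) by (auto simp: smooth_into_def)
  then obtain U x where c: "(U, x) \<in> \<A>" "g z \<in> U" using chart_at by metis
  obtain N \<xi> where N: "openin M N" "g z \<in> N" "N \<subseteq> U" "\<xi> \<in> smooth_vector_functions"
    "\<And>q. q \<in> N \<Longrightarrow> \<xi> q = x q"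
    using local_coordinates[OF c] by blast
  let ?T = "{z \<in> Z. g z \<in> N}"
  have o: "open ?T" by (rule smooth_into_open_vimage[OF assms(1,2) N(1)])
  have sub: "?T \<subseteq> Z" by auto
  have comp: "smooth_on Z (\<lambda>z. \<xi> (g z) \<bullet> b)" for b
    using bspec[OF conjunct2[OF assms(2)[unfolded smooth_into_def]] smooth_vector_functionsD[OF N(4), of b]] .
  have "smooth_on ?T (\<lambda>z. \<xi> (g z))"
    by (rule smooth_on_componentwise[OF o]) (rule smooth_on_subset[OF comp sub])
  then have "smooth_on ?T (\<lambda>z. (\<tau> z, \<xi> (g z)))"
    by (intro smooth_on_Pair o) (auto intro: smooth_on_subset[OF assms(3)])
  then have "smooth_on ?T (\<lambda>z. case (\<tau> z, \<xi> (g z)) of (t, q) \<Rightarrow> \<phi> t (inv_into U x q))"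
    by (intro smooth_on_compose[OF smooth_familyD[OF assms(6) c(1)]] o open_chart_Times[OF assms(5) c(1)])
      (use N assms(4) in auto)
  moreover have "smooth_on ?T (\<lambda>z. case (\<tau> z, \<xi> (g z)) of (t, q) \<Rightarrow> \<phi> t (inv_into U x q))
      \<longleftrightarrow> smooth_on ?T (\<lambda>z. \<phi> (\<tau> z) (g z))"
    by (rule smooth_on_cong[OF o]) (use N c in auto)
  ultimately show "\<exists>T. open T \<and> z \<in> T \<and> smooth_on T (\<lambda>z. \<phi> (\<tau> z) (g z))"
    using o z N by (intro exI[of _ ?T]) auto
qed

end


subsection \<open>Closed manifolds\<close>

locale closed_manifold = smooth_manifold M \<A>
  for M :: "'a topology" and \<A> :: "('a, 'e::euclidean_space) chart set" +
  assumes compact_space: "compact_space M"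

sublocale closed_symplectic_manifold \<subseteq> closed_manifold
  by unfold_locales (rule compact)

context closed_manifold
begin

lemma finite_subcover:
  assumes "\<And>p. p \<in> topspace M \<Longrightarrow> openin M (N p) \<and> p \<in> N p"
  obtains F where "finite F" "F \<subseteq> topspace M" "topspace M \<subseteq> (\<Union>p\<in>F. N p)"
proof -
  have "compactin M (topspace M)" using compact_space by (simp add: compact_space_def)
  moreover have "\<forall>W\<in>N ` topspace M. openin M W" "topspace M \<subseteq> \<Union>(N ` topspace M)" using assms by auto
  ultimately obtain \<F> where F: "finite \<F>" "\<F> \<subseteq> N ` topspace M" "topspace M \<subseteq> \<Union>\<F>"
    unfolding compactin_def by meson
  from finite_subset_image[OF F(1,2)] obtain F where "F \<subseteq> topspace M" "finite F" "\<F> = N ` F" by blast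
  then show ?thesis using that[of F] F(3) by blast
qed

lemma smooth_family_bounded:
  assumes "smooth_family J \<phi>" "compact K" "K \<subseteq> J"
  obtains B where "\<And>t p. t \<in> K \<Longrightarrow> p \<in> topspace M \<Longrightarrow> \<bar>\<phi> t p\<bar> \<le> B"
proof -
  have "\<exists>N B. openin M N \<and> p \<in> N \<and> (\<forall>t\<in>K. \<forall>q\<in>N. \<bar>\<phi> t q\<bar> \<le> B)" if "p \<in> topspace M" for p
  proof -
    obtain U x where c: "(U, x) \<in> \<A>" "p \<in> U" using chart_at[OF \<open>p \<in> topspace M\<close>] .
    obtain r where r: "r > 0" "cball (x p) r \<subseteq> x ` U"
      using chart_codomain[OF c(1)] c(2) open_contains_cball by (metis imageI)
    have "compact ((\<lambda>(t, q). \<phi> t (inv_into U x q)) ` (K \<times> cball (x p) r))"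
      by (intro compact_continuous_image compact_Times assms compact_cball
          continuous_on_subset[OF smooth_on_imp_continuous_on[OF smooth_familyD[OF assms(1) c(1)]]])
        (use r assms in auto)
    from compact_imp_bounded[OF this] obtain B
      where B0: "\<forall>y\<in>(\<lambda>(t, q). \<phi> t (inv_into U x q)) ` (K \<times> cball (x p) r). norm y \<le> B"
      unfolding bounded_iff by blast
    have B: "\<bar>\<phi> t (inv_into U x q)\<bar> \<le> B" if "t \<in> K" "q \<in> cball (x p) r" for t q
      using bspec[OF B0, of "\<phi> t (inv_into U x q)"] that by force
    have "\<bar>\<phi> t q\<bar> \<le> B" if "t \<in> K" "q \<in> {q \<in> U. x q \<in> ball (x p) r}" for t q
      using B[OF that(1), of "x q"] that c by auto
    then show ?thesis using chart_open_vimage[OF c(1) open_ball, of "x p" r] c r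
      by (intro exI[of _ "{q \<in> U. x q \<in> ball (x p) r}"] exI[of _ B]) auto
  qed
  then obtain N B where NB: "\<And>p. p \<in> topspace M \<Longrightarrow> openin M (N p) \<and> p \<in> N p \<and> (\<forall>t\<in>K. \<forall>q\<in>N p. \<bar>\<phi> t q\<bar> \<le> B p)"
    by metis
  obtain F where F: "finite F" "F \<subseteq> topspace M" "topspace M \<subseteq> (\<Union>p\<in>F. N p)"
    by (rule finite_subcover[of N]) (use NB in auto)
  show ?thesis
  proof (rule that[of "\<Sum>p\<in>F. \<bar>B p\<bar>"])
    fix t q assume tq: "t \<in> K" "q \<in> topspace M"
    then obtain p where p: "p \<in> F" "q \<in> N p" using F by blast
    then have "\<bar>\<phi> t q\<bar> \<le> \<bar>B p\<bar>" using NB[of p] F(2) tq by fastforce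
    also have "\<dots> \<le> (\<Sum>p\<in>F. \<bar>B p\<bar>)" using F(1) p by (intro member_le_sum) auto
    finally show "\<bar>\<phi> t q\<bar> \<le> (\<Sum>p\<in>F. \<bar>B p\<bar>)" .
  qed
qed

text \<open>The supports have compact coordinate images \<open>C i\<close>, as required both for
  extension by zero and for integration by parts in a chart.\<close>

definition chart_partition ::
    "'i set \<Rightarrow> ('i \<Rightarrow> 'a set) \<Rightarrow> ('i \<Rightarrow> 'a \<Rightarrow> 'e) \<Rightarrow> ('i \<Rightarrow> 'e set) \<Rightarrow> ('i \<Rightarrow> 'a \<Rightarrow> real) \<Rightarrow> bool" where
  "chart_partition F U x C \<eta> \<longleftrightarrow> finite F \<and> (\<forall>p\<in>topspace M. (\<Sum>i\<in>F. \<eta> i p) = 1) \<and>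
    (\<forall>i\<in>F. (U i, x i) \<in> \<A> \<and> compact (C i) \<and> C i \<subseteq> x i ` U i \<and> \<eta> i \<in> smooth_functions \<and>
      (\<forall>p. \<eta> i p \<noteq> 0 \<longrightarrow> p \<in> U i \<and> x i p \<in> C i))"

lemma chart_partitionD:
  assumes "chart_partition F U x C \<eta>"
  shows "finite F" "\<And>i. i \<in> F \<Longrightarrow> (U i, x i) \<in> \<A>" "\<And>i. i \<in> F \<Longrightarrow> compact (C i)" "\<And>i. i \<in> F \<Longrightarrow> C i \<subseteq> x i ` U i"
    "\<And>i. i \<in> F \<Longrightarrow> \<eta> i \<in> smooth_functions" "\<And>i p. i \<in> F \<Longrightarrow> \<eta> i p \<noteq> 0 \<Longrightarrow> p \<in> U i \<and> x i p \<in> C i"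
    "\<And>p. p \<in> topspace M \<Longrightarrow> (\<Sum>i\<in>F. \<eta> i p) = 1"
  using assms unfolding chart_partition_def by blast+

lemma partition_of_unity: "\<exists>(F :: 'a set) U x C \<eta>. chart_partition F U x C \<eta>"
proof -
  have "\<exists>U x C \<beta> N. (U, x) \<in> \<A> \<and> compact C \<and> C \<subseteq> x ` U \<and> \<beta> \<in> smooth_functions \<and> (\<forall>q. 0 \<le> \<beta> q) \<and>
      (\<forall>q. \<beta> q \<noteq> 0 \<longrightarrow> q \<in> U \<and> x q \<in> C) \<and> openin M N \<and> p \<in> N \<and> (\<forall>q\<in>N. \<beta> q = (1::real))"
    if p: "p \<in> topspace M" for p
  proof -
    obtain U x where c: "(U, x) \<in> \<A>" "p \<in> U" using chart_at[OF p] .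
    obtain \<beta> C N where b: "smooth_on UNIV \<beta>" "compact C" "C \<subseteq> x ` (U \<inter> topspace M)" "\<And>q. 0 \<le> \<beta> q" "\<And>q. \<beta> q \<le> (1::real)"
      "\<And>q. q \<notin> C \<Longrightarrow> \<beta> q = 0" "openin M N" "p \<in> N" "N \<subseteq> U \<inter> topspace M" "\<And>q. q \<in> N \<Longrightarrow> \<beta> (x q) = 1"
      "(\<lambda>q. if q \<in> U then \<beta> (x q) else 0) \<in> smooth_functions"
      using bump_on_manifold[OF c openin_topspace p] by blast
    show ?thesis
      by (rule exI[of _ U], rule exI[of _ x], rule exI[of _ C], rule exI[of _ "\<lambda>q. if q \<in> U then \<beta> (x q) else 0"],
          rule exI[of _ N]) (use b c in auto)
  qed
  then obtain U x C \<beta> N where *: "\<And>p. p \<in> topspace M \<Longrightarrow> (U p, x p) \<in> \<A> \<and> compact (C p) \<and> C p \<subseteq> x p ` U p \<and>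
      \<beta> p \<in> smooth_functions \<and> (\<forall>q. 0 \<le> \<beta> p q) \<and> (\<forall>q. \<beta> p q \<noteq> 0 \<longrightarrow> q \<in> U p \<and> x p q \<in> C p) \<and>
      openin M (N p) \<and> p \<in> N p \<and> (\<forall>q\<in>N p. \<beta> p q = (1::real))"
    by metis
  obtain F where F: "finite F" "F \<subseteq> topspace M" "topspace M \<subseteq> (\<Union>p\<in>F. N p)"
    by (rule finite_subcover[of N]) (use * in auto)
  define s where "s q = (\<Sum>p\<in>F. \<beta> p q)" for q
  have pos: "s q > 0" if q: "q \<in> topspace M" for q
  proof -
    obtain p where p: "p \<in> F" "q \<in> N p" using F q by blast
    then have "1 \<le> \<beta> p q" using * F by auto
    also have "\<dots> \<le> s q" unfolding s_def using F p * by (intro member_le_sum) auto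
    finally show ?thesis by simp
  qed
  define \<eta> where "\<eta> p q = \<beta> p q * inverse (s q)" for p q
  have \<beta>F: "smooth_family UNIV (\<lambda>t. \<beta> i)" if "i \<in> F" for i
    using * F that by (auto simp flip: smooth_functions_iff)
  have "smooth_family UNIV (\<lambda>t q. inverse (s q))"
    unfolding s_def
    by (intro smooth_family_inverse smooth_family_sum open_UNIV \<beta>F) (use pos in \<open>force simp: s_def\<close>)+
  then have "\<eta> i \<in> smooth_functions" if "i \<in> F" for i
    unfolding smooth_functions_iff \<eta>_def by (intro smooth_family_mult \<beta>F that open_UNIV)
  moreover have "(\<Sum>i\<in>F. \<eta> i p) = 1" if "p \<in> topspace M" for p
    using pos[OF that] by (simp add: \<eta>_def s_def flip: sum_distrib_right)
  moreover have "p \<in> U i \<and> x i p \<in> C i" if "i \<in> F" "\<eta> i p \<noteq> 0" for i p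
    using * F that by (auto simp: \<eta>_def)
  moreover have "(U i, x i) \<in> \<A>" "compact (C i)" "C i \<subseteq> x i ` U i" if "i \<in> F" for i
    using * F that by blast+
  ultimately have "chart_partition F U x C \<eta>"
    unfolding chart_partition_def using F(1) by blast
  then show ?thesis by blast
qed

end

section \<open>Flows of time-dependent vector fields\<close>

context smooth_manifold
begin

definition smooth_field :: "real set \<Rightarrow> (real \<Rightarrow> 'a \<Rightarrow> ('a \<Rightarrow> real) \<Rightarrow> real) \<Rightarrow> bool" where
  "smooth_field J X \<longleftrightarrow> (\<forall>(U, x)\<in>\<A>. \<exists>\<xi>. smooth_on (J \<times> x ` U) \<xi> \<and>
    (\<forall>t\<in>J. \<forall>p\<in>U. X t p = coord_vector (U, x) p (\<xi> (t, x p))))"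

text \<open>With derivatives taken within \<open>T\<close>, one notion covers both the closed
  interval of times in the definition of \<open>Ham\<close> and the open intervals on which flows
  are built.\<close>

definition integral_curve :: "real set \<Rightarrow> (real \<Rightarrow> 'a \<Rightarrow> ('a \<Rightarrow> real) \<Rightarrow> real) \<Rightarrow> (real \<Rightarrow> 'a) \<Rightarrow> bool" where
  "integral_curve T X \<gamma> \<longleftrightarrow> (\<forall>t\<in>T. \<gamma> t \<in> topspace M \<and> (\<forall>f\<in>smooth_functions.
    ((\<lambda>s. f (\<gamma> s)) has_real_derivative X t (\<gamma> t) f) (at t within T)))"

lemma smooth_fieldE:
  assumes "smooth_field J X" "(U, x) \<in> \<A>"
  obtains \<xi> where "smooth_on (J \<times> x ` U) \<xi>" "\<And>t p. t \<in> J \<Longrightarrow> p \<in> U \<Longrightarrow> X t p = coord_vector (U, x) p (\<xi> (t, x p))"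
  using assms unfolding smooth_field_def by blast

lemma smooth_field_tangent:
  assumes "smooth_field J X" "t \<in> J" "(U, x) \<in> \<A>" "p \<in> U"
  obtains v where "X t p = coord_vector (U, x) p v"
  using assms by (metis smooth_fieldE)

lemma smooth_field_apply:
  assumes "open J" "smooth_field J X" "smooth_family J \<phi>"
  shows "smooth_family J (\<lambda>t p. X t p (\<phi> t))"
proof (rule smooth_familyI)
  fix U x assume c: "(U, x) \<in> \<A>"
  obtain \<xi> where \<xi>: "smooth_on (J \<times> x ` U) \<xi>" "\<And>t p. t \<in> J \<Longrightarrow> p \<in> U \<Longrightarrow> X t p = coord_vector (U, x) p (\<xi> (t, x p))"
    using smooth_fieldE[OF assms(2) c] by blast
  let ?G = "\<lambda>(t, q). \<phi> t (inv_into U x q)"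
  note G = smooth_familyD[OF assms(3) c]
  have o: "open (J \<times> x ` U)" by (rule open_chart_Times[OF assms(1) c])
  have "smooth_on (J \<times> x ` U) (\<lambda>z. frechet_derivative ?G (at z) (0, \<xi> z))"
    by (rule smooth_on_apply_linear[OF o _ smooth_on_frechet_derivative[OF G]])
      (use has_derivative_linear[OF smooth_on_has_derivative[OF G]] \<xi>(1) o in \<open>auto intro!: smooth_on_Pair smooth_on_const\<close>)
  moreover have "frechet_derivative ?G (at z) (0, \<xi> z) = (case z of (t, q) \<Rightarrow> X t (inv_into U x q) (\<phi> t))"
    if "z \<in> J \<times> x ` U" for z
  proof -
    from that obtain t p where z: "z = (t, x p)" "t \<in> J" "p \<in> U" by auto
    have "((\<lambda>q. (t, q)) has_derivative (\<lambda>v. (0, v))) (at (x p))"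
      by (auto intro!: derivative_eq_intros)
    from has_derivative_compose[OF this, of ?G] smooth_on_has_derivative[OF G that]
    have "((\<lambda>q. \<phi> t (inv_into U x q)) has_derivative (\<lambda>v. frechet_derivative ?G (at z) (0, v))) (at (x p))"
      by (simp add: z)
    from coord_vector_eqI[OF c z(3) smooth_family_at[OF assms(1,3) z(2)] this]
    show ?thesis using \<xi>(2)[OF z(2,3)] z c by simp
  qed
  ultimately show "smooth_on (J \<times> x ` U) (\<lambda>(t, q). X t (inv_into U x q) (\<phi> t))"
    by (rule iffD1[OF smooth_on_cong[OF o], rotated])
qed

section \<open>Integral curves: coordinates, uniqueness, local existence\<close>

lemma integral_curve_subset:
  "integral_curve T X \<gamma> \<Longrightarrow> S \<subseteq> T \<Longrightarrow> integral_curve S X \<gamma>"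
  unfolding integral_curve_def by (meson DERIV_subset subsetD)

lemma integral_curve_in: "integral_curve T X \<gamma> \<Longrightarrow> t \<in> T \<Longrightarrow> \<gamma> t \<in> topspace M"
  by (simp add: integral_curve_def)

lemma integral_curve_deriv:
  "integral_curve T X \<gamma> \<Longrightarrow> t \<in> T \<Longrightarrow> f \<in> smooth_functions \<Longrightarrow>
    ((\<lambda>s. f (\<gamma> s)) has_real_derivative X t (\<gamma> t) f) (at t within T)"
  by (simp add: integral_curve_def)

text \<open>Continuity of an integral curve is recovered by testing: a bump function supported in
  \<open>N\<close> is 1 at \<open>\<gamma> t0\<close> and differentiable along the curve, hence
  nonzero at nearby times.\<close>

lemma integral_curve_near:
  assumes "integral_curve T X \<gamma>" "t0 \<in> T" "openin M N" "\<gamma> t0 \<in> N"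
  obtains d where "d > 0" "\<And>t. t \<in> T \<Longrightarrow> \<bar>t - t0\<bar> < d \<Longrightarrow> \<gamma> t \<in> N"
proof -
  obtain \<eta> N' where b: "\<eta> \<in> smooth_functions" "\<And>q. 0 \<le> \<eta> q" "\<And>q. \<eta> q \<le> (1::real)" "\<And>q. \<eta> q \<noteq> 0 \<Longrightarrow> q \<in> N"
    "openin M N'" "\<gamma> t0 \<in> N'" "N' \<subseteq> N" "\<And>q. q \<in> N' \<Longrightarrow> \<eta> q = 1"
    using bump_at[OF assms(3,4)] by blast
  have "continuous (at t0 within T) (\<lambda>s. \<eta> (\<gamma> s))"
    using DERIV_continuous[OF integral_curve_deriv[OF assms(1,2) b(1)]] .
  then obtain d where "d > 0" "\<And>t. t \<in> T \<Longrightarrow> dist t t0 < d \<Longrightarrow> dist (\<eta> (\<gamma> t)) (\<eta> (\<gamma> t0)) < 1"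
    unfolding continuous_within_eps_delta by (meson zero_less_one)
  then show ?thesis
    using that[of d] b(4,6,8) by (force simp: dist_real_def)
qed

text \<open>Near \<open>\<gamma> t0\<close> the chart agrees with cut-off coordinates, on which the
  defining property of the curve can be tested. The sets \<open>S\<close> allow differentiation
  within a segment of times, as the uniqueness proof requires.\<close>

lemma integral_curve_coordinates:
  assumes "integral_curve T X \<gamma>" "t0 \<in> T" "(U, x) \<in> \<A>" "\<gamma> t0 \<in> U"
    and \<xi>: "\<And>t p. t \<in> T \<Longrightarrow> p \<in> U \<Longrightarrow> X t p = coord_vector (U, x) p (\<xi> (t, x p))"
  obtains d where "d > 0" "\<And>t. t \<in> T \<Longrightarrow> \<bar>t - t0\<bar> < d \<Longrightarrow> \<gamma> t \<in> U"
    "\<And>t S. t \<in> S \<Longrightarrow> S \<subseteq> T \<Longrightarrow> S \<subseteq> ball t0 d \<Longrightarrow>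
      ((\<lambda>s. x (\<gamma> s)) has_vector_derivative \<xi> (t, x (\<gamma> t))) (at t within S)"
proof -
  obtain N \<zeta> where N: "openin M N" "\<gamma> t0 \<in> N" "N \<subseteq> U" "\<zeta> \<in> smooth_vector_functions" "\<And>q. q \<in> N \<Longrightarrow> \<zeta> q = x q"
    using local_coordinates[OF assms(3,4)] by blast
  obtain d where d: "d > 0" "\<And>t. t \<in> T \<Longrightarrow> \<bar>t - t0\<bar> < d \<Longrightarrow> \<gamma> t \<in> N"
    using integral_curve_near[OF assms(1,2) N(1,2)] by blast
  show ?thesis
  proof (rule that[OF d(1)])
    show "\<gamma> t \<in> U" if "t \<in> T" "\<bar>t - t0\<bar> < d" for t using d(2)[OF that] N(3) by blast
    fix t S assume t: "t \<in> S" and S: "S \<subseteq> T" "S \<subseteq> ball t0 d"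
    have inN: "\<gamma> s \<in> N" if "s \<in> S" for s using d(2)[of s] subsetD[OF S(1) that] subsetD[OF S(2) that] by (simp add: dist_real_def abs_minus_commute)
    have "((\<lambda>s. \<zeta> (\<gamma> s) \<bullet> b) has_vector_derivative \<xi> (t, x (\<gamma> t)) \<bullet> b) (at t within S)" for b
    proof -
      have c: "X t (\<gamma> t) (\<lambda>q. \<zeta> q \<bullet> b) = \<xi> (t, x (\<gamma> t)) \<bullet> b"
        using coord_vector_coordinate[OF assms(3) subsetD[OF N(3) inN[OF t]] N(1) inN[OF t] N(3) smooth_vector_functionsD[OF N(4)] N(5),
            where c = b and v = "\<xi> (t, x (\<gamma> t))"] \<xi>[OF subsetD[OF S(1) t] subsetD[OF N(3) inN[OF t]]] by simp
      show ?thesis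
        using DERIV_subset[OF integral_curve_deriv[OF assms(1) subsetD[OF S(1) t] smooth_vector_functionsD[OF N(4), of b]] S(1)]
        unfolding c by (simp add: has_real_derivative_iff_has_vector_derivative)
    qed
    then have d: "((\<lambda>s. \<zeta> (\<gamma> s)) has_vector_derivative \<xi> (t, x (\<gamma> t))) (at t within S)"
      unfolding has_vector_derivative_def
      by (subst has_derivative_componentwise_within) (auto simp: inner_scaleR_left)
    show "((\<lambda>s. x (\<gamma> s)) has_vector_derivative \<xi> (t, x (\<gamma> t))) (at t within S)"
      by (rule has_vector_derivative_transform[OF t _ d]) (use inN N(5) in auto)
  qed
qed

lemma integral_curve_from_chart:
  assumes "(U, x) \<in> \<A>" "\<And>t. t \<in> T \<Longrightarrow> c t \<in> x ` U"
    and "\<And>t. t \<in> T \<Longrightarrow> (c has_vector_derivative \<xi> (t, c t)) (at t within T)"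
    and \<xi>: "\<And>t p. t \<in> T \<Longrightarrow> p \<in> U \<Longrightarrow> X t p = coord_vector (U, x) p (\<xi> (t, x p))"
  shows "integral_curve T X (\<lambda>t. inv_into U x (c t))"
  unfolding integral_curve_def
proof (intro ballI conjI)
  fix t assume t: "t \<in> T"
  have p: "inv_into U x (c t) \<in> U" "x (inv_into U x (c t)) = c t"
    using assms(1,2) t chart_inv_into by auto
  then show "inv_into U x (c t) \<in> topspace M" using chart_subset[OF assms(1)] by blast
  fix f assume f: "f \<in> smooth_functions"
  have "((\<lambda>q. f (inv_into U x q)) has_derivative (\<lambda>v. coord_vector (U, x) (inv_into U x (c t)) v f)) (at (c t))"
    using coord_vector_has_derivative[OF assms(1) p(1) f] p(2) by simp
  from has_derivative_compose[OF assms(3)[OF t, unfolded has_vector_derivative_def] this]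
  have "((\<lambda>s. f (inv_into U x (c s))) has_derivative
      (\<lambda>h. coord_vector (U, x) (inv_into U x (c t)) (h *\<^sub>R \<xi> (t, c t)) f)) (at t within T)" .
  moreover have "coord_vector (U, x) (inv_into U x (c t)) (h *\<^sub>R \<xi> (t, c t)) f = X t (inv_into U x (c t)) f * h" for h
    using coord_vector_linear[OF assms(1) p(1), of h "\<xi> (t, c t)" 0 0] \<xi>[OF t p(1)] p(2)
    by (simp add: fun_eq_iff mult.commute)
  ultimately show "((\<lambda>s. f (inv_into U x (c s))) has_real_derivative X t (inv_into U x (c t)) f) (at t within T)"
    by (simp add: has_field_derivative_def)
qed

text \<open>The coefficient of \<open>X\<close> is Lipschitz near the point, and over a time span
  \<open>d\<close> with \<open>d * L \<le> 1/2\<close> every bound for the difference of the two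
  curves can be halved.\<close>

lemma integral_curve_unique_local:
  assumes "open J" "smooth_field J X" "T \<subseteq> J" "is_interval T"
    and \<gamma>: "integral_curve T X \<gamma>" "integral_curve T X \<delta>" and t0: "t0 \<in> T" "\<gamma> t0 = \<delta> t0"
  obtains d where "d > 0" "\<And>t. t \<in> T \<Longrightarrow> \<bar>t - t0\<bar> < d \<Longrightarrow> \<gamma> t = \<delta> t"
proof -
  have "\<gamma> t0 \<in> topspace M" using integral_curve_in \<gamma>(1) t0(1) .
  then obtain U x where c: "(U, x) \<in> \<A>" "\<gamma> t0 \<in> U" using chart_at by blast
  obtain \<xi> where \<xi>: "smooth_on (J \<times> x ` U) \<xi>" "\<And>t p. t \<in> J \<Longrightarrow> p \<in> U \<Longrightarrow> X t p = coord_vector (U, x) p (\<xi> (t, x p))"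
    using smooth_fieldE[OF assms(2) c(1)] by blast
  have \<xi>T: "\<And>t p. t \<in> T \<Longrightarrow> p \<in> U \<Longrightarrow> X t p = coord_vector (U, x) p (\<xi> (t, x p))" using \<xi>(2) assms(3) by blast
  have z0: "(t0, x (\<gamma> t0)) \<in> J \<times> x ` U" using t0 assms(3) c by blast
  obtain r where r: "r > 0" "cball (t0, x (\<gamma> t0)) r \<subseteq> J \<times> x ` U"
    using open_chart_Times[OF assms(1) c(1)] z0 open_contains_cball by metis
  obtain L where L: "L \<ge> 0"
    "\<And>z w. z \<in> cball (t0, x (\<gamma> t0)) r \<Longrightarrow> norm (frechet_derivative \<xi> (at z) w) \<le> L * norm w"
    using smooth_on_compact_derivative_bound[OF \<xi>(1) compact_cball r(2)] by blast
  note lip = smooth_on_lipschitz_cball[OF \<xi>(1) r(2) L(2)]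
  obtain d1 where d1: "d1 > 0" "\<And>t. t \<in> T \<Longrightarrow> \<bar>t - t0\<bar> < d1 \<Longrightarrow> \<gamma> t \<in> U"
    "\<And>t S. t \<in> S \<Longrightarrow> S \<subseteq> T \<Longrightarrow> S \<subseteq> ball t0 d1 \<Longrightarrow>
      ((\<lambda>s. x (\<gamma> s)) has_vector_derivative \<xi> (t, x (\<gamma> t))) (at t within S)"
    using integral_curve_coordinates[OF \<gamma>(1) t0(1) c \<xi>T] by blast
  obtain d2 where d2: "d2 > 0" "\<And>t. t \<in> T \<Longrightarrow> \<bar>t - t0\<bar> < d2 \<Longrightarrow> \<delta> t \<in> U"
    "\<And>t S. t \<in> S \<Longrightarrow> S \<subseteq> T \<Longrightarrow> S \<subseteq> ball t0 d2 \<Longrightarrow>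
      ((\<lambda>s. x (\<delta> s)) has_vector_derivative \<xi> (t, x (\<delta> t))) (at t within S)"
    using integral_curve_coordinates[OF \<gamma>(2) t0(1) c(1) _ \<xi>T] c(2) t0(2) by metis
  have near: "openin M {p \<in> U. x p \<in> ball (x (\<gamma> t0)) (r/2)}" by (rule chart_open_vimage[OF c(1) open_ball])
  obtain d3 where d3: "d3 > 0" "\<And>t. t \<in> T \<Longrightarrow> \<bar>t - t0\<bar> < d3 \<Longrightarrow> \<gamma> t \<in> {p \<in> U. x p \<in> ball (x (\<gamma> t0)) (r/2)}"
    using integral_curve_near[OF \<gamma>(1) t0(1) near] c(2) r(1) by auto
  obtain d4 where d4: "d4 > 0" "\<And>t. t \<in> T \<Longrightarrow> \<bar>t - t0\<bar> < d4 \<Longrightarrow> \<delta> t \<in> {p \<in> U. x p \<in> ball (x (\<gamma> t0)) (r/2)}"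
    using integral_curve_near[OF \<gamma>(2) t0(1) near] c(2) r(1) t0(2) by auto
  \<comment> \<open>\<open>d1\<close> and \<open>d2\<close> keep the curves in the chart,
    \<open>d3\<close> and \<open>d4\<close> keep them within \<open>r/2\<close> of the starting
    coordinates, and \<open>r/2\<close> limits the change of time, so that time and position
    together stay in the ball of radius \<open>r\<close>. The last entry gives the
    contraction.\<close>
  define d where "d = Min {d1, d2, d3, d4, r/2, 1 / (2 * (L + 1))}"
  have d: "d > 0" "d \<le> d1" "d \<le> d2" "d \<le> d3" "d \<le> d4" "d \<le> r/2" "d \<le> 1 / (2 * (L + 1))"
  proof -
    have "d \<le> y" if "y \<in> {d1, d2, d3, d4, r/2, 1 / (2 * (L + 1))}" for y
      unfolding d_def using that by (intro Min_le) auto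
    then show "d \<le> d1" "d \<le> d2" "d \<le> d3" "d \<le> d4" "d \<le> r/2" "d \<le> 1 / (2 * (L + 1))"
      by blast+
    show "d > 0" unfolding d_def using d1(1) d2(1) d3(1) d4(1) r(1) L(1) by (subst Min_gr_iff) simp_all
  qed
  have dL: "d * L \<le> 1/2"
  proof -
    have "d * L \<le> (1 / (2 * (L + 1))) * L" using L d by (intro mult_right_mono) auto
    also have "\<dots> \<le> 1/2" using L by (simp add: field_simps)
    finally show ?thesis .
  qed
  show ?thesis
  proof (rule that[OF d(1)])
    fix t assume t: "t \<in> T" "\<bar>t - t0\<bar> < d"
    let ?S = "closed_segment t0 t"
    have ST: "?S \<subseteq> T"
      using assms(4) t t0 by (simp add: closed_segment_subset is_interval_convex_1)
    have Sd: "\<bar>s - t0\<bar> < d" if "s \<in> ?S" for s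
      using that t(2) by (auto simp: closed_segment_eq_real_ivl split: if_splits)
    have Sb: "?S \<subseteq> ball t0 d1" "?S \<subseteq> ball t0 d2"
      using Sd d by (force simp: dist_real_def abs_minus_commute)+
    have der: "((\<lambda>s. x (\<gamma> s)) has_vector_derivative \<xi> (s, x (\<gamma> s))) (at s within ?S)"
      "((\<lambda>s. x (\<delta> s)) has_vector_derivative \<xi> (s, x (\<delta> s))) (at s within ?S)" if "s \<in> ?S" for s
      using d1(3)[OF that ST Sb(1)] d2(3)[OF that ST Sb(2)] .
    have "x (\<gamma> t) = x (\<delta> t)"
    proof (rule contraction_unique[of ?S "\<lambda>s. x (\<gamma> s)" "\<lambda>s. x (\<delta> s)"])
      show "continuous_on ?S (\<lambda>s. x (\<gamma> s))" "continuous_on ?S (\<lambda>s. x (\<delta> s))"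
        using has_vector_derivative_continuous[OF der(1)] has_vector_derivative_continuous[OF der(2)]
        by (auto simp: continuous_on_eq_continuous_within)
      fix e assume e: "\<forall>s\<in>?S. norm (x (\<gamma> s) - x (\<delta> s)) \<le> e"
      have "e \<ge> 0" using bspec[OF e, of t] norm_ge_zero order_trans by (metis ends_in_segment(2))
      show "\<forall>s\<in>?S. norm (x (\<gamma> s) - x (\<delta> s)) \<le> e / 2"
      proof
        fix s assume s: "s \<in> ?S"
        have "norm ((x (\<gamma> s) - x (\<delta> s)) - (x (\<gamma> t0) - x (\<delta> t0))) \<le> (L * e) * \<bar>s - t0\<bar>"
        proof (rule vector_derivative_bound[of ?S _ "\<lambda>s. \<xi> (s, x (\<gamma> s)) - \<xi> (s, x (\<delta> s))"])
          fix s assume s: "s \<in> ?S"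
          show "((\<lambda>s. x (\<gamma> s) - x (\<delta> s)) has_vector_derivative \<xi> (s, x (\<gamma> s)) - \<xi> (s, x (\<delta> s))) (at s within ?S)"
            by (intro has_vector_derivative_diff der s)
          have b: "(s, x p) \<in> cball (t0, x (\<gamma> t0)) r" if "x p \<in> ball (x (\<gamma> t0)) (r/2)" for p
          proof -
            have "dist (t0, x (\<gamma> t0)) (s, x p) \<le> dist t0 s + dist (x (\<gamma> t0)) (x p)"
              unfolding dist_prod_def by (rule sqrt_add_le_add_sqrt[THEN order_trans]) (simp_all add: dist_real_def)
            also have "\<dots> \<le> r/2 + r/2"
              using that Sd[OF s] d by (intro add_mono) (auto simp: dist_real_def abs_minus_commute)
            finally show ?thesis by simp
          qed
          have "\<bar>s - t0\<bar> < d3" "\<bar>s - t0\<bar> < d4" "s \<in> T" using Sd[OF s] d s ST by auto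
          then have "norm (\<xi> (s, x (\<gamma> s)) - \<xi> (s, x (\<delta> s))) \<le> L * norm ((s, x (\<gamma> s)) - (s, x (\<delta> s)))"
            by (intro lip b) (use d3(2)[of s] d4(2)[of s] in auto)
          also have "\<dots> \<le> L * e" using e s L(1) by (intro mult_left_mono) (auto simp: norm_Pair)
          finally show "norm (\<xi> (s, x (\<gamma> s)) - \<xi> (s, x (\<delta> s))) \<le> L * e" .
        qed (use s in auto)
        also have "\<dots> \<le> (L * e) * d" using Sd[OF s] L \<open>e \<ge> 0\<close> by (intro mult_left_mono) auto
        also have "\<dots> \<le> (1/2) * e" using mult_right_mono[OF dL \<open>e \<ge> 0\<close>] by (simp add: algebra_simps)
        finally show "norm (x (\<gamma> s) - x (\<delta> s)) \<le> e / 2" using t0(2) by simp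
      qed
    qed auto
    moreover have "\<gamma> t \<in> U" "\<delta> t \<in> U" using d1(2) d2(2) t d by auto
    ultimately show "\<gamma> t = \<delta> t" using chart_inj[OF c(1)] by (auto dest: inj_onD)
  qed
qed

text \<open>Agreement of the curves is locally constant in time: it spreads by local uniqueness, and
  disagreement spreads because distinct points have disjoint neighbourhoods. Connectedness of the
  interval does the rest.\<close>

lemma integral_curve_unique:
  assumes "open J" "smooth_field J X" "T \<subseteq> J" "is_interval T"
    and \<gamma>: "integral_curve T X \<gamma>" "integral_curve T X \<delta>" and "t0 \<in> T" "\<gamma> t0 = \<delta> t0" "t \<in> T"
  shows "\<gamma> t = \<delta> t"
proof (rule connected_induction_simple[of T t0 t "\<lambda>t. \<gamma> t = \<delta> t"])
  show "connected T" using assms(4) by (simp add: is_interval_connected_1)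
  fix a assume a: "a \<in> T"
  have "\<exists>d>0. \<forall>s\<in>T. \<bar>s - a\<bar> < d \<longrightarrow> (\<gamma> s = \<delta> s \<longleftrightarrow> \<gamma> a = \<delta> a)"
  proof (cases "\<gamma> a = \<delta> a")
    case True
    then show ?thesis using integral_curve_unique_local[OF assms(1-4) \<gamma> a] by metis
  next
    case False
    obtain V W where VW: "openin M V" "openin M W" "\<gamma> a \<in> V" "\<delta> a \<in> W" "disjnt V W"
      using Hausdorff False integral_curve_in[OF \<gamma>(1) a] integral_curve_in[OF \<gamma>(2) a]
      unfolding Hausdorff_space_def by metis
    obtain d where d: "d > 0" "\<And>t. t \<in> T \<Longrightarrow> \<bar>t - a\<bar> < d \<Longrightarrow> \<gamma> t \<in> V"
      using integral_curve_near[OF \<gamma>(1) a VW(1,3)] by blast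
    obtain e where e: "e > 0" "\<And>t. t \<in> T \<Longrightarrow> \<bar>t - a\<bar> < e \<Longrightarrow> \<delta> t \<in> W"
      using integral_curve_near[OF \<gamma>(2) a VW(2,4)] by blast
    have "\<gamma> s \<noteq> \<delta> s" if "s \<in> T" "\<bar>s - a\<bar> < d" "\<bar>s - a\<bar> < e" for s
      using d(2)[OF that(1,2)] e(2)[OF that(1,3)] VW(5) unfolding disjnt_iff by metis
    then show ?thesis
      using d(1) e(1) False by (intro exI[of _ "min d e"]) auto
  qed
  then obtain d where d: "d > 0" "\<And>s. s \<in> T \<Longrightarrow> \<bar>s - a\<bar> < d \<Longrightarrow> (\<gamma> s = \<delta> s \<longleftrightarrow> \<gamma> a = \<delta> a)" by blast
  have "openin (top_of_set T) (T \<inter> ball a d)" by (simp add: openin_open_Int)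
  moreover have "a \<in> T \<inter> ball a d" using a d by simp
  moreover have "\<forall>s\<in>T \<inter> ball a d. \<forall>s'\<in>T \<inter> ball a d. \<gamma> s = \<delta> s \<longrightarrow> \<gamma> s' = \<delta> s'"
    using d(2) by (auto simp: dist_real_def abs_minus_commute)
  ultimately show "\<exists>S. openin (top_of_set T) S \<and> a \<in> S \<and> (\<forall>s\<in>S. \<forall>s'\<in>S. \<gamma> s = \<delta> s \<longrightarrow> \<gamma> s' = \<delta> s')"
    by blast
qed (use assms in auto)

text \<open>Time is adjoined as a coordinate: the field \<open>(1, \<xi>)\<close> on the product of
  \<open>J\<close> with the chart image is autonomous, so \<open>local_flow_exists\<close> applies.
  Its starting points \<open>(s, x p)\<close> provide smooth dependence on the initial time as
  well.\<close>

lemma integral_curve_local: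
  assumes "open J" "smooth_field J X" "t0 \<in> J" "p0 \<in> topspace M"
  obtains \<epsilon> N \<Psi> where "\<epsilon> > 0" "{t0 - \<epsilon><..<t0 + \<epsilon>} \<subseteq> J" "openin M N" "p0 \<in> N"
    "\<And>s p. s \<in> {t0 - \<epsilon><..<t0 + \<epsilon>} \<Longrightarrow> p \<in> N \<Longrightarrow> integral_curve {t0 - \<epsilon><..<t0 + \<epsilon>} X (\<lambda>t. \<Psi> t s p) \<and> \<Psi> s s p = p"
    "\<And>V y. (V, y) \<in> \<A> \<Longrightarrow> smooth_into ({t0 - \<epsilon><..<t0 + \<epsilon>} \<times> {t0 - \<epsilon><..<t0 + \<epsilon>} \<times> y ` (V \<inter> N))
        (\<lambda>(t, s, q). \<Psi> t s (inv_into V y q))"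
proof -
  obtain U x where c: "(U, x) \<in> \<A>" "p0 \<in> U" using chart_at[OF assms(4)] .
  obtain \<xi> where \<xi>: "smooth_on (J \<times> x ` U) \<xi>" "\<And>t p. t \<in> J \<Longrightarrow> p \<in> U \<Longrightarrow> X t p = coord_vector (U, x) p (\<xi> (t, x p))"
    using smooth_fieldE[OF assms(2) c(1)] by blast
  let ?S = "J \<times> x ` U" and ?z0 = "(t0, x p0)"
  have oS: "open ?S" by (rule open_chart_Times[OF assms(1) c(1)])
  have z0: "?z0 \<in> ?S" using assms(3) c(2) by blast
  have sX: "smooth_on ?S (\<lambda>z. (1::real, \<xi> z))" by (intro smooth_on_Pair smooth_on_const oS \<xi>(1))
  obtain \<epsilon> \<delta> \<Phi> where \<Phi>: "\<epsilon> > (0::real)" "\<delta> > 0" "\<And>z. z \<in> ball ?z0 \<delta> \<Longrightarrow> \<Phi> (0, z) = z"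
    "\<And>t z. t \<in> {-\<epsilon><..<\<epsilon>} \<Longrightarrow> z \<in> ball ?z0 \<delta> \<Longrightarrow> \<Phi> (t, z) \<in> ?S"
    "\<And>t z. t \<in> {-\<epsilon><..<\<epsilon>} \<Longrightarrow> z \<in> ball ?z0 \<delta> \<Longrightarrow>
      ((\<lambda>t. \<Phi> (t, z)) has_vector_derivative (1, \<xi> (\<Phi> (t, z)))) (at t)"
    "smooth_on ({-\<epsilon><..<\<epsilon>} \<times> ball ?z0 \<delta>) \<Phi>"
    using local_flow_exists[OF oS sX z0] by blast
  obtain e where e: "e > 0" "ball t0 e \<subseteq> J" using assms(1,3) open_contains_ball by blast
  \<comment> \<open>Half of \<open>\<epsilon>\<close>, since the local flow is run for the
    difference of two times of the interval; half of \<open>\<delta>\<close>, since a starting point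
    combines a time with a position.\<close>
  define \<eta> where "\<eta> = Min {\<epsilon>/2, \<delta>/2, e}"
  have \<eta>: "\<eta> > 0" "\<eta> \<le> \<epsilon>/2" "\<eta> \<le> \<delta>/2" "\<eta> \<le> e" using \<Phi>(1,2) e by (auto simp: \<eta>_def)
  let ?I = "{t0 - \<eta><..<t0 + \<eta>}"
  define N where "N = {p \<in> U. x p \<in> ball (x p0) (\<delta>/2)}"
  have N: "openin M N" "p0 \<in> N"
    unfolding N_def by (rule chart_open_vimage[OF c(1) open_ball]) (use c(2) \<Phi>(2) in auto)
  have ball: "(s, x p) \<in> ball ?z0 \<delta>" if "s \<in> ?I" "p \<in> N" for s p
  proof -
    have "dist (t0, x p0) (s, x p) \<le> dist t0 s + dist (x p0) (x p)"
      unfolding dist_prod_def by (rule sqrt_add_le_add_sqrt[THEN order_trans]) (simp_all add: dist_real_def)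
    also have "\<dots> < \<delta>/2 + \<delta>/2"
      using that \<eta> by (intro add_strict_mono) (auto simp: dist_real_def N_def abs_if)
    finally show ?thesis by simp
  qed
  have diff: "t - s \<in> {-\<epsilon><..<\<epsilon>}" if "t \<in> ?I" "s \<in> ?I" for t s using that \<eta> by auto
  have IJ: "?I \<subseteq> J" using e \<eta> by (auto simp: dist_real_def subset_iff)
  have der: "((\<lambda>t. \<Phi> (t - s, s, x p)) has_vector_derivative (1, \<xi> (\<Phi> (t - s, s, x p)))) (at t within ?I)"
    if "t \<in> ?I" "s \<in> ?I" "p \<in> N" for t s p
  proof -
    have "((\<lambda>t. t - s) has_vector_derivative 1) (at t)" by (auto intro!: derivative_eq_intros)
    from vector_diff_chain_at[OF this \<Phi>(5)[OF diff[OF that(1,2)] ball[OF that(2,3)]]]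
    show ?thesis by (auto simp: o_def intro: has_vector_derivative_at_within)
  qed
  \<comment> \<open>The adjoined coordinate moves with unit speed and so equals the true time; hence
    the remaining component solves the time-dependent equation.\<close>
  have fst: "fst (\<Phi> (t - s, s, x p)) = t" if "t \<in> ?I" "s \<in> ?I" "p \<in> N" for t s p
  proof -
    have "norm ((fst (\<Phi> (t - s, s, x p)) - t) - (fst (\<Phi> (s - s, s, x p)) - s)) \<le> 0 * \<bar>t - s\<bar>"
    proof (rule vector_derivative_bound[of ?I _ "\<lambda>_. 0"])
      fix t assume t: "t \<in> ?I"
      have "((\<lambda>t. fst (\<Phi> (t - s, s, x p)) - t) has_vector_derivative 1 - 1) (at t within ?I)"
        using bounded_linear.has_vector_derivative[OF bounded_linear_fst der[OF t that(2,3)]]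
        by (intro has_vector_derivative_diff has_vector_derivative_id) simp
      then show "((\<lambda>t. fst (\<Phi> (t - s, s, x p)) - t) has_vector_derivative 0) (at t within ?I)" by simp
    qed (use that in auto)
    then show ?thesis using \<Phi>(3)[OF ball[OF that(2,3)]] by simp
  qed
  define \<Psi> where "\<Psi> t s p = inv_into U x (snd (\<Phi> (t - s, s, x p)))" for t s p
  show ?thesis
  proof (rule that[OF \<eta>(1) IJ N])
    fix s p assume sp: "s \<in> ?I" "p \<in> N"
    have "integral_curve ?I X (\<lambda>t. inv_into U x (snd (\<Phi> (t - s, s, x p))))"
    proof (rule integral_curve_from_chart[OF c(1)])
      fix t assume t: "t \<in> ?I"
      show "snd (\<Phi> (t - s, s, x p)) \<in> x ` U" using \<Phi>(4)[OF diff[OF t sp(1)] ball[OF sp]] by auto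
      have "(t, snd (\<Phi> (t - s, s, x p))) = \<Phi> (t - s, s, x p)" using fst[OF t sp] by (metis prod.collapse)
      then show "((\<lambda>t. snd (\<Phi> (t - s, s, x p))) has_vector_derivative \<xi> (t, snd (\<Phi> (t - s, s, x p)))) (at t within ?I)"
        using bounded_linear.has_vector_derivative[OF bounded_linear_snd der[OF t sp]] by simp
      show "X t p = coord_vector (U, x) p (\<xi> (t, x p))" if "p \<in> U" for p using \<xi>(2) t IJ that by blast
    qed
    then show "integral_curve ?I X (\<lambda>t. \<Psi> t s p) \<and> \<Psi> s s p = p"
      using \<Phi>(3)[OF ball[OF sp]] sp(2) c(1) by (simp add: \<Psi>_def N_def)
  next
    fix V y assume V: "(V, y) \<in> \<A>"
    let ?Z = "?I \<times> ?I \<times> y ` (V \<inter> N)"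
    have oVN: "open (y ` (V \<inter> N))" by (rule chart_open_image[OF V N(1)])
    have oZ: "open ?Z" by (intro open_Times oVN) auto
    have inN: "inv_into V y q \<in> N" "inv_into V y q \<in> V" "q \<in> y ` (V \<inter> U)" if "q \<in> y ` (V \<inter> N)" for q
      using that V by (auto simp: N_def)
    have "smooth_on ?Z (\<lambda>z. (x \<circ> inv_into V y) (snd (snd z)))"
      by (rule smooth_on_compose[OF charts_compatible[OF V c(1)] smooth_on_snd[OF oZ smooth_on_snd[OF oZ smooth_on_id[OF oZ]]] oZ
            chart_open_image[OF V chart_domain[OF c(1)]]]) (use inN in auto)
    then have "smooth_on ?Z (\<lambda>z. (fst z - fst (snd z), fst (snd z), x (inv_into V y (snd (snd z)))))"
      by (intro smooth_on_Pair smooth_on_diff smooth_on_fst smooth_on_snd smooth_on_id oZ) (simp add: o_def)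
    then have s1: "smooth_on ?Z (\<lambda>z. \<Phi> (fst z - fst (snd z), fst (snd z), x (inv_into V y (snd (snd z)))))"
      by (rule smooth_on_compose[OF \<Phi>(6) _ oZ]) (use diff ball inN in \<open>auto intro!: open_Times\<close>)
    have in_xU: "snd (\<Phi> (t - s, s, x p)) \<in> x ` U" if "t \<in> ?I" "s \<in> ?I" "p \<in> N" for t s p
      using \<Phi>(4)[OF diff[OF that(1,2)] ball[OF that(2,3)]] by auto
    show "smooth_into ?Z (\<lambda>(t, s, q). \<Psi> t s (inv_into V y q))"
      unfolding smooth_into_def
    proof (intro conjI ballI)
      show "(\<lambda>(t, s, q). \<Psi> t s (inv_into V y q)) ` ?Z \<subseteq> topspace M"
        using in_xU inN chart_inv_into[OF c(1)] chart_subset[OF c(1)] by (fastforce simp: \<Psi>_def)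
      fix f assume f: "f \<in> smooth_functions"
      have "smooth_on ?Z (\<lambda>z. f (inv_into U x (snd (\<Phi> (fst z - fst (snd z), fst (snd z), x (inv_into V y (snd (snd z))))))))"
        by (rule smooth_on_compose[OF smooth_functionsD[OF f c(1)] smooth_on_snd[OF oZ s1] oZ chart_codomain[OF c(1)]])
          (use in_xU inN in auto)
      then show "smooth_on ?Z (\<lambda>z. f (case z of (t, s, q) \<Rightarrow> \<Psi> t s (inv_into V y q)))"
        by (simp add: \<Psi>_def case_prod_unfold)
    qed
  qed
qed

section \<open>Two-time flows on intervals\<close>

definition flow :: "real set \<Rightarrow> (real \<Rightarrow> 'a \<Rightarrow> ('a \<Rightarrow> real) \<Rightarrow> real) \<Rightarrow> real \<Rightarrow> real \<Rightarrow> 'a \<Rightarrow> 'a" where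
  "flow I X t s p = (SOME \<gamma>. integral_curve I X \<gamma> \<and> \<gamma> s = p) t"

text \<open>Smoothness is required jointly in final time, initial time and point. It is the initial
  time that varies when a test function is transported backwards along the flow.\<close>

definition complete_flow :: "real set \<Rightarrow> (real \<Rightarrow> 'a \<Rightarrow> ('a \<Rightarrow> real) \<Rightarrow> real) \<Rightarrow> bool" where
  "complete_flow I X \<longleftrightarrow> (\<forall>s\<in>I. \<forall>p\<in>topspace M. \<exists>\<gamma>. integral_curve I X \<gamma> \<and> \<gamma> s = p) \<and>
    (\<forall>(V, y)\<in>\<A>. smooth_into (I \<times> I \<times> y ` V) (\<lambda>(t, s, q). flow I X t s (inv_into V y q)))"

lemma flow_integral_curve:
  assumes "complete_flow I X" "s \<in> I" "p \<in> topspace M"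
  shows "integral_curve I X (\<lambda>t. flow I X t s p)" "flow I X s s p = p"
proof -
  have "\<exists>\<gamma>. integral_curve I X \<gamma> \<and> \<gamma> s = p" using assms unfolding complete_flow_def by blast
  from someI_ex[OF this] show "integral_curve I X (\<lambda>t. flow I X t s p)" "flow I X s s p = p"
    unfolding flow_def by auto
qed

lemma flow_in: "complete_flow I X \<Longrightarrow> t \<in> I \<Longrightarrow> s \<in> I \<Longrightarrow> p \<in> topspace M \<Longrightarrow> flow I X t s p \<in> topspace M"
  using flow_integral_curve integral_curve_in by blast

lemma flow_eq:
  assumes "open J" "smooth_field J X" "I \<subseteq> J" "complete_flow I X"
    and "T \<subseteq> I" "is_interval T" "integral_curve T X \<gamma>" "s \<in> T" "t \<in> T"
  shows "flow I X t s (\<gamma> s) = \<gamma> t"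
proof -
  have s: "s \<in> I" "\<gamma> s \<in> topspace M" using assms integral_curve_in by auto
  have "integral_curve T X (\<lambda>t. flow I X t s (\<gamma> s))"
    by (rule integral_curve_subset[OF flow_integral_curve(1)[OF assms(4) s] assms(5)])
  from integral_curve_unique[OF assms(1,2) _ assms(6) this assms(7,8) _ assms(9)]
  show ?thesis using flow_integral_curve(2)[OF assms(4) s] assms(3,5) by auto
qed

lemma flow_flow:
  assumes "open J" "smooth_field J X" "I \<subseteq> J" "is_interval I" "complete_flow I X"
    and "t \<in> I" "r \<in> I" "s \<in> I" "p \<in> topspace M"
  shows "flow I X t r (flow I X r s p) = flow I X t s p"
  using flow_eq[OF assms(1-3,5) order_refl assms(4) flow_integral_curve(1)[OF assms(5,8,9)] assms(7,6)] .


lemma smooth_into_subset: "smooth_into Z g \<Longrightarrow> Y \<subseteq> Z \<Longrightarrow> smooth_into Y g"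
  unfolding smooth_into_def by (meson image_mono order_trans smooth_on_subset)

lemma smooth_into_cong:
  assumes "open Z" "\<And>z. z \<in> Z \<Longrightarrow> g z = h z" "smooth_into Z g"
  shows "smooth_into Z h"
proof -
  have "smooth_on Z (\<lambda>z. f (g z)) \<longleftrightarrow> smooth_on Z (\<lambda>z. f (h z))" for f :: "'a \<Rightarrow> real"
    by (rule smooth_on_cong[OF assms(1)]) (simp add: assms(2))
  then show ?thesis using assms(2,3) by (auto simp: smooth_into_def)
qed

lemma smooth_into_local:
  assumes "\<And>z. z \<in> Z \<Longrightarrow> \<exists>T. open T \<and> z \<in> T \<and> smooth_into T g"
  shows "smooth_into Z g"
  unfolding smooth_into_def
proof (intro conjI ballI)
  show "g ` Z \<subseteq> topspace M" using assms unfolding smooth_into_def by blast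
  show "smooth_on Z (\<lambda>z. f (g z))" if "f \<in> smooth_functions" for f
    by (rule smooth_on_local) (use assms that in \<open>unfold smooth_into_def, blast\<close>)
qed

lemma smooth_into_compose:
  assumes "smooth_into Z g" "open Z" "open Y" "smooth_on Y h" "h ` Y \<subseteq> Z"
  shows "smooth_into Y (\<lambda>y. g (h y))"
  unfolding smooth_into_def
proof (intro conjI ballI)
  show "(\<lambda>y. g (h y)) ` Y \<subseteq> topspace M" using assms(1,5) unfolding smooth_into_def by blast
  fix f assume f: "f \<in> smooth_functions"
  have "smooth_on Z (\<lambda>z. f (g z))" using assms(1) f unfolding smooth_into_def by blast
  from smooth_on_compose[OF this assms(4,3,2,5)] show "smooth_on Y (\<lambda>y. f (g (h y)))" .
qed

lemma flow_smooth_into: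
  assumes "complete_flow I X" "(V, y) \<in> \<A>"
  shows "smooth_into (I \<times> I \<times> y ` V) (\<lambda>(t, s, q). flow I X t s (inv_into V y q))"
  using assms unfolding complete_flow_def by blast

text \<open>Motion from \<open>s\<close> to \<open>t\<close> is split at the common time
  \<open>r\<close>: \<open>\<psi>\<close> leads from \<open>s\<close> to \<open>r\<close>,
  \<open>\<phi>\<close> from \<open>r\<close> to \<open>t\<close>. Each is patched from the two
  given flows, which agree on the overlap by uniqueness of integral curves, so the composite is
  smooth on the whole union.\<close>

lemma complete_flow_Un:
  assumes J: "open J" "smooth_field J X"
    and I1: "open I1" "is_interval I1" "I1 \<subseteq> J" "complete_flow I1 X"
    and I2: "open I2" "is_interval I2" "I2 \<subseteq> J" "complete_flow I2 X"
    and r: "r \<in> I1" "r \<in> I2"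
  shows "complete_flow (I1 \<union> I2) X"
proof -
  let ?I = "I1 \<union> I2"
  have int: "is_interval ?I"
    using I1 I2 r unfolding is_interval_connected_1 by (intro connected_Un) auto
  have IJ: "?I \<subseteq> J" using I1 I2 by blast
  define \<phi> where "\<phi> t = (if t \<in> I1 then flow I1 X t else flow I2 X t)" for t
  have \<phi>_in: "\<phi> t r p \<in> topspace M" if "t \<in> ?I" "p \<in> topspace M" for t p
    using flow_in[OF I1(4)] flow_in[OF I2(4)] r that by (auto simp: \<phi>_def)
  have agree: "flow I1 X t r p = flow I2 X t r p" if "t \<in> I1" "t \<in> I2" "p \<in> topspace M" for t p
  proof -
    have "integral_curve (I1 \<inter> I2) X (\<lambda>t. flow I1 X t r p)"
      by (rule integral_curve_subset[OF flow_integral_curve(1)[OF I1(4) r(1) that(3)]]) auto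
    from flow_eq[OF J I2(3,4) _ is_interval_Int[OF I1(2) I2(2)] this, of r t]
    show ?thesis using r that flow_integral_curve(2)[OF I1(4) r(1) that(3)] by auto
  qed
  have \<phi>2: "\<phi> t r p = flow I2 X t r p" if "t \<in> I2" "p \<in> topspace M" for t p
    using agree that by (auto simp: \<phi>_def)
  have curve_r: "integral_curve ?I X (\<lambda>t. \<phi> t r p)" if p: "p \<in> topspace M" for p
    unfolding integral_curve_def
  proof (intro ballI conjI)
    fix t assume t: "t \<in> ?I"
    show "\<phi> t r p \<in> topspace M" by (rule \<phi>_in[OF t p])
    fix f assume f: "f \<in> smooth_functions"
    have "((\<lambda>s. f (\<phi> s r p)) has_real_derivative X t (\<phi> t r p) f) (at t)"
    proof (cases "t \<in> I1")
      case True
      have "((\<lambda>s. f (flow I1 X s r p)) has_real_derivative X t (flow I1 X t r p) f) (at t)"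
        using integral_curve_deriv[OF flow_integral_curve(1)[OF I1(4) r(1) p] True f]
        by (simp add: at_within_open[OF True I1(1)])
      then show ?thesis
        using has_field_derivative_transform_within_open[OF _ I1(1) True, of "\<lambda>s. f (flow I1 X s r p)" _ "\<lambda>s. f (\<phi> s r p)"] True
        by (simp add: \<phi>_def)
    next
      case False
      then have t2: "t \<in> I2" using t by blast
      have "((\<lambda>s. f (flow I2 X s r p)) has_real_derivative X t (flow I2 X t r p) f) (at t)"
        using integral_curve_deriv[OF flow_integral_curve(1)[OF I2(4) r(2) p] t2 f]
        by (simp add: at_within_open[OF t2 I2(1)])
      then show ?thesis
        using has_field_derivative_transform_within_open[OF _ I2(1) t2, of "\<lambda>s. f (flow I2 X s r p)" _ "\<lambda>s. f (\<phi> s r p)"]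
          \<phi>2[OF _ p] t2 by simp
    qed
    then show "((\<lambda>s. f (\<phi> s r p)) has_real_derivative X t (\<phi> t r p) f) (at t within ?I)"
      by (rule has_field_derivative_at_within)
  qed
  define \<psi> where "\<psi> s = (if s \<in> I1 then flow I1 X r s else flow I2 X r s)" for s
  have \<psi>_in: "\<psi> s p \<in> topspace M" if "s \<in> ?I" "p \<in> topspace M" for s p
    using flow_in[OF I1(4)] flow_in[OF I2(4)] r that by (auto simp: \<psi>_def)
  have \<phi>\<psi>: "\<phi> s r (\<psi> s p) = p" if s: "s \<in> ?I" and p: "p \<in> topspace M" for s p
  proof (cases "s \<in> I1")
    case True
    then show ?thesis
      using flow_flow[OF J I1(3,2,4) True r(1) True p] flow_integral_curve(2)[OF I1(4) True p]
      by (simp add: \<phi>_def \<psi>_def)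
  next
    case False
    then have s2: "s \<in> I2" using s by blast
    then show ?thesis
      using False flow_flow[OF J I2(3,2,4) s2 r(2) s2 p] flow_integral_curve(2)[OF I2(4) s2 p]
      by (simp add: \<phi>_def \<psi>_def)
  qed
  have ex: "\<exists>\<gamma>. integral_curve ?I X \<gamma> \<and> \<gamma> s = p" if "s \<in> ?I" "p \<in> topspace M" for s p
    using curve_r[OF \<psi>_in[OF that]] \<phi>\<psi>[OF that] by blast
  have fl: "flow ?I X t s p = \<phi> t r (\<psi> s p)" if "t \<in> ?I" "s \<in> ?I" "p \<in> topspace M" for t s p
  proof -
    have "integral_curve ?I X (\<lambda>t. flow ?I X t s p) \<and> flow ?I X s s p = p"
      using someI_ex[OF ex[OF that(2,3)]] unfolding flow_def by auto
    then show ?thesis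
      using integral_curve_unique[OF J IJ int _ curve_r[OF \<psi>_in[OF that(2,3)]] that(2) _ that(1)] \<phi>\<psi>[OF that(2,3)] by metis
  qed
  have \<phi>_fam: "smooth_family ?I (\<lambda>t p. f (\<phi> t r p))" if f: "f \<in> smooth_functions" for f
  proof (rule smooth_familyI)
    fix V y assume V: "(V, y) \<in> \<A>"
    have fam: "smooth_on (I \<times> y ` V) (\<lambda>(t, q). f (\<phi> t r (inv_into V y q)))"
      if I: "open I" "complete_flow I X" "r \<in> I" "\<And>t p. t \<in> I \<Longrightarrow> p \<in> topspace M \<Longrightarrow> \<phi> t r p = flow I X t r p" for I
    proof -
      have o: "open (I \<times> y ` V)" by (rule open_chart_Times[OF I(1) V])
      have o3: "open (I \<times> I \<times> y ` V)" by (intro open_Times I(1) chart_codomain[OF V])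
      have "smooth_into (I \<times> y ` V) (\<lambda>z. case (fst z, r, snd z) of (t, s, q) \<Rightarrow> flow I X t s (inv_into V y q))"
        by (rule smooth_into_compose[OF flow_smooth_into[OF I(2) V] o3 o])
          (use I(3) o in \<open>auto intro!: smooth_on_intros\<close>)
      then have "smooth_on (I \<times> y ` V) (\<lambda>z. f (case (fst z, r, snd z) of (t, s, q) \<Rightarrow> flow I X t s (inv_into V y q)))"
        using f unfolding smooth_into_def by blast
      then show ?thesis
        by (rule smooth_on_cong[OF o, THEN iffD1, rotated])
          (use I(4) V chart_inv_into[OF V] chart_subset[OF V] in \<open>force\<close>)
    qed
    show "smooth_on (?I \<times> y ` V) (\<lambda>(t, q). f (\<phi> t r (inv_into V y q)))"
    proof (rule smooth_on_local)
      fix z assume z: "z \<in> ?I \<times> y ` V"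
      have 1: "smooth_on (I1 \<times> y ` V) (\<lambda>(t, q). f (\<phi> t r (inv_into V y q)))"
        by (rule fam[OF I1(1,4) r(1)]) (simp add: \<phi>_def)
      have 2: "smooth_on (I2 \<times> y ` V) (\<lambda>(t, q). f (\<phi> t r (inv_into V y q)))"
        by (rule fam[OF I2(1,4) r(2) \<phi>2])
      show "\<exists>T. open T \<and> z \<in> T \<and> smooth_on T (\<lambda>(t, q). f (\<phi> t r (inv_into V y q)))"
      proof (cases "fst z \<in> I1")
        case True
        then show ?thesis using z 1 open_chart_Times[OF I1(1) V] by (intro exI[of _ "I1 \<times> y ` V"]) auto
      next
        case False
        then show ?thesis using z 2 open_chart_Times[OF I2(1) V] by (intro exI[of _ "I2 \<times> y ` V"]) auto
      qed
    qed
  qed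
  have \<psi>_into: "smooth_into (?I \<times> y ` V) (\<lambda>(s, q). \<psi> s (inv_into V y q))" if V: "(V, y) \<in> \<A>" for V y
  proof -
    have into: "smooth_into (I \<times> y ` V) (\<lambda>(s, q). flow I X r s (inv_into V y q))"
      if I: "open I" "complete_flow I X" "r \<in> I" for I
    proof -
      have o: "open (I \<times> y ` V)" by (rule open_chart_Times[OF I(1) V])
      have o3: "open (I \<times> I \<times> y ` V)" by (intro open_Times I(1) chart_codomain[OF V])
      have "smooth_into (I \<times> y ` V) (\<lambda>z. case (r, fst z, snd z) of (t, s, q) \<Rightarrow> flow I X t s (inv_into V y q))"
        by (rule smooth_into_compose[OF flow_smooth_into[OF I(2) V] o3 o])
          (use I(3) o in \<open>auto intro!: smooth_on_intros\<close>)
      then show ?thesis by (simp add: case_prod_unfold)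
    qed
    have agree\<psi>: "flow I1 X r s p = flow I2 X r s p" if s: "s \<in> I1" "s \<in> I2" and p: "p \<in> topspace M" for s p
    proof -
      have "integral_curve (I1 \<inter> I2) X (\<lambda>t. flow I1 X t s p)"
        by (rule integral_curve_subset[OF flow_integral_curve(1)[OF I1(4) s(1) p]]) auto
      from flow_eq[OF J I2(3,4) _ is_interval_Int[OF I1(2) I2(2)] this, of s r]
      show ?thesis using r s flow_integral_curve(2)[OF I1(4) s(1) p] by auto
    qed
    have o1: "open (I1 \<times> y ` V)" and o2: "open (I2 \<times> y ` V)" using open_chart_Times[OF _ V] I1(1) I2(1) by auto
    have 1: "smooth_into (I1 \<times> y ` V) (\<lambda>(s, q). \<psi> s (inv_into V y q))"
      by (rule smooth_into_cong[OF o1 _ into[OF I1(1,4) r(1)]]) (auto simp: \<psi>_def)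
    have 2: "smooth_into (I2 \<times> y ` V) (\<lambda>(s, q). \<psi> s (inv_into V y q))"
      by (rule smooth_into_cong[OF o2 _ into[OF I2(1,4) r(2)]])
        (use agree\<psi> V chart_inv_into[OF V] chart_subset[OF V] in \<open>force simp: \<psi>_def\<close>)
    show ?thesis
    proof (rule smooth_into_local)
      fix z assume z: "z \<in> ?I \<times> y ` V"
      show "\<exists>T. open T \<and> z \<in> T \<and> smooth_into T (\<lambda>(s, q). \<psi> s (inv_into V y q))"
      proof (cases "fst z \<in> I1")
        case True
        then show ?thesis using z 1 o1 by (intro exI[of _ "I1 \<times> y ` V"]) auto
      next
        case False
        then show ?thesis using z 2 o2 by (intro exI[of _ "I2 \<times> y ` V"]) auto
      qed
    qed
  qed
  show ?thesis
    unfolding complete_flow_def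
  proof (intro conjI ballI)
    show "\<exists>\<gamma>. integral_curve ?I X \<gamma> \<and> \<gamma> s = p" if "s \<in> ?I" "p \<in> topspace M" for s p by (rule ex[OF that])
    fix c assume "c \<in> \<A>"
    then obtain V y where V: "c = (V, y)" "(V, y) \<in> \<A>" by (cases c) auto
    let ?Z = "?I \<times> ?I \<times> y ` V"
    have oI: "open ?I" using I1(1) I2(1) by blast
    have oZ: "open ?Z" by (intro open_Times oI chart_codomain[OF V(2)])
    have "smooth_into ?Z (\<lambda>z. case snd z of (s, q) \<Rightarrow> \<psi> s (inv_into V y q))"
      by (rule smooth_into_compose[OF \<psi>_into[OF V(2)] open_chart_Times[OF oI V(2)] oZ])
        (use oZ in \<open>auto intro!: smooth_on_intros\<close>)
    then have into: "smooth_into ?Z (\<lambda>z. \<psi> (fst (snd z)) (inv_into V y (snd (snd z))))"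
      by (simp add: case_prod_unfold)
    have eq: "flow ?I X (fst z) (fst (snd z)) (inv_into V y (snd (snd z)))
        = \<phi> (fst z) r (\<psi> (fst (snd z)) (inv_into V y (snd (snd z))))" if "z \<in> ?Z" for z
      by (rule fl) (use that chart_inv_into[OF V(2)] chart_subset[OF V(2)] in auto)
    have "smooth_into ?Z (\<lambda>z. flow ?I X (fst z) (fst (snd z)) (inv_into V y (snd (snd z))))"
      unfolding smooth_into_def
    proof (intro conjI ballI)
      show "(\<lambda>z. flow ?I X (fst z) (fst (snd z)) (inv_into V y (snd (snd z)))) ` ?Z \<subseteq> topspace M"
      proof (rule image_subsetI)
        fix z assume z: "z \<in> ?Z"
        then have "\<psi> (fst (snd z)) (inv_into V y (snd (snd z))) \<in> topspace M"
          using into unfolding smooth_into_def by blast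
        moreover have "fst z \<in> ?I" using z by auto
        ultimately show "flow ?I X (fst z) (fst (snd z)) (inv_into V y (snd (snd z))) \<in> topspace M"
          unfolding eq[OF z] by (intro \<phi>_in)
      qed
      fix f assume f: "f \<in> smooth_functions"
      have "smooth_on ?Z (\<lambda>z. f (\<phi> (fst z) r (\<psi> (fst (snd z)) (inv_into V y (snd (snd z))))))"
        by (rule smooth_family_along[OF oZ into smooth_on_fst[OF oZ smooth_on_id[OF oZ]] _ oI \<phi>_fam[OF f]]) auto
      then show "smooth_on ?Z (\<lambda>z. f (flow ?I X (fst z) (fst (snd z)) (inv_into V y (snd (snd z)))))"
        by (rule smooth_on_cong[OF oZ, THEN iffD1, rotated]) (simp only: eq)
    qed
    then show "case c of (V, y) \<Rightarrow> smooth_into (?I \<times> ?I \<times> y ` V) (\<lambda>(t, s, q). flow ?I X t s (inv_into V y q))"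
      by (simp add: V case_prod_unfold)
  qed
qed

end

context closed_manifold
begin

text \<open>Every point has its own time span of existence. Finitely many neighbourhoods cover the
  compact manifold, and the least of their spans serves all starting points at once.\<close>

lemma complete_flow_local:
  assumes "open J" "smooth_field J X" "t0 \<in> J"
  obtains \<epsilon> where "\<epsilon> > 0" "{t0 - \<epsilon><..<t0 + \<epsilon>} \<subseteq> J" "complete_flow {t0 - \<epsilon><..<t0 + \<epsilon>} X"
proof -
  define P where "P p \<epsilon> N \<Psi> \<longleftrightarrow> \<epsilon> > 0 \<and> {t0 - \<epsilon><..<t0 + \<epsilon>} \<subseteq> J \<and> openin M N \<and> p \<in> N \<and>
    (\<forall>s\<in>{t0 - \<epsilon><..<t0 + \<epsilon>}. \<forall>q\<in>N. integral_curve {t0 - \<epsilon><..<t0 + \<epsilon>} X (\<lambda>t. \<Psi> t s q) \<and> \<Psi> s s q = q) \<and>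
    (\<forall>V y. (V, y) \<in> \<A> \<longrightarrow> smooth_into ({t0 - \<epsilon><..<t0 + \<epsilon>} \<times> {t0 - \<epsilon><..<t0 + \<epsilon>} \<times> y ` (V \<inter> N))
        (\<lambda>(t, s, q). \<Psi> t s (inv_into V y q)))" for p \<epsilon> N \<Psi>
  have "\<exists>\<epsilon> N \<Psi>. P p \<epsilon> N \<Psi>" if p: "p \<in> topspace M" for p
  proof (rule integral_curve_local[OF assms p])
    fix \<epsilon> N \<Psi>
    assume A: "\<epsilon> > 0" "{t0 - \<epsilon><..<t0 + \<epsilon>} \<subseteq> J" "openin M N" "p \<in> N"
      "\<And>s p. s \<in> {t0 - \<epsilon><..<t0 + \<epsilon>} \<Longrightarrow> p \<in> N \<Longrightarrow>
        integral_curve {t0 - \<epsilon><..<t0 + \<epsilon>} X (\<lambda>t. \<Psi> t s p) \<and> \<Psi> s s p = p"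
      "\<And>V y. (V, y) \<in> \<A> \<Longrightarrow> smooth_into ({t0 - \<epsilon><..<t0 + \<epsilon>} \<times> {t0 - \<epsilon><..<t0 + \<epsilon>} \<times> y ` (V \<inter> N))
        (\<lambda>(t, s, q). \<Psi> t s (inv_into V y q))"
    have "P p \<epsilon> N \<Psi>" unfolding P_def using A by blast
    then show "\<exists>\<epsilon> N \<Psi>. P p \<epsilon> N \<Psi>" by blast
  qed
  then obtain \<epsilon> N \<Psi> where P: "\<And>p. p \<in> topspace M \<Longrightarrow> P p (\<epsilon> p) (N p) (\<Psi> p)" by metis
  note * = P[unfolded P_def]
  obtain F where F: "finite F" "F \<subseteq> topspace M" "topspace M \<subseteq> (\<Union>p\<in>F. N p)"
    by (rule finite_subcover[of N]) (use * in auto)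
  obtain e where e: "e > 0" "ball t0 e \<subseteq> J" using assms(1,3) open_contains_ball by blast
  define \<eta> where "\<eta> = Min (insert e (\<epsilon> ` F))"
  have \<eta>: "\<eta> > 0" "\<And>p. p \<in> F \<Longrightarrow> \<eta> \<le> \<epsilon> p" "\<eta> \<le> e"
    using F * e by (auto simp: \<eta>_def)
  let ?I = "{t0 - \<eta><..<t0 + \<eta>}"
  have IJ: "?I \<subseteq> J" using e \<eta> by (auto simp: dist_real_def subset_iff)
  have sub: "?I \<subseteq> {t0 - \<epsilon> p<..<t0 + \<epsilon> p}" if "p \<in> F" for p using \<eta>(2)[OF that] by auto
  have curve: "integral_curve ?I X (\<lambda>t. \<Psi> p t s q) \<and> \<Psi> p s s q = q" if "p \<in> F" "s \<in> ?I" "q \<in> N p" for p s q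
    using *[of p] F(2) that integral_curve_subset[OF _ sub[OF that(1)]] sub[OF that(1)] by blast
  have ex: "\<exists>\<gamma>. integral_curve ?I X \<gamma> \<and> \<gamma> s = p" if "s \<in> ?I" "p \<in> topspace M" for s p
    using F(3) that curve by blast
  have fl: "flow ?I X t s q = \<Psi> p t s q" if "p \<in> F" "s \<in> ?I" "t \<in> ?I" "q \<in> N p" for p s t q
  proof -
    have "q \<in> topspace M" using *[of p] F(2) that openin_subset by blast
    then have "integral_curve ?I X (\<lambda>t. flow ?I X t s q) \<and> flow ?I X s s q = q"
      using someI_ex[OF ex[OF that(2), of q]] unfolding flow_def by auto
    then show ?thesis
      using integral_curve_unique[OF assms(1,2) IJ is_interval_oo _ conjunct1[OF curve[OF that(1,2,4)]] that(2) _ that(3)]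
        curve[OF that(1,2,4)] by metis
  qed
  show ?thesis
  proof (rule that[OF \<eta>(1) IJ], unfold complete_flow_def, intro conjI ballI)
    show "\<exists>\<gamma>. integral_curve ?I X \<gamma> \<and> \<gamma> s = p" if "s \<in> ?I" "p \<in> topspace M" for s p by (rule ex[OF that])
    fix c assume "c \<in> \<A>"
    then obtain V y where V: "c = (V, y)" "(V, y) \<in> \<A>" by (cases c) auto
    have "smooth_into (?I \<times> ?I \<times> y ` V) (\<lambda>(t, s, q). flow ?I X t s (inv_into V y q))"
    proof (rule smooth_into_local)
      fix z assume "z \<in> ?I \<times> ?I \<times> y ` V"
      then obtain t s q where z: "z = (t, s, y q)" "t \<in> ?I" "s \<in> ?I" "q \<in> V" by auto
      then obtain p where p: "p \<in> F" "q \<in> N p" using F(3) chart_subset[OF V(2)] by blast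
      let ?Z = "?I \<times> ?I \<times> y ` (V \<inter> N p)"
      have "openin M (N p)" using * p F by blast
      then have o: "open ?Z" by (intro open_Times chart_open_image[OF V(2)]) auto
      have 1: "smooth_into ?Z (\<lambda>(t, s, q). \<Psi> p t s (inv_into V y q))"
        by (rule smooth_into_subset[of "{t0 - \<epsilon> p<..<t0 + \<epsilon> p} \<times> {t0 - \<epsilon> p<..<t0 + \<epsilon> p} \<times> y ` (V \<inter> N p)"])
          (use * p F V sub in blast)+
      have "smooth_into ?Z (\<lambda>(t, s, q). flow ?I X t s (inv_into V y q))"
        by (rule smooth_into_cong[OF o _ 1]) (use fl[OF p(1)] V in auto)
      then show "\<exists>T. open T \<and> z \<in> T \<and> smooth_into T (\<lambda>(t, s, q). flow ?I X t s (inv_into V y q))"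
        using o z p by (intro exI[of _ ?Z]) auto
    qed
    then show "case c of (V, y) \<Rightarrow> smooth_into (?I \<times> ?I \<times> y ` V) (\<lambda>(t, s, q). flow ?I X t s (inv_into V y q))"
      by (simp add: V)
  qed
qed

text \<open>Bisection: short intervals are served by \<open>complete_flow_local\<close>, and
  adjacent intervals are joined at their common endpoint by \<open>complete_flow_Un\<close>.\<close>

lemma complete_flow_exists:
  assumes "open J" "smooth_field J X" "{a..b} \<subseteq> J" "a \<le> b"
  obtains I where "open I" "is_interval I" "{a..b} \<subseteq> I" "I \<subseteq> J" "complete_flow I X"
proof -
  have "\<exists>I. open I \<and> is_interval I \<and> {a..b} \<subseteq> I \<and> I \<subseteq> J \<and> complete_flow I X"
    using assms(4)
  proof (induction a b rule: Bolzano)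
    case (trans a b c)
    then obtain I1 I2 where I: "open I1" "is_interval I1" "{a..b} \<subseteq> I1" "I1 \<subseteq> J" "complete_flow I1 X"
      "open I2" "is_interval I2" "{b..c} \<subseteq> I2" "I2 \<subseteq> J" "complete_flow I2 X" by blast
    have b: "b \<in> I1" "b \<in> I2" using I trans by auto
    have "is_interval (I1 \<union> I2)"
      using I b unfolding is_interval_connected_1 by (intro connected_Un) auto
    moreover have "{a..c} \<subseteq> I1 \<union> I2" using I(3,8) by (auto simp: subset_iff) (meson linear)
    ultimately show ?case
      using complete_flow_Un[OF assms(1,2) I(1,2,4,5) I(6,7,9,10) b] I by blast
  next
    case (local t)
    then have "t \<in> J" using assms(3) by auto
    then obtain \<epsilon> where \<epsilon>: "\<epsilon> > 0" "{t - \<epsilon><..<t + \<epsilon>} \<subseteq> J" "complete_flow {t - \<epsilon><..<t + \<epsilon>} X"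
      using complete_flow_local[OF assms(1,2)] by blast
    show ?case
    proof (intro exI[of _ \<epsilon>] conjI allI impI \<epsilon>(1))
      fix a b assume "a \<le> t \<and> t \<le> b \<and> b - a < \<epsilon>"
      then have "{a..b} \<subseteq> {t - \<epsilon><..<t + \<epsilon>}" by auto
      with \<epsilon>(2,3) show "\<exists>I. open I \<and> is_interval I \<and> {a..b} \<subseteq> I \<and> I \<subseteq> J \<and> complete_flow I X"
        by (intro exI[of _ "{t - \<epsilon><..<t + \<epsilon>}"]) (simp add: is_interval_oo)
    qed
  qed
  then show ?thesis using that by blast
qed

end

section \<open>Integration on manifolds\<close>

lemma has_real_derivative_quadratic:
  fixes F :: "real \<Rightarrow> real"
  assumes "\<delta> > 0" "\<And>t. \<bar>t - t0\<bar> < \<delta> \<Longrightarrow> \<bar>F t - F t0 - (t - t0) * D\<bar> \<le> K * (t - t0)\<^sup>2"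
  shows "(F has_real_derivative D) (at t0)"
  unfolding has_field_derivative_def has_derivative_iff_norm
proof (intro conjI)
  have "((\<lambda>t. \<bar>K\<bar> * \<bar>t - t0\<bar>) \<longlongrightarrow> \<bar>K\<bar> * \<bar>t0 - t0\<bar>) (at t0)" by (intro tendsto_intros)
  then have lim: "((\<lambda>t. \<bar>K\<bar> * \<bar>t - t0\<bar>) \<longlongrightarrow> 0) (at t0)" by simp
  have "\<forall>\<^sub>F t in at t0. norm (norm (F t - F t0 - D * (t - t0)) / norm (t - t0)) \<le> \<bar>K\<bar> * \<bar>t - t0\<bar>"
    unfolding eventually_at
  proof (intro exI[of _ \<delta>] conjI ballI impI assms(1))
    fix t assume t: "t \<noteq> t0 \<and> dist t t0 < \<delta>"
    then have "\<bar>F t - F t0 - D * (t - t0)\<bar> \<le> K * (t - t0)\<^sup>2"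
      using assms(2)[of t] by (simp add: dist_real_def mult.commute)
    also have "\<dots> \<le> \<bar>K\<bar> * (\<bar>t - t0\<bar> * \<bar>t - t0\<bar>)"
      by (simp add: power2_eq_square mult_right_mono)
    finally show "norm (norm (F t - F t0 - D * (t - t0)) / norm (t - t0)) \<le> \<bar>K\<bar> * \<bar>t - t0\<bar>"
      using t by (simp add: pos_divide_le_eq mult.assoc)
  qed
  then show "((\<lambda>t. norm (F t - F t0 - D * (t - t0)) / norm (t - t0)) \<longlongrightarrow> 0) (at t0)"
    by (rule Lim_null_comparison[OF _ lim])
qed (rule bounded_linear_mult_right)

text \<open>The integrals are compared on the very set where the inequality fails; there the
  difference is positive but its integral is not.\<close>

lemma AE_le_of_set_integrals:
  fixes f g :: "'a \<Rightarrow> real"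
  assumes [measurable]: "f \<in> borel_measurable \<mu>" "g \<in> borel_measurable \<mu>" "B \<in> sets \<mu>"
    and fg: "set_integrable \<mu> B f" "set_integrable \<mu> B g"
    and le: "\<And>A. A \<in> sets \<mu> \<Longrightarrow> A \<subseteq> B \<Longrightarrow> (LINT p:A|\<mu>. f p) \<le> (LINT p:A|\<mu>. g p)"
  shows "AE p in \<mu>. p \<in> B \<longrightarrow> f p \<le> g p"
proof -
  let ?A = "{p \<in> space \<mu>. p \<in> B \<and> g p < f p}"
  have A: "?A \<in> sets \<mu>" "?A \<subseteq> B" by auto
  have int: "set_integrable \<mu> ?A f" "set_integrable \<mu> ?A g"
    using set_integrable_subset[OF _ A] fg by auto
  let ?h = "\<lambda>p. indicator ?A p * (f p - g p)"
  have h: "integrable \<mu> ?h"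
    using set_integral_diff(1)[OF int] by (simp add: set_integrable_def)
  have nn: "0 \<le> ?h p" for p by (auto simp: indicator_def)
  have "integral\<^sup>L \<mu> ?h = (LINT p:?A|\<mu>. f p) - (LINT p:?A|\<mu>. g p)"
    using set_integral_diff(2)[OF int] by (simp add: set_lebesgue_integral_def)
  then have "integral\<^sup>L \<mu> ?h \<le> 0" using le[OF A] by simp
  moreover have "0 \<le> integral\<^sup>L \<mu> ?h" by (rule integral_nonneg_AE) (simp add: nn)
  ultimately have "AE p in \<mu>. ?h p = 0"
    using integral_nonneg_eq_0_iff_AE[OF h] nn by simp
  then show ?thesis
    by (rule AE_mp) (auto simp: indicator_def intro!: AE_I2)
qed

lemma AE_eq_of_set_integrals:
  fixes f g :: "'a \<Rightarrow> real"
  assumes "f \<in> borel_measurable \<mu>" "g \<in> borel_measurable \<mu>" "B \<in> sets \<mu>"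
    and "set_integrable \<mu> B f" "set_integrable \<mu> B g"
    and "\<And>A. A \<in> sets \<mu> \<Longrightarrow> A \<subseteq> B \<Longrightarrow> (LINT p:A|\<mu>. f p) = (LINT p:A|\<mu>. g p)"
  shows "AE p in \<mu>. p \<in> B \<longrightarrow> f p = g p"
proof -
  have "AE p in \<mu>. p \<in> B \<longrightarrow> f p \<le> g p" "AE p in \<mu>. p \<in> B \<longrightarrow> g p \<le> f p"
    using AE_le_of_set_integrals[OF assms(1-5)] AE_le_of_set_integrals[OF assms(2,1,3,5,4)] assms(6) by auto
  then show ?thesis by eventually_elim auto
qed

text \<open>By translation invariance the difference quotients of \<open>F\<close> have integral
  exactly 0, and dominated convergence passes to the derivative.\<close>

lemma integral_partial_derivative_eq_0:
  fixes F :: "'e::euclidean_space \<Rightarrow> real"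
  assumes "smooth_on UNIV F" "compact C" "\<And>q. q \<notin> C \<Longrightarrow> F q = 0"
  shows "integrable lborel (\<lambda>q. frechet_derivative F (at q) b)"
    and "(\<integral>q. frechet_derivative F (at q) b \<partial>lborel) = 0"
proof -
  let ?D = "\<lambda>q. frechet_derivative F (at q) b"
  have contF: "continuous_on S F" for S using smooth_on_imp_continuous_on[OF assms(1)] continuous_on_subset by blast
  have contD: "continuous_on S ?D" for S
    using smooth_on_imp_continuous_on[OF smooth_on_frechet_derivative[OF assms(1)]] continuous_on_subset by blast
  obtain R where R: "\<And>q. q \<in> C \<Longrightarrow> norm q \<le> R" using compact_imp_bounded[OF assms(2)] by (auto simp: bounded_iff)
  \<comment> \<open>The steps \<open>s n\<close> are at most 1, so a difference quotient vanishes
    farther than \<open>norm b\<close> from the ball around the support. The bound \<open>L\<close>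
    for the derivative is taken on a ball enlarged once more by \<open>norm b\<close>, to contain
    the points between \<open>q\<close> and its translate.\<close>
  define K where "K = cball (0::'e) (\<bar>R\<bar> + norm b)"
  have K: "compact K" by (simp add: K_def)
  have F0: "F (q + s *\<^sub>R b) = 0" if "q \<notin> K" "s \<in> {0..1}" for q s
  proof (rule assms(3), rule notI)
    assume "q + s *\<^sub>R b \<in> C"
    then have "norm (q + s *\<^sub>R b) \<le> \<bar>R\<bar>" using R by fastforce
    moreover have "norm (s *\<^sub>R b) \<le> norm b" using that(2) by (simp add: mult_left_le_one_le)
    ultimately have "norm q \<le> \<bar>R\<bar> + norm b"
      using norm_triangle_ineq4[of "q + s *\<^sub>R b" "s *\<^sub>R b"] by simp
    then show False using that(1) by (simp add: K_def)
  qed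
  have der: "((\<lambda>s. F (q + s *\<^sub>R b)) has_vector_derivative ?D (q + t *\<^sub>R b)) (at t)" for q t
    by (rule has_vector_derivative_line_shift, rule has_vector_derivative_along_line)
      (rule smooth_on_has_derivative[OF assms(1) UNIV_I])
  have D0: "?D q = 0" if "q \<notin> C" for q
  proof -
    have "open (- C)" using compact_imp_closed[OF assms(2)] by auto
    then have "(F has_derivative (\<lambda>_. 0)) (at q)"
      by (rule has_derivative_transform_within_open[OF has_derivative_const]) (use that assms(3) in auto)
    from fun_cong[OF frechet_derivative_at[OF this], of b] show ?thesis by simp
  qed
  have "integrable lborel (\<lambda>q. indicator C q *\<^sub>R ?D q)" by (rule borel_integrable_compact[OF assms(2) contD])
  moreover have "(\<lambda>q. indicator C q *\<^sub>R ?D q) = ?D" using D0 by (auto simp: indicator_def fun_eq_iff)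
  ultimately show intD: "integrable lborel ?D" by (simp only:)
  have "integrable lborel (\<lambda>q. indicator C q *\<^sub>R F q)" by (rule borel_integrable_compact[OF assms(2) contF])
  moreover have "(\<lambda>q. indicator C q *\<^sub>R F q) = F" using assms(3) by (auto simp: indicator_def fun_eq_iff)
  ultimately have intF: "integrable lborel F" by (simp only:)
  have mF [measurable]: "F \<in> borel_measurable borel" using contF by (rule borel_measurable_continuous_onI)
  have mD [measurable]: "?D \<in> borel_measurable borel" using contD by (rule borel_measurable_continuous_onI)
  have shift: "integrable lborel (\<lambda>q. F (c + q))" "(\<integral>q. F (c + q) \<partial>lborel) = (\<integral>q. F q \<partial>lborel)" for c :: 'e
  proof -
    show "integrable lborel (\<lambda>q. F (c + q))"
      using integrable_distr_eq[of "(+) c" lborel borel F] intF unfolding lborel_distr_plus by simp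
    show "(\<integral>q. F (c + q) \<partial>lborel) = (\<integral>q. F q \<partial>lborel)"
      using integral_distr[of "(+) c" lborel borel F] unfolding lborel_distr_plus by simp
  qed
  obtain L where L: "\<And>q. q \<in> cball (0::'e) (\<bar>R\<bar> + norm b + norm b) \<Longrightarrow> \<bar>?D q\<bar> \<le> L"
  proof -
    have "bounded (?D ` cball 0 (\<bar>R\<bar> + norm b + norm b))"
      by (intro compact_imp_bounded compact_continuous_image contD compact_cball)
    then obtain L where "\<forall>y\<in>?D ` cball 0 (\<bar>R\<bar> + norm b + norm b). norm y \<le> L" unfolding bounded_iff by blast
    then show ?thesis by (intro that[of L]) force
  qed
  define s where "s n = inverse (real (Suc n))" for n
  have s: "0 < s n" "s n \<le> 1" for n by (auto simp: s_def inverse_le_1_iff)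
  have s0: "s \<longlonglongrightarrow> 0" unfolding s_def by (rule LIMSEQ_inverse_real_of_nat)
  define G where "G n q = inverse (s n) * (F (s n *\<^sub>R b + q) - F q)" for n q
  have "(\<lambda>n. integral\<^sup>L lborel (G n)) \<longlonglongrightarrow> (\<integral>q. ?D q \<partial>lborel)"
  proof (rule integral_dominated_convergence[where w = "\<lambda>q. indicator K q *\<^sub>R L"])
    show "integrable lborel (\<lambda>q. indicator K q *\<^sub>R L)" by (rule borel_integrable_compact[OF K]) simp
    show "G n \<in> borel_measurable lborel" for n unfolding G_def by measurable
    show "AE q in lborel. (\<lambda>n. G n q) \<longlonglongrightarrow> ?D q"
    proof (rule AE_I2)
      fix q
      have "((\<lambda>s. inverse s *\<^sub>R (F (q + s *\<^sub>R b) - F (q + 0 *\<^sub>R b))) \<longlongrightarrow> ?D (q + 0 *\<^sub>R b)) (at 0)"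
        using der[of q 0] unfolding has_vector_derivative_0_iff .
      moreover have "filterlim s (at 0) sequentially"
        using s0 s(1) by (auto simp: filterlim_at less_imp_neq[symmetric] intro!: always_eventually)
      ultimately show "(\<lambda>n. G n q) \<longlonglongrightarrow> ?D q"
        using filterlim_compose[of _ _ "at 0" s sequentially] by (fastforce simp: G_def add.commute)
    qed
    show "AE q in lborel. norm (G n q) \<le> indicator K q *\<^sub>R L" for n
    proof (rule AE_I2)
      fix q
      show "norm (G n q) \<le> indicator K q *\<^sub>R L"
      proof (cases "q \<in> K")
        case False
        then show ?thesis using F0[OF False, of "s n"] F0[OF False, of 0] s[of n] by (simp add: G_def add.commute)
      next
        case True
        have "norm (F (q + s n *\<^sub>R b) - F (q + 0 *\<^sub>R b)) \<le> L * \<bar>s n - 0\<bar>"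
        proof (rule vector_derivative_bound[of "{0..1}" _ "\<lambda>t. ?D (q + t *\<^sub>R b)"])
          fix t :: real assume t: "t \<in> {0..1}"
          show "((\<lambda>s. F (q + s *\<^sub>R b)) has_vector_derivative ?D (q + t *\<^sub>R b)) (at t within {0..1})"
            by (rule has_vector_derivative_at_within[OF der])
          have "norm (t *\<^sub>R b) \<le> norm b" using t by (simp add: mult_left_le_one_le)
          then have "norm (q + t *\<^sub>R b) \<le> \<bar>R\<bar> + norm b + norm b"
            using True norm_triangle_ineq[of q "t *\<^sub>R b"] by (simp add: K_def)
          then show "norm (?D (q + t *\<^sub>R b)) \<le> L" using L by simp
        qed (use s[of n] in auto)
        then show ?thesis using s[of n] True by (simp add: G_def abs_mult field_simps add.commute)
      qed
    qed
  qed (use mD in simp)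
  moreover have "integral\<^sup>L lborel (G n) = 0" for n
  proof -
    have "G n = (\<lambda>q. inverse (s n) * (F (s n *\<^sub>R b + q) - F q))" by (simp add: G_def fun_eq_iff)
    then show ?thesis using shift[of "s n *\<^sub>R b"] intF by simp
  qed
  ultimately have "(\<lambda>n. 0) \<longlonglongrightarrow> (\<integral>q. ?D q \<partial>lborel)" by simp
  then show "(\<integral>q. ?D q \<partial>lborel) = 0" by (simp add: LIMSEQ_const_iff)
qed

context smooth_manifold
begin

lemma space_borelM [simp]: "space borelM = topspace M"
  unfolding borelM_def by (rule space_measure_of) (auto dest: openin_subset)

lemma openin_sets_borelM: "openin M W \<Longrightarrow> W \<in> sets borelM"
  unfolding borelM_def by (subst sets_measure_of) (auto dest: openin_subset)

lemma chart_sets_borelM: "(U, x) \<in> \<A> \<Longrightarrow> U \<in> sets borelM"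
  by (rule openin_sets_borelM[OF chart_domain])

lemma measurable_into_borelM:
  assumes "f \<in> space N \<rightarrow> topspace M" "\<And>W. openin M W \<Longrightarrow> f -` W \<inter> space N \<in> sets N"
  shows "f \<in> measurable N borelM"
  unfolding borelM_def by (rule measurable_measure_of) (use assms in \<open>auto dest: openin_subset\<close>)

lemma continuous_map_borelM:
  fixes f :: "'a \<Rightarrow> real"
  assumes "continuous_map M euclidean f"
  shows "f \<in> borel_measurable borelM"
proof (rule borel_measurableI)
  fix S :: "real set" assume "open S"
  then have "openin M {p \<in> topspace M. f p \<in> S}"
    using assms openin_continuous_map_preimage by fastforce
  moreover have "{p \<in> topspace M. f p \<in> S} = f -` S \<inter> space borelM" by auto
  ultimately show "f -` S \<inter> space borelM \<in> sets borelM" using openin_sets_borelM by metis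
qed

lemma smooth_functions_measurable: "f \<in> smooth_functions \<Longrightarrow> f \<in> borel_measurable borelM"
  by (rule continuous_map_borelM[OF smooth_functions_continuous])

lemma PinfD:
  assumes "\<mu> \<in> Pinf"
  shows "prob_space \<mu>" "sets \<mu> = sets borelM" "space \<mu> = topspace M"
    "(U, x) \<in> \<A> \<Longrightarrow> \<exists>\<rho>. smooth_on (x ` U) \<rho> \<and> (\<forall>q\<in>x ` U. \<rho> q > 0) \<and> has_chart_density (measure \<mu>) (U, x) \<rho>"
proof -
  show "prob_space \<mu>" and s: "sets \<mu> = sets borelM" using assms by (auto simp: Pinf_def)
  show "space \<mu> = topspace M" using sets_eq_imp_space_eq[OF s] by simp
  show "\<exists>\<rho>. smooth_on (x ` U) \<rho> \<and> (\<forall>q\<in>x ` U. \<rho> q > 0) \<and> has_chart_density (measure \<mu>) (U, x) \<rho>"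
    if "(U, x) \<in> \<A>" using assms that by (auto simp: Pinf_def)
qed

lemma Pinf_measurable: "\<mu> \<in> Pinf \<Longrightarrow> f \<in> borel_measurable \<mu> \<longleftrightarrow> f \<in> borel_measurable borelM"
  by (intro arg_cong2[where f = "(\<in>)"] refl measurable_cong_sets PinfD(2))

lemma chart_inverse_measurable:
  assumes "(U, x) \<in> \<A>" "p0 \<in> U"
  shows "(\<lambda>q. if q \<in> x ` U then inv_into U x q else p0) \<in> measurable borel borelM"
proof (rule measurable_into_borelM)
  show "(\<lambda>q. if q \<in> x ` U then inv_into U x q else p0) \<in> space borel \<rightarrow> topspace M"
    using chart_inv_into[OF assms(1)] chart_subset[OF assms(1)] assms(2) by auto
  fix W assume "openin M W"
  then have o: "open (x ` (U \<inter> W))" by (rule chart_open_image[OF assms(1)])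
  have "(\<lambda>q. if q \<in> x ` U then inv_into U x q else p0) -` W \<inter> space borel
      = x ` (U \<inter> W) \<union> (if p0 \<in> W then - x ` U else {})"
    using assms(1) by (auto split: if_splits)
  then show "(\<lambda>q. if q \<in> x ` U then inv_into U x q else p0) -` W \<inter> space borel \<in> sets borel"
    using o chart_codomain[OF assms(1)] by auto
qed

text \<open>\<open>has_chart_density\<close> says that, on Borel subsets of \<open>U\<close>, the
  measure \<mu> is the image under the inverse chart of a density for Lebesgue measure. Once this is
  an equality of measures, the rules for \<open>distr\<close> and \<open>density\<close> extend it
  from sets to functions.\<close>

lemma chart_integral:
  assumes \<mu>: "\<mu> \<in> Pinf" and c: "(U, x) \<in> \<A>" and \<rho>: "has_chart_density (measure \<mu>) (U, x) \<rho>"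
    and pos: "\<And>q. q \<in> x ` U \<Longrightarrow> 0 < \<rho> q"
    and f: "f \<in> borel_measurable borelM" and A: "A \<in> sets borelM" "A \<subseteq> U"
  shows "set_integrable \<mu> A f \<longleftrightarrow> set_integrable lborel (x ` A) (\<lambda>q. \<rho> q * f (inv_into U x q))"
    and "(LINT p:A|\<mu>. f p) = (LINT q:x ` A|lborel. \<rho> q * (f (inv_into U x q) :: real))"
proof -
  have "(set_integrable \<mu> A f \<longleftrightarrow> set_integrable lborel (x ` A) (\<lambda>q. \<rho> q * f (inv_into U x q))) \<and>
    (LINT p:A|\<mu>. f p) = (LINT q:x ` A|lborel. \<rho> q * f (inv_into U x q))"
  proof (cases "U = {}")
    case True
    then have "A = {}" using A by blast
    then show ?thesis by (simp add: set_integrable_def set_lebesgue_integral_def)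
  next
    case False
    then obtain p0 where p0: "p0 \<in> U" by blast
    interpret prob_space \<mu> using PinfD(1)[OF \<mu>] .
    note sets\<mu> = PinfD(2)[OF \<mu>]
    let ?g = "\<lambda>q. if q \<in> x ` U then inv_into U x q else p0"
    \<comment> \<open>The inverse chart is made total by the arbitrary value \<open>p0\<close>,
      which is attained only where the density \<open>?r\<close> vanishes. This is why empty
      \<open>U\<close> was treated apart.\<close>
    have g [measurable]: "?g \<in> measurable lborel borelM" using chart_inverse_measurable[OF c p0] by simp
    have U: "U \<in> sets borelM" by (rule chart_sets_borelM[OF c])
    have dens: "set_integrable lborel (x ` B) \<rho>" "measure \<mu> B = (LINT q:x ` B|lborel. \<rho> q)"
      if "B \<in> sets borelM" "B \<subseteq> U" for B
      using \<rho> that by (auto simp: has_chart_density_def)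
    let ?r = "\<lambda>q. indicator (x ` U) q * \<rho> q"
    have r [measurable]: "?r \<in> borel_measurable lborel"
      using dens(1)[OF U order_refl] by (simp add: set_integrable_def integrable_iff_bounded)
    have r0: "0 \<le> ?r q" for q using pos by (auto simp: indicator_def less_imp_le)
    let ?N = "density lborel (\<lambda>q. ennreal (?r q))"
    have eq: "distr ?N borelM ?g = density \<mu> (\<lambda>p. ennreal (indicator U p))"
    proof (rule measure_eqI)
      show "sets (distr ?N borelM ?g) = sets (density \<mu> (\<lambda>p. ennreal (indicator U p)))" by (simp add: sets\<mu>)
      fix B assume "B \<in> sets (distr ?N borelM ?g)"
      then have B: "B \<in> sets borelM" by simp
      have UB: "U \<inter> B \<in> sets borelM" "U \<inter> B \<subseteq> U" using U B by auto
      have gB: "?g -` B \<in> sets borel"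
        using measurable_sets[OF chart_inverse_measurable[OF c p0] B] by simp
      have "emeasure (distr ?N borelM ?g) B = emeasure ?N (?g -` B)"
        using g B by (subst emeasure_distr) auto
      also have "\<dots> = (\<integral>\<^sup>+q. ennreal (?r q) * indicator (?g -` B) q \<partial>lborel)"
        using gB by (subst emeasure_density) auto
      also have "\<dots> = (\<integral>\<^sup>+q. ennreal (indicator (x ` (U \<inter> B)) q *\<^sub>R \<rho> q) \<partial>lborel)"
        by (rule nn_integral_cong) (use c in \<open>auto simp: indicator_def inj_on_eq_iff[OF chart_inj]\<close>)
      also have "\<dots> = ennreal (LINT q:x ` (U \<inter> B)|lborel. \<rho> q)"
        using dens(1)[OF UB] unfolding set_integrable_def set_lebesgue_integral_def
        by (intro nn_integral_eq_integral) (use pos in \<open>auto simp: indicator_def less_imp_le intro!: AE_I2\<close>)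
      also have "\<dots> = emeasure \<mu> (U \<inter> B)"
        using dens(2)[OF UB] emeasure_eq_measure by simp
      also have "\<dots> = (\<integral>\<^sup>+p. indicator (U \<inter> B) p \<partial>\<mu>)"
        using UB sets\<mu> by simp
      also have "\<dots> = (\<integral>\<^sup>+p. ennreal (indicator U p) * indicator B p \<partial>\<mu>)"
        by (rule nn_integral_cong) (auto simp: indicator_def)
      also have "\<dots> = emeasure (density \<mu> (\<lambda>p. ennreal (indicator U p))) B"
        using B U sets\<mu> by (subst emeasure_density) auto
      finally show "emeasure (distr ?N borelM ?g) B = emeasure (density \<mu> (\<lambda>p. ennreal (indicator U p))) B" .
    qed
    let ?h = "\<lambda>p. indicator A p *\<^sub>R f p"
    have h [measurable]: "?h \<in> borel_measurable borelM" using f A by measurable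
    have h\<mu>: "?h \<in> borel_measurable \<mu>" using h Pinf_measurable[OF \<mu>] by blast
    have U\<mu>: "indicator U \<in> borel_measurable \<mu>" using U sets\<mu> by (intro borel_measurable_indicator) simp
    have Uh: "indicator U p *\<^sub>R ?h p = ?h p" for p using A by (auto simp: indicator_def)
    have rh: "?r q *\<^sub>R ?h (?g q) = indicator (x ` A) q *\<^sub>R (\<rho> q * f (inv_into U x q))" for q
    proof (cases "q \<in> x ` U")
      case True
      then obtain p where p: "q = x p" "p \<in> U" by blast
      have "x p \<in> x ` A \<longleftrightarrow> p \<in> A" by (rule inj_on_image_mem_iff[OF chart_inj[OF c] p(2) A(2)])
      then show ?thesis using p c by (simp add: indicator_def)
    next
      case False
      then have "q \<notin> x ` A" using A(2) by blast
      then show ?thesis using False by (simp add: indicator_def)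
    qed
    have Uhf: "(\<lambda>p. indicator U p *\<^sub>R ?h p) = ?h" by (rule ext) (rule Uh)
    have Unn: "AE p in \<mu>. (0::real) \<le> indicator U p" by simp
    have "integrable \<mu> ?h \<longleftrightarrow> integrable (distr ?N borelM ?g) ?h"
      unfolding eq using integrable_density[OF h\<mu> U\<mu> Unn] unfolding Uhf by blast
    also have "\<dots> \<longleftrightarrow> integrable ?N (\<lambda>q. ?h (?g q))"
      by (rule integrable_distr_eq) (use g h in auto)
    also have "\<dots> \<longleftrightarrow> integrable lborel (\<lambda>q. ?r q *\<^sub>R ?h (?g q))"
      by (rule integrable_density) (use r r0 measurable_compose[OF g h] in auto)
    finally have 1: "integrable \<mu> ?h \<longleftrightarrow> integrable lborel (\<lambda>q. ?r q *\<^sub>R ?h (?g q))" .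
    have "integral\<^sup>L \<mu> ?h = integral\<^sup>L (distr ?N borelM ?g) ?h"
      unfolding eq using integral_density[OF h\<mu> U\<mu> Unn] unfolding Uhf by (rule sym)
    also have "\<dots> = integral\<^sup>L ?N (\<lambda>q. ?h (?g q))"
      by (rule integral_distr) (use g h in auto)
    also have "\<dots> = integral\<^sup>L lborel (\<lambda>q. ?r q *\<^sub>R ?h (?g q))"
      by (rule integral_density) (use r r0 measurable_compose[OF g h] in auto)
    finally show ?thesis using 1 unfolding rh set_integrable_def set_lebesgue_integral_def by simp
  qed
  then show "set_integrable \<mu> A f \<longleftrightarrow> set_integrable lborel (x ` A) (\<lambda>q. \<rho> q * f (inv_into U x q))"
    "(LINT p:A|\<mu>. f p) = (LINT q:x ` A|lborel. \<rho> q * f (inv_into U x q))" by auto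
qed

lemma chart_function_measurable:
  assumes "(U, x) \<in> \<A>" "continuous_on (x ` U) (g :: 'e \<Rightarrow> real)"
  shows "(\<lambda>p. if p \<in> U then g (x p) else 0) \<in> borel_measurable borelM"
proof (rule borel_measurableI)
  fix S :: "real set" assume "open S"
  then have "open (g -` S \<inter> x ` U)"
    using assms(2) chart_codomain[OF assms(1)] by (auto simp: continuous_on_open_vimage)
  from openin_sets_borelM[OF chart_open_vimage[OF assms(1) this]]
  have 1: "{p \<in> U. x p \<in> g -` S \<inter> x ` U} \<in> sets borelM" .
  have "(\<lambda>p. if p \<in> U then g (x p) else 0) -` S \<inter> space borelM
      = {p \<in> U. x p \<in> g -` S \<inter> x ` U} \<union> (if 0 \<in> S then space borelM - U else {})"
    using chart_subset[OF assms(1)] by (force split: if_splits)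
  then show "(\<lambda>p. if p \<in> U then g (x p) else 0) -` S \<inter> space borelM \<in> sets borelM"
    using 1 sets.compl_sets[OF chart_sets_borelM[OF assms(1)]] by auto
qed

lemma coord_vector_cong:
  assumes "(U, x) \<in> \<A>" "p \<in> U" "f \<in> smooth_functions" "g \<in> smooth_functions" "\<And>q. q \<in> topspace M \<Longrightarrow> f q = g q"
  shows "coord_vector (U, x) p v f = coord_vector (U, x) p v g"
  by (rule coord_vector_local[OF assms(1-4) openin_topspace]) (use chart_subset[OF assms(1)] assms in auto)

lemma coord_vector_sum:
  assumes "(U, x) \<in> \<A>" "p \<in> U" "\<And>i. i \<in> F \<Longrightarrow> h i \<in> smooth_functions"
  shows "coord_vector (U, x) p v (\<lambda>q. \<Sum>i\<in>F. h i q) = (\<Sum>i\<in>F. coord_vector (U, x) p v (h i))"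
  using assms(3)
  by (induction F rule: infinite_finite_induct)
    (auto simp: coord_vector_const[OF assms(1,2)] coord_vector_add[OF assms(1,2)] smooth_functions_sum)

text \<open>Multiplied by \<rho>, the integrand becomes the Euclidean divergence of the compactly
  supported field with components \<open>\<rho> q * (\<xi> q \<bullet> b) * \<eta>\<close>, so it
  integrates to 0. The sum divided by \<rho> is thus the divergence of the field relative to
  \<mu>.\<close>

lemma integral_divergence_chart:
  assumes \<mu>: "\<mu> \<in> Pinf" and c: "(U, x) \<in> \<A>" and \<rho>: "has_chart_density (measure \<mu>) (U, x) \<rho>"
    and pos: "\<And>q. q \<in> x ` U \<Longrightarrow> 0 < \<rho> q" and s\<rho>: "smooth_on (x ` U) \<rho>"
    and s\<xi>: "smooth_on (x ` U) \<xi>" and \<eta>: "\<eta> \<in> smooth_functions"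
    and C: "compact C" "C \<subseteq> x ` U" "\<And>p. \<eta> p \<noteq> 0 \<Longrightarrow> p \<in> U \<and> x p \<in> C"
  shows "(LINT p:U|\<mu>. coord_vector (U, x) p (\<xi> (x p)) \<eta> + \<eta> p *
      ((\<Sum>b\<in>Basis. frechet_derivative (\<lambda>q. \<rho> q * (\<xi> q \<bullet> b)) (at (x p)) b) / \<rho> (x p))) = 0"
proof -
  let ?S = "x ` U"
  have oS: "open ?S" by (rule chart_codomain[OF c])
  let ?\<eta> = "\<lambda>q. \<eta> (inv_into U x q)"
  have s\<eta>: "smooth_on ?S ?\<eta>" by (rule smooth_functionsD[OF \<eta> c])
  have \<eta>0: "?\<eta> q = 0" if "q \<in> ?S" "q \<notin> C" for q using C(3)[of "inv_into U x q"] c that by auto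
  let ?f = "\<lambda>b q. \<rho> q * (\<xi> q \<bullet> b)"
  have sf: "smooth_on ?S (?f b)" for b by (intro smooth_on_intros oS s\<rho> s\<xi>)
  define F where "F b q = (if q \<in> ?S then ?f b q * ?\<eta> q else 0)" for b q
  have sF: "smooth_on UNIV (F b)" for b
  proof (rule smooth_on_local)
    fix q :: 'e
    show "\<exists>T. open T \<and> q \<in> T \<and> smooth_on T (F b)"
    proof (cases "q \<in> ?S")
      case True
      have "smooth_on ?S (\<lambda>q. ?f b q * ?\<eta> q)" by (intro smooth_on_mult oS sf s\<eta>)
      moreover have "smooth_on ?S (\<lambda>q. ?f b q * ?\<eta> q) \<longleftrightarrow> smooth_on ?S (F b)"
        by (rule smooth_on_cong[OF oS]) (simp add: F_def)
      ultimately show ?thesis using oS True by blast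
    next
      case False
      have o: "open (- C)" using compact_imp_closed[OF C(1)] by auto
      have "smooth_on (- C) (\<lambda>q. 0 :: real) \<longleftrightarrow> smooth_on (- C) (F b)"
        by (rule smooth_on_cong[OF o]) (use \<eta>0 in \<open>auto simp: F_def\<close>)
      then show ?thesis using o False C(2) smooth_on_const[OF o] by (intro exI[of _ "- C"]) auto
    qed
  qed
  have F0: "F b q = 0" if "q \<notin> C" for b q using \<eta>0 that by (auto simp: F_def)
  have dF: "frechet_derivative (F b) (at q) b
      = ?f b q * frechet_derivative ?\<eta> (at q) b + frechet_derivative (?f b) (at q) b * ?\<eta> q" if "q \<in> ?S" for b q
  proof -
    have "((\<lambda>q. ?f b q * ?\<eta> q) has_derivative
        (\<lambda>v. ?f b q * frechet_derivative ?\<eta> (at q) v + frechet_derivative (?f b) (at q) v * ?\<eta> q)) (at q)"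
      by (intro has_derivative_mult smooth_on_has_derivative[OF sf that] smooth_on_has_derivative[OF s\<eta> that])
    then have "(F b has_derivative
        (\<lambda>v. ?f b q * frechet_derivative ?\<eta> (at q) v + frechet_derivative (?f b) (at q) v * ?\<eta> q)) (at q)"
      by (rule has_derivative_transform_within_open[OF _ oS that]) (simp add: F_def)
    from fun_cong[OF frechet_derivative_at[OF this], of b] show ?thesis by (rule sym)
  qed
  have dF0: "frechet_derivative (F b) (at q) b = 0" if "q \<notin> ?S" for b q
  proof -
    have "open (- C)" using compact_imp_closed[OF C(1)] by auto
    then have "(F b has_derivative (\<lambda>_. 0)) (at q)"
      by (rule has_derivative_transform_within_open[OF has_derivative_const]) (use that C(2) F0 in auto)
    from fun_cong[OF frechet_derivative_at[OF this], of b] show ?thesis by simp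
  qed
  let ?d = "\<lambda>q. \<Sum>b\<in>Basis. frechet_derivative (?f b) (at q) b"
  define T where "T p = (if p \<in> U then frechet_derivative ?\<eta> (at (x p)) (\<xi> (x p)) + ?\<eta> (x p) * (?d (x p) / \<rho> (x p)) else 0)" for p
  have lin: "linear (frechet_derivative ?\<eta> (at q))" if "q \<in> ?S" for q
    by (rule has_derivative_linear[OF smooth_on_has_derivative[OF s\<eta> that]])
  have sA: "smooth_on ?S (\<lambda>q. frechet_derivative ?\<eta> (at q) (\<xi> q))"
    using smooth_on_apply_linear[OF oS lin smooth_on_frechet_derivative[OF s\<eta>] s\<xi>] .
  have sd: "smooth_on ?S ?d"
  proof (rule smooth_on_sum[OF oS])
    show "smooth_on ?S (\<lambda>q. frechet_derivative (?f b) (at q) b)" for b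
      using smooth_on_frechet_derivative[OF sf[of b], of b] .
  qed
  have "smooth_on ?S (\<lambda>q. frechet_derivative ?\<eta> (at q) (\<xi> q) + ?\<eta> q * (?d q / \<rho> q))"
    by (rule smooth_on_add[OF oS sA smooth_on_mult[OF oS s\<eta> smooth_on_divide[OF oS sd s\<rho>]]])
      (use pos in force)
  then have mT: "T \<in> borel_measurable borelM"
    unfolding T_def by (intro chart_function_measurable[OF c] smooth_on_imp_continuous_on)
  have "(LINT p:U|\<mu>. coord_vector (U, x) p (\<xi> (x p)) \<eta> + \<eta> p * (?d (x p) / \<rho> (x p))) = (LINT p:U|\<mu>. T p)"
    unfolding set_lebesgue_integral_def
    by (intro Bochner_Integration.integral_cong refl)
      (use c in \<open>auto simp: T_def indicator_def coord_vector_apply[OF \<eta>]\<close>)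
  also have "\<dots> = (LINT q:?S|lborel. \<rho> q * T (inv_into U x q))"
    by (rule chart_integral(2)[OF \<mu> c \<rho> pos mT chart_sets_borelM[OF c]]) auto
  also have "\<dots> = (\<integral>q. (\<Sum>b\<in>Basis. frechet_derivative (F b) (at q) b) \<partial>lborel)"
    unfolding set_lebesgue_integral_def
  proof (intro Bochner_Integration.integral_cong refl)
    fix q
    show "indicator ?S q *\<^sub>R (\<rho> q * T (inv_into U x q)) = (\<Sum>b\<in>Basis. frechet_derivative (F b) (at q) b)"
    proof (cases "q \<in> ?S")
      case True
      have "(\<Sum>b\<in>Basis. frechet_derivative (F b) (at q) b)
          = (\<Sum>b\<in>Basis. ?f b q * frechet_derivative ?\<eta> (at q) b) + ?d q * ?\<eta> q"
        by (simp add: dF[OF True] sum.distrib sum_distrib_right)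
      also have "(\<Sum>b\<in>Basis. ?f b q * frechet_derivative ?\<eta> (at q) b) = \<rho> q * frechet_derivative ?\<eta> (at q) (\<xi> q)"
        unfolding linear_expand_Basis[OF lin[OF True], of "\<xi> q"] by (simp add: sum_distrib_left mult.assoc)
      finally show ?thesis
        using True c chart_inv_into[OF c True] pos[OF True] by (simp add: T_def algebra_simps)
    qed (simp add: dF0)
  qed
  also have "\<dots> = (\<Sum>b\<in>Basis. \<integral>q. frechet_derivative (F b) (at q) b \<partial>lborel)"
    by (rule Bochner_Integration.integral_sum) (rule integral_partial_derivative_eq_0(1)[OF sF C(1) F0])
  also have "\<dots> = 0" by (simp add: integral_partial_derivative_eq_0(2)[OF sF C(1) F0])
  finally show ?thesis .
qed


lemma has_chart_density_times:
  assumes "\<mu> \<in> Pinf" "(U, x) \<in> \<A>" "has_chart_density (measure \<mu>) (U, x) \<rho>" "\<And>q. q \<in> x ` U \<Longrightarrow> 0 < \<rho> q"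
    and "f \<in> borel_measurable borelM" "integrable \<mu> f" "\<And>A. A \<in> sets borelM \<Longrightarrow> \<nu> A = (LINT p:A|\<mu>. f p)"
  shows "has_chart_density \<nu> (U, x) (\<lambda>q. \<rho> q * f (inv_into U x q))"
proof -
  have "set_integrable \<mu> A f" if "A \<in> sets borelM" for A
    unfolding set_integrable_def using that assms(6) PinfD(2)[OF assms(1)] by (intro integrable_mult_indicator) auto
  then show ?thesis
    using chart_integral[OF assms(1-5)] assms(7) by (auto simp: has_chart_density_def)
qed

end

context closed_manifold
begin

section \<open>Differentiation under the integral, divergences and global densities\<close>

lemma smooth_integrable:
  assumes "finite_measure \<nu>" "sets \<nu> = sets borelM" "f \<in> smooth_functions"
  shows "integrable \<nu> f"
proof -
  obtain B where B: "\<And>t p. t \<in> {0::real} \<Longrightarrow> p \<in> topspace M \<Longrightarrow> \<bar>f p\<bar> \<le> B"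
    using smooth_family_bounded[of UNIV "\<lambda>_. f" "{0}"] assms(3) by (auto simp: smooth_functions_iff)
  have "space \<nu> = topspace M" using sets_eq_imp_space_eq[OF assms(2)] by simp
  then have "AE p in \<nu>. norm (f p) \<le> B" using B by (intro AE_I2) simp
  moreover have "f \<in> borel_measurable \<nu>"
    using smooth_functions_measurable[OF assms(3)] measurable_cong_sets[OF assms(2) refl] by blast
  ultimately show ?thesis by (rule finite_measure.integrable_const_bound[OF assms(1)])
qed

lemma smooth_set_integrable:
  "finite_measure \<nu> \<Longrightarrow> sets \<nu> = sets borelM \<Longrightarrow> f \<in> smooth_functions \<Longrightarrow> A \<in> sets borelM \<Longrightarrow> set_integrable \<nu> A f"
  unfolding set_integrable_def by (intro integrable_mult_indicator smooth_integrable) auto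

lemma Pinf_finite: "\<mu> \<in> Pinf \<Longrightarrow> finite_measure \<mu>"
  using PinfD(1) prob_space.finite_measure by blast

lemmas Pinf_integrable = smooth_integrable[OF Pinf_finite PinfD(2)]
  and Pinf_set_integrable = smooth_set_integrable[OF Pinf_finite PinfD(2)]

text \<open>The second time derivative is bounded uniformly over the compact manifold and a compact
  interval of times, so the Taylor remainder is quadratic with one constant for all points and
  survives integration over a finite measure.\<close>

lemma set_integral_family_deriv:
  assumes \<nu>: "finite_measure \<nu>" "sets \<nu> = sets borelM" and J: "open J" "smooth_family J g" "t0 \<in> J" and A: "A \<in> sets borelM"
  shows "((\<lambda>t. LINT p:A|\<nu>. g t p) has_real_derivative (LINT p:A|\<nu>. time_deriv g t0 p)) (at t0)"
proof -
  interpret finite_measure \<nu> by (rule \<nu>(1))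
  have sp: "space \<nu> = topspace M" using sets_eq_imp_space_eq[OF \<nu>(2)] by simp
  note g1 = smooth_family_time_deriv[OF J(1,2)]
  note g2 = smooth_family_time_deriv[OF J(1) g1]
  obtain \<delta> where \<delta>: "\<delta> > 0" "cball t0 \<delta> \<subseteq> J" using J(1,3) open_contains_cball by blast
  obtain B where B: "\<And>t p. t \<in> cball t0 \<delta> \<Longrightarrow> p \<in> topspace M \<Longrightarrow> \<bar>time_deriv (time_deriv g) t p\<bar> \<le> B"
    using smooth_family_bounded[OF g2 compact_cball \<delta>(2)] by blast
  have taylor: "\<bar>g t p - g t0 p - (t - t0) * time_deriv g t0 p\<bar> \<le> B * (t - t0)\<^sup>2"
    if t: "\<bar>t - t0\<bar> < \<delta>" and p: "p \<in> topspace M" for t p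
  proof -
    let ?S = "closed_segment t0 t"
    have S: "?S \<subseteq> cball t0 \<delta>"
      using t by (intro closed_segment_subset) (auto simp: dist_real_def abs_minus_commute)
    have B0: "B \<ge> 0" using B[of t0 p] \<delta> p by force
    have d1: "\<bar>time_deriv g s p - time_deriv g t0 p\<bar> \<le> B * \<bar>t - t0\<bar>" if s: "s \<in> ?S" for s
    proof -
      have "norm (time_deriv g s p - time_deriv g t0 p) \<le> B * \<bar>s - t0\<bar>"
      proof (rule vector_derivative_bound[of ?S _ "\<lambda>s. time_deriv (time_deriv g) s p"])
        fix r assume r: "r \<in> ?S"
        have "((\<lambda>s. time_deriv g s p) has_vector_derivative time_deriv (time_deriv g) r p) (at r)"
          using has_time_deriv[OF g1 _ p, of r] r S \<delta>(2)
          by (auto simp: has_real_derivative_iff_has_vector_derivative)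
        then show "((\<lambda>s. time_deriv g s p) has_vector_derivative time_deriv (time_deriv g) r p) (at r within ?S)"
          by (rule has_vector_derivative_at_within)
        show "norm (time_deriv (time_deriv g) r p) \<le> B" using B[OF subsetD[OF S r] p] by simp
      qed (use s in auto)
      also have "\<dots> \<le> B * \<bar>t - t0\<bar>"
        using s B0 by (intro mult_left_mono) (auto simp: closed_segment_eq_real_ivl split: if_splits)
      finally show ?thesis by simp
    qed
    have "norm ((g t p - t * time_deriv g t0 p) - (g t0 p - t0 * time_deriv g t0 p)) \<le> (B * \<bar>t - t0\<bar>) * \<bar>t - t0\<bar>"
    proof (rule vector_derivative_bound[of ?S _ "\<lambda>s. time_deriv g s p - time_deriv g t0 p"])
      fix s assume s: "s \<in> ?S"
      have "((\<lambda>s. g s p - s * time_deriv g t0 p) has_real_derivative time_deriv g s p - 1 * time_deriv g t0 p) (at s)"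
        by (intro DERIV_diff DERIV_cmult_right DERIV_ident has_time_deriv[OF J(2) _ p]) (use s S \<delta>(2) in blast)
      then show "((\<lambda>s. g s p - s * time_deriv g t0 p) has_vector_derivative time_deriv g s p - time_deriv g t0 p) (at s within ?S)"
        by (auto simp: has_real_derivative_iff_has_vector_derivative intro: has_vector_derivative_at_within)
    qed (use d1 in auto)
    then show ?thesis by (simp add: algebra_simps power2_eq_square)
  qed
  show ?thesis
  proof (rule has_real_derivative_quadratic[OF \<delta>(1), where K = "B * measure \<nu> (space \<nu>)"])
    fix t assume t: "\<bar>t - t0\<bar> < \<delta>"
    have tJ: "t \<in> J" using t \<delta>(2) by (auto simp: dist_real_def subset_iff abs_minus_commute)
    have i: "set_integrable \<nu> A (g t)" "set_integrable \<nu> A (g t0)" "set_integrable \<nu> A (time_deriv g t0)"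
      by (intro smooth_set_integrable[OF \<nu> _ A] smooth_family_at[OF J(1)] J g1 tJ)+
    let ?r = "\<lambda>p. indicator A p * (g t p - g t0 p - (t - t0) * time_deriv g t0 p)"
    have ri: "integrable \<nu> ?r"
    proof -
      have "set_integrable \<nu> A (\<lambda>p. g t p - g t0 p - (t - t0) * time_deriv g t0 p)"
        by (intro set_integral_diff(1) set_integrable_mult_right i)
      then show ?thesis by (simp add: set_integrable_def)
    qed
    have "(LINT p:A|\<nu>. g t p) - (LINT p:A|\<nu>. g t0 p) - (t - t0) * (LINT p:A|\<nu>. time_deriv g t0 p)
        = (LINT p:A|\<nu>. g t p - g t0 p - (t - t0) * time_deriv g t0 p)"
      using i by (simp add: set_integral_diff set_integrable_mult_right)
    also have "\<dots> = integral\<^sup>L \<nu> ?r" by (simp add: set_lebesgue_integral_def)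
    finally have "\<bar>(LINT p:A|\<nu>. g t p) - (LINT p:A|\<nu>. g t0 p) - (t - t0) * (LINT p:A|\<nu>. time_deriv g t0 p)\<bar>
        \<le> (\<integral>p. \<bar>?r p\<bar> \<partial>\<nu>)"
      using integral_norm_bound[of \<nu> ?r] by simp
    also have "\<dots> \<le> (\<integral>p. B * (t - t0)\<^sup>2 \<partial>\<nu>)"
    proof (rule integral_mono)
      fix p assume "p \<in> space \<nu>"
      then have "\<bar>g t p - g t0 p - (t - t0) * time_deriv g t0 p\<bar> \<le> B * (t - t0)\<^sup>2" using taylor[OF t] sp by simp
      then show "\<bar>?r p\<bar> \<le> B * (t - t0)\<^sup>2"
        by (cases "p \<in> A") (auto intro: order_trans[OF abs_ge_zero])
    qed (use ri in auto)
    also have "\<dots> = B * measure \<nu> (space \<nu>) * (t - t0)\<^sup>2" by simp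
    finally show "\<bar>(LINT p:A|\<nu>. g t p) - (LINT p:A|\<nu>. g t0 p) - (t - t0) * (LINT p:A|\<nu>. time_deriv g t0 p)\<bar>
        \<le> B * measure \<nu> (space \<nu>) * (t - t0)\<^sup>2" .
  qed
qed

lemma integral_family_deriv:
  assumes \<nu>: "finite_measure \<nu>" "sets \<nu> = sets borelM" and J: "open J" "smooth_family J g" "t0 \<in> J"
  shows "((\<lambda>t. \<integral>p. g t p \<partial>\<nu>) has_real_derivative (\<integral>p. time_deriv g t0 p \<partial>\<nu>)) (at t0)"
proof -
  have sp: "space \<nu> = topspace M" using sets_eq_imp_space_eq[OF \<nu>(2)] by simp
  have "topspace M \<in> sets borelM" by (rule openin_sets_borelM) simp
  from set_integral_family_deriv[OF \<nu> J this]
  have d: "((\<lambda>t. LINT p:space \<nu>|\<nu>. g t p) has_real_derivative (LINT p:space \<nu>|\<nu>. time_deriv g t0 p)) (at t0)"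
    by (simp add: sp)
  have eq: "(LINT p:space \<nu>|\<nu>. g t p) = (\<integral>p. g t p \<partial>\<nu>)" if "t \<in> J" for t
    by (rule set_integral_space[OF smooth_integrable[OF \<nu> smooth_family_at[OF J(1,2) that]]])
  have "(LINT p:space \<nu>|\<nu>. time_deriv g t0 p) = (\<integral>p. time_deriv g t0 p \<partial>\<nu>)"
    by (rule set_integral_space[OF smooth_integrable[OF \<nu> smooth_family_at[OF J(1) smooth_family_time_deriv[OF J(1,2)] J(3)]]])
  with has_field_derivative_transform_within_open[OF d J(1,3) eq] show ?thesis by simp
qed

lemma smooth_on_integral_family:
  assumes \<nu>: "finite_measure \<nu>" "sets \<nu> = sets borelM" and J: "open J" "smooth_family J g"
  shows "smooth_on J (\<lambda>t. \<integral>p. g t p \<partial>\<nu>)"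
proof (rule smooth_onI)
  fix k show "Ck_on k J (\<lambda>t. \<integral>p. g t p \<partial>\<nu>)"
    using J(2)
  proof (induction k arbitrary: g)
    case 0
    then show ?case
      using DERIV_isCont[OF integral_family_deriv[OF \<nu> J(1) 0]] by (auto intro!: continuous_at_imp_continuous_on)
  next
    case (Suc k)
    show ?case
      by (rule Ck_on_real_Suc[OF J(1) integral_family_deriv[OF \<nu> J(1) Suc.prems] Suc.IH[OF smooth_family_time_deriv[OF J(1) Suc.prems]]])
  qed
qed

lemma frechet_derivative_section:
  assumes "(G has_derivative G') (at (t, q))"
  shows "frechet_derivative (\<lambda>q. G (t, q)) (at q) b = G' (0, b)"
proof -
  have "((\<lambda>q. (t, q)) has_derivative (\<lambda>v. (0, v))) (at q)"
    by (auto intro!: derivative_eq_intros)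
  from has_derivative_compose[OF this assms] have "((\<lambda>q. G (t, q)) has_derivative (\<lambda>v. G' (0, v))) (at q)" .
  from fun_cong[OF frechet_derivative_at[OF this], of b] show ?thesis by simp
qed

text \<open>The chart formula is applied to the test function \<open>\<eta> i * \<psi>\<close>,
  whose support lies in one chart, and summed over the partition. The divergence appears as the sum
  of the chart divergences weighted by \<open>\<eta> i\<close>, each extended by zero.\<close>

lemma divergence_exists:
  assumes \<mu>: "\<mu> \<in> Pinf" and J: "open J" "smooth_field J X"
  obtains D where "smooth_family J D"
    "\<And>t \<psi>. t \<in> J \<Longrightarrow> \<psi> \<in> smooth_functions \<Longrightarrow> (\<integral>p. X t p \<psi> \<partial>\<mu>) = - (\<integral>p. \<psi> p * D t p \<partial>\<mu>)"
proof -
  obtain F :: "'a set" and U x C \<eta> where part: "chart_partition F U x C \<eta>"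
    using partition_of_unity by blast
  note F = chart_partitionD(1)[OF part] and c = chart_partitionD(2)[OF part] and C = chart_partitionD(3,4)[OF part]
    and \<eta> = chart_partitionD(5-7)[OF part]
  have "\<forall>i\<in>F. \<exists>\<rho>. smooth_on (x i ` U i) \<rho> \<and> (\<forall>q\<in>x i ` U i. \<rho> q > 0) \<and> has_chart_density (measure \<mu>) (U i, x i) \<rho>"
    using PinfD(4)[OF \<mu>] c by blast
  from bchoice[OF this] obtain \<rho> where \<rho>: "\<And>i. i \<in> F \<Longrightarrow> smooth_on (x i ` U i) (\<rho> i)"
    "\<And>i q. i \<in> F \<Longrightarrow> q \<in> x i ` U i \<Longrightarrow> \<rho> i q > 0" "\<And>i. i \<in> F \<Longrightarrow> has_chart_density (measure \<mu>) (U i, x i) (\<rho> i)"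
    by blast
  have "\<forall>i\<in>F. \<exists>\<xi>. smooth_on (J \<times> x i ` U i) \<xi> \<and> (\<forall>t\<in>J. \<forall>p\<in>U i. X t p = coord_vector (U i, x i) p (\<xi> (t, x i p)))"
    using J(2) c unfolding smooth_field_def by blast
  from bchoice[OF this] obtain \<xi> where \<xi>: "\<And>i. i \<in> F \<Longrightarrow> smooth_on (J \<times> x i ` U i) (\<xi> i)"
    "\<And>i t p. i \<in> F \<Longrightarrow> t \<in> J \<Longrightarrow> p \<in> U i \<Longrightarrow> X t p = coord_vector (U i, x i) p (\<xi> i (t, x i p))"
    by blast
  have o: "open (J \<times> x i ` U i)" if "i \<in> F" for i by (rule open_chart_Times[OF J(1) c[OF that]])
  define G where "G i b z = \<rho> i (snd z) * (\<xi> i z \<bullet> b)" for i and b :: 'e and z :: "real \<times> 'e"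
  have s\<rho>: "smooth_on (J \<times> x i ` U i) (\<lambda>z. \<rho> i (snd z))" if i: "i \<in> F" for i
    by (rule smooth_on_compose[OF \<rho>(1)[OF i]])
      (use o[OF i] chart_codomain[OF c[OF i]] in \<open>auto intro!: smooth_on_intros\<close>)
  have sG: "smooth_on (J \<times> x i ` U i) (G i b)" if i: "i \<in> F" for i b
    unfolding G_def by (intro smooth_on_mult smooth_on_inner smooth_on_const o i s\<rho> \<xi>)
  define d where "d i z = (\<Sum>b\<in>Basis. frechet_derivative (G i b) (at z) (0, b)) / \<rho> i (snd z)" for i z
  have sd: "smooth_on (J \<times> x i ` U i) (d i)" if i: "i \<in> F" for i
  proof -
    have "smooth_on (J \<times> x i ` U i) (\<lambda>z. \<Sum>b\<in>Basis. frechet_derivative (G i b) (at z) (0, b))"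
    proof (rule smooth_on_sum[OF o[OF i]])
      show "smooth_on (J \<times> x i ` U i) (\<lambda>z. frechet_derivative (G i b) (at z) (0, b))" for b
        using smooth_on_frechet_derivative[OF sG[OF i]] .
    qed
    from smooth_on_divide[OF o[OF i] this s\<rho>[OF i]] show ?thesis
      using \<rho>(2)[OF i] unfolding d_def by force
  qed
  define K where "K i z = \<eta> i (inv_into (U i) (x i) (snd z)) * d i z" for i z
  define Di where "Di i t p = (if p \<in> U i then K i (t, x i p) else 0)" for i t p
  have sDi: "smooth_family J (Di i)" if i: "i \<in> F" for i
    unfolding Di_def
  proof (rule smooth_family_extend[OF J(1) c[OF i] C(1)[OF i] C(2)[OF i]])
    have "smooth_on (J \<times> x i ` U i) (\<lambda>z. \<eta> i (inv_into (U i) (x i) (snd z)))"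
      by (rule smooth_on_compose[OF smooth_functionsD[OF \<eta>(1)[OF i] c[OF i]]])
        (use o[OF i] chart_codomain[OF c[OF i]] in \<open>auto intro!: smooth_on_intros\<close>)
    then show "smooth_on (J \<times> x i ` U i) (K i)"
      unfolding K_def by (intro smooth_on_mult o i sd)
    show "K i (t, q) = 0" if "q \<in> x i ` U i" "q \<notin> C i" for t q
      using \<eta>(2)[OF i, of "inv_into (U i) (x i) q"] c[OF i] that by (auto simp: K_def)
  qed
  show ?thesis
  proof (rule that[of "\<lambda>t p. \<Sum>i\<in>F. Di i t p"])
    show "smooth_family J (\<lambda>t p. \<Sum>i\<in>F. Di i t p)" by (rule smooth_family_sum[OF J(1) sDi])
    fix t \<psi> assume t: "t \<in> J" and \<psi>: "\<psi> \<in> smooth_functions"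
    have f: "(\<lambda>p. \<eta> i p * \<psi> p) \<in> smooth_functions" if "i \<in> F" for i
      by (rule smooth_functions_mult[OF \<eta>(1)[OF that] \<psi>])
    have Xf: "(\<lambda>p. X t p f) \<in> smooth_functions" if "f \<in> smooth_functions" for f
      using smooth_family_at[OF J(1) smooth_field_apply[OF J smooth_family_const[OF J(1) that]] t] by simp
    have \<psi>D: "(\<lambda>p. \<psi> p * Di i t p) \<in> smooth_functions" if "i \<in> F" for i
      by (rule smooth_functions_mult[OF \<psi> smooth_family_at[OF J(1) sDi[OF that] t]])
    \<comment> \<open>Outside \<open>U i\<close> the function \<open>\<eta> i\<close> vanishes on a
      whole neighbourhood, the complement of a compact set, so its derivative vanishes as
      well.\<close>
    have zero: "X t p (\<lambda>p. \<eta> i p * \<psi> p) = 0" if i: "i \<in> F" and p: "p \<in> topspace M" "p \<notin> U i" for i p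
    proof -
      obtain V y where V: "(V, y) \<in> \<A>" "p \<in> V" using chart_at[OF p(1)] .
      obtain v where v: "X t p = coord_vector (V, y) p v" using smooth_field_tangent[OF J(2) t V] .
      let ?W = "topspace M - {p \<in> U i. x i p \<in> C i}"
      have "openin M ?W"
        using compactin_imp_closedin[OF Hausdorff chart_compact_vimage[OF c[OF i] C(1)[OF i] C(2)[OF i]]] by blast
      then have "coord_vector (V, y) p v (\<lambda>p. \<eta> i p * \<psi> p) = coord_vector (V, y) p v (\<lambda>p. 0)"
        by (rule coord_vector_local[OF V f[OF i] smooth_functions_const]) (use p \<eta>(2)[OF i] in auto)
      then show ?thesis using coord_vector_const[OF V] v by simp
    qed
    have single: "(\<integral>p. X t p (\<lambda>p. \<eta> i p * \<psi> p) \<partial>\<mu>) = - (\<integral>p. \<psi> p * Di i t p \<partial>\<mu>)" if i: "i \<in> F" for i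
    proof -
      have sx: "smooth_on (x i ` U i) (\<lambda>q. \<xi> i (t, q))"
        by (rule smooth_on_compose[OF \<xi>(1)[OF i]])
          (use o[OF i] t chart_codomain[OF c[OF i]] in \<open>auto intro!: smooth_on_intros\<close>)
      have "0 = (LINT p:U i|\<mu>. coord_vector (U i, x i) p (\<xi> i (t, x i p)) (\<lambda>p. \<eta> i p * \<psi> p) + \<eta> i p * \<psi> p *
        ((\<Sum>b\<in>Basis. frechet_derivative (\<lambda>q. \<rho> i q * (\<xi> i (t, q) \<bullet> b)) (at (x i p)) b) / \<rho> i (x i p)))"
        by (rule integral_divergence_chart[OF \<mu> c[OF i] \<rho>(3,2,1)[OF i] sx f[OF i] C(1)[OF i] C(2)[OF i], symmetric])
          (use i \<eta>(2)[OF i] in auto)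
      also have "\<dots> = (\<integral>p. X t p (\<lambda>p. \<eta> i p * \<psi> p) + \<psi> p * Di i t p \<partial>\<mu>)"
        unfolding set_lebesgue_integral_def
      proof (intro Bochner_Integration.integral_cong refl)
        fix p assume "p \<in> space \<mu>"
        then have p: "p \<in> topspace M" using PinfD(3)[OF \<mu>] by simp
        show "indicator (U i) p *\<^sub>R (coord_vector (U i, x i) p (\<xi> i (t, x i p)) (\<lambda>p. \<eta> i p * \<psi> p) + \<eta> i p * \<psi> p *
            ((\<Sum>b\<in>Basis. frechet_derivative (\<lambda>q. \<rho> i q * (\<xi> i (t, q) \<bullet> b)) (at (x i p)) b) / \<rho> i (x i p)))
            = X t p (\<lambda>p. \<eta> i p * \<psi> p) + \<psi> p * Di i t p"
        proof (cases "p \<in> U i")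
          case True
          have "frechet_derivative (\<lambda>q. \<rho> i q * (\<xi> i (t, q) \<bullet> b)) (at (x i p)) b
              = frechet_derivative (G i b) (at (t, x i p)) (0, b)" for b
            using frechet_derivative_section[OF smooth_on_has_derivative[OF sG[OF i]], of t "x i p" b b] t True
            by (simp add: G_def)
          then show ?thesis
            using True \<xi>(2)[OF i t True] c[OF i] by (simp add: Di_def K_def d_def)
        next
          case False
          then show ?thesis using zero[OF i p] by (simp add: Di_def)
        qed
      qed
      also have "\<dots> = (\<integral>p. X t p (\<lambda>p. \<eta> i p * \<psi> p) \<partial>\<mu>) + (\<integral>p. \<psi> p * Di i t p \<partial>\<mu>)"
        by (intro Bochner_Integration.integral_add Pinf_integrable[OF \<mu>  \<mu>] Xf f \<psi>D i)
      finally show ?thesis by simp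
    qed
    have "(\<integral>p. X t p \<psi> \<partial>\<mu>) = (\<integral>p. (\<Sum>i\<in>F. X t p (\<lambda>p. \<eta> i p * \<psi> p)) \<partial>\<mu>)"
    proof (intro Bochner_Integration.integral_cong refl)
      fix p assume "p \<in> space \<mu>"
      then have p: "p \<in> topspace M" using PinfD(3)[OF \<mu>] by simp
      obtain V y where V: "(V, y) \<in> \<A>" "p \<in> V" using chart_at[OF p(1)] .
      obtain v where v: "X t p = coord_vector (V, y) p v" using smooth_field_tangent[OF J(2) t V] .
      have sumf: "(\<lambda>p. \<Sum>i\<in>F. \<eta> i p * \<psi> p) \<in> smooth_functions"
        by (rule smooth_functions_sum) (rule f)
      have "coord_vector (V, y) p v \<psi> = coord_vector (V, y) p v (\<lambda>p. \<Sum>i\<in>F. \<eta> i p * \<psi> p)"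
        by (rule coord_vector_cong[OF V \<psi> sumf]) (subst sum_distrib_right[symmetric], simp add: \<eta>(3))
      then show "X t p \<psi> = (\<Sum>i\<in>F. X t p (\<lambda>p. \<eta> i p * \<psi> p))"
        unfolding v using coord_vector_sum[OF V f] by simp
    qed
    also have "\<dots> = (\<Sum>i\<in>F. \<integral>p. X t p (\<lambda>p. \<eta> i p * \<psi> p) \<partial>\<mu>)"
      by (intro Bochner_Integration.integral_sum Pinf_integrable[OF \<mu> \<mu>] Xf f)
    also have "\<dots> = - (\<Sum>i\<in>F. \<integral>p. \<psi> p * Di i t p \<partial>\<mu>)"
      by (simp add: single sum_negf)
    also have "(\<Sum>i\<in>F. \<integral>p. \<psi> p * Di i t p \<partial>\<mu>) = (\<integral>p. (\<Sum>i\<in>F. \<psi> p * Di i t p) \<partial>\<mu>)"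
      by (intro Bochner_Integration.integral_sum[symmetric] Pinf_integrable[OF \<mu> \<mu>] \<psi>D)
    finally show "(\<integral>p. X t p \<psi> \<partial>\<mu>) = - (\<integral>p. \<psi> p * (\<Sum>i\<in>F. Di i t p) \<partial>\<mu>)"
      by (simp add: sum_distrib_left)
  qed
qed

text \<open>In chart \<open>i\<close> the density relative to \<mu> can only be the quotient
  \<open>k i\<close> of the chart densities of \<open>\<nu> t\<close> and \<mu>. Integrals over
  subsets of an overlap show that two such quotients agree there almost everywhere; averaging them
  with the partition gives one smooth function that represents all of them.\<close>

lemma density_family_exists:
  assumes \<mu>: "\<mu> \<in> Pinf" and J: "open J"
    and add: "\<And>t A B. t \<in> J \<Longrightarrow> A \<in> sets borelM \<Longrightarrow> B \<in> sets borelM \<Longrightarrow> A \<inter> B = {} \<Longrightarrow> \<nu> t (A \<union> B) = \<nu> t A + (\<nu> t B :: real)"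
    and dens: "\<And>U x. (U, x) \<in> \<A> \<Longrightarrow> \<exists>\<rho>. smooth_on (J \<times> x ` U) (\<lambda>(t, q). \<rho> t q) \<and>
      (\<forall>t\<in>J. has_chart_density (\<nu> t) (U, x) (\<rho> t))"
  obtains h where "smooth_family J h" "\<And>t A. t \<in> J \<Longrightarrow> A \<in> sets borelM \<Longrightarrow> \<nu> t A = (LINT p:A|\<mu>. h t p)"
proof -
  obtain F :: "'a set" and U x C \<eta> where part: "chart_partition F U x C \<eta>"
    using partition_of_unity by blast
  note F = chart_partitionD(1)[OF part] and c = chart_partitionD(2)[OF part] and C = chart_partitionD(3,4)[OF part]
    and \<eta> = chart_partitionD(5-7)[OF part]
  note sets\<mu> = PinfD(2)[OF \<mu>]
  have "\<forall>i\<in>F. \<exists>r. smooth_on (x i ` U i) r \<and> (\<forall>q\<in>x i ` U i. r q > 0) \<and> has_chart_density (measure \<mu>) (U i, x i) r"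
    using PinfD(4)[OF \<mu>] c by blast
  from bchoice[OF this] obtain r where r: "\<And>i. i \<in> F \<Longrightarrow> smooth_on (x i ` U i) (r i)"
    "\<And>i q. i \<in> F \<Longrightarrow> q \<in> x i ` U i \<Longrightarrow> r i q > 0" "\<And>i. i \<in> F \<Longrightarrow> has_chart_density (measure \<mu>) (U i, x i) (r i)"
    by blast
  have "\<forall>i\<in>F. \<exists>\<rho>. smooth_on (J \<times> x i ` U i) (\<lambda>(t, q). \<rho> t q) \<and> (\<forall>t\<in>J. has_chart_density (\<nu> t) (U i, x i) (\<rho> t))"
    using dens c by blast
  from bchoice[OF this] obtain \<rho> where \<rho>: "\<And>i. i \<in> F \<Longrightarrow> smooth_on (J \<times> x i ` U i) (\<lambda>(t, q). \<rho> i t q)"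
    "\<And>i t. i \<in> F \<Longrightarrow> t \<in> J \<Longrightarrow> has_chart_density (\<nu> t) (U i, x i) (\<rho> i t)"
    by blast
  have o: "open (J \<times> x i ` U i)" if "i \<in> F" for i by (rule open_chart_Times[OF J(1) c[OF that]])
  define k where "k i t p = (if p \<in> U i then \<rho> i t (x i p) / r i (x i p) else 0)" for i t p
  have Um: "U i \<in> sets borelM" if "i \<in> F" for i by (rule chart_sets_borelM[OF c[OF that]])
  have km: "k i t \<in> borel_measurable borelM" if i: "i \<in> F" "t \<in> J" for i t
  proof -
    have "continuous_on (x i ` U i) (\<lambda>q. case (t, q) of (t, q) \<Rightarrow> \<rho> i t q)"
      by (rule continuous_on_compose2[OF smooth_on_imp_continuous_on[OF \<rho>(1)[OF i(1)]]])
        (use i in \<open>auto intro!: continuous_intros\<close>)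
    then have "continuous_on (x i ` U i) (\<lambda>q. \<rho> i t q / r i q)"
      using smooth_on_imp_continuous_on[OF r(1)[OF i(1)]] r(2)[OF i(1)]
      by (intro continuous_on_divide) (auto simp: less_imp_neq[symmetric])
    then show ?thesis unfolding k_def by (rule chart_function_measurable[OF c[OF i(1)]])
  qed
  have k\<mu>: "k i t \<in> borel_measurable \<mu>" if "i \<in> F" "t \<in> J" for i t using km[OF that] Pinf_measurable[OF \<mu>] by blast
  have kint: "set_integrable \<mu> A (k i t)" "\<nu> t A = (LINT p:A|\<mu>. k i t p)"
    if i: "i \<in> F" "t \<in> J" and A: "A \<in> sets borelM" "A \<subseteq> U i" for i t A
  proof -
    have eq: "indicator (x i ` A) q *\<^sub>R (r i q * k i t (inv_into (U i) (x i) q)) = indicator (x i ` A) q *\<^sub>R \<rho> i t q" for q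
    proof (cases "q \<in> x i ` A")
      case True
      then have q: "q \<in> x i ` U i" using A(2) by blast
      then show ?thesis
        using chart_inv_into[OF c[OF i(1)] q] chart_right_inv[OF c[OF i(1)] q] r(2)[OF i(1) q] by (simp add: k_def)
    qed simp
    note ci = chart_integral[OF \<mu> c[OF i(1)] r(3,2)[OF i(1)] km[OF i] A]
    have "set_integrable lborel (x i ` A) (\<rho> i t)" "\<nu> t A = (LINT q:x i ` A|lborel. \<rho> i t q)"
      using \<rho>(2)[OF i] A by (auto simp: has_chart_density_def)
    moreover have eqf: "(\<lambda>q. indicator (x i ` A) q *\<^sub>R (r i q * k i t (inv_into (U i) (x i) q)))
        = (\<lambda>q. indicator (x i ` A) q *\<^sub>R \<rho> i t q)" by (rule ext) (rule eq)
    ultimately have "set_integrable lborel (x i ` A) (\<lambda>q. r i q * k i t (inv_into (U i) (x i) q))"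
      "\<nu> t A = (LINT q:x i ` A|lborel. r i q * k i t (inv_into (U i) (x i) q))"
      unfolding set_integrable_def set_lebesgue_integral_def eqf by auto
    then show "set_integrable \<mu> A (k i t)" "\<nu> t A = (LINT p:A|\<mu>. k i t p)"
      using ci i by auto
  qed
  have kk: "AE p in \<mu>. p \<in> U i \<inter> U j \<longrightarrow> k i t p = k j t p" if ij: "i \<in> F" "j \<in> F" "t \<in> J" for i j t
  proof (rule AE_eq_of_set_integrals[OF k\<mu>[OF ij(1,3)] k\<mu>[OF ij(2,3)]])
    show "U i \<inter> U j \<in> sets \<mu>" using Um ij sets\<mu> by auto
    show "set_integrable \<mu> (U i \<inter> U j) (k i t)" "set_integrable \<mu> (U i \<inter> U j) (k j t)"
      by (rule kint(1)[OF ij(1,3)] kint(1)[OF ij(2,3)]; use Um ij in auto)+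
    show "(LINT p:A|\<mu>. k i t p) = (LINT p:A|\<mu>. k j t p)" if "A \<in> sets \<mu>" "A \<subseteq> U i \<inter> U j" for A
      using kint(2)[OF ij(1,3), of A] kint(2)[OF ij(2,3), of A] that sets\<mu> by auto
  qed
  define K where "K i z = \<eta> i (inv_into (U i) (x i) (snd z)) * ((case z of (t, q) \<Rightarrow> \<rho> i t q) / r i (snd z))" for i and z :: "real \<times> 'e"
  define h where "h t p = (\<Sum>i\<in>F. if p \<in> U i then K i (t, x i p) else 0)" for t p
  have hk: "h t p = (\<Sum>i\<in>F. \<eta> i p * k i t p)" for t p
    unfolding h_def by (rule sum.cong) (use c in \<open>auto simp: K_def k_def\<close>)
  have sh: "smooth_family J h"
    unfolding h_def
  proof (rule smooth_family_sum[OF J])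
    fix i assume i: "i \<in> F"
    show "smooth_family J (\<lambda>t p. if p \<in> U i then K i (t, x i p) else 0)"
    proof (rule smooth_family_extend[OF J(1) c[OF i] C(1)[OF i] C(2)[OF i]])
      have "smooth_on (J \<times> x i ` U i) (\<lambda>z. \<eta> i (inv_into (U i) (x i) (snd z)))"
        by (rule smooth_on_compose[OF smooth_functionsD[OF \<eta>(1)[OF i] c[OF i]]])
          (use o[OF i] chart_codomain[OF c[OF i]] in \<open>auto intro!: smooth_on_intros\<close>)
      moreover have "smooth_on (J \<times> x i ` U i) (\<lambda>z. r i (snd z))"
        by (rule smooth_on_compose[OF r(1)[OF i]])
          (use o[OF i] chart_codomain[OF c[OF i]] in \<open>auto intro!: smooth_on_intros\<close>)
      ultimately show "smooth_on (J \<times> x i ` U i) (K i)"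
        unfolding K_def using r(2)[OF i]
        by (intro smooth_on_mult smooth_on_divide o i \<rho>(1)) (auto simp: less_imp_neq[symmetric])
      show "K i (t, q) = 0" if "q \<in> x i ` U i" "q \<notin> C i" for t q
        using \<eta>(2)[OF i, of "inv_into (U i) (x i) q"] c[OF i] that by (auto simp: K_def)
    qed
  qed
  have h\<mu>: "h t \<in> borel_measurable \<mu>" if "t \<in> J" for t
    using smooth_functions_measurable[OF smooth_family_at[OF J sh that]] Pinf_measurable[OF \<mu>] by blast
  have local: "\<nu> t A = (LINT p:A|\<mu>. h t p)" if j: "j \<in> F" and t: "t \<in> J" and A: "A \<in> sets borelM" "A \<subseteq> U j" for j t A
  proof -
    have "AE p in \<mu>. \<forall>i\<in>F. p \<in> U i \<inter> U j \<longrightarrow> k i t p = k j t p"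
      using F kk[OF _ j t] by (subst AE_finite_all) auto
    then have "AE p\<in>A in \<mu>. k j t p = h t p"
    proof (rule AE_mp, intro AE_I2 impI)
      fix p assume p: "p \<in> space \<mu>" "\<forall>i\<in>F. p \<in> U i \<inter> U j \<longrightarrow> k i t p = k j t p" "p \<in> A"
      have "h t p = (\<Sum>i\<in>F. \<eta> i p * k j t p)"
        unfolding hk by (rule sum.cong) (use p A \<eta>(2) in auto)
      also have "\<dots> = k j t p"
        using \<eta>(3)[of p] p(1) PinfD(3)[OF \<mu>] by (simp flip: sum_distrib_right)
      finally show "k j t p = h t p" by simp
    qed
    then have "(LINT p:A|\<mu>. k j t p) = (LINT p:A|\<mu>. h t p)"
      using A sets\<mu> by (intro set_lebesgue_integral_cong_AE k\<mu>[OF j t] h\<mu>[OF t]) auto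
    then show ?thesis using kint(2)[OF j t A] by simp
  qed
  \<comment> \<open>Additivity cuts a Borel set into pieces contained in single charts, one chart at
    a time.\<close>
  have global: "\<nu> t A = (LINT p:A|\<mu>. h t p)" if t: "t \<in> J" and fin: "finite F'" and sub: "F' \<subseteq> F"
    and A: "A \<in> sets borelM" "A \<subseteq> (\<Union>i\<in>F'. U i)" for t F' A
    using fin sub A
  proof (induction F' arbitrary: A rule: finite_induct)
    case empty
    then have "A = {}" by auto
    moreover have "\<nu> t {} = 0" using add[OF t, of "{}" "{}"] by simp
    ultimately show ?case by (simp add: set_lebesgue_integral_def)
  next
    case (insert j F')
    let ?A1 = "A \<inter> U j" and ?A2 = "A - U j"
    have m: "?A1 \<in> sets borelM" "?A2 \<in> sets borelM" using insert Um by auto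
    have A12: "A = ?A1 \<union> ?A2" "?A1 \<inter> ?A2 = {}" by auto
    have hi: "set_integrable \<mu> B (h t)" if "B \<in> sets borelM" for B
      by (rule Pinf_set_integrable[OF \<mu> \<mu> smooth_family_at[OF J sh t] that])
    have "\<nu> t A = \<nu> t ?A1 + \<nu> t ?A2" using add[OF t m A12(2)] A12(1) by simp
    also have "\<nu> t ?A1 = (LINT p:?A1|\<mu>. h t p)" by (rule local[OF _ t m(1)]) (use insert in auto)
    also have "\<nu> t ?A2 = (LINT p:?A2|\<mu>. h t p)" by (rule insert.IH[OF _ m(2)]) (use insert in auto)
    also have "(LINT p:?A1|\<mu>. h t p) + (LINT p:?A2|\<mu>. h t p) = (LINT p:?A1 \<union> ?A2|\<mu>. h t p)"
      by (rule set_integral_Un[OF A12(2) hi[OF m(1)] hi[OF m(2)], symmetric])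
    finally show ?case using A12(1) by simp
  qed
  have cov: "A \<subseteq> (\<Union>i\<in>F. U i)" if "A \<in> sets borelM" for A
  proof
    fix p assume "p \<in> A"
    then have "p \<in> topspace M" using sets.sets_into_space[OF that] by auto
    then have "(\<Sum>i\<in>F. \<eta> i p) \<noteq> 0" using \<eta>(3) by simp
    then obtain i where "i \<in> F" "\<eta> i p \<noteq> 0" by (rule sum.not_neutral_contains_not_neutral)
    then show "p \<in> (\<Union>i\<in>F. U i)" using \<eta>(2) by blast
  qed
  show ?thesis
  proof (rule that[OF sh])
    show "\<nu> t A = (LINT p:A|\<mu>. h t p)" if "t \<in> J" "A \<in> sets borelM" for t A
      by (rule global[OF that(1) F order_refl that(2) cov[OF that(2)]])
  qed
qed

section \<open>The space of smooth positive probability measures\<close>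

text \<open>The value 0 off the Borel sets follows the convention of
  \<open>smooth_densities\<close>, so that tangent vectors can be compared as functions on all
  sets.\<close>

definition dens :: "'a measure \<Rightarrow> ('a \<Rightarrow> real) \<Rightarrow> 'a set \<Rightarrow> real" where
  "dens \<mu> h A = (if A \<in> sets borelM then LINT p:A|\<mu>. h p else 0)"

lemma topspace_sets_borelM: "topspace M \<in> sets borelM"
  by (rule openin_sets_borelM) simp

lemma dens_topspace:
  assumes "\<mu> \<in> Pinf" "h \<in> smooth_functions"
  shows "dens \<mu> h (topspace M) = (\<integral>p. h p \<partial>\<mu>)"
  using set_integral_space[OF Pinf_integrable[OF assms(1,1,2)]] topspace_sets_borelM PinfD(3)[OF assms(1)]
  by (simp add: dens_def)

lemma dens_countably_additive:
  fixes A :: "nat \<Rightarrow> 'a set"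
  assumes \<mu>: "\<mu> \<in> Pinf" and h: "h \<in> smooth_functions" and A: "range A \<subseteq> sets borelM" "disjoint_family A"
  shows "(\<lambda>i. dens \<mu> h (A i)) sums dens \<mu> h (\<Union>i. A i)"
proof -
  have Am: "A i \<in> sets borelM" for i using A by blast
  define B where "B n = (\<Union>i<n. A i)" for n
  have Bm: "B n \<in> sets borelM" for n unfolding B_def using Am by blast
  have int: "set_integrable \<mu> S h" if "S \<in> sets borelM" for S by (rule Pinf_set_integrable[OF \<mu> \<mu> h that])
  have "(\<Sum>i<n. dens \<mu> h (A i)) = (LINT p:B n|\<mu>. h p)" for n
  proof (induction n)
    case (Suc n)
    have "A i \<inter> A n = {}" if "i < n" for i
      using disjoint_family_onD[OF A(2) UNIV_I UNIV_I] that by simp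
    then have "B n \<inter> A n = {}" unfolding B_def by blast
    from set_integral_Un[OF this int[OF Bm] int[OF Am]]
    have "(LINT p:B n \<union> A n|\<mu>. h p) = (LINT p:B n|\<mu>. h p) + (LINT p:A n|\<mu>. h p)" .
    moreover have "B (Suc n) = B n \<union> A n" by (auto simp: B_def lessThan_Suc)
    ultimately show ?case using Suc Am by (simp add: dens_def)
  qed (simp add: B_def set_lebesgue_integral_def)
  moreover have "(\<lambda>n. LINT p:B n|\<mu>. h p) \<longlonglongrightarrow> (LINT p:(\<Union>n. B n)|\<mu>. h p)"
  proof (rule set_integral_cont_up)
    show "B n \<in> sets \<mu>" for n using Bm PinfD(2)[OF \<mu>] by simp
    show "incseq B" unfolding incseq_def B_def by (auto intro: less_le_trans)
    show "set_integrable \<mu> (\<Union>n. B n) h" by (rule int) (use Bm in blast)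
  qed
  moreover have "(\<Union>n. B n) = (\<Union>i. A i)" unfolding B_def by auto
  moreover have "(\<Union>i. A i) \<in> sets borelM" using Am by blast
  ultimately show ?thesis by (simp add: sums_def dens_def)
qed

lemma dens_smooth_density:
  assumes \<mu>: "\<mu> \<in> Pinf" and h: "h \<in> smooth_functions"
  shows "dens \<mu> h \<in> smooth_densities"
  unfolding smooth_densities_def
proof (intro CollectI conjI allI impI ballI)
  show "dens \<mu> h A = 0" if "A \<notin> sets borelM" for A using that by (simp add: dens_def)
  show "(\<lambda>i. dens \<mu> h (A i)) sums dens \<mu> h (\<Union>i. A i)"
    if "range A \<subseteq> sets borelM \<and> disjoint_family A" for A :: "nat \<Rightarrow> 'a set"
    using dens_countably_additive[OF \<mu> h] that by blast
  fix c assume "c \<in> \<A>"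
  then obtain U x where c: "c = (U, x)" "(U, x) \<in> \<A>" by (cases c) auto
  obtain \<rho> where \<rho>: "smooth_on (x ` U) \<rho>" "\<forall>q\<in>x ` U. \<rho> q > 0" "has_chart_density (measure \<mu>) (U, x) \<rho>"
    using PinfD(4)[OF \<mu> c(2)] by blast
  have "has_chart_density (dens \<mu> h) (U, x) (\<lambda>q. \<rho> q * h (inv_into U x q))"
    by (rule has_chart_density_times[OF \<mu> c(2) \<rho>(3) _ smooth_functions_measurable[OF h] Pinf_integrable[OF \<mu> \<mu> h]])
      (use \<rho>(2) in \<open>auto simp: dens_def\<close>)
  moreover have "smooth_on (x ` U) (\<lambda>q. \<rho> q * h (inv_into U x q))"
    by (intro smooth_on_mult chart_codomain[OF c(2)] \<rho>(1) smooth_functionsD[OF h c(2)])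
  ultimately show "case c of (U, x) \<Rightarrow> \<exists>\<rho>. smooth_on (x ` U) \<rho> \<and> has_chart_density (dens \<mu> h) (U, x) \<rho>"
    unfolding c(1) by auto
qed

text \<open>The set function is regarded as a family constant in time, so that
  \<open>density_family_exists\<close> applies; finite additivity has to be extracted from countable
  additivity first.\<close>

lemma smooth_densityE:
  assumes \<mu>: "\<mu> \<in> Pinf" and \<nu>: "\<nu> \<in> smooth_densities"
  obtains h where "h \<in> smooth_functions" "\<nu> = dens \<mu> h"
proof -
  have zero: "\<nu> A = 0" if "A \<notin> sets borelM" for A using \<nu> that by (auto simp: smooth_densities_def)
  have sums: "(\<lambda>i. \<nu> (A i)) sums \<nu> (\<Union>i. A i)" if "range A \<subseteq> sets borelM" "disjoint_family A" for A :: "nat \<Rightarrow> 'a set"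
    using \<nu> that by (auto simp: smooth_densities_def)
  \<comment> \<open>Applied to a sequence of empty sets, countable additivity makes a constant
    series converge, which forces the value 0.\<close>
  have "(\<lambda>i. \<nu> {}) sums \<nu> {}" using sums[of "\<lambda>_. {}"] by (simp add: disjoint_family_on_def)
  then have "summable (\<lambda>i::nat. \<nu> {})" by (rule sums_summable)
  then have empty: "\<nu> {} = 0" by (simp add: summable_const_iff)
  have add: "\<nu> (A \<union> B) = \<nu> A + \<nu> B" if "A \<in> sets borelM" "B \<in> sets borelM" "A \<inter> B = {}" for A B
  proof -
    define S where "S i = (if i = 0 then A else if i = 1 then B else {})" for i :: nat
    have "(\<lambda>i. \<nu> (S i)) sums \<nu> (\<Union>i. S i)"
      by (rule sums) (use that in \<open>auto simp: S_def disjoint_family_on_def\<close>)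
    moreover have "(\<Union>i. S i) = A \<union> B" by (auto simp: S_def split: if_splits)
    moreover have "(\<lambda>i. \<nu> (S i)) sums (\<Sum>i\<in>{0, 1}. \<nu> (S i))"
      by (rule sums_finite) (auto simp: S_def empty)
    ultimately show ?thesis using sums_unique2 by (fastforce simp: S_def)
  qed
  have dens: "\<exists>\<rho>. smooth_on (UNIV \<times> x ` U) (\<lambda>(t, q). \<rho> t q) \<and> (\<forall>t\<in>(UNIV::real set). has_chart_density \<nu> (U, x) (\<rho> t))"
    if c: "(U, x) \<in> \<A>" for U x
  proof -
    obtain \<rho> where \<rho>: "smooth_on (x ` U) \<rho>" "has_chart_density \<nu> (U, x) \<rho>"
      using \<nu> c by (auto simp: smooth_densities_def)
    have o: "open (UNIV \<times> x ` U :: (real \<times> 'e) set)" by (rule open_chart_Times[OF open_UNIV c])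
    have "smooth_on (UNIV \<times> x ` U) (\<lambda>z::real \<times> 'e. \<rho> (snd z))"
      by (rule smooth_on_compose[OF \<rho>(1)]) (use o chart_codomain[OF c] in \<open>auto intro!: smooth_on_intros\<close>)
    then show ?thesis using \<rho>(2) by (intro exI[of _ "\<lambda>t. \<rho>"]) (simp add: case_prod_unfold)
  qed
  obtain h where h: "smooth_family UNIV h" "\<And>t A. t \<in> (UNIV::real set) \<Longrightarrow> A \<in> sets borelM \<Longrightarrow> \<nu> A = (LINT p:A|\<mu>. h t p)"
    using density_family_exists[OF \<mu> open_UNIV, of "\<lambda>t. \<nu>"] add dens by blast
  have "\<nu> = dens \<mu> (h 0)" using h(2)[of 0] zero by (auto simp: dens_def fun_eq_iff)
  then show ?thesis using that[OF smooth_family_at[OF open_UNIV h(1) UNIV_I]] by blast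
qed

lemma AE_eq_of_dens:
  assumes \<mu>: "\<mu> \<in> Pinf" and h: "h \<in> smooth_functions" "k \<in> smooth_functions"
    and "\<And>A. A \<in> sets borelM \<Longrightarrow> (LINT p:A|\<mu>. h p) = (LINT p:A|\<mu>. k p)"
  shows "AE p in \<mu>. h p = k p"
proof -
  note sets\<mu> = PinfD(2)[OF \<mu>]
  have "AE p in \<mu>. p \<in> space \<mu> \<longrightarrow> h p = k p"
  proof (rule AE_eq_of_set_integrals)
    show "h \<in> borel_measurable \<mu>" "k \<in> borel_measurable \<mu>"
      using h smooth_functions_measurable Pinf_measurable[OF \<mu>] by blast+
    show "set_integrable \<mu> (space \<mu>) h" "set_integrable \<mu> (space \<mu>) k"
      using Pinf_set_integrable[OF \<mu> \<mu>] h topspace_sets_borelM PinfD(3)[OF \<mu>] by auto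
  qed (use assms(4) sets\<mu> in auto)
  then show ?thesis by (rule AE_mp) (auto intro!: AE_I2)
qed

lemma integral_cong_AE_smooth:
  assumes \<mu>: "\<mu> \<in> Pinf" and "f \<in> smooth_functions" "g \<in> smooth_functions" "AE p in \<mu>. f p = g p"
  shows "(\<integral>p. f p \<partial>\<mu>) = (\<integral>p. g p \<partial>\<mu>)"
  by (rule integral_cong_AE)
    (use assms smooth_functions_measurable Pinf_measurable[OF \<mu>] in blast)+

lemma tangent_PinfE:
  assumes "\<mu> \<in> Pinf" "v \<in> tangent_Pinf \<nu>"
  obtains h where "h \<in> smooth_functions" "v = dens \<mu> h" "(\<integral>p. h p \<partial>\<mu>) = 0"
  using smooth_densityE[OF assms(1), of v] assms dens_topspace[OF assms(1)]
  unfolding tangent_Pinf_def by (smt (verit) mem_Collect_eq)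

lemma dens_tangent_Pinf:
  "\<mu> \<in> Pinf \<Longrightarrow> h \<in> smooth_functions \<Longrightarrow> (\<integral>p. h p \<partial>\<mu>) = 0 \<Longrightarrow> dens \<mu> h \<in> tangent_Pinf \<nu>"
  by (simp add: tangent_Pinf_def dens_smooth_density dens_topspace)

text \<open>Nonnegativity of \<open>measure c\<close> forces \<open>h\<close> to be nonnegative
  almost everywhere; then \<open>c\<close> is \<mu> with density \<open>h\<close>, and the formula
  for sets extends to functions.\<close>

lemma Pinf_eq_density:
  assumes \<mu>: "\<mu> \<in> Pinf" and c: "c \<in> Pinf" and h: "h \<in> smooth_functions"
    and eq: "\<And>A. A \<in> sets borelM \<Longrightarrow> measure c A = (LINT p:A|\<mu>. h p)"
  shows "f \<in> borel_measurable borelM \<Longrightarrow> (\<integral>p. f p \<partial>c) = (\<integral>p. h p * (f p :: real) \<partial>\<mu>)"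
proof -
  assume f: "f \<in> borel_measurable borelM"
  note sets\<mu> = PinfD(2)[OF \<mu>] and setsc = PinfD(2)[OF c]
  interpret c: prob_space c by (rule PinfD(1)[OF c])
  have m [measurable]: "h \<in> borel_measurable \<mu>" "f \<in> borel_measurable \<mu>"
    using f smooth_functions_measurable[OF h] Pinf_measurable[OF \<mu>] by blast+
  have "AE p in \<mu>. p \<in> space \<mu> \<longrightarrow> 0 \<le> h p"
  proof (rule AE_le_of_set_integrals)
    show "set_integrable \<mu> (space \<mu>) (\<lambda>p. 0 :: real)" "set_integrable \<mu> (space \<mu>) h"
      using Pinf_set_integrable[OF \<mu> \<mu>] h smooth_functions_const topspace_sets_borelM PinfD(3)[OF \<mu>] by auto
    show "(LINT p:A|\<mu>. 0) \<le> (LINT p:A|\<mu>. h p)" if "A \<in> sets \<mu>" for A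
      using eq[of A] that sets\<mu> measure_nonneg[of c A] by (simp add: set_lebesgue_integral_def)
  qed auto
  then have nn: "AE p in \<mu>. 0 \<le> h p" by (rule AE_mp) (auto intro!: AE_I2)
  have "c = density \<mu> (\<lambda>p. ennreal (h p))"
  proof (rule measure_eqI)
    show "sets c = sets (density \<mu> (\<lambda>p. ennreal (h p)))" using sets\<mu> setsc by simp
    fix A assume "A \<in> sets c"
    then have A: "A \<in> sets borelM" "A \<in> sets \<mu>" using sets\<mu> setsc by auto
    have i: "integrable \<mu> (\<lambda>p. indicator A p *\<^sub>R h p)"
      using Pinf_set_integrable[OF \<mu> \<mu> h A(1)] by (simp add: set_integrable_def)
    have "emeasure (density \<mu> (\<lambda>p. ennreal (h p))) A = (\<integral>\<^sup>+p. ennreal (h p) * indicator A p \<partial>\<mu>)"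
      using A by (intro emeasure_density) auto
    also have "\<dots> = (\<integral>\<^sup>+p. ennreal (indicator A p *\<^sub>R h p) \<partial>\<mu>)"
      by (rule nn_integral_cong) (auto simp: indicator_def)
    also have "\<dots> = ennreal (LINT p:A|\<mu>. h p)"
      unfolding set_lebesgue_integral_def
      by (rule nn_integral_eq_integral[OF i]) (use nn in \<open>auto simp: indicator_def elim: AE_mp\<close>)
    also have "\<dots> = emeasure c A" using eq[OF A(1)] c.emeasure_eq_measure by simp
    finally show "emeasure c A = emeasure (density \<mu> (\<lambda>p. ennreal (h p))) A" by simp
  qed
  then show ?thesis using integral_density[OF m(2,1) nn] by simp
qed

text \<open>Replaces the chart densities of a curve by a single smooth family of functions relative
  to a fixed measure; from here on curves are handled through \<open>h\<close> alone.\<close>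

lemma smooth_curveE:
  assumes \<mu>: "\<mu> \<in> Pinf" and J: "open J" "smooth_curve J c"
  obtains h where "smooth_family J h" "\<And>t A. t \<in> J \<Longrightarrow> A \<in> sets borelM \<Longrightarrow> measure (c t) A = (LINT p:A|\<mu>. h t p)"
    "\<And>t f. t \<in> J \<Longrightarrow> f \<in> borel_measurable borelM \<Longrightarrow> (\<integral>p. f p \<partial>c t) = (\<integral>p. h t p * (f p :: real) \<partial>\<mu>)"
proof -
  have c: "c t \<in> Pinf" if "t \<in> J" for t using J that by (simp add: smooth_curve_def)
  have dens: "\<exists>\<rho>. smooth_on (J \<times> x ` U) (\<lambda>(t, q). \<rho> t q) \<and> (\<forall>t\<in>J. has_chart_density (measure (c t)) (U, x) (\<rho> t))"
    if "(U, x) \<in> \<A>" for U x using J that by (auto simp: smooth_curve_def)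
  have add: "measure (c t) (A \<union> B) = measure (c t) A + measure (c t) B"
    if "t \<in> J" "A \<in> sets borelM" "B \<in> sets borelM" "A \<inter> B = {}" for t A B
    using finite_measure.finite_measure_Union[OF Pinf_finite[OF c[OF that(1)]]] that PinfD(2)[OF c[OF that(1)]] by simp
  obtain h where h: "smooth_family J h" "\<And>t A. t \<in> J \<Longrightarrow> A \<in> sets borelM \<Longrightarrow> measure (c t) A = (LINT p:A|\<mu>. h t p)"
    using density_family_exists[OF \<mu> J(1), of "\<lambda>t. measure (c t)"] add dens by blast
  show ?thesis
  proof (rule that[OF h])
    show "(\<integral>p. f p \<partial>c t) = (\<integral>p. h t p * f p \<partial>\<mu>)" if "t \<in> J" "f \<in> borel_measurable borelM" for t and f :: "'a \<Rightarrow> real"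
      by (rule Pinf_eq_density[OF \<mu> c smooth_family_at[OF J(1) h(1)] h(2) that(2)]) (use that in auto)
  qed auto
qed

lemma smooth_curveI:
  assumes \<mu>: "\<mu> \<in> Pinf" and J: "open J" "smooth_family J h"
    and pos: "\<And>t p. t \<in> J \<Longrightarrow> p \<in> topspace M \<Longrightarrow> 0 < h t p" and one: "\<And>t. t \<in> J \<Longrightarrow> (\<integral>p. h t p \<partial>\<mu>) = 1"
    and c: "\<And>t. t \<in> J \<Longrightarrow> c t = density \<mu> (\<lambda>p. ennreal (h t p))"
  shows "smooth_curve J c" "\<And>t A. t \<in> J \<Longrightarrow> A \<in> sets borelM \<Longrightarrow> measure (c t) A = (LINT p:A|\<mu>. h t p)"
proof -
  note sets\<mu> = PinfD(2)[OF \<mu>]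
  have hs: "h t \<in> smooth_functions" if "t \<in> J" for t by (rule smooth_family_at[OF J that])
  have hm: "h t \<in> borel_measurable \<mu>" if "t \<in> J" for t
    using smooth_functions_measurable[OF hs[OF that]] Pinf_measurable[OF \<mu>] by blast
  have em: "emeasure (c t) A = ennreal (LINT p:A|\<mu>. h t p)" if t: "t \<in> J" and A: "A \<in> sets borelM" for t A
  proof -
    have i: "integrable \<mu> (\<lambda>p. indicator A p *\<^sub>R h t p)"
      using Pinf_set_integrable[OF \<mu> \<mu> hs[OF t] A] by (simp add: set_integrable_def)
    have "emeasure (c t) A = (\<integral>\<^sup>+p. ennreal (h t p) * indicator A p \<partial>\<mu>)"
      unfolding c[OF t] using A sets\<mu> hm[OF t] by (intro emeasure_density) auto
    also have "\<dots> = (\<integral>\<^sup>+p. ennreal (indicator A p *\<^sub>R h t p) \<partial>\<mu>)"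
      by (rule nn_integral_cong) (auto simp: indicator_def)
    also have "\<dots> = ennreal (LINT p:A|\<mu>. h t p)"
      unfolding set_lebesgue_integral_def
      by (rule nn_integral_eq_integral[OF i])
        (use pos[OF t] PinfD(3)[OF \<mu>] in \<open>auto simp: indicator_def less_imp_le intro!: AE_I2\<close>)
    finally show ?thesis .
  qed
  have nn: "0 \<le> (LINT p:A|\<mu>. h t p)" if "t \<in> J" for t A
    unfolding set_lebesgue_integral_def
    by (rule integral_nonneg_AE) (use pos[OF that] PinfD(3)[OF \<mu>] in \<open>auto simp: indicator_def less_imp_le intro!: AE_I2\<close>)
  show m: "measure (c t) A = (LINT p:A|\<mu>. h t p)" if "t \<in> J" "A \<in> sets borelM" for t A
    using em[OF that] nn[OF that(1)] by (simp add: measure_def)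
  have dens: "\<exists>\<rho>. smooth_on (J \<times> x ` U) (\<lambda>(t, q). \<rho> t q) \<and> (\<forall>t\<in>J. (\<forall>q\<in>x ` U. \<rho> t q > 0) \<and>
      has_chart_density (measure (c t)) (U, x) (\<rho> t))" if ch: "(U, x) \<in> \<A>" for U x
  proof -
    obtain r where r: "smooth_on (x ` U) r" "\<forall>q\<in>x ` U. r q > 0" "has_chart_density (measure \<mu>) (U, x) r"
      using PinfD(4)[OF \<mu> ch] by blast
    have o: "open (J \<times> x ` U)" by (rule open_chart_Times[OF J(1) ch])
    have "smooth_on (J \<times> x ` U) (\<lambda>z. r (snd z))"
      by (rule smooth_on_compose[OF r(1)]) (use o chart_codomain[OF ch] in \<open>auto intro!: smooth_on_intros\<close>)
    from smooth_on_mult[OF o this smooth_familyD[OF J(2) ch]]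
    have "smooth_on (J \<times> x ` U) (\<lambda>(t, q). r q * h t (inv_into U x q))" by (simp add: case_prod_unfold)
    moreover have "has_chart_density (measure (c t)) (U, x) (\<lambda>q. r q * h t (inv_into U x q))" if t: "t \<in> J" for t
      by (rule has_chart_density_times[OF \<mu> ch r(3) _ smooth_functions_measurable[OF hs[OF t]] Pinf_integrable[OF \<mu> \<mu> hs[OF t]] m[OF t]])
        (use r(2) in auto)
    moreover have "r q * h t (inv_into U x q) > 0" if "t \<in> J" "q \<in> x ` U" for t q
      using pos[OF that(1)] r(2) that chart_inv_into[OF ch that(2)] chart_subset[OF ch] by auto
    ultimately show ?thesis by (intro exI[of _ "\<lambda>t q. r q * h t (inv_into U x q)"]) auto
  qed
  have "c t \<in> Pinf" if t: "t \<in> J" for t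
    unfolding Pinf_def
  proof (intro CollectI conjI ballI)
    have sp: "space (c t) = topspace M" using c[OF t] PinfD(3)[OF \<mu>] by simp
    have "(LINT p:topspace M|\<mu>. h t p) = 1"
      using set_integral_space[OF Pinf_integrable[OF \<mu> \<mu> hs[OF t]]] one[OF t] PinfD(3)[OF \<mu>] by simp
    then show "prob_space (c t)" using em[OF t topspace_sets_borelM] sp by (intro prob_spaceI) simp
    show "sets (c t) = sets borelM" using c[OF t] sets\<mu> by simp
    fix ch assume "ch \<in> \<A>"
    then obtain U x where ch: "ch = (U, x)" "(U, x) \<in> \<A>" by (cases ch) auto
    obtain \<rho> where \<rho>: "smooth_on (J \<times> x ` U) (\<lambda>(t, q). \<rho> t q)"
      "\<forall>t\<in>J. (\<forall>q\<in>x ` U. \<rho> t q > 0) \<and> has_chart_density (measure (c t)) (U, x) (\<rho> t)"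
      using dens[OF ch(2)] by blast
    have "smooth_on (x ` U) (\<lambda>q. case (t, q) of (t, q) \<Rightarrow> \<rho> t q)"
      by (rule smooth_on_compose[OF \<rho>(1)])
        (use t chart_codomain[OF ch(2)] open_chart_Times[OF J(1) ch(2)] in \<open>auto intro!: smooth_on_intros\<close>)
    then show "case ch of (U, x) \<Rightarrow> \<exists>\<rho>. smooth_on (x ` U) \<rho> \<and> (\<forall>q\<in>x ` U. \<rho> q > 0) \<and> has_chart_density (measure (c t)) (U, x) \<rho>"
      unfolding ch(1) using \<rho>(2) t by auto
  qed
  then show "smooth_curve J c" using dens unfolding smooth_curve_def by blast
qed

section \<open>Velocities and differentials of linear functionals\<close>

lemma has_velocity_family:
  assumes \<mu>: "\<mu> \<in> Pinf" and J: "open J" "smooth_family J h" "t \<in> J"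
    and m: "\<And>t A. t \<in> J \<Longrightarrow> A \<in> sets borelM \<Longrightarrow> measure (c t) A = (LINT p:A|\<mu>. h t p)"
  shows "has_velocity c v t \<longleftrightarrow> v \<in> tangent_Pinf (c t) \<and> (\<forall>A\<in>sets borelM. v A = (LINT p:A|\<mu>. time_deriv h t p))"
proof -
  have "((\<lambda>s. measure (c s) A) has_real_derivative (LINT p:A|\<mu>. time_deriv h t p)) (at t)" if A: "A \<in> sets borelM" for A
    by (rule has_field_derivative_transform_within_open[OF set_integral_family_deriv[OF Pinf_finite[OF \<mu>] PinfD(2)[OF \<mu>] J A] J(1,3)])
      (simp add: m A)
  then show ?thesis unfolding has_velocity_def using DERIV_unique by metis
qed

lemma time_deriv_eqI:
  "((\<lambda>s. g s p) has_real_derivative d) (at t) \<Longrightarrow> time_deriv g t p = d"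
  unfolding time_deriv_def by (rule DERIV_imp_deriv)

lemma lin_fun_curve_deriv:
  assumes \<mu>: "\<mu> \<in> Pinf" and J: "open J" "t \<in> J" "smooth_family J k" and \<phi>: "\<phi> \<in> smooth_functions"
    and c: "\<And>t f. t \<in> J \<Longrightarrow> f \<in> borel_measurable borelM \<Longrightarrow> (\<integral>p. f p \<partial>c t) = (\<integral>p. k t p * (f p :: real) \<partial>\<mu>)"
  shows "((lin_fun \<phi> \<circ> c) has_real_derivative (\<integral>p. time_deriv k t p * \<phi> p \<partial>\<mu>)) (at t)"
proof -
  have fam: "smooth_family J (\<lambda>t p. k t p * \<phi> p)"
    by (intro smooth_family_mult J smooth_family_const \<phi>)
  have "time_deriv (\<lambda>t p. k t p * \<phi> p) t p = time_deriv k t p * \<phi> p" if "p \<in> topspace M" for p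
    by (intro time_deriv_eqI DERIV_cmult_right has_time_deriv[OF J(3,2) that])
  then have "(\<integral>p. time_deriv (\<lambda>t p. k t p * \<phi> p) t p \<partial>\<mu>) = (\<integral>p. time_deriv k t p * \<phi> p \<partial>\<mu>)"
    using PinfD(3)[OF \<mu>] by (intro Bochner_Integration.integral_cong refl) simp
  with integral_family_deriv[OF Pinf_finite[OF \<mu>] PinfD(2)[OF \<mu>] J(1) fam J(2)]
  have "((\<lambda>t. \<integral>p. k t p * \<phi> p \<partial>\<mu>) has_real_derivative (\<integral>p. time_deriv k t p * \<phi> p \<partial>\<mu>)) (at t)" by simp
  then show ?thesis
    by (rule has_field_derivative_transform_within_open[OF _ J(1,2)])
      (simp add: lin_fun_def c smooth_functions_measurable[OF \<phi>])
qed

text \<open>The curve is \<mu> with density \<open>1 + t * h p\<close>: the mean value 0 of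
  \<open>h\<close> preserves total mass. Without such a curve the defining condition of
  \<open>differential\<close> would hold vacuously for every number.\<close>

lemma smooth_curve_through:
  assumes \<mu>: "\<mu> \<in> Pinf" and h: "h \<in> smooth_functions" "(\<integral>p. h p \<partial>\<mu>) = 0"
  obtains J c where "open J" "0 \<in> J" "smooth_curve J c" "c 0 = \<mu>" "has_velocity c (dens \<mu> h) 0"
proof -
  obtain B where B: "\<And>t p. t \<in> {0::real} \<Longrightarrow> p \<in> topspace M \<Longrightarrow> \<bar>h p\<bar> \<le> B"
    using smooth_family_bounded[of UNIV "\<lambda>_. h" "{0}"] h by (auto simp: smooth_functions_iff)
  \<comment> \<open>For \<open>\<bar>t\<bar> < \<delta>\<close> the perturbation
    \<open>t * h p\<close> has modulus below 1, so the density stays positive.\<close>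
  define \<delta> where "\<delta> = 1 / (\<bar>B\<bar> + 1)"
  have \<delta>: "\<delta> > 0" by (simp add: \<delta>_def add_nonneg_pos)
  let ?J = "{-\<delta><..<\<delta>}"
  define k where "k t p = 1 + t * h p" for t p
  define c where "c t = density \<mu> (\<lambda>p. ennreal (k t p))" for t
  have J: "open ?J" "0 \<in> ?J" using \<delta> by auto
  have fam: "smooth_family ?J k" unfolding k_def
    by (intro smooth_family_add smooth_family_mult smooth_family_const h smooth_functions_const J(1)
        smooth_family_time[OF J(1) smooth_on_id[OF J(1)]])
  have pos: "k t p > 0" if "t \<in> ?J" "p \<in> topspace M" for t p
  proof -
    have "\<bar>t * h p\<bar> \<le> \<bar>t\<bar> * (\<bar>B\<bar> + 1)"
      unfolding abs_mult using B[of 0 p] that by (intro mult_left_mono) auto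
    also have "\<dots> < \<delta> * (\<bar>B\<bar> + 1)" using that by (intro mult_strict_right_mono) auto
    also have "\<dots> = 1" by (simp add: \<delta>_def add_nonneg_pos[THEN less_imp_neq, symmetric])
    finally show ?thesis by (simp add: k_def)
  qed
  interpret prob_space \<mu> by (rule PinfD(1)[OF \<mu>])
  have one: "(\<integral>p. k t p \<partial>\<mu>) = 1" for t
    unfolding k_def using Pinf_integrable[OF \<mu> \<mu> h(1)] h(2) by (simp add: prob_space)
  note sc = smooth_curveI[OF \<mu> J(1) fam pos one c_def]
  have m: "measure (c t) A = (LINT p:A|\<mu>. k t p)" if "t \<in> ?J" "A \<in> sets borelM" for t A
    using sc(2) that by blast
  have "c 0 = \<mu>" by (simp add: c_def k_def density_1)
  moreover have "has_velocity c (dens \<mu> h) 0"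
  proof (subst has_velocity_family[OF \<mu> J(1) fam J(2) m], assumption, assumption, intro conjI ballI)
    show "dens \<mu> h \<in> tangent_Pinf (c 0)" by (rule dens_tangent_Pinf[OF \<mu> h])
    fix A assume A: "A \<in> sets borelM"
    have "time_deriv k 0 p = h p" for p
      unfolding k_def by (rule time_deriv_eqI) (auto intro!: derivative_eq_intros)
    then show "dens \<mu> h A = (LINT p:A|\<mu>. time_deriv k 0 p)" using A by (simp add: dens_def)
  qed
  ultimately show ?thesis using that J sc(1) by blast
qed

text \<open>Along any curve with the given velocity the time derivative of the density equals
  \<open>h\<close> almost everywhere, so the derivative of \<open>lin_fun \<phi>\<close> depends on
  the velocity only; \<open>smooth_curve_through\<close> then singles out its value.\<close>

lemma differential_lin_fun:
  assumes \<mu>: "\<mu> \<in> Pinf" and \<phi>: "\<phi> \<in> smooth_functions" and h: "h \<in> smooth_functions" "(\<integral>p. h p \<partial>\<mu>) = 0"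
  shows "differential (lin_fun \<phi>) \<mu> (dens \<mu> h) = (\<integral>p. h p * \<phi> p \<partial>\<mu>)"
proof -
  let ?d = "\<integral>p. h p * \<phi> p \<partial>\<mu>"
  have all: "((lin_fun \<phi> \<circ> c) has_real_derivative ?d) (at 0)"
    if c: "open J" "0 \<in> J" "smooth_curve J c" "c 0 = \<mu>" "has_velocity c (dens \<mu> h) 0" for J c
  proof -
    obtain k where k: "smooth_family J k" "\<And>t A. t \<in> J \<Longrightarrow> A \<in> sets borelM \<Longrightarrow> measure (c t) A = (LINT p:A|\<mu>. k t p)"
      "\<And>t f. t \<in> J \<Longrightarrow> f \<in> borel_measurable borelM \<Longrightarrow> (\<integral>p. f p \<partial>c t) = (\<integral>p. k t p * (f p :: real) \<partial>\<mu>)"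
      using smooth_curveE[OF \<mu> c(1,3)] by blast
    have k0: "time_deriv k 0 \<in> smooth_functions"
      by (rule smooth_family_at[OF c(1) smooth_family_time_deriv[OF c(1) k(1)] c(2)])
    have "AE p in \<mu>. time_deriv k 0 p = h p"
    proof (rule AE_eq_of_dens[OF \<mu> k0 h(1)])
      show "(LINT p:A|\<mu>. time_deriv k 0 p) = (LINT p:A|\<mu>. h p)" if A: "A \<in> sets borelM" for A
      proof -
        have "has_velocity c (dens \<mu> h) 0 \<longleftrightarrow> dens \<mu> h \<in> tangent_Pinf (c 0) \<and>
            (\<forall>A\<in>sets borelM. dens \<mu> h A = (LINT p:A|\<mu>. time_deriv k 0 p))"
          by (rule has_velocity_family[OF \<mu> c(1) k(1) c(2)]) (rule k(2))
        then have "dens \<mu> h A = (LINT p:A|\<mu>. time_deriv k 0 p)" using c(5) A by blast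
        then show ?thesis using A by (simp add: dens_def)
      qed
    qed
    then have "(\<integral>p. time_deriv k 0 p * \<phi> p \<partial>\<mu>) = ?d"
      by (intro integral_cong_AE_smooth[OF \<mu>] smooth_functions_mult k0 h \<phi>) (auto elim: AE_mp)
    moreover have "((lin_fun \<phi> \<circ> c) has_real_derivative (\<integral>p. time_deriv k 0 p * \<phi> p \<partial>\<mu>)) (at 0)"
      by (rule lin_fun_curve_deriv[OF \<mu> c(1,2) k(1) \<phi>]) (rule k(3))
    ultimately show ?thesis by simp
  qed
  obtain J c where c: "open J" "0 \<in> J" "smooth_curve J c" "c 0 = \<mu>" "has_velocity c (dens \<mu> h) 0"
    using smooth_curve_through[OF \<mu> h] by blast
  have "(THE d. \<forall>J c. open J \<and> 0 \<in> J \<and> smooth_curve J c \<and> c 0 = \<mu> \<and> has_velocity c (dens \<mu> h) 0 \<longrightarrow>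
      ((lin_fun \<phi> \<circ> c) has_real_derivative d) (at 0)) = ?d"
  proof (rule the_equality)
    show "\<forall>J c. open J \<and> 0 \<in> J \<and> smooth_curve J c \<and> c 0 = \<mu> \<and> has_velocity c (dens \<mu> h) 0 \<longrightarrow>
      ((lin_fun \<phi> \<circ> c) has_real_derivative ?d) (at 0)" using all by blast
    fix d assume "\<forall>J c. open J \<and> 0 \<in> J \<and> smooth_curve J c \<and> c 0 = \<mu> \<and> has_velocity c (dens \<mu> h) 0 \<longrightarrow>
      ((lin_fun \<phi> \<circ> c) has_real_derivative d) (at 0)"
    then have "((lin_fun \<phi> \<circ> c) has_real_derivative d) (at 0)" using c by blast
    then show "d = ?d" by (rule DERIV_unique) (rule all[OF c])
  qed
  then show ?thesis using dens_tangent_Pinf[OF \<mu> h] by (simp add: differential_def)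
qed

lemma lin_fun_Pinf_functions:
  assumes \<phi>: "\<phi> \<in> smooth_functions"
  shows "lin_fun \<phi> \<in> Pinf_functions"
  unfolding Pinf_functions_def
proof (intro CollectI conjI ballI)
  show "smooth_on_Pinf (lin_fun \<phi>)"
    unfolding smooth_on_Pinf_def
  proof (intro allI impI)
    fix c assume c: "smooth_curve UNIV c"
    then have \<mu>: "c 0 \<in> Pinf" by (simp add: smooth_curve_def)
    obtain k where k: "smooth_family UNIV k"
      "\<And>t A. t \<in> UNIV \<Longrightarrow> A \<in> sets borelM \<Longrightarrow> measure (c t) A = (LINT p:A|c 0. k t p)"
      "\<And>t f. t \<in> UNIV \<Longrightarrow> f \<in> borel_measurable borelM \<Longrightarrow> (\<integral>p. f p \<partial>c t) = (\<integral>p. k t p * (f p :: real) \<partial>c 0)"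
      using smooth_curveE[OF \<mu> open_UNIV c] by blast
    have fam: "smooth_family UNIV (\<lambda>t p. k t p * \<phi> p)"
      by (intro smooth_family_mult k smooth_family_const \<phi> open_UNIV)
    have "(lin_fun \<phi> \<circ> c) = (\<lambda>t. \<integral>p. k t p * \<phi> p \<partial>c 0)"
      using k(3)[OF UNIV_I smooth_functions_measurable[OF \<phi>]] by (simp add: fun_eq_iff lin_fun_def)
    then show "smooth_on UNIV (lin_fun \<phi> \<circ> c)"
      using smooth_on_integral_family[OF Pinf_finite[OF \<mu>] PinfD(2)[OF \<mu>] open_UNIV fam] by simp
  qed
  show "differential (lin_fun \<phi>) \<mu> \<in> cotangent_Pinf \<mu>" for \<mu>
    using \<phi> by (auto simp: cotangent_Pinf_def)
qed

text \<open>The indicator of an open set is a bounded pointwise limit of smooth functions, so the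
  measures agree on open sets; these are stable under intersection and generate the Borel sets. The
  limit exists since a second countable space is Lindelof: countably many sets on which a bump
  function is 1 exhaust \<open>W\<close>.\<close>

lemma smooth_test_functions_determine:
  assumes \<nu>: "finite_measure \<nu>" "sets \<nu> = sets borelM" and \<nu>': "finite_measure \<nu>'" "sets \<nu>' = sets borelM"
    and eq: "\<And>\<psi>. \<psi> \<in> smooth_functions \<Longrightarrow> (\<integral>p. \<psi> p \<partial>\<nu>) = (\<integral>p. \<psi> p \<partial>\<nu>')"
  shows "\<nu> = \<nu>'"
proof -
  have lim: "\<exists>f :: nat \<Rightarrow> 'a \<Rightarrow> real. (\<forall>n. f n \<in> smooth_functions \<and> (\<forall>p. 0 \<le> f n p \<and> f n p \<le> 1)) \<and>
      (\<forall>p. (\<lambda>n. f n p) \<longlonglongrightarrow> indicator W p)" if W: "openin M W" for W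
  proof (cases "W = {}")
    case True
    then show ?thesis using smooth_functions_const[of 0] by (intro exI[of _ "\<lambda>n p. 0"]) auto
  next
    case False
    define P where "P p \<eta> N \<longleftrightarrow> \<eta> \<in> smooth_functions \<and> (\<forall>q. 0 \<le> \<eta> q \<and> \<eta> q \<le> (1::real)) \<and> (\<forall>q. \<eta> q \<noteq> 0 \<longrightarrow> q \<in> W) \<and>
      openin M N \<and> p \<in> N \<and> N \<subseteq> W \<and> (\<forall>q\<in>N. \<eta> q = 1)" for p \<eta> N
    have "\<exists>\<eta> N. P p \<eta> N" if "p \<in> W" for p
      using bump_at[OF W that] unfolding P_def by metis
    then obtain \<eta> N where P: "\<And>p. p \<in> W \<Longrightarrow> P p (\<eta> p) (N p)" by metis
    note P = P[unfolded P_def]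
    have "Lindelof_space (subtopology M W)"
      using second_countable second_countable_subtopology second_countable_imp_Lindelof_space by blast
    moreover have "\<forall>V\<in>N ` W. openin (subtopology M W) V"
      using P W by (auto simp: openin_open_subtopology)
    moreover have "\<Union>(N ` W) = topspace (subtopology M W)"
      using P W openin_subset by (fastforce simp: topspace_subtopology)
    ultimately obtain \<V> where V: "countable \<V>" "\<V> \<subseteq> N ` W" "\<Union>\<V> = topspace (subtopology M W)"
      unfolding Lindelof_space_def by meson
    have topW: "topspace (subtopology M W) = W" using W openin_subset by (auto simp: topspace_subtopology)
    obtain K where K: "countable K" "K \<subseteq> W" "\<V> = N ` K"
      using countable_subset_image[of \<V> N W] V by blast
    have "K \<noteq> {}" using False V K topW by auto
    define e where "e = from_nat_into K"
    have e: "e n \<in> W" "K = range e" for n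
      using from_nat_into[OF \<open>K \<noteq> {}\<close>] range_from_nat_into[OF \<open>K \<noteq> {}\<close> K(1)] K(2) by (auto simp: e_def)
    \<comment> \<open>One minus a product of complements combines the bump functions smoothly: it
      stays between 0 and 1, equals 1 as soon as one of them does, and is 0 off
      \<open>W\<close>.\<close>
    define f where "f n p = 1 - (\<Prod>i<n. (1 - \<eta> (e i) p))" for n p
    have "(\<lambda>p. \<Prod>i<n. (1 - \<eta> (e i) p)) \<in> smooth_functions" for n
    proof (induction n)
      case (Suc n)
      have "(\<lambda>p. (\<Prod>i<n. (1 - \<eta> (e i) p)) * (1 - \<eta> (e n) p)) \<in> smooth_functions"
        by (intro smooth_functions_mult Suc smooth_functions_diff smooth_functions_const) (use P e in blast)
      then show ?case by (simp add: mult.commute)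
    qed (simp add: smooth_functions_const)
    then have "f n \<in> smooth_functions" for n
      unfolding f_def by (intro smooth_functions_diff smooth_functions_const)
    moreover have "0 \<le> f n p \<and> f n p \<le> 1" for n p
    proof -
      have b: "0 \<le> 1 - \<eta> (e i) p" "1 - \<eta> (e i) p \<le> 1" for i using P[OF e(1)[of i]] by auto
      have "0 \<le> (\<Prod>i<n. (1 - \<eta> (e i) p))" "(\<Prod>i<n. (1 - \<eta> (e i) p)) \<le> 1"
        by (intro prod_nonneg b prod_le_1 conjI)+
      then show ?thesis by (simp add: f_def)
    qed
    moreover have "(\<lambda>n. f n p) \<longlonglongrightarrow> indicator W p" for p
    proof (cases "p \<in> W")
      case True
      then have "p \<in> \<Union>(N ` range e)" using V(3) K(3) e(2) topW by metis
      then obtain k where k: "p \<in> N (e k)" by blast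
      then have "\<eta> (e k) p = 1" using P[OF e(1)[of k]] by blast
      then have "f n p = 1" if "n > k" for n
        unfolding f_def using that by (auto intro!: prod_zero bexI[of _ k])
      then have "eventually (\<lambda>n. f n p = 1) sequentially"
        by (rule eventually_sequentiallyI[of "Suc k"]) simp
      then show ?thesis using True by (simp add: tendsto_eventually)
    next
      case False
      then have "\<eta> (e i) p = 0" for i using P[OF e(1)[of i]] by blast
      then show ?thesis using False by (simp add: f_def)
    qed
    ultimately show ?thesis by blast
  qed
  have opens: "emeasure \<nu> W = emeasure \<nu>' W" if W: "openin M W" for W
  proof -
    obtain f :: "nat \<Rightarrow> 'a \<Rightarrow> real" where f: "\<And>n. f n \<in> smooth_functions" "\<And>n p. 0 \<le> f n p \<and> f n p \<le> 1"
      "\<And>p. (\<lambda>n. f n p) \<longlonglongrightarrow> indicator W p"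
      using lim[OF W] by blast
    have conv: "(\<lambda>n. \<integral>p. f n p \<partial>\<kappa>) \<longlonglongrightarrow> measure \<kappa> W" if \<kappa>: "finite_measure \<kappa>" "sets \<kappa> = sets borelM" for \<kappa>
    proof -
      interpret finite_measure \<kappa> by (rule \<kappa>(1))
      have Wm: "W \<in> sets \<kappa>" using openin_sets_borelM[OF W] \<kappa>(2) by simp
      have "(\<lambda>n. \<integral>p. f n p \<partial>\<kappa>) \<longlonglongrightarrow> (\<integral>p. indicator W p \<partial>\<kappa>)"
      proof (rule integral_dominated_convergence[where w = "\<lambda>p. 1"])
        show "f n \<in> borel_measurable \<kappa>" for n
          using smooth_functions_measurable[OF f(1)] measurable_cong_sets[OF \<kappa>(2) refl] by blast
      qed (use f Wm in auto)
      then show ?thesis using Wm by simp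
    qed
    have "measure \<nu> W = measure \<nu>' W"
      using LIMSEQ_unique[OF conv[OF \<nu>]] conv[OF \<nu>'] eq[OF f(1)] by simp
    then show ?thesis
      using finite_measure.emeasure_eq_measure[OF \<nu>(1)] finite_measure.emeasure_eq_measure[OF \<nu>'(1)] by simp
  qed
  show ?thesis
  proof (rule measure_eqI_generator_eq[where E = "{W. openin M W}" and \<Omega> = "topspace M" and A = "\<lambda>n::nat. topspace M"])
    show "Int_stable {W. openin M W}" by (auto simp: Int_stable_def)
    show "{W. openin M W} \<subseteq> Pow (topspace M)" by (auto dest: openin_subset)
    have "sets borelM = sigma_sets (topspace M) {W. openin M W}"
      unfolding borelM_def by (rule sets_measure_of) (auto dest: openin_subset)
    then show "sets \<nu> = sigma_sets (topspace M) {W. openin M W}" "sets \<nu>' = sigma_sets (topspace M) {W. openin M W}"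
      using \<nu>(2) \<nu>'(2) by auto
    show "emeasure \<nu> (topspace M) \<noteq> \<infinity>" using finite_measure.emeasure_finite[OF \<nu>(1)] by simp
  qed (use opens in auto)
qed

section \<open>The continuity equation\<close>

lemma smooth_field_subset:
  assumes "smooth_field J X" "I \<subseteq> J"
  shows "smooth_field I X"
  unfolding smooth_field_def
proof (intro ballI)
  fix c assume "c \<in> \<A>"
  then obtain U x where c: "c = (U, x)" "(U, x) \<in> \<A>" by (cases c) auto
  obtain \<xi> where \<xi>: "smooth_on (J \<times> x ` U) \<xi>" "\<And>t p. t \<in> J \<Longrightarrow> p \<in> U \<Longrightarrow> X t p = coord_vector (U, x) p (\<xi> (t, x p))"
    using smooth_fieldE[OF assms(1) c(2)] by blast
  have "smooth_on (I \<times> x ` U) \<xi>" by (rule smooth_on_subset[OF \<xi>(1)]) (use assms(2) in auto)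
  then show "case c of (U, x) \<Rightarrow> \<exists>\<xi>. smooth_on (I \<times> x ` U) \<xi> \<and>
      (\<forall>t\<in>I. \<forall>p\<in>U. X t p = coord_vector (U, x) p (\<xi> (t, x p)))"
    unfolding c(1) using \<xi>(2) assms(2) by auto
qed

text \<open>The chain rule for the chart expression along the graph of the curve, whose velocity
  \<open>(1, v)\<close> splits into a part giving \<open>time_deriv\<close> and a part giving the
  action of the field.\<close>

lemma family_along_curve_deriv:
  assumes J: "open J" "smooth_field J X" "smooth_family J \<phi>"
    and T: "open T" "T \<subseteq> J" "integral_curve T X \<gamma>" "t \<in> T"
  shows "((\<lambda>s. \<phi> s (\<gamma> s)) has_real_derivative time_deriv \<phi> t (\<gamma> t) + X t (\<gamma> t) (\<phi> t)) (at t)"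
proof -
  obtain U x where c: "(U, x) \<in> \<A>" "\<gamma> t \<in> U" using chart_at[OF integral_curve_in[OF T(3,4)]] .
  obtain \<xi> where "smooth_on (J \<times> x ` U) \<xi>" and \<xi>: "\<And>t p. t \<in> J \<Longrightarrow> p \<in> U \<Longrightarrow> X t p = coord_vector (U, x) p (\<xi> (t, x p))"
    using smooth_fieldE[OF J(2) c(1)] by blast
  have \<xi>T: "X t p = coord_vector (U, x) p (\<xi> (t, x p))" if "t \<in> T" "p \<in> U" for t p
    using \<xi> that T(2) by blast
  obtain d where d: "d > 0" "\<And>s. s \<in> T \<Longrightarrow> \<bar>s - t\<bar> < d \<Longrightarrow> \<gamma> s \<in> U"
    "\<And>s S. s \<in> S \<Longrightarrow> S \<subseteq> T \<Longrightarrow> S \<subseteq> ball t d \<Longrightarrow> ((\<lambda>s. x (\<gamma> s)) has_vector_derivative \<xi> (s, x (\<gamma> s))) (at s within S)"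
    using integral_curve_coordinates[OF T(3,4) c \<xi>T] by blast
  define S where "S = T \<inter> ball t d"
  have S: "open S" "t \<in> S" "S \<subseteq> T" "S \<subseteq> ball t d" using T d(1) by (auto simp: S_def)
  have tJ: "t \<in> J" using T by blast
  define G where "G = (\<lambda>(t, q). \<phi> t (inv_into U x q))"
  define v where "v = \<xi> (t, x (\<gamma> t))"
  have sG: "smooth_on (J \<times> x ` U) G" unfolding G_def by (rule smooth_familyD[OF J(3) c(1)])
  let ?D = "frechet_derivative G (at (t, x (\<gamma> t)))"
  have dG: "(G has_derivative ?D) (at (t, x (\<gamma> t)))"
    by (rule smooth_on_has_derivative[OF sG]) (use tJ c(2) in auto)
  have "((\<lambda>s. x (\<gamma> s)) has_vector_derivative v) (at t)"
    using d(3)[OF S(2,3,4)] at_within_open[OF S(2,1)] by (simp add: v_def)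
  then have graph: "((\<lambda>s. (s, x (\<gamma> s))) has_vector_derivative (1, v)) (at t)"
    by (intro has_vector_derivative_Pair has_vector_derivative_id)
  have "(G \<circ> (\<lambda>s. (s, x (\<gamma> s))) has_vector_derivative ?D (1, v)) (at t)"
    using vector_derivative_diff_chain_within[of "\<lambda>s. (s, x (\<gamma> s))" "(1, v)" t UNIV G ?D]
      graph has_derivative_at_withinI[OF dG] by simp
  then have "((\<lambda>s. G (s, x (\<gamma> s))) has_real_derivative ?D (1, v)) (at t)"
    by (simp add: o_def has_real_derivative_iff_has_vector_derivative)
  moreover have "?D (1, v) = time_deriv \<phi> t (\<gamma> t) + X t (\<gamma> t) (\<phi> t)"
  proof -
    have "?D (1, v) = ?D ((1, 0) + (0, v))" by simp
    also have "\<dots> = ?D (1, 0) + ?D (0, v)" by (rule linear_add[OF has_derivative_linear[OF dG]])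
    also have "?D (1, 0) = time_deriv \<phi> t (\<gamma> t)"
      using time_deriv_chart[OF J(3) c(1) tJ, of "x (\<gamma> t)"] has_time_deriv[OF J(3) tJ integral_curve_in[OF T(3,4)]] c DERIV_unique
      by (auto simp: G_def)
    also have "?D (0, v) = X t (\<gamma> t) (\<phi> t)"
      using frechet_derivative_section[OF dG, of v] \<xi>[OF tJ c(2)] coord_vector_apply[OF smooth_family_at[OF J(1,3) tJ], of U x "\<gamma> t" v]
      by (simp add: G_def v_def)
    finally show ?thesis .
  qed
  ultimately have "((\<lambda>s. G (s, x (\<gamma> s))) has_real_derivative time_deriv \<phi> t (\<gamma> t) + X t (\<gamma> t) (\<phi> t)) (at t)" by simp
  then show ?thesis
  proof (rule has_field_derivative_transform_within_open[OF _ S(1,2)])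
    fix s assume "s \<in> S"
    then have "\<gamma> s \<in> U" using d(2)[of s] by (auto simp: S_def dist_real_def abs_minus_commute)
    then show "G (s, x (\<gamma> s)) = \<phi> s (\<gamma> s)" using c(1) by (simp add: G_def)
  qed
qed

text \<open>The three functions of \<open>t\<close> let either time argument of the flow vary while
  the other stays fixed; both cases occur, one for transported test functions and one for integrals
  along flow lines.\<close>

lemma smooth_family_flow:
  assumes I: "open I" "complete_flow I X" "smooth_family I \<phi>"
    and J: "open J" "smooth_on J \<tau>" "smooth_on J a" "smooth_on J b" "\<tau> ` J \<subseteq> I" "a ` J \<subseteq> I" "b ` J \<subseteq> I"
  shows "smooth_family J (\<lambda>t p. \<phi> (\<tau> t) (flow I X (a t) (b t) p))"
proof (rule smooth_familyI)
  fix V y assume c: "(V, y) \<in> \<A>"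
  have o: "open (J \<times> y ` V)" "open (I \<times> I \<times> y ` V)"
    using I(1) J(1) chart_codomain[OF c] by (auto intro!: open_Times)
  have fst: "smooth_on (J \<times> y ` V) (\<lambda>z. f (fst z))" if "smooth_on J f" for f :: "real \<Rightarrow> real"
    by (rule smooth_on_compose[OF that]) (use o J(1) in \<open>auto intro!: smooth_on_intros\<close>)
  have h: "smooth_on (J \<times> y ` V) (\<lambda>z. (a (fst z), b (fst z), snd z))"
    by (intro smooth_on_Pair fst J smooth_on_snd smooth_on_id o)
  have "smooth_into (J \<times> y ` V) (\<lambda>z. (\<lambda>(t, s, q). flow I X t s (inv_into V y q)) (a (fst z), b (fst z), snd z))"
    by (rule smooth_into_compose[OF flow_smooth_into[OF I(2) c] o(2,1) h]) (use J in auto)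
  moreover have "(\<lambda>z. \<tau> (fst z)) ` (J \<times> y ` V) \<subseteq> I" using J(5) by auto
  ultimately have "smooth_on (J \<times> y ` V) (\<lambda>z. \<phi> (\<tau> (fst z)) ((\<lambda>(t, s, q). flow I X t s (inv_into V y q)) (a (fst z), b (fst z), snd z)))"
    by (rule smooth_family_along[OF o(1) _ fst[OF J(2)] _ I(1,3)])
  then show "smooth_on (J \<times> y ` V) (\<lambda>(t, q). \<phi> (\<tau> t) (flow I X (a t) (b t) (inv_into V y q)))"
    by (simp add: case_prod_unfold)
qed

lemma smooth_functions_flow:
  assumes "open I" "complete_flow I X" "\<psi> \<in> smooth_functions" "t \<in> I" "s \<in> I"
  shows "(\<lambda>p. \<psi> (flow I X t s p)) \<in> smooth_functions"
proof -
  have "smooth_family UNIV (\<lambda>_ p. (\<lambda>_. \<psi>) s (flow I X t s p))"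
    by (rule smooth_family_flow[OF assms(1,2) smooth_family_const[OF assms(1,3)]])
      (use assms in \<open>auto intro!: smooth_on_const\<close>)
  then show ?thesis by (simp add: smooth_functions_iff)
qed

lemma flow_measurable:
  assumes I: "open I" "complete_flow I X" "t \<in> I" "s \<in> I"
  shows "flow I X t s \<in> measurable borelM borelM"
proof (rule measurable_into_borelM)
  show "flow I X t s \<in> space borelM \<rightarrow> topspace M" using flow_in[OF I(2,3,4)] by simp
  fix W assume W: "openin M W"
  have "openin M (flow I X t s -` W \<inter> topspace M)"
  proof (subst openin_subopen, intro ballI)
    fix p assume p: "p \<in> flow I X t s -` W \<inter> topspace M"
    then obtain V y where c: "(V, y) \<in> \<A>" "p \<in> V" using chart_at by blast
    have o: "open (y ` V)" "open (I \<times> I \<times> y ` V)"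
      using I(1) chart_codomain[OF c(1)] by (auto intro!: open_Times)
    have "smooth_into (y ` V) (\<lambda>q. (\<lambda>(t, s, q). flow I X t s (inv_into V y q)) (t, s, q))"
      by (rule smooth_into_compose[OF flow_smooth_into[OF I(2) c(1)] o(2,1)])
        (use I o in \<open>auto intro!: smooth_on_intros\<close>)
    then have si: "smooth_into (y ` V) (\<lambda>q. flow I X t s (inv_into V y q))" by simp
    have "openin M {p' \<in> V. y p' \<in> {q \<in> y ` V. flow I X t s (inv_into V y q) \<in> W}}"
      by (rule chart_open_vimage[OF c(1) smooth_into_open_vimage[OF o(1) si W]])
    moreover have "{p' \<in> V. y p' \<in> {q \<in> y ` V. flow I X t s (inv_into V y q) \<in> W}} \<subseteq> flow I X t s -` W \<inter> topspace M"
    proof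
      fix p' assume "p' \<in> {p' \<in> V. y p' \<in> {q \<in> y ` V. flow I X t s (inv_into V y q) \<in> W}}"
      then have "p' \<in> V" "flow I X t s (inv_into V y (y p')) \<in> W" by auto
      then show "p' \<in> flow I X t s -` W \<inter> topspace M" using chart_inv[OF c(1)] chart_subset[OF c(1)] by auto
    qed
    moreover have "p \<in> {p' \<in> V. y p' \<in> {q \<in> y ` V. flow I X t s (inv_into V y q) \<in> W}}" using p c by simp
    ultimately show "\<exists>S. openin M S \<and> p \<in> S \<and> S \<subseteq> flow I X t s -` W \<inter> topspace M" by blast
  qed
  then show "flow I X t s -` W \<inter> space borelM \<in> sets borelM" by (simp add: openin_sets_borelM)
qed

text \<open>The weak continuity equation for the measures \<open>h t \<cdot> \<mu>\<close> moving along \<open>X\<close>.\<close>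

definition continuity_equation ::
    "'a measure \<Rightarrow> (('a \<Rightarrow> ('a \<Rightarrow> real) \<Rightarrow> real)) \<Rightarrow> ('a \<Rightarrow> real) \<Rightarrow> ('a \<Rightarrow> real) \<Rightarrow> bool" where
  "continuity_equation \<mu> Y h h' \<longleftrightarrow> (\<forall>\<psi>\<in>smooth_functions. (\<integral>p. \<psi> p * h' p \<partial>\<mu>) = (\<integral>p. Y p \<psi> * h p \<partial>\<mu>))"

lemma smooth_field_function:
  assumes "open J" "smooth_field J X" "t \<in> J" "\<psi> \<in> smooth_functions"
  shows "(\<lambda>p. X t p \<psi>) \<in> smooth_functions"
  using smooth_family_at[OF assms(1) smooth_field_apply[OF assms(1,2) smooth_family_const[OF assms(1,4)]] assms(3)] .

text \<open>The backward transport \<open>g t\<close> satisfies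
  \<open>time_deriv g t = - X t (g t)\<close>, because it is constant along flow lines. In the
  derivative of the integral of \<open>g t * h t\<close> this term cancels against the continuity
  equation. The equation is required only on \<open>S\<close>, a possibly closed interval inside the
  open interval \<open>I\<close> where the families live.\<close>

lemma transport_integral:
  assumes \<mu>: "\<mu> \<in> Pinf" and X: "open J" "smooth_field J X"
    and I: "open I" "is_interval I" "I \<subseteq> J" "complete_flow I X"
    and h: "smooth_family I h" and S: "is_interval S" "S \<subseteq> I" "t0 \<in> S" "t1 \<in> S"
    and eq: "\<And>t. t \<in> S \<Longrightarrow> continuity_equation \<mu> (X t) (h t) (time_deriv h t)" and \<psi>: "\<psi> \<in> smooth_functions"
  shows "(\<integral>p. \<psi> p * h t1 p \<partial>\<mu>) = (\<integral>p. \<psi> (flow I X t1 t0 p) * h t0 p \<partial>\<mu>)"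
proof -
  define g where "g t p = \<psi> (flow I X t1 t p)" for t p
  have t1: "t1 \<in> I" using S by blast
  have XI: "smooth_field I X" by (rule smooth_field_subset[OF X(2) I(3)])
  have "smooth_family I (\<lambda>t p. (\<lambda>_. \<psi>) t (flow I X t1 t p))"
    by (rule smooth_family_flow[OF I(1,4) smooth_family_const[OF I(1) \<psi>] I(1)])
      (use t1 I(1) in \<open>auto intro!: smooth_on_intros\<close>)
  then have g: "smooth_family I g" unfolding g_def .
  have dg: "time_deriv g t p = - X t p (g t)" if t: "t \<in> I" and p: "p \<in> topspace M" for t p
  proof -
    note curve = flow_integral_curve[OF I(4) t p]
    have "((\<lambda>s. g s (flow I X s t p)) has_real_derivative
        time_deriv g t (flow I X t t p) + X t (flow I X t t p) (g t)) (at t)"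
      by (rule family_along_curve_deriv[OF I(1) XI g I(1) subset_refl curve(1) t])
    moreover have "((\<lambda>s. g s (flow I X s t p)) has_real_derivative 0) (at t)"
    proof (rule has_field_derivative_transform_within_open[OF DERIV_const[of "\<psi> (flow I X t1 t p)"] I(1) t])
      fix s assume s: "s \<in> I"
      show "\<psi> (flow I X t1 t p) = g s (flow I X s t p)"
        unfolding g_def by (simp add: flow_flow[OF X I(3,2,4) t1 s t p])
    qed
    ultimately have "time_deriv g t (flow I X t t p) + X t (flow I X t t p) (g t) = 0" by (rule DERIV_unique)
    then show ?thesis using curve(2) by simp
  qed
  have gh: "smooth_family I (\<lambda>t p. g t p * h t p)" by (intro smooth_family_mult I g h)
  have D0: "((\<lambda>t. \<integral>p. g t p * h t p \<partial>\<mu>) has_real_derivative 0) (at t within S)" if "t \<in> S" for t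
  proof -
    have t: "t \<in> I" using that S by blast
    have gt: "g t \<in> smooth_functions" "h t \<in> smooth_functions" "time_deriv h t \<in> smooth_functions" "(\<lambda>p. X t p (g t)) \<in> smooth_functions"
      using smooth_family_at[OF I(1) g t] smooth_family_at[OF I(1) h t] smooth_family_at[OF I(1) smooth_family_time_deriv[OF I(1) h] t]
        smooth_field_function[OF I(1) XI t] by blast+
    have "(\<integral>p. time_deriv (\<lambda>t p. g t p * h t p) t p \<partial>\<mu>) = (\<integral>p. g t p * time_deriv h t p - X t p (g t) * h t p \<partial>\<mu>)"
    proof (intro Bochner_Integration.integral_cong refl time_deriv_eqI)
      fix p assume "p \<in> space \<mu>"
      then have p: "p \<in> topspace M" using PinfD(3)[OF \<mu>] by simp
      show "((\<lambda>s. g s p * h s p) has_real_derivative g t p * time_deriv h t p - X t p (g t) * h t p) (at t)"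
        using DERIV_mult[OF has_time_deriv[OF g t p] has_time_deriv[OF h t p]] dg[OF t p] by (simp add: algebra_simps)
    qed
    also have "\<dots> = (\<integral>p. g t p * time_deriv h t p \<partial>\<mu>) - (\<integral>p. X t p (g t) * h t p \<partial>\<mu>)"
      by (intro Bochner_Integration.integral_diff Pinf_integrable[OF \<mu> \<mu>] smooth_functions_mult gt)
    also have "\<dots> = 0" using eq[OF that] gt(1) by (simp add: continuity_equation_def)
    finally show ?thesis
      using integral_family_deriv[OF Pinf_finite[OF \<mu>] PinfD(2)[OF \<mu>] I(1) gh t] by (simp add: has_field_derivative_at_within)
  qed
  have "convex S" using S(1) by (simp add: is_interval_convex)
  from has_field_derivative_zero_constant[OF this D0] obtain k where
    k: "\<And>t. t \<in> S \<Longrightarrow> (\<integral>p. g t p * h t p \<partial>\<mu>) = k" by blast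
  have "(\<integral>p. g t1 p * h t1 p \<partial>\<mu>) = (\<integral>p. g t0 p * h t0 p \<partial>\<mu>)" using k S by simp
  moreover have "(\<integral>p. g t1 p * h t1 p \<partial>\<mu>) = (\<integral>p. \<psi> p * h t1 p \<partial>\<mu>)"
    by (intro Bochner_Integration.integral_cong refl)
      (use flow_integral_curve(2)[OF I(4) t1] PinfD(3)[OF \<mu>] in \<open>simp add: g_def\<close>)
  ultimately show ?thesis by (simp add: g_def)
qed

text \<open>Along the flow lines of \<open>X\<close> the logarithm of the density decreases at the rate given by the
  divergence of \<open>X\<close>.\<close>

lemma continuity_equation_solution:
  assumes \<mu>: "\<mu> \<in> Pinf" and X: "open J" "smooth_field J X"
    and I: "open I" "is_interval I" "I \<subseteq> J" "complete_flow I X" "0 \<in> I"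
  obtains h where "smooth_family I h" "\<And>t p. h t p > 0" "\<And>p. p \<in> topspace M \<Longrightarrow> h 0 p = 1"
    "\<And>t. t \<in> I \<Longrightarrow> continuity_equation \<mu> (X t) (h t) (time_deriv h t)"
proof -
  have XI: "smooth_field I X" by (rule smooth_field_subset[OF X(2) I(3)])
  obtain D where D: "smooth_family I D"
    "\<And>t \<psi>. t \<in> I \<Longrightarrow> \<psi> \<in> smooth_functions \<Longrightarrow> (\<integral>p. X t p \<psi> \<partial>\<mu>) = - (\<integral>p. \<psi> p * D t p \<partial>\<mu>)"
    using divergence_exists[OF \<mu> I(1) XI] by blast
  \<comment> \<open>Everything is first indexed by positions at time 0: \<open>f\<close> is minus
    the divergence along the flow line that starts at \<open>p\<close>, \<open>K\<close> its time
    integral, and \<open>k\<close> reads \<open>K\<close> off at the starting position of the flow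
    line through \<open>p\<close> at time \<open>t\<close>.\<close>
  define f where "f s p = - D s (flow I X s 0 p)" for s p
  define K where "K t p = prim (\<lambda>s. f s p) t" for t p
  define k where "k t p = K t (flow I X 0 t p)" for t p
  define h where "h t p = exp (k t p)" for t p
  have "smooth_family I (\<lambda>s p. D s (flow I X s 0 p))"
    by (rule smooth_family_flow[OF I(1,4) D(1) I(1)]) (use I in \<open>auto intro!: smooth_on_intros\<close>)
  then have f: "smooth_family I f" unfolding f_def by (rule smooth_family_uminus[OF I(1)])
  have fc: "continuous_on I (\<lambda>s. f s p)" if "p \<in> topspace M" for p
    using has_time_deriv[OF f _ that] by (meson DERIV_continuous continuous_at_imp_continuous_on)
  have K: "smooth_family I K"
  proof (rule smooth_familyI)
    fix U x assume c: "(U, x) \<in> \<A>"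
    show "smooth_on (I \<times> x ` U) (\<lambda>(t, q). K t (inv_into U x q))"
      using smooth_on_prim[OF I(1,2,5) chart_codomain[OF c] smooth_familyD[OF f c]] by (simp add: K_def)
  qed
  have "smooth_family I k"
    unfolding k_def by (rule smooth_family_flow[OF I(1,4) K I(1)]) (use I in \<open>auto intro!: smooth_on_intros\<close>)
  then have h: "smooth_family I h" unfolding h_def by (rule smooth_family_exp[OF I(1)])
  \<comment> \<open>The derivative of \<open>h\<close> along a flow line is computed in two ways: by
    the chain rule, and from \<open>exp (K s ?p)\<close>, where the starting position
    \<open>?p\<close> no longer depends on time. The product rule for \<open>X t\<close> applied to
    \<open>\<psi> * h t\<close> later turns the identity into the weak equation.\<close>
  have dh: "time_deriv h t p + X t p (h t) = - h t p * D t p" if t: "t \<in> I" and p: "p \<in> topspace M" for t p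
  proof -
    note curve = flow_integral_curve[OF I(4) t p]
    let ?p = "flow I X 0 t p"
    have p0: "?p \<in> topspace M" by (rule flow_in[OF I(4,5) t p])
    have "((\<lambda>s. h s (flow I X s t p)) has_real_derivative
        time_deriv h t (flow I X t t p) + X t (flow I X t t p) (h t)) (at t)"
      by (rule family_along_curve_deriv[OF I(1) XI h I(1) subset_refl curve(1) t])
    moreover have "((\<lambda>s. h s (flow I X s t p)) has_real_derivative exp (K t ?p) * f t ?p) (at t)"
    proof (rule has_field_derivative_transform_within_open[OF _ I(1) t])
      have "(prim (\<lambda>s. f s ?p) has_vector_derivative f t ?p) (at t)"
        by (rule prim_has_derivative[OF I(1,2,5) fc[OF p0] t])
      then have "((\<lambda>s. K s ?p) has_real_derivative f t ?p) (at t)"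
        by (simp add: K_def has_real_derivative_iff_has_vector_derivative)
      then show "((\<lambda>s. exp (K s ?p)) has_real_derivative exp (K t ?p) * f t ?p) (at t)" by (rule DERIV_fun_exp)
      show "exp (K s ?p) = h s (flow I X s t p)" if "s \<in> I" for s
        unfolding h_def k_def by (simp add: flow_flow[OF X I(3,2,4,5) that t p])
    qed
    ultimately have "time_deriv h t p + X t p (h t) = exp (K t ?p) * f t ?p"
      using DERIV_unique curve(2) by fastforce
    moreover have "f t ?p = - D t p" unfolding f_def by (simp add: flow_flow[OF X I(3,2,4) t I(5) t p] curve(2))
    ultimately show ?thesis by (simp add: h_def k_def)
  qed
  show ?thesis
  proof (rule that[OF h])
    show "h t p > 0" for t p by (simp add: h_def)
    show "h 0 p = 1" if "p \<in> topspace M" for p by (simp add: h_def k_def K_def)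
    fix t assume t: "t \<in> I"
    show "continuity_equation \<mu> (X t) (h t) (time_deriv h t)"
      unfolding continuity_equation_def
    proof
      fix \<psi> assume \<psi>: "\<psi> \<in> smooth_functions"
      have sm: "h t \<in> smooth_functions" "D t \<in> smooth_functions" "(\<lambda>p. X t p (h t)) \<in> smooth_functions" "(\<lambda>p. X t p \<psi>) \<in> smooth_functions"
        using smooth_family_at[OF I(1) h t] smooth_family_at[OF I(1) D(1) t] smooth_field_function[OF I(1) XI t] \<psi> by blast+
      have \<psi>h: "(\<lambda>p. \<psi> p * h t p) \<in> smooth_functions" by (intro smooth_functions_mult \<psi> sm)
      have i: "integrable \<mu> (\<lambda>p. \<psi> p * h t p * D t p)" "integrable \<mu> (\<lambda>p. \<psi> p * X t p (h t))" "integrable \<mu> (\<lambda>p. X t p \<psi> * h t p)"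
        by (intro Pinf_integrable[OF \<mu> \<mu>] smooth_functions_mult \<psi> sm)+
      have "(\<integral>p. \<psi> p * time_deriv h t p \<partial>\<mu>) = (\<integral>p. - (\<psi> p * h t p * D t p) - \<psi> p * X t p (h t) \<partial>\<mu>)"
      proof (intro Bochner_Integration.integral_cong refl)
        fix p assume "p \<in> space \<mu>"
        then have "time_deriv h t p = - h t p * D t p - X t p (h t)" using dh[OF t, of p] PinfD(3)[OF \<mu>] by simp
        then have "\<psi> p * time_deriv h t p = \<psi> p * (- h t p * D t p - X t p (h t))" by simp
        then show "\<psi> p * time_deriv h t p = - (\<psi> p * h t p * D t p) - \<psi> p * X t p (h t)" by (simp add: right_diff_distrib)
      qed
      also have "\<dots> = - (\<integral>p. \<psi> p * h t p * D t p \<partial>\<mu>) - (\<integral>p. \<psi> p * X t p (h t) \<partial>\<mu>)" using i by simp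
      also have "- (\<integral>p. \<psi> p * h t p * D t p \<partial>\<mu>) = (\<integral>p. X t p (\<lambda>p. \<psi> p * h t p) \<partial>\<mu>)"
        using D(2)[OF t \<psi>h] by simp
      also have "\<dots> = (\<integral>p. \<psi> p * X t p (h t) + X t p \<psi> * h t p \<partial>\<mu>)"
      proof (intro Bochner_Integration.integral_cong refl)
        fix p assume "p \<in> space \<mu>"
        then obtain U x where c: "(U, x) \<in> \<A>" "p \<in> U" using chart_at PinfD(3)[OF \<mu>] by metis
        obtain v where v: "X t p = coord_vector (U, x) p v" using smooth_field_tangent[OF XI t c] .
        show "X t p (\<lambda>p. \<psi> p * h t p) = \<psi> p * X t p (h t) + X t p \<psi> * h t p"
          unfolding v by (rule coord_vector_mult[OF c \<psi> sm(1)])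
      qed
      also have "\<dots> = (\<integral>p. \<psi> p * X t p (h t) \<partial>\<mu>) + (\<integral>p. X t p \<psi> * h t p \<partial>\<mu>)" using i by simp
      finally show "(\<integral>p. \<psi> p * time_deriv h t p \<partial>\<mu>) = (\<integral>p. X t p \<psi> * h t p \<partial>\<mu>)" by simp
    qed
  qed
qed

text \<open>\<open>advection Y \<nu> v\<close> says that \<open>v\<close> is minus the Lie derivative of \<open>\<nu>\<close> along \<open>Y\<close>.\<close>

definition advection :: "('a \<Rightarrow> ('a \<Rightarrow> real) \<Rightarrow> real) \<Rightarrow> 'a measure \<Rightarrow> ('a set \<Rightarrow> real) \<Rightarrow> bool" where
  "advection Y \<nu> v \<longleftrightarrow> (\<exists>g\<in>smooth_functions. v = dens \<nu> g \<and>
    (\<forall>\<psi>\<in>smooth_functions. (\<integral>p. \<psi> p * g p \<partial>\<nu>) = (\<integral>p. Y p \<psi> \<partial>\<nu>)))"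

text \<open>Relative to \<mu> the velocity has density \<open>time_deriv h t\<close>, and the
  advection vector has density \<open>h t * g\<close>. Equal integrals over Borel sets make these
  agree almost everywhere, and testing with \<psi> gives the equation.\<close>

lemma advection_continuity_equation:
  assumes \<mu>: "\<mu> \<in> Pinf" and J: "open J" "t \<in> J" "smooth_family J h"
    and m: "\<And>t A. t \<in> J \<Longrightarrow> A \<in> sets borelM \<Longrightarrow> measure (c t) A = (LINT p:A|\<mu>. h t p)"
    and int: "\<And>f. f \<in> borel_measurable borelM \<Longrightarrow> (\<integral>p. f p \<partial>c t) = (\<integral>p. h t p * (f p :: real) \<partial>\<mu>)"
    and Y: "\<And>\<psi>. \<psi> \<in> smooth_functions \<Longrightarrow> (\<lambda>p. Y p \<psi>) \<in> smooth_functions"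
    and v: "advection Y (c t) v" "has_velocity c v t"
  shows "continuity_equation \<mu> Y (h t) (time_deriv h t)"
  unfolding continuity_equation_def
proof
  fix \<psi> assume \<psi>: "\<psi> \<in> smooth_functions"
  obtain g where g: "g \<in> smooth_functions" "v = dens (c t) g"
    "\<And>\<psi>. \<psi> \<in> smooth_functions \<Longrightarrow> (\<integral>p. \<psi> p * g p \<partial>c t) = (\<integral>p. Y p \<psi> \<partial>c t)"
    using v(1) unfolding advection_def by blast
  have ht: "h t \<in> smooth_functions" "time_deriv h t \<in> smooth_functions"
    using smooth_family_at[OF J(1,3,2)] smooth_family_at[OF J(1) smooth_family_time_deriv[OF J(1,3)] J(2)] by blast+
  have gh: "(\<lambda>p. h t p * g p) \<in> smooth_functions" by (intro smooth_functions_mult g ht)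
  have vel: "has_velocity c v t \<longleftrightarrow> v \<in> tangent_Pinf (c t) \<and> (\<forall>A\<in>sets borelM. v A = (LINT p:A|\<mu>. time_deriv h t p))"
    by (rule has_velocity_family[OF \<mu> J(1,3,2)]) (rule m)
  have "AE p in \<mu>. time_deriv h t p = h t p * g p"
  proof (rule AE_eq_of_dens[OF \<mu> ht(2) gh])
    fix A assume A: "A \<in> sets borelM"
    have "(\<lambda>p. indicator A p * g p) \<in> borel_measurable borelM"
      using A smooth_functions_measurable[OF g(1)] by measurable
    from int[OF this] have "v A = (LINT p:A|\<mu>. h t p * g p)"
      using A g(2) by (simp add: dens_def set_lebesgue_integral_def mult.left_commute)
    then show "(LINT p:A|\<mu>. time_deriv h t p) = (LINT p:A|\<mu>. h t p * g p)" using vel v(2) A by simp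
  qed
  then have "(\<integral>p. \<psi> p * time_deriv h t p \<partial>\<mu>) = (\<integral>p. h t p * (\<psi> p * g p) \<partial>\<mu>)"
    by (intro integral_cong_AE_smooth[OF \<mu>] smooth_functions_mult \<psi> ht g) (auto elim: AE_mp)
  also have "\<dots> = (\<integral>p. Y p \<psi> \<partial>c t)"
    using int[OF smooth_functions_measurable[OF smooth_functions_mult[OF \<psi> g(1)]]] g(3)[OF \<psi>] by simp
  also have "\<dots> = (\<integral>p. Y p \<psi> * h t p \<partial>\<mu>)"
    using int[OF smooth_functions_measurable[OF Y[OF \<psi>]]] by (simp add: mult.commute)
  finally show "(\<integral>p. \<psi> p * time_deriv h t p \<partial>\<mu>) = (\<integral>p. Y p \<psi> * h t p \<partial>\<mu>)" .
qed

text \<open>Dividing by \<open>h t\<close> passes from densities relative to \<mu> to densities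
  relative to \<open>c t\<close>: \<open>g\<close> is the logarithmic time derivative of
  \<open>h\<close>. Testing with the constant 1, which \<open>Y\<close> annihilates, shows that it
  has mean value 0 and so defines a tangent vector.\<close>

lemma continuity_equation_advection:
  assumes \<mu>: "\<mu> \<in> Pinf" and J: "open J" "t \<in> J" "smooth_family J h"
    and pos: "\<And>t p. t \<in> J \<Longrightarrow> p \<in> topspace M \<Longrightarrow> h t p > 0"
    and m: "\<And>t A. t \<in> J \<Longrightarrow> A \<in> sets borelM \<Longrightarrow> measure (c t) A = (LINT p:A|\<mu>. h t p)"
    and ct: "c t \<in> Pinf"
    and Y: "\<And>\<psi>. \<psi> \<in> smooth_functions \<Longrightarrow> (\<lambda>p. Y p \<psi>) \<in> smooth_functions" "\<And>p. p \<in> topspace M \<Longrightarrow> Y p (\<lambda>_. 1) = 0"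
    and eq: "continuity_equation \<mu> Y (h t) (time_deriv h t)"
  obtains v where "advection Y (c t) v" "has_velocity c v t"
proof -
  have ht: "h t \<in> smooth_functions" "time_deriv h t \<in> smooth_functions"
    using smooth_family_at[OF J(1,3,2)] smooth_family_at[OF J(1) smooth_family_time_deriv[OF J(1,3)] J(2)] by blast+
  have int: "(\<integral>p. f p \<partial>c t) = (\<integral>p. h t p * (f p :: real) \<partial>\<mu>)" if "f \<in> borel_measurable borelM" for f
    by (rule Pinf_eq_density[OF \<mu> ct ht(1) _ that]) (rule m[OF J(2)])
  define g where "g p = time_deriv h t p * inverse (h t p)" for p
  have "smooth_family J (\<lambda>t p. inverse (h t p))"
    by (rule smooth_family_inverse[OF J(1,3)]) (use pos in \<open>auto simp: less_imp_neq[symmetric]\<close>)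
  from smooth_family_at[OF J(1) this J(2)] have g: "g \<in> smooth_functions"
    unfolding g_def by (rule smooth_functions_mult[OF ht(2)])
  have hg: "h t p * g p = time_deriv h t p" if "p \<in> topspace M" for p
    using pos[OF J(2) that] by (simp add: g_def)
  have test: "(\<integral>p. \<psi> p * g p \<partial>c t) = (\<integral>p. Y p \<psi> \<partial>c t)" if \<psi>: "\<psi> \<in> smooth_functions" for \<psi>
  proof -
    have "(\<integral>p. \<psi> p * g p \<partial>c t) = (\<integral>p. h t p * (\<psi> p * g p) \<partial>\<mu>)"
      by (rule int[OF smooth_functions_measurable[OF smooth_functions_mult[OF \<psi> g]]])
    also have "\<dots> = (\<integral>p. \<psi> p * time_deriv h t p \<partial>\<mu>)"
      by (intro Bochner_Integration.integral_cong refl) (use hg PinfD(3)[OF \<mu>] in \<open>simp add: mult.left_commute\<close>)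
    also have "\<dots> = (\<integral>p. Y p \<psi> * h t p \<partial>\<mu>)" using eq \<psi> by (simp add: continuity_equation_def)
    also have "\<dots> = (\<integral>p. Y p \<psi> \<partial>c t)"
      using int[OF smooth_functions_measurable[OF Y(1)[OF \<psi>]]] by (simp add: mult.commute)
    finally show ?thesis .
  qed
  have "(\<integral>p. Y p (\<lambda>_. 1) \<partial>c t) = (\<integral>p. 0 \<partial>c t)"
    by (intro Bochner_Integration.integral_cong refl) (use Y(2) PinfD(3)[OF ct] in simp)
  then have g0: "(\<integral>p. g p \<partial>c t) = 0" using test[OF smooth_functions_const[of 1]] by simp
  have "has_velocity c (dens (c t) g) t \<longleftrightarrow> dens (c t) g \<in> tangent_Pinf (c t) \<and>
      (\<forall>A\<in>sets borelM. dens (c t) g A = (LINT p:A|\<mu>. time_deriv h t p))"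
    by (rule has_velocity_family[OF \<mu> J(1,3,2)]) (rule m)
  moreover have "dens (c t) g A = (LINT p:A|\<mu>. time_deriv h t p)" if A: "A \<in> sets borelM" for A
  proof -
    have "(\<lambda>p. indicator A p * g p) \<in> borel_measurable borelM"
      using A smooth_functions_measurable[OF g(1)] by measurable
    from int[OF this] have "dens (c t) g A = (\<integral>p. indicator A p * (h t p * g p) \<partial>\<mu>)"
      using A by (simp add: dens_def set_lebesgue_integral_def mult.left_commute)
    also have "\<dots> = (LINT p:A|\<mu>. time_deriv h t p)"
      unfolding set_lebesgue_integral_def
      by (intro Bochner_Integration.integral_cong refl) (use hg PinfD(3)[OF \<mu>] in simp)
    finally show ?thesis .
  qed
  ultimately have "has_velocity c (dens (c t) g) t" using dens_tangent_Pinf[OF ct g g0] by blast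
  moreover have "advection Y (c t) (dens (c t) g)" using g test unfolding advection_def by blast
  ultimately show ?thesis using that by blast
qed

lemma smooth_field_const: "open J \<Longrightarrow> smooth_field J X \<Longrightarrow> t \<in> J \<Longrightarrow> p \<in> topspace M \<Longrightarrow> X t p (\<lambda>_. c) = 0"
  by (metis chart_at coord_vector_const smooth_field_tangent)

text \<open>A solution \<open>h\<close> of the continuity equation with initial value 1 is taken
  first. By \<open>transport_integral\<close> the measure with density \<open>h t\<close> and the
  pushforward have the same integrals of smooth functions, hence are equal; smoothness and velocity
  of the curve are then read off from \<open>h\<close>.\<close>

lemma flow_pushforward_curve:
  assumes \<mu>: "\<mu> \<in> Pinf" and X: "open J" "smooth_field J X"
    and I: "open I" "is_interval I" "I \<subseteq> J" "complete_flow I X" "0 \<in> I"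
  defines "c \<equiv> \<lambda>t. distr \<mu> borelM (flow I X t 0)"
  shows "smooth_curve I c" "c 0 = \<mu>" "\<And>t. t \<in> I \<Longrightarrow> \<exists>v. advection (X t) (c t) v \<and> has_velocity c v t"
proof -
  obtain h where h: "smooth_family I h" "\<And>t p. h t p > 0" "\<And>p. p \<in> topspace M \<Longrightarrow> h 0 p = 1"
    "\<And>t. t \<in> I \<Longrightarrow> continuity_equation \<mu> (X t) (h t) (time_deriv h t)"
    using continuity_equation_solution[OF \<mu> X I] by blast
  have tr: "(\<integral>p. \<psi> p * h t p \<partial>\<mu>) = (\<integral>p. \<psi> (flow I X t 0 p) \<partial>\<mu>)" if "\<psi> \<in> smooth_functions" "t \<in> I" for \<psi> t
  proof -
    have "(\<integral>p. \<psi> p * h t p \<partial>\<mu>) = (\<integral>p. \<psi> (flow I X t 0 p) * h 0 p \<partial>\<mu>)"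
      by (rule transport_integral[OF \<mu> X I(1-4) h(1) I(2) subset_refl I(5) that(2) h(4) that(1)])
    also have "\<dots> = (\<integral>p. \<psi> (flow I X t 0 p) \<partial>\<mu>)"
      by (intro Bochner_Integration.integral_cong refl) (use h(3) PinfD(3)[OF \<mu>] in simp)
    finally show ?thesis .
  qed
  interpret prob_space \<mu> by (rule PinfD(1)[OF \<mu>])
  have one: "(\<integral>p. h t p \<partial>\<mu>) = 1" if "t \<in> I" for t
    using tr[OF smooth_functions_const[of 1] that] by (simp add: prob_space)
  have pos: "0 < h t p" if "t \<in> I" "p \<in> topspace M" for t p by (rule h(2))
  define c' where "c' t = density \<mu> (\<lambda>p. ennreal (h t p))" for t
  have c'Pinf: "c' t \<in> Pinf" if "t \<in> I" for t
    using smooth_curveI(1)[OF \<mu> I(1) h(1) pos one c'_def] that by (simp add: smooth_curve_def)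
  have ht: "h t \<in> borel_measurable \<mu>" if "t \<in> I" for t
    using smooth_functions_measurable[OF smooth_family_at[OF I(1) h(1) that]] Pinf_measurable[OF \<mu>] by blast
  have cc: "c t = density \<mu> (\<lambda>p. ennreal (h t p))" if t: "t \<in> I" for t
  proof -
    have fm: "flow I X t 0 \<in> measurable \<mu> borelM"
      using flow_measurable[OF I(1,4) t I(5)] measurable_cong_sets[OF PinfD(2)[OF \<mu>] refl] by blast
    have "c t = c' t"
    proof (rule smooth_test_functions_determine)
      interpret c: prob_space "c t" unfolding c_def by (rule prob_space_distr[OF fm])
      show "finite_measure (c t)" by (rule c.finite_measure_axioms)
      show "sets (c t) = sets borelM" by (simp add: c_def)
      show "finite_measure (c' t)" "sets (c' t) = sets borelM"
        using Pinf_finite[OF c'Pinf[OF t]] PinfD(2)[OF c'Pinf[OF t]] .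
      fix \<psi> assume \<psi>: "\<psi> \<in> smooth_functions"
      have \<psi>m: "\<psi> \<in> borel_measurable \<mu>" using smooth_functions_measurable[OF \<psi>] Pinf_measurable[OF \<mu>] by blast
      have "(\<integral>p. \<psi> p \<partial>c t) = (\<integral>p. \<psi> (flow I X t 0 p) \<partial>\<mu>)"
        unfolding c_def by (rule integral_distr[OF fm smooth_functions_measurable[OF \<psi>]])
      also have "\<dots> = (\<integral>p. \<psi> p * h t p \<partial>\<mu>)" using tr[OF \<psi> t] by simp
      also have "\<dots> = (\<integral>p. \<psi> p \<partial>c' t)"
        unfolding c'_def using integral_density[OF \<psi>m ht[OF t]] h(2) by (simp add: less_imp_le mult.commute)
      finally show "(\<integral>p. \<psi> p \<partial>c t) = (\<integral>p. \<psi> p \<partial>c' t)" .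
    qed
    then show ?thesis by (simp add: c'_def)
  qed
  note sc = smooth_curveI[OF \<mu> I(1) h(1) pos one cc]
  show "smooth_curve I c" by (rule sc(1))
  have "density \<mu> (\<lambda>p. ennreal (h 0 p)) = density \<mu> (\<lambda>p. 1)"
    by (rule density_cong) (use ht[OF I(5)] h(3) PinfD(3)[OF \<mu>] in \<open>auto intro!: AE_I2\<close>)
  then show "c 0 = \<mu>" using cc[OF I(5)] by (simp add: density_1)
  fix t assume t: "t \<in> I"
  have tJ: "t \<in> J" using t I by blast
  have ct: "c t \<in> Pinf" using sc(1) t by (simp add: smooth_curve_def)
  have m: "measure (c t) A = (LINT p:A|\<mu>. h t p)" if "t \<in> I" "A \<in> sets borelM" for t A
    by (rule smooth_curveI(2)[OF \<mu> I(1) h(1) pos one cc]) (use that in auto)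
  obtain v where "advection (X t) (c t) v" "has_velocity c v t"
    using continuity_equation_advection[OF \<mu> I(1) t h(1) pos m ct smooth_field_function[OF X tJ]
      smooth_field_const[OF X tJ] h(4)[OF t]] by blast
  then show "\<exists>v. advection (X t) (c t) v \<and> has_velocity c v t" by blast
qed

text \<open>Relative to the initial measure \<open>c 0\<close> the density family of the curve
  solves the continuity equation on \<open>{0..1}\<close>, so \<open>transport_integral\<close>
  determines the integrals of smooth functions at time 1 and thereby \<open>c 1\<close>.\<close>

lemma curve_eq_flow_pushforward:
  assumes X: "open J" "smooth_field J X" and I: "open I" "is_interval I" "I \<subseteq> J" "complete_flow I X"
    and c: "smooth_curve I c" "{0..1} \<subseteq> I"
    and v: "\<And>t. t \<in> {0..1} \<Longrightarrow> \<exists>v. advection (X t) (c t) v \<and> has_velocity c v t"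
  shows "c 1 = distr (c 0) borelM (flow I X 1 0)"
proof -
  have 01: "0 \<in> I" "1 \<in> I" using c(2) by auto
  have P: "c t \<in> Pinf" if "t \<in> I" for t using c(1) that by (simp add: smooth_curve_def)
  note \<mu> = P[OF 01(1)]
  obtain h where h: "smooth_family I h" "\<And>t A. t \<in> I \<Longrightarrow> A \<in> sets borelM \<Longrightarrow> measure (c t) A = (LINT p:A|c 0. h t p)"
    "\<And>t f. t \<in> I \<Longrightarrow> f \<in> borel_measurable borelM \<Longrightarrow> (\<integral>p. f p \<partial>c t) = (\<integral>p. h t p * (f p :: real) \<partial>c 0)"
    using smooth_curveE[OF \<mu> I(1) c(1)] by blast
  have eq: "continuity_equation (c 0) (X t) (h t) (time_deriv h t)" if t: "t \<in> {0..1}" for t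
  proof -
    obtain v where v: "advection (X t) (c t) v" "has_velocity c v t" using v[OF t] by blast
    have tI: "t \<in> I" "t \<in> J" using t c(2) I(3) by auto
    show ?thesis
      by (rule advection_continuity_equation[OF \<mu> I(1) tI(1) h(1) h(2) h(3)[OF tI(1)] smooth_field_function[OF X tI(2)] v])
  qed
  have fm: "flow I X 1 0 \<in> measurable (c 0) borelM"
    using flow_measurable[OF I(1,4) 01(2,1)] measurable_cong_sets[OF PinfD(2)[OF \<mu>] refl] by blast
  show ?thesis
  proof (rule smooth_test_functions_determine[OF Pinf_finite[OF P[OF 01(2)]] PinfD(2)[OF P[OF 01(2)]]])
    interpret prob_space "c 0" by (rule PinfD(1)[OF \<mu>])
    interpret d: prob_space "distr (c 0) borelM (flow I X 1 0)" by (rule prob_space_distr[OF fm])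
    show "finite_measure (distr (c 0) borelM (flow I X 1 0))" by (rule d.finite_measure_axioms)
    show "sets (distr (c 0) borelM (flow I X 1 0)) = sets borelM" by simp
    fix \<psi> assume \<psi>: "\<psi> \<in> smooth_functions"
    have \<psi>f: "(\<lambda>p. \<psi> (flow I X 1 0 p)) \<in> smooth_functions" by (rule smooth_functions_flow[OF I(1,4) \<psi> 01(2,1)])
    have "(\<integral>p. \<psi> p \<partial>c 1) = (\<integral>p. \<psi> p * h 1 p \<partial>c 0)"
      using h(3)[OF 01(2) smooth_functions_measurable[OF \<psi>]] by (simp add: mult.commute)
    also have "\<dots> = (\<integral>p. \<psi> (flow I X 1 0 p) * h 0 p \<partial>c 0)"
      by (rule transport_integral[OF \<mu> X I h(1) is_interval_cc c(2) _ _ eq \<psi>]) auto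
    also have "\<dots> = (\<integral>p. \<psi> (flow I X 1 0 p) \<partial>c 0)"
      using h(3)[OF 01(1) smooth_functions_measurable[OF \<psi>f]] by (simp add: mult.commute)
    also have "\<dots> = (\<integral>p. \<psi> p \<partial>distr (c 0) borelM (flow I X 1 0))"
      by (rule integral_distr[OF fm smooth_functions_measurable[OF \<psi>], symmetric])
    finally show "(\<integral>p. \<psi> p \<partial>c 1) = (\<integral>p. \<psi> p \<partial>distr (c 0) borelM (flow I X 1 0))" .
  qed
qed

end

context closed_symplectic_manifold
begin

section \<open>Hamiltonian vector fields\<close>

text \<open>The form is represented through the Euclidean inner product with its first argument left
  open, so that the condition defining \<open>ham_vector\<close> becomes
  \<open>form_matrix c p v = gradient c f p\<close>.\<close>

definition form_matrix :: "('a, 'e) chart \<Rightarrow> 'a \<Rightarrow> 'e \<Rightarrow> 'e" where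
  "form_matrix c p v = (\<Sum>b\<in>Basis. \<omega> p (coord_vector c p b) (coord_vector c p v) *\<^sub>R b)"

definition gradient :: "('a, 'e) chart \<Rightarrow> ('a \<Rightarrow> real) \<Rightarrow> 'a \<Rightarrow> 'e" where
  "gradient c f p = (\<Sum>b\<in>Basis. coord_vector c p b f *\<^sub>R b)"

lemma coord_vector_tangent: "(U, x) \<in> \<A> \<Longrightarrow> p \<in> U \<Longrightarrow> coord_vector (U, x) p v \<in> tangent_space p"
  by (simp add: tangent_space_chart)

lemma form_linear_chart:
  assumes "(U, x) \<in> \<A>" "p \<in> U"
  shows "linear (\<lambda>v. \<omega> p (coord_vector (U, x) p v) (coord_vector (U, x) p w))" (is ?L)
    and "linear (\<lambda>v. \<omega> p (coord_vector (U, x) p w) (coord_vector (U, x) p v))" (is ?R)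
proof -
  have p: "p \<in> topspace M" using chart_subset[OF assms(1)] assms(2) by blast
  note T = coord_vector_tangent[OF assms]
  have comb: "\<omega> p (coord_vector (U, x) p (a *\<^sub>R v + b *\<^sub>R v')) (coord_vector (U, x) p w)
      = a * \<omega> p (coord_vector (U, x) p v) (coord_vector (U, x) p w) + b * \<omega> p (coord_vector (U, x) p v') (coord_vector (U, x) p w)" for a b v v'
    unfolding coord_vector_linear[OF assms] by (rule form_linear[OF p T T T])
  show L: ?L
  proof (rule linearI)
    show "\<omega> p (coord_vector (U, x) p (v + v')) (coord_vector (U, x) p w)
      = \<omega> p (coord_vector (U, x) p v) (coord_vector (U, x) p w) + \<omega> p (coord_vector (U, x) p v') (coord_vector (U, x) p w)" for v v'
      using comb[of 1 v 1 v'] by simp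
    show "\<omega> p (coord_vector (U, x) p (a *\<^sub>R v)) (coord_vector (U, x) p w)
      = a *\<^sub>R \<omega> p (coord_vector (U, x) p v) (coord_vector (U, x) p w)" for a v
      using comb[of a v 0 v] by simp
  qed
  have "(\<lambda>v. \<omega> p (coord_vector (U, x) p w) (coord_vector (U, x) p v)) = (\<lambda>v. - \<omega> p (coord_vector (U, x) p v) (coord_vector (U, x) p w))"
    by (rule ext) (rule form_skew[OF p T T])
  then show ?R by (rule ssubst[where P = linear]) (rule linear_compose_neg[OF L])
qed

lemma inner_form_matrix:
  assumes "(U, x) \<in> \<A>" "p \<in> U"
  shows "form_matrix (U, x) p v \<bullet> w = \<omega> p (coord_vector (U, x) p w) (coord_vector (U, x) p v)"
  using linear_expand_Basis[OF form_linear_chart(1)[OF assms, of v], of w]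
  by (simp add: form_matrix_def inner_sum_left inner_sum_right inner_commute[of _ w] mult.commute)

lemma inner_gradient:
  assumes "(U, x) \<in> \<A>" "p \<in> U"
  shows "gradient (U, x) f p \<bullet> w = coord_vector (U, x) p w f"
proof -
  have "linear (\<lambda>v. coord_vector (U, x) p v f)"
  proof (rule linearI)
    show "coord_vector (U, x) p (v + v') f = coord_vector (U, x) p v f + coord_vector (U, x) p v' f" for v v'
      using fun_cong[OF coord_vector_linear[OF assms, of 1 v 1 v'], of f] by simp
    show "coord_vector (U, x) p (a *\<^sub>R v) f = a *\<^sub>R coord_vector (U, x) p v f" for a v
      using fun_cong[OF coord_vector_linear[OF assms, of a v 0 v], of f] by simp
  qed
  from linear_expand_Basis[OF this, of w] show ?thesis
    by (simp add: gradient_def inner_sum_left inner_sum_right inner_commute[of _ w] mult.commute)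
qed

lemma linear_form_matrix:
  assumes "(U, x) \<in> \<A>" "p \<in> U"
  shows "linear (form_matrix (U, x) p)"
proof (rule linearI)
  note lin = form_linear_chart(2)[OF assms]
  show "form_matrix (U, x) p (v + w) = form_matrix (U, x) p v + form_matrix (U, x) p w" for v w
    unfolding form_matrix_def by (simp add: linear_add[OF lin] scaleR_add_left sum.distrib)
  show "form_matrix (U, x) p (a *\<^sub>R v) = a *\<^sub>R form_matrix (U, x) p v" for a v
    unfolding form_matrix_def by (simp add: linear_scale[OF lin] scaleR_sum_right)
qed

lemma form_matrix_eq_0:
  assumes c: "(U, x) \<in> \<A>" "p \<in> U" and "form_matrix (U, x) p v = 0"
  shows "v = 0"
proof -
  have p: "p \<in> topspace M" using chart_subset[OF c(1)] c(2) by blast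
  note T = coord_vector_tangent[OF c]
  have "\<omega> p (coord_vector (U, x) p v) Y = 0" if Y: "Y \<in> tangent_space p" for Y
  proof -
    obtain w where "Y = coord_vector (U, x) p w" using Y tangent_space_chart[OF c] by auto
    then show ?thesis using inner_form_matrix[OF c, of v w] assms(3) form_skew[OF p T T, of v w] by simp
  qed
  then have "coord_vector (U, x) p v = (\<lambda>f. 0)" using form_nondegenerate[OF p T] by blast
  also have "\<dots> = coord_vector (U, x) p 0" using coord_vector_linear[OF c, of 0 0 0 0] by simp
  finally show ?thesis by (rule coord_vector_inj[OF c])
qed

lemma form_matrix_inj:
  assumes "(U, x) \<in> \<A>" "p \<in> U"
  shows "inj (form_matrix (U, x) p)"
  using form_matrix_eq_0[OF assms] linear_injective_0[OF linear_form_matrix[OF assms]] by blast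

lemma ham_vector_chart:
  assumes c: "(U, x) \<in> \<A>" "p \<in> U" and v: "form_matrix (U, x) p v = gradient (U, x) f p"
  shows "ham_vector f p = coord_vector (U, x) p v"
  unfolding ham_vector_def
proof (rule the_equality)
  have char: "(\<forall>Y\<in>tangent_space p. \<omega> p Y (coord_vector (U, x) p u) = Y f)
      \<longleftrightarrow> form_matrix (U, x) p u = gradient (U, x) f p" for u
  proof
    assume eq: "\<forall>Y\<in>tangent_space p. \<omega> p Y (coord_vector (U, x) p u) = Y f"
    show "form_matrix (U, x) p u = gradient (U, x) f p"
    proof (rule euclidean_eqI)
      fix b :: 'e
      show "form_matrix (U, x) p u \<bullet> b = gradient (U, x) f p \<bullet> b"
        unfolding inner_form_matrix[OF c] inner_gradient[OF c] by (rule bspec[OF eq coord_vector_tangent[OF c]])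
    qed
  next
    assume eq: "form_matrix (U, x) p u = gradient (U, x) f p"
    show "\<forall>Y\<in>tangent_space p. \<omega> p Y (coord_vector (U, x) p u) = Y f"
    proof
      fix Y assume "Y \<in> tangent_space p"
      then obtain w where "Y = coord_vector (U, x) p w" using tangent_space_chart[OF c] by auto
      then show "\<omega> p Y (coord_vector (U, x) p u) = Y f"
        using inner_form_matrix[OF c, of u w] inner_gradient[OF c, of f w] eq by simp
    qed
  qed
  show "coord_vector (U, x) p v \<in> tangent_space p \<and> (\<forall>Y\<in>tangent_space p. \<omega> p Y (coord_vector (U, x) p v) = Y f)"
    using char v coord_vector_tangent[OF c] by blast
  fix X assume X: "X \<in> tangent_space p \<and> (\<forall>Y\<in>tangent_space p. \<omega> p Y X = Y f)"
  then obtain u where u: "X = coord_vector (U, x) p u" using tangent_space_chart[OF c] by auto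
  then have "form_matrix (U, x) p u = form_matrix (U, x) p v" using X char[of u] v by simp
  then show "X = coord_vector (U, x) p v" using form_matrix_inj[OF c] u by (auto dest: injD)
qed

lemma form_matrix_solvable:
  assumes "(U, x) \<in> \<A>" "p \<in> U"
  obtains v where "form_matrix (U, x) p v = w"
proof -
  have "surj (form_matrix (U, x) p)"
    by (rule linear_inj_imp_surj[OF linear_form_matrix[OF assms] form_matrix_inj[OF assms]])
  then show ?thesis using that by (metis surjD)
qed

lemma ham_vector_tangent: "p \<in> topspace M \<Longrightarrow> ham_vector f p \<in> tangent_space p"
  by (metis chart_at form_matrix_solvable ham_vector_chart coord_vector_tangent)

lemma form_ham_vector:
  assumes p: "p \<in> topspace M" and Y: "Y \<in> tangent_space p"
  shows "\<omega> p Y (ham_vector f p) = Y f"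
proof -
  obtain U x where c: "(U, x) \<in> \<A>" "p \<in> U" using chart_at[OF p] .
  obtain v where v: "form_matrix (U, x) p v = gradient (U, x) f p" using form_matrix_solvable[OF c] .
  obtain w where "Y = coord_vector (U, x) p w" using Y tangent_space_chart[OF c] by auto
  then show ?thesis
    using inner_form_matrix[OF c, of v w] inner_gradient[OF c, of f w] v ham_vector_chart[OF c v] by simp
qed

lemma poisson_eq: "p \<in> topspace M \<Longrightarrow> poisson \<phi> f p = ham_vector \<phi> p f"
  unfolding poisson_def by (rule form_ham_vector[OF _ ham_vector_tangent])

lemma poisson_skew: "p \<in> topspace M \<Longrightarrow> poisson \<phi> f p = - poisson f \<phi> p"
  unfolding poisson_def by (rule form_skew[OF _ ham_vector_tangent ham_vector_tangent])

text \<open>In a chart the coefficient of the field solves a linear system with the smooth matrices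
  of \<omega> and the gradient of \<open>\<phi> t\<close> on the right. Nondegeneracy makes the
  matrices injective, and \<open>Ck_on_linear_solve\<close> makes the solution smooth in time and
  position.\<close>

lemma smooth_field_ham_vector:
  assumes J: "open J" "smooth_family J \<phi>"
  shows "smooth_field J (\<lambda>t. ham_vector (\<phi> t))"
  unfolding smooth_field_def
proof (intro ballI)
  fix ch assume "ch \<in> \<A>"
  then obtain U x where ch: "ch = (U, x)" and c: "(U, x) \<in> \<A>" by (cases ch) auto
  define S where "S = J \<times> x ` U"
  define p where "p z = inv_into U x (snd z)" for z :: "real \<times> 'e"
  have oS: "open S" unfolding S_def by (rule open_chart_Times[OF J(1) c])
  have pU: "p z \<in> U" and xp: "x (p z) = snd z" if "z \<in> S" for z
    using chart_inv_into[OF c, of "snd z"] chart_right_inv[OF c, of "snd z"] that by (auto simp: S_def p_def)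
  define A where "A z = form_matrix (U, x) (p z)" for z
  define G where "G = (\<lambda>(t, q). \<phi> t (inv_into U x q))"
  define b where "b z = (\<Sum>i\<in>Basis. frechet_derivative G (at z) (0, i) *\<^sub>R i)" for z
  \<comment> \<open>A pointwise choice suffices, because the solution is unique at every
    point.\<close>
  define \<xi> where "\<xi> z = (SOME v. A z v = b z)" for z
  have \<xi>: "A z (\<xi> z) = b z" if "z \<in> S" for z
    unfolding \<xi>_def by (rule someI_ex) (use form_matrix_solvable[OF c pU[OF that], of "b z"] in \<open>auto simp: A_def\<close>)
  have sG: "smooth_on S G" unfolding G_def S_def by (rule smooth_familyD[OF J(2) c])
  have sb: "smooth_on S b" unfolding b_def
    by (intro smooth_on_sum smooth_on_scaleR smooth_on_const smooth_on_frechet_derivative sG oS)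
  have sA: "smooth_on S (\<lambda>z. A z w)" for w
  proof -
    have "smooth_on S (\<lambda>z. \<omega> (p z) (coord_vector (U, x) (p z) i) (coord_vector (U, x) (p z) w))" for i
      unfolding p_def
      by (rule smooth_on_compose[OF form_smooth[OF c, unfolded Let_def] smooth_on_snd[OF oS smooth_on_id[OF oS]] oS chart_codomain[OF c]])
        (auto simp: S_def)
    then show ?thesis unfolding A_def form_matrix_def
      by (intro smooth_on_sum smooth_on_scaleR smooth_on_const oS)
  qed
  have "smooth_on S \<xi>"
  proof (rule smooth_onI)
    show "Ck_on k S \<xi>" for k
      by (rule Ck_on_linear_solve[OF oS _ _ smooth_onD[OF sA] smooth_onD[OF sb] \<xi>])
        (use linear_form_matrix[OF c pU] form_matrix_eq_0[OF c pU] in \<open>auto simp: A_def\<close>)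
  qed
  moreover have "ham_vector (\<phi> t) p' = coord_vector (U, x) p' (\<xi> (t, x p'))" if t: "t \<in> J" and p': "p' \<in> U" for t p'
  proof (rule ham_vector_chart[OF c p'])
    have z: "(t, x p') \<in> S" using t p' by (simp add: S_def)
    have pz: "p (t, x p') = p'" using c p' by (simp add: p_def)
    have "coord_vector (U, x) p' i (\<phi> t) = frechet_derivative G (at (t, x p')) (0, i)" for i
      using frechet_derivative_section[OF smooth_on_has_derivative[OF sG z], of i]
        coord_vector_apply[OF smooth_family_at[OF J t], of U x p' i] by (simp add: G_def)
    then show "form_matrix (U, x) p' (\<xi> (t, x p')) = gradient (U, x) (\<phi> t) p'"
      using \<xi>[OF z] by (simp add: A_def pz b_def gradient_def)
  qed
  ultimately show "case ch of (U, x) \<Rightarrow> \<exists>\<xi>. smooth_on (J \<times> x ` U) \<xi> \<and>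
      (\<forall>t\<in>J. \<forall>p\<in>U. ham_vector (\<phi> t) p = coord_vector (U, x) p (\<xi> (t, x p)))"
    unfolding ch S_def by auto
qed

lemma smooth_field_ham_vector_const: "\<phi> \<in> smooth_functions \<Longrightarrow> smooth_field UNIV (\<lambda>_. ham_vector \<phi>)"
  using smooth_field_ham_vector[OF open_UNIV smooth_family_const[OF open_UNIV]] .

section \<open>The Poisson structure on the space of measures\<close>

lemma lin_fun_poisson: "\<mu> \<in> Pinf \<Longrightarrow> lin_fun (poisson \<phi> f) \<mu> = (\<integral>p. ham_vector \<phi> p f \<partial>\<mu>)"
  unfolding lin_fun_def by (intro Bochner_Integration.integral_cong refl) (simp add: PinfD(3) poisson_eq)

lemma lin_fun_poisson_skew: "\<mu> \<in> Pinf \<Longrightarrow> lin_fun (poisson \<phi> f) \<mu> = - lin_fun (poisson f \<phi>) \<mu>"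
proof -
  assume \<mu>: "\<mu> \<in> Pinf"
  have "lin_fun (poisson \<phi> f) \<mu> = (\<integral>p. - poisson f \<phi> p \<partial>\<mu>)"
    unfolding lin_fun_def
    by (intro Bochner_Integration.integral_cong refl poisson_skew) (simp add: PinfD(3)[OF \<mu>])
  then show ?thesis by (simp add: lin_fun_def)
qed

lemma advection_exists:
  assumes \<mu>: "\<mu> \<in> Pinf" and \<phi>: "\<phi> \<in> smooth_functions"
  obtains v where "advection (ham_vector \<phi>) \<mu> v"
proof -
  obtain D where D: "smooth_family UNIV D"
    "\<And>t \<psi>. t \<in> (UNIV :: real set) \<Longrightarrow> \<psi> \<in> smooth_functions \<Longrightarrow> (\<integral>p. ham_vector \<phi> p \<psi> \<partial>\<mu>) = - (\<integral>p. \<psi> p * D t p \<partial>\<mu>)"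
    using divergence_exists[OF \<mu> open_UNIV smooth_field_ham_vector_const[OF \<phi>]] by blast
  have "(\<lambda>p. - D 0 p) \<in> smooth_functions"
    by (rule smooth_family_at[OF open_UNIV smooth_family_uminus[OF open_UNIV D(1)] UNIV_I])
  then have "advection (ham_vector \<phi>) \<mu> (dens \<mu> (\<lambda>p. - D 0 p))"
    unfolding advection_def using D(2)[of 0] by auto
  then show ?thesis by (rule that)
qed

text \<open>Testing with the constant 1, which the field annihilates, gives the mean value 0; this
  is what allows \<open>differential_lin_fun\<close> to be evaluated at \<open>v\<close>.\<close>

lemma advectionE:
  assumes "\<mu> \<in> Pinf" "advection (ham_vector \<phi>) \<mu> v"
  obtains g where "g \<in> smooth_functions" "v = dens \<mu> g" "(\<integral>p. g p \<partial>\<mu>) = 0"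
    "\<And>\<psi>. \<psi> \<in> smooth_functions \<Longrightarrow> lin_fun (poisson \<phi> \<psi>) \<mu> = (\<integral>p. g p * \<psi> p \<partial>\<mu>)"
proof -
  obtain g where g: "g \<in> smooth_functions" "v = dens \<mu> g"
    "\<forall>\<psi>\<in>smooth_functions. (\<integral>p. \<psi> p * g p \<partial>\<mu>) = (\<integral>p. ham_vector \<phi> p \<psi> \<partial>\<mu>)"
    using assms(2) unfolding advection_def by blast
  have "(\<integral>p. ham_vector \<phi> p (\<lambda>_. 1) \<partial>\<mu>) = (\<integral>p. 0 \<partial>\<mu>)"
  proof (intro Bochner_Integration.integral_cong refl)
    fix p assume "p \<in> space \<mu>"
    then have p: "p \<in> topspace M" using PinfD(3)[OF assms(1)] by simp
    then obtain U x where c: "(U, x) \<in> \<A>" "p \<in> U" using chart_at by blast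
    then obtain w where "ham_vector \<phi> p = coord_vector (U, x) p w"
      using ham_vector_tangent[OF p] tangent_space_chart[OF c] by auto
    then show "ham_vector \<phi> p (\<lambda>_. 1) = 0" using coord_vector_const[OF c] by simp
  qed
  then have "(\<integral>p. g p \<partial>\<mu>) = 0" using g(3) smooth_functions_const[of 1] by fastforce
  then show ?thesis using that[OF g(1,2)] g(3) lin_fun_poisson[OF assms(1)] by (simp add: mult.commute)
qed

text \<open>The bracket with \<phi> is the evaluation of the covector of \<psi> at one fixed tangent
  vector \<open>dens \<mu> g\<close>, so it sees only the covector.\<close>

lemma lin_fun_poisson_cong:
  assumes \<mu>: "\<mu> \<in> Pinf" and \<phi>: "\<phi> \<in> smooth_functions" and \<psi>: "\<psi> \<in> smooth_functions" "\<psi>' \<in> smooth_functions"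
    and eq: "differential (lin_fun \<psi>) \<mu> = differential (lin_fun \<psi>') \<mu>"
  shows "lin_fun (poisson \<phi> \<psi>) \<mu> = lin_fun (poisson \<phi> \<psi>') \<mu>"
proof -
  obtain v where "advection (ham_vector \<phi>) \<mu> v" using advection_exists[OF \<mu> \<phi>] .
  from advectionE[OF \<mu> this] obtain g where g: "g \<in> smooth_functions" "(\<integral>p. g p \<partial>\<mu>) = 0"
    "\<And>\<psi>. \<psi> \<in> smooth_functions \<Longrightarrow> lin_fun (poisson \<phi> \<psi>) \<mu> = (\<integral>p. g p * \<psi> p \<partial>\<mu>)" by metis
  have "differential (lin_fun \<psi>) \<mu> (dens \<mu> g) = differential (lin_fun \<psi>') \<mu> (dens \<mu> g)" using eq by simp
  then show ?thesis
    using differential_lin_fun[OF \<mu> \<psi>(1) g(1,2)] differential_lin_fun[OF \<mu> \<psi>(2) g(1,2)] g(3) \<psi> by simp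
qed

text \<open>Representatives are exchanged one at a time: the second argument directly, the first
  after a flip by skewness.\<close>

lemma bivector_lin_fun:
  assumes \<mu>: "\<mu> \<in> Pinf" and \<phi>: "\<phi> \<in> smooth_functions" and \<psi>: "\<psi> \<in> smooth_functions"
  shows "bivector \<mu> (differential (lin_fun \<phi>) \<mu>) (differential (lin_fun \<psi>) \<mu>) = lin_fun (poisson \<phi> \<psi>) \<mu>"
  unfolding bivector_def
proof (rule the_equality)
  fix r assume "\<exists>\<phi>1\<in>smooth_functions. \<exists>\<phi>2\<in>smooth_functions. differential (lin_fun \<phi>) \<mu> = differential (lin_fun \<phi>1) \<mu> \<and>
     differential (lin_fun \<psi>) \<mu> = differential (lin_fun \<phi>2) \<mu> \<and> r = lin_fun (poisson \<phi>1 \<phi>2) \<mu>"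
  then obtain \<phi>1 \<phi>2 where s: "\<phi>1 \<in> smooth_functions" "\<phi>2 \<in> smooth_functions"
    and d: "differential (lin_fun \<phi>) \<mu> = differential (lin_fun \<phi>1) \<mu>" "differential (lin_fun \<psi>) \<mu> = differential (lin_fun \<phi>2) \<mu>"
    and r: "r = lin_fun (poisson \<phi>1 \<phi>2) \<mu>" by blast
  have "r = lin_fun (poisson \<phi>1 \<psi>) \<mu>" unfolding r by (rule lin_fun_poisson_cong[OF \<mu> s(1) s(2) \<psi> d(2)[symmetric]])
  also have "\<dots> = - lin_fun (poisson \<psi> \<phi>1) \<mu>" by (rule lin_fun_poisson_skew[OF \<mu>])
  also have "lin_fun (poisson \<psi> \<phi>1) \<mu> = lin_fun (poisson \<psi> \<phi>) \<mu>" by (rule lin_fun_poisson_cong[OF \<mu> \<psi> s(1) \<phi> d(1)[symmetric]])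
  also have "- \<dots> = lin_fun (poisson \<phi> \<psi>) \<mu>" by (rule lin_fun_poisson_skew[OF \<mu>, symmetric])
  finally show "r = lin_fun (poisson \<phi> \<psi>) \<mu>" .
qed (use \<phi> \<psi> in blast)

lemma bracket_lin_fun:
  "\<mu> \<in> Pinf \<Longrightarrow> \<phi> \<in> smooth_functions \<Longrightarrow> \<psi> \<in> smooth_functions \<Longrightarrow>
    bracket (lin_fun \<phi>) (lin_fun \<psi>) \<mu> = lin_fun (poisson \<phi> \<psi>) \<mu>"
  unfolding bracket_def by (rule bivector_lin_fun)

lemma dens_cong_AE:
  assumes \<mu>: "\<mu> \<in> Pinf" and "f \<in> smooth_functions" "g \<in> smooth_functions" "AE p in \<mu>. f p = g p"
  shows "dens \<mu> f = dens \<mu> g"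
proof
  fix A
  have [measurable]: "f \<in> borel_measurable \<mu>" "g \<in> borel_measurable \<mu>"
    using assms smooth_functions_measurable Pinf_measurable[OF \<mu>] by blast+
  show "dens \<mu> f A = dens \<mu> g A"
  proof (cases "A \<in> sets borelM")
    case True
    then have [measurable]: "A \<in> sets \<mu>" using PinfD(2)[OF \<mu>] by simp
    have "(LINT p:A|\<mu>. f p) = (LINT p:A|\<mu>. g p)"
      unfolding set_lebesgue_integral_def
    proof (rule integral_cong_AE)
      show "AE p in \<mu>. indicator A p *\<^sub>R f p = indicator A p *\<^sub>R g p"
        using assms(4) by (rule AE_mp) (auto intro!: AE_I2)
    qed measurable
    then show ?thesis by (simp add: dens_def)
  qed (simp add: dens_def)
qed

text \<open>By the definition of advection, \<open>v\<close> pairs with linear functionals as the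
  bracket prescribes. Since all functions in \<open>Pinf_functions\<close> have differentials of
  this kind, it satisfies the whole defining condition of \<open>W\<close>.\<close>

lemma W_lin_fun:
  assumes \<mu>: "\<mu> \<in> Pinf" and \<phi>: "\<phi> \<in> smooth_functions" and v: "advection (ham_vector \<phi>) \<mu> v"
  shows "W (lin_fun \<phi>) \<mu> = v"
  unfolding W_def
proof (rule the_equality)
  from advectionE[OF \<mu> v] obtain g where g: "g \<in> smooth_functions" "v = dens \<mu> g" "(\<integral>p. g p \<partial>\<mu>) = 0"
    "\<And>\<psi>. \<psi> \<in> smooth_functions \<Longrightarrow> lin_fun (poisson \<phi> \<psi>) \<mu> = (\<integral>p. g p * \<psi> p \<partial>\<mu>)" by metis
  have "differential G \<mu> v = bracket (lin_fun \<phi>) G \<mu>" if G: "G \<in> Pinf_functions" for G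
  proof -
    obtain \<psi> where \<psi>: "\<psi> \<in> smooth_functions" "differential G \<mu> = differential (lin_fun \<psi>) \<mu>"
      using G \<mu> unfolding Pinf_functions_def cotangent_Pinf_def by blast
    have "bracket (lin_fun \<phi>) G \<mu> = lin_fun (poisson \<phi> \<psi>) \<mu>"
      unfolding bracket_def \<psi>(2) by (rule bivector_lin_fun[OF \<mu> \<phi> \<psi>(1)])
    then show ?thesis using differential_lin_fun[OF \<mu> \<psi>(1) g(1,3)] g(2) g(4)[OF \<psi>(1)] \<psi>(2) by simp
  qed
  then show "v \<in> tangent_Pinf \<mu> \<and> (\<forall>G\<in>Pinf_functions. differential G \<mu> v = bracket (lin_fun \<phi>) G \<mu>)"
    using dens_tangent_Pinf[OF \<mu> g(1,3)] g(2) by blast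
  fix w assume w: "w \<in> tangent_Pinf \<mu> \<and> (\<forall>G\<in>Pinf_functions. differential G \<mu> w = bracket (lin_fun \<phi>) G \<mu>)"
  then obtain h where h: "h \<in> smooth_functions" "w = dens \<mu> h" "(\<integral>p. h p \<partial>\<mu>) = 0" using tangent_PinfE[OF \<mu>] by metis
  \<comment> \<open>Uniqueness: the difference of the two densities serves as its own test function,
    so the integral of its square is 0.\<close>
  define \<psi> where "\<psi> p = h p - g p" for p
  have \<psi>: "\<psi> \<in> smooth_functions" unfolding \<psi>_def by (rule smooth_functions_diff[OF h(1) g(1)])
  have "(\<integral>p. h p * \<psi> p \<partial>\<mu>) = (\<integral>p. g p * \<psi> p \<partial>\<mu>)"
    using w lin_fun_Pinf_functions[OF \<psi>] differential_lin_fun[OF \<mu> \<psi> h(1,3)] h(2)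
      bracket_lin_fun[OF \<mu> \<phi> \<psi>] g(4)[OF \<psi>] by simp
  moreover have i: "integrable \<mu> (\<lambda>p. h p * \<psi> p)" "integrable \<mu> (\<lambda>p. g p * \<psi> p)" "integrable \<mu> (\<lambda>p. \<psi> p * \<psi> p)"
    by (intro Pinf_integrable[OF \<mu> \<mu>] smooth_functions_mult h g \<psi>)+
  moreover have "(\<integral>p. \<psi> p * \<psi> p \<partial>\<mu>) = (\<integral>p. h p * \<psi> p - g p * \<psi> p \<partial>\<mu>)"
    by (intro Bochner_Integration.integral_cong refl) (simp add: \<psi>_def algebra_simps)
  ultimately have "(\<integral>p. \<psi> p * \<psi> p \<partial>\<mu>) = 0" by simp
  then have "AE p in \<mu>. \<psi> p * \<psi> p = 0" using integral_nonneg_eq_0_iff_AE[OF i(3)] by simp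
  then have "AE p in \<mu>. h p = g p" by (rule AE_mp) (auto simp: \<psi>_def intro!: AE_I2)
  then show "w = v" using dens_cong_AE[OF \<mu> h(1) g(1)] h(2) g(2) by simp
qed

lemma differential_W:
  assumes \<mu>: "\<mu> \<in> Pinf" and \<phi>: "\<phi> \<in> smooth_functions" and \<psi>: "\<psi> \<in> smooth_functions"
  shows "differential (lin_fun \<psi>) \<mu> (W (lin_fun \<phi>) \<mu>) = lin_fun (poisson \<phi> \<psi>) \<mu>"
proof -
  obtain v where v: "advection (ham_vector \<phi>) \<mu> v" using advection_exists[OF \<mu> \<phi>] .
  from advectionE[OF \<mu> v] obtain g where g: "g \<in> smooth_functions" "v = dens \<mu> g" "(\<integral>p. g p \<partial>\<mu>) = 0"
    "\<And>\<psi>. \<psi> \<in> smooth_functions \<Longrightarrow> lin_fun (poisson \<phi> \<psi>) \<mu> = (\<integral>p. g p * \<psi> p \<partial>\<mu>)" by metis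
  show ?thesis using differential_lin_fun[OF \<mu> \<psi> g(1,3)] W_lin_fun[OF \<mu> \<phi> v] g(2) g(4)[OF \<psi>] by simp
qed

text \<open>By \<open>differential_W\<close> a tangent vector
  \<open>W (lin_fun \<phi>) \<mu>\<close> determines all brackets with \<phi>. So each function may
  be exchanged for another with the same \<open>W\<close>, the second one after a flip by
  skewness.\<close>

lemma leaf_form_W:
  assumes \<mu>: "\<mu> \<in> Pinf" and \<phi>: "\<phi>1 \<in> smooth_functions" "\<phi>2 \<in> smooth_functions"
  shows "leaf_form \<mu> (W (lin_fun \<phi>1) \<mu>) (W (lin_fun \<phi>2) \<mu>) = lin_fun (poisson \<phi>1 \<phi>2) \<mu>"
  unfolding leaf_form_def
proof (rule the_equality)
  show "\<exists>\<phi>1'\<in>smooth_functions. \<exists>\<phi>2'\<in>smooth_functions. W (lin_fun \<phi>1) \<mu> = W (lin_fun \<phi>1') \<mu> \<and>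
      W (lin_fun \<phi>2) \<mu> = W (lin_fun \<phi>2') \<mu> \<and> lin_fun (poisson \<phi>1 \<phi>2) \<mu> = bracket (lin_fun \<phi>1') (lin_fun \<phi>2') \<mu>"
    using \<phi> bracket_lin_fun[OF \<mu> \<phi>] by force
  fix r assume "\<exists>\<phi>1'\<in>smooth_functions. \<exists>\<phi>2'\<in>smooth_functions. W (lin_fun \<phi>1) \<mu> = W (lin_fun \<phi>1') \<mu> \<and>
      W (lin_fun \<phi>2) \<mu> = W (lin_fun \<phi>2') \<mu> \<and> r = bracket (lin_fun \<phi>1') (lin_fun \<phi>2') \<mu>"
  then obtain \<phi>1' \<phi>2' where s: "\<phi>1' \<in> smooth_functions" "\<phi>2' \<in> smooth_functions"
    and W: "W (lin_fun \<phi>1) \<mu> = W (lin_fun \<phi>1') \<mu>" "W (lin_fun \<phi>2) \<mu> = W (lin_fun \<phi>2') \<mu>"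
    and r: "r = bracket (lin_fun \<phi>1') (lin_fun \<phi>2') \<mu>" by blast
  have "r = lin_fun (poisson \<phi>1' \<phi>2') \<mu>" using r bracket_lin_fun[OF \<mu> s] by simp
  also have "\<dots> = lin_fun (poisson \<phi>1 \<phi>2') \<mu>"
    using differential_W[OF \<mu> s] differential_W[OF \<mu> \<phi>(1) s(2)] W(1) by simp
  also have "\<dots> = - lin_fun (poisson \<phi>2' \<phi>1) \<mu>" by (rule lin_fun_poisson_skew[OF \<mu>])
  also have "\<dots> = - lin_fun (poisson \<phi>2 \<phi>1) \<mu>"
    using differential_W[OF \<mu> s(2) \<phi>(1)] differential_W[OF \<mu> \<phi>(2,1)] W(2) by simp
  also have "\<dots> = lin_fun (poisson \<phi>1 \<phi>2) \<mu>" by (rule lin_fun_poisson_skew[OF \<mu>, symmetric])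
  finally show "r = lin_fun (poisson \<phi>1 \<phi>2) \<mu>" .
qed

section \<open>Symplectic leaves and Hamiltonian orbits\<close>

lemma ham_integral_curve_iff: "ham_integral_curve T \<phi> \<gamma> \<longleftrightarrow> integral_curve T (\<lambda>t. ham_vector (\<phi> t)) \<gamma>"
  by (simp add: ham_integral_curve_def integral_curve_def)

lemma ham_flow_eq:
  assumes "open J" "smooth_family J \<phi>" "T \<subseteq> J" "is_interval T" "0 \<in> T" "t \<in> T"
    and \<gamma>: "integral_curve T (\<lambda>t. ham_vector (\<phi> t)) \<gamma>" "\<gamma> 0 = p"
  shows "ham_flow T \<phi> t p = \<gamma> t"
  unfolding ham_flow_def ham_integral_curve_iff
proof (rule the_equality)
  fix q assume "\<exists>\<delta>. integral_curve T (\<lambda>t. ham_vector (\<phi> t)) \<delta> \<and> \<delta> 0 = p \<and> \<delta> t = q"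
  then obtain \<delta> where \<delta>: "integral_curve T (\<lambda>t. ham_vector (\<phi> t)) \<delta>" "\<delta> 0 = p" "\<delta> t = q" by blast
  have "\<delta> t = \<gamma> t"
    by (rule integral_curve_unique[OF assms(1) smooth_field_ham_vector[OF assms(1,2)] assms(3,4) \<delta>(1) \<gamma>(1) assms(5) _ assms(6)])
      (simp add: \<gamma>(2) \<delta>(2))
  then show "q = \<gamma> t" using \<delta>(3) by simp
qed (use \<gamma> in blast)

lemma distr_ham_flow:
  assumes \<mu>: "\<mu> \<in> Pinf" and J: "open J" "smooth_family J \<phi>" and I: "I \<subseteq> J" "{0..1} \<subseteq> I"
    "complete_flow I (\<lambda>t. ham_vector (\<phi> t))"
  shows "distr \<mu> borelM (ham_flow {0..1} \<phi> 1) = distr \<mu> borelM (flow I (\<lambda>t. ham_vector (\<phi> t)) 1 0)"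
proof (rule distr_cong[OF refl refl])
  fix p assume "p \<in> space \<mu>"
  then have p: "p \<in> topspace M" using PinfD(3)[OF \<mu>] by simp
  have "0 \<in> I" using I(2) by auto
  note curve = flow_integral_curve[OF I(3) this p]
  have "{0..1} \<subseteq> J" using I by blast
  from ham_flow_eq[OF J this is_interval_cc _ _ integral_curve_subset[OF curve(1) I(2)] curve(2)]
  show "ham_flow {0..1} \<phi> 1 p = flow I (\<lambda>t. ham_vector (\<phi> t)) 1 0 p" by simp
qed

lemma smooth_curve_subset:
  assumes "smooth_curve J c" "I \<subseteq> J"
  shows "smooth_curve I c"
  unfolding smooth_curve_def
proof (intro conjI ballI)
  show "c t \<in> Pinf" if "t \<in> I" for t using assms that by (auto simp: smooth_curve_def)
  fix ch assume "ch \<in> \<A>"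
  then obtain U x where ch: "ch = (U, x)" "(U, x) \<in> \<A>" by (cases ch) auto
  obtain \<rho> where \<rho>: "smooth_on (J \<times> x ` U) (\<lambda>(t, q). \<rho> t q)" "\<forall>t\<in>J. has_chart_density (measure (c t)) (U, x) (\<rho> t)"
    using assms(1) ch(2) by (auto simp: smooth_curve_def)
  have "smooth_on (I \<times> x ` U) (\<lambda>(t, q). \<rho> t q)"
    by (rule smooth_on_subset[OF \<rho>(1)]) (use assms(2) in auto)
  then show "case ch of (U, x) \<Rightarrow> \<exists>\<rho>. smooth_on (I \<times> x ` U) (\<lambda>(t, q). \<rho> t q) \<and>
      (\<forall>t\<in>I. has_chart_density (measure (c t)) (U, x) (\<rho> t))"
    unfolding ch(1) using \<rho>(2) assms(2) by auto
qed

text \<open>\<open>W_lin_fun\<close> translates between the fields \<open>W\<close> and advection,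
  after which the two inclusions are uniqueness and existence for the continuity equation. The open
  set \<open>J\<close> may be disconnected and is replaced by an open interval \<open>I\<close>
  around \<open>{0..1}\<close> with complete flow.\<close>

lemma symplectic_leaf_eq_Ham_orbit:
  assumes \<mu>: "\<mu> \<in> Pinf"
  shows "symplectic_leaf \<mu> = Ham_orbit \<mu>"
proof
  show "symplectic_leaf \<mu> \<subseteq> Ham_orbit \<mu>"
  proof
    fix \<nu> assume "\<nu> \<in> symplectic_leaf \<mu>"
    then obtain c J \<phi> where c: "\<nu> = c 1" "smooth_curve J c" "c 0 = \<mu>"
      and J: "open J" "{0..1} \<subseteq> J" "smooth_family J \<phi>"
      and v: "\<forall>t\<in>{0..1}. has_velocity c (W (lin_fun (\<phi> t)) (c t)) t"
      unfolding symplectic_leaf_def by blast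
    let ?X = "\<lambda>t. ham_vector (\<phi> t)"
    have X: "smooth_field J ?X" by (rule smooth_field_ham_vector[OF J(1,3)])
    obtain I where I: "open I" "is_interval I" "{0..1} \<subseteq> I" "I \<subseteq> J" "complete_flow I ?X"
      using complete_flow_exists[OF J(1) X J(2)] by auto
    have "\<exists>w. advection (?X t) (c t) w \<and> has_velocity c w t" if t: "t \<in> {0..1}" for t
    proof -
      have ct: "c t \<in> Pinf" using c(2) J(2) t by (auto simp: smooth_curve_def)
      have \<phi>t: "\<phi> t \<in> smooth_functions" by (rule smooth_family_at[OF J(1,3)]) (use J t in auto)
      obtain w where w: "advection (?X t) (c t) w" using advection_exists[OF ct \<phi>t] .
      then show ?thesis using W_lin_fun[OF ct \<phi>t w] v t by auto
    qed
    then have "c 1 = distr (c 0) borelM (flow I ?X 1 0)"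
      by (rule curve_eq_flow_pushforward[OF J(1) X I(1,2,4,5) smooth_curve_subset[OF c(2) I(4)] I(3)])
    then have "\<nu> = distr \<mu> borelM (ham_flow {0..1} \<phi> 1)"
      using c distr_ham_flow[OF \<mu> J(1,3) I(4,3,5)] by simp
    then show "\<nu> \<in> Ham_orbit \<mu>" unfolding Ham_orbit_def Ham_def using J by blast
  qed
  show "Ham_orbit \<mu> \<subseteq> symplectic_leaf \<mu>"
  proof
    fix \<nu> assume "\<nu> \<in> Ham_orbit \<mu>"
    then obtain J \<phi> where \<nu>: "\<nu> = distr \<mu> borelM (ham_flow {0..1} \<phi> 1)" and J: "open J" "{0..1} \<subseteq> J" "smooth_family J \<phi>"
      unfolding Ham_orbit_def Ham_def by blast
    let ?X = "\<lambda>t. ham_vector (\<phi> t)"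
    have X: "smooth_field J ?X" by (rule smooth_field_ham_vector[OF J(1,3)])
    obtain I where I: "open I" "is_interval I" "{0..1} \<subseteq> I" "I \<subseteq> J" "complete_flow I ?X"
      using complete_flow_exists[OF J(1) X J(2)] by auto
    have I0: "0 \<in> I" using I(3) by auto
    define c where "c t = distr \<mu> borelM (flow I ?X t 0)" for t
    note c = flow_pushforward_curve[OF \<mu> J(1) X I(1,2,4,5) I0, folded c_def]
    have "has_velocity c (W (lin_fun (\<phi> t)) (c t)) t" if t: "t \<in> {0..1}" for t
    proof -
      have tI: "t \<in> I" using t I(3) by blast
      have ct: "c t \<in> Pinf" using c(1) tI by (auto simp: smooth_curve_def)
      have \<phi>t: "\<phi> t \<in> smooth_functions" by (rule smooth_family_at[OF J(1,3)]) (use J t in auto)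
      obtain w where "advection (?X t) (c t) w" "has_velocity c w t" using c(3)[OF tI] by blast
      then show ?thesis using W_lin_fun[OF ct \<phi>t] by simp
    qed
    moreover have "\<nu> = c 1" unfolding \<nu> c_def by (rule distr_ham_flow[OF \<mu> J(1,3) I(4,3,5)])
    ultimately show "\<nu> \<in> symplectic_leaf \<mu>"
      unfolding symplectic_leaf_def using c(1,2) I(1,3) smooth_family_subset[OF J(3) I(4)] by blast
  qed
qed

text \<open>\<open>inf_motion\<close> refers to a flow for all times, so the solutions on the
  compact intervals \<open>{- real n - 1..real n + 1}\<close> are joined; they agree where both are
  defined by uniqueness.\<close>

lemma global_integral_curve:
  assumes X: "smooth_field UNIV X" and p: "p \<in> topspace M"
  obtains \<gamma> where "integral_curve UNIV X \<gamma>" "\<gamma> 0 = p"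
proof -
  have "\<exists>I. open I \<and> is_interval I \<and> {- real n - 1..real n + 1} \<subseteq> I \<and> complete_flow I X" for n
  proof -
    have "- real n - 1 \<le> real n + 1" by simp
    from complete_flow_exists[OF open_UNIV X subset_UNIV this] show ?thesis by metis
  qed
  then obtain I where I: "\<And>n. open (I n)" "\<And>n. is_interval (I n)" "\<And>n. {- real n - 1..real n + 1} \<subseteq> I n" "\<And>n. complete_flow (I n) X"
    by metis
  \<comment> \<open>The n-th interval reaches one unit beyond \<open>n\<close>, so the piece used at
    \<open>t\<close> also describes the curve at all nearby times and the derivative at
    \<open>t\<close> can be read off from it.\<close>
  define N where "N t = nat \<lceil>\<bar>t\<bar>\<rceil>" for t :: real
  have in_I: "t \<in> I n" if "\<bar>t\<bar> \<le> real n + 1" for t n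
    by (rule subsetD[OF I(3)]) (use that in \<open>simp add: abs_le_iff\<close>)
  have tN: "\<bar>t\<bar> \<le> real (N t)" for t unfolding N_def by (simp add: real_nat_ceiling_ge)
  have I0: "0 \<in> I n" for n by (rule in_I) simp
  note curve = flow_integral_curve[OF I(4) I0 p]
  have same: "flow (I m) X t 0 p = flow (I n) X t 0 p" if "t \<in> I m" "t \<in> I n" for m n t
    by (rule integral_curve_unique[OF open_UNIV X subset_UNIV is_interval_Int[OF I(2) I(2)]
        integral_curve_subset[OF curve(1) Int_lower1] integral_curve_subset[OF curve(1) Int_lower2], of 0])
      (use I0 that curve(2) in auto)
  define \<gamma> where "\<gamma> t = flow (I (N t)) X t 0 p" for t
  have \<gamma>: "\<gamma> t = flow (I n) X t 0 p" if "\<bar>t\<bar> \<le> real n + 1" for t n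
    unfolding \<gamma>_def by (rule same) (use that in_I tN[of t] in \<open>auto intro!: in_I\<close>)
  have "integral_curve UNIV X \<gamma>"
    unfolding integral_curve_def
  proof (intro ballI conjI)
    fix t
    show "\<gamma> t \<in> topspace M" unfolding \<gamma>_def by (rule flow_in[OF I(4) _ I0 p]) (use tN[of t] in \<open>auto intro!: in_I\<close>)
    fix f assume f: "f \<in> smooth_functions"
    let ?n = "N t"
    have t: "t \<in> {- real ?n - 1<..<real ?n + 1}" using tN[of t] by auto
    have tI: "t \<in> I ?n" using I(3)[of ?n] t by auto
    have "((\<lambda>s. f (flow (I ?n) X s 0 p)) has_real_derivative X t (flow (I ?n) X t 0 p) f) (at t)"
      using integral_curve_deriv[OF curve(1) tI f] at_within_open[OF tI I(1)] by simp
    then have "((\<lambda>s. f (\<gamma> s)) has_real_derivative X t (flow (I ?n) X t 0 p) f) (at t)"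
    proof (rule has_field_derivative_transform_within_open[OF _ open_greaterThanLessThan t])
      show "f (flow (I ?n) X s 0 p) = f (\<gamma> s)" if "s \<in> {- real ?n - 1<..<real ?n + 1}" for s
        using \<gamma>[of s ?n] that by (simp add: abs_le_iff)
    qed
    then show "((\<lambda>s. f (\<gamma> s)) has_real_derivative X t (\<gamma> t) f) (at t)" by (simp add: \<gamma>_def)
  qed
  moreover have "\<gamma> 0 = p" unfolding \<gamma>_def by (rule curve(2))
  ultimately show ?thesis by (rule that)
qed

text \<open>The global flow in \<open>inf_motion\<close> agrees near time 0 with the flow on a small
  interval \<open>I\<close>, since both follow the same integral curves; the latter has velocity
  \<open>W (lin_fun \<phi>) \<mu>\<close> at 0. A velocity is unique because it is fixed on Borel
  sets by derivatives and 0 on all other sets.\<close>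

lemma inf_motion_eq_W:
  assumes \<mu>: "\<mu> \<in> Pinf" and \<phi>: "\<phi> \<in> smooth_functions"
  shows "inf_motion \<phi> \<mu> = W (lin_fun \<phi>) \<mu>"
proof -
  let ?X = "\<lambda>_::real. ham_vector \<phi>"
  have X: "smooth_field UNIV ?X" by (rule smooth_field_ham_vector_const[OF \<phi>])
  have fam: "smooth_family UNIV (\<lambda>_. \<phi>)" by (rule smooth_family_const[OF open_UNIV \<phi>])
  \<comment> \<open>The degenerate interval \<open>{0..0}\<close> serves only to get an open
    interval of times around 0.\<close>
  obtain I where I: "open I" "is_interval I" "{0..0} \<subseteq> I" "complete_flow I ?X"
    using complete_flow_exists[OF open_UNIV X, of 0 0] by auto
  have I0: "0 \<in> I" using I(3) by auto
  define c where "c t = distr \<mu> borelM (flow I ?X t 0)" for t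
  note c = flow_pushforward_curve[OF \<mu> open_UNIV X I(1,2) subset_UNIV I(4) I0, folded c_def]
  define c' where "c' t = distr \<mu> borelM (ham_flow UNIV (\<lambda>_. \<phi>) t)" for t
  have cc: "c t = c' t" if t: "t \<in> I" for t
    unfolding c_def c'_def
  proof (rule distr_cong[OF refl refl])
    fix p assume "p \<in> space \<mu>"
    then have p: "p \<in> topspace M" using PinfD(3)[OF \<mu>] by simp
    obtain \<gamma> where \<gamma>: "integral_curve UNIV ?X \<gamma>" "\<gamma> 0 = p" using global_integral_curve[OF X p] .
    have "flow I ?X t 0 (\<gamma> 0) = \<gamma> t"
      by (rule flow_eq[OF open_UNIV X subset_UNIV I(4) subset_refl I(2) integral_curve_subset[OF \<gamma>(1) subset_UNIV] I0 t])
    moreover have "ham_flow UNIV (\<lambda>_. \<phi>) t p = \<gamma> t"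
      by (rule ham_flow_eq[OF open_UNIV fam subset_refl is_interval_univ UNIV_I UNIV_I \<gamma>])
    ultimately show "flow I ?X t 0 p = ham_flow UNIV (\<lambda>_. \<phi>) t p" using \<gamma>(2) by simp
  qed
  obtain v where v: "advection (ham_vector \<phi>) (c 0) v" "has_velocity c v 0" using c(3)[OF I0] by blast
  have vW: "v = W (lin_fun \<phi>) \<mu>" using W_lin_fun[OF \<mu> \<phi>] v(1) c(2) by simp
  have "has_velocity c' v 0"
    unfolding has_velocity_def
  proof (intro conjI ballI)
    show "v \<in> tangent_Pinf (c' 0)" using v(2) by (simp add: has_velocity_def tangent_Pinf_def)
    fix A assume "A \<in> sets borelM"
    then have "((\<lambda>s. measure (c s) A) has_real_derivative v A) (at 0)" using v(2) by (simp add: has_velocity_def)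
    then show "((\<lambda>s. measure (c' s) A) has_real_derivative v A) (at 0)"
      by (rule has_field_derivative_transform_within_open[OF _ I(1) I0]) (simp add: cc)
  qed
  moreover have "w = v" if w: "has_velocity c' w 0" and v: "has_velocity c' v 0" for w v
  proof
    fix A
    show "w A = v A"
    proof (cases "A \<in> sets borelM")
      case True
      then show ?thesis using w v DERIV_unique unfolding has_velocity_def by blast
    next
      case False
      then show ?thesis using w v unfolding has_velocity_def tangent_Pinf_def smooth_densities_def by simp
    qed
  qed
  ultimately have "(THE v. has_velocity c' v 0) = v" by blast
  then show ?thesis using vW unfolding inf_motion_def c'_def by simp
qed

lemma leaf_form_inf_motion:
  assumes "\<mu> \<in> Pinf" "\<phi>1 \<in> smooth_functions" "\<phi>2 \<in> smooth_functions"
  shows "leaf_form \<mu> (inf_motion \<phi>1 \<mu>) (inf_motion \<phi>2 \<mu>) = (\<integral>p. poisson \<phi>1 \<phi>2 p \<partial>\<mu>)"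
  using leaf_form_W[OF assms] assms by (simp add: inf_motion_eq_W lin_fun_def)

lemma inf_motion_leaf_tangent: "\<mu> \<in> Pinf \<Longrightarrow> \<phi> \<in> smooth_functions \<Longrightarrow> inf_motion \<phi> \<mu> \<in> leaf_tangent \<mu>"
  unfolding leaf_tangent_def by (auto simp: inf_motion_eq_W)

end

theorem proposition6p6:
  fixes M :: "'a topology" and \<A> :: "('a, 'e::euclidean_space) chart set"
    and \<omega> :: "'a \<Rightarrow> (('a \<Rightarrow> real) \<Rightarrow> real) \<Rightarrow> (('a \<Rightarrow> real) \<Rightarrow> real) \<Rightarrow> real" and n :: nat
  assumes "closed_symplectic_manifold M \<A> \<omega> n"
  shows
    "(\<forall>\<mu>\<in>smooth_manifold.Pinf M \<A>.
        closed_symplectic_manifold.symplectic_leaf M \<A> \<omega> \<mu> =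
        closed_symplectic_manifold.Ham_orbit M \<A> \<omega> \<mu>) \<and>
     (\<forall>\<mu>\<in>smooth_manifold.Pinf M \<A>.
      \<forall>\<phi>1\<in>smooth_manifold.smooth_functions \<A>. \<forall>\<phi>2\<in>smooth_manifold.smooth_functions \<A>.
        closed_symplectic_manifold.inf_motion M \<A> \<omega> \<phi>1 \<mu>
          \<in> closed_symplectic_manifold.leaf_tangent M \<A> \<omega> \<mu> \<and>
        closed_symplectic_manifold.inf_motion M \<A> \<omega> \<phi>2 \<mu>
          \<in> closed_symplectic_manifold.leaf_tangent M \<A> \<omega> \<mu> \<and>
        closed_symplectic_manifold.leaf_form M \<A> \<omega> \<mu>
          (closed_symplectic_manifold.inf_motion M \<A> \<omega> \<phi>1 \<mu>)
          (closed_symplectic_manifold.inf_motion M \<A> \<omega> \<phi>2 \<mu>)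
        = (\<integral>p. closed_symplectic_manifold.poisson \<A> \<omega> \<phi>1 \<phi>2 p \<partial>\<mu>))"
proof -
  interpret closed_symplectic_manifold M \<A> \<omega> n by (rule assms)
  show ?thesis
    using symplectic_leaf_eq_Ham_orbit leaf_form_inf_motion inf_motion_leaf_tangent by blast
qed

end
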